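(* Let $q>d$, $1<r\le q$ and $(m,w)\in W^{1,q}(\Omega)\times L^q(\Omega)^d$. Suppose that $\mathcal{L}_r(m,w)<\infty$. If $v:=(w/m)\mathbf 1_{E_1^m}\notin L^r(\Omega)^d$, then $\partial\mathcal{L}_r(m,w)=\emptyset$. Otherwise, $\mathcal{L}_r$ is subdifferentiable at $(m,w)$ and $$\partial\mathcal{L}_r(m,w)=\Big\{(\alpha,\beta)\in\overline{\mathcal{A}_{r'}}\ :\ \alpha\llcorner E_1^m=-\tfrac1{r'}|v|^r\ \text{ and }\ \beta\llcorner E_1^m=|v|^{r-2}v\Big\}.$$ In particular, the singular part of $\alpha$ is concentrated in $E_0^m$.
   Context: $\Omega\subset\mathbb{R}^d$ ($d\ge2$) is a non-empty, bounded open set with smooth boundary satisfying a uniform interior ball condition. For $s>1$, $s':=s/(s-1)$. $\mathfrak{M}(\overline\Omega)$ is the space of signed Radon measures on $\overline\Omega$. Since $q>d$, $m\in W^{1,q}(\Omega)$ is identified with its representative in $C(\overline\Omega)$ and measures on $\overline\Omega$ are identified with elements of $(W^{1,q}(\Omega))^*$. $\mathcal{L}_r:W^{1,q}(\Omega)\times L^q(\Omega)^d\to\mathbb{R}\cup\{+\infty\}$ is $\mathcal{L}_r(m,w):=\int_\Omega\ell_r(m(x),w(x))\,dx$, where for $(a,b)\in\mathbb{R}\times\mathbb{R}^d$: $\ell_r(a,b):=\frac1r\frac{|b|^r}{a^{r-1}}$ if $a>0$, $\ell_r(0,0):=0$, and $\ell_r(a,b):=+\infty$ otherwise. $\partial\mathcal{L}_r(m,w)\subset(W^{1,q}(\Omega))^*\times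 L^{q'}(\Omega)^d$ is the convex subdifferential. $\mathcal{A}_{r'}$ is the set of $(a,b)\in L^\infty(\Omega)\times L^\infty(\Omega)^d$ with $a(x)+\frac1{r'}|b(x)|^{r'}\le0$ for a.e. $x\in\Omega$, and $\overline{\mathcal{A}_{r'}}$ is its closure in $(W^{1,q}(\Omega))^*\times L^{q'}(\Omega)^d$. It equals the set of $(\alpha,\beta)\in\mathfrak{M}(\overline\Omega)\times L^{r'}(\Omega)^d$ with $\int_{\overline\Omega}\phi\,d\alpha+\frac1{r'}\int_\Omega\phi|\beta|^{r'}dx\le0$ for every non-negative $\phi\in C(\overline\Omega)$. $E_0^m:=\{x\in\overline\Omega:m(x)=0\}$, $E_1^m:=\{x\in\overline\Omega:m(x)>0\}$. $\mathbf 1_E$ is the indicator function equal to $1$ on $E$ and $0$ off $E$ (so $v=w/m$ on $E_1^m$ and $v=0$ elsewhere). $\alpha\llcorner E$ is the restriction $\alpha\llcorner E(B)=\alpha(E\cap B)$; the equality $\alpha\llcorner E_1^m=-\frac1{r'}|v|^r$ means that this restriction is absolutely continuous with respect to Lebesgue measure with density $-\frac1{r'}|v|^r$ on $E_1^m$, and $\beta\llcorner E_1^m=|v|^{r-2}v$ means equality a.e. in $E_1^m$ (with $|v|^{r-2}v:=0$ where $v=0$). *)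

theory Defs
  imports "HOL-Analysis.Analysis"
begin

section \<open>Smooth functions and smooth bounded domains\<close>

text \<open>Meant for open \<open>S\<close>: all iterated partial derivatives of order at most \<open>k\<close> exist and are
  continuous.\<close>

fun Ck_on :: "nat \<Rightarrow> 'a::euclidean_space set \<Rightarrow> ('a \<Rightarrow> real) \<Rightarrow> bool" where
  "Ck_on 0 S f = continuous_on S f"
| "Ck_on (Suc k) S f =
     ((\<forall>x\<in>S. f differentiable (at x)) \<and>
      (\<forall>b\<in>Basis. Ck_on k S (\<lambda>x. frechet_derivative f (at x) b)))"

definition smooth :: "('a::euclidean_space \<Rightarrow> real) \<Rightarrow> bool" where
  "smooth f \<longleftrightarrow> (\<forall>k. Ck_on k UNIV f)"

text \<open>Near each boundary point \<open>\<Omega>\<close> is the strict epigraph of a smooth function over a hyperplane.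
  The unit vector \<open>e\<close> is the last axis of the rotated coordinate system, and
  \<open>x - (x \<bullet> e) *\<^sub>R e\<close> stands for the remaining coordinates; smooth functions on the hyperplane
  orthogonal to \<open>e\<close> are the restrictions of smooth functions on the whole space.\<close>

definition smooth_boundary :: "'a::euclidean_space set \<Rightarrow> bool" where
  "smooth_boundary \<Omega> \<longleftrightarrow>
     (\<forall>x0\<in>frontier \<Omega>. \<exists>\<rho>>0. \<exists>e \<gamma>. norm e = 1 \<and> smooth \<gamma> \<and>
        \<Omega> \<inter> ball x0 \<rho> = {x \<in> ball x0 \<rho>. x \<bullet> e > \<gamma> (x - (x \<bullet> e) *\<^sub>R e)})"

definition uniform_interior_ball :: "'a::euclidean_space set \<Rightarrow> bool" where
  "uniform_interior_ball \<Omega> \<longleftrightarrow>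
     (\<exists>\<rho>>0. \<forall>x\<in>frontier \<Omega>. \<exists>y. ball y \<rho> \<subseteq> \<Omega> \<and> x \<in> sphere y \<rho>)"

section \<open>Lebesgue and Sobolev spaces\<close>

text \<open>The elements of these spaces are functions rather than classes modulo equality almost
  everywhere. Only the values on \<open>\<Omega>\<close>, up to null sets, matter.\<close>

definition conj_exp :: "real \<Rightarrow> real" where
  "conj_exp s = s / (s - 1)"

definition Lp :: "'a::euclidean_space set \<Rightarrow> real \<Rightarrow> ('a \<Rightarrow> 'b::euclidean_space) set" where
  "Lp \<Omega> p = {f. f \<in> borel_measurable (lebesgue_on \<Omega>) \<and>
                 integrable (lebesgue_on \<Omega>) (\<lambda>x. norm (f x) powr p)}"

definition Lp_norm :: "'a::euclidean_space set \<Rightarrow> real \<Rightarrow> ('a \<Rightarrow> 'b::euclidean_space) \<Rightarrow> real" where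
  "Lp_norm \<Omega> p f = (LINT x|lebesgue_on \<Omega>. norm (f x) powr p) powr (1 / p)"

definition Linf :: "'a::euclidean_space set \<Rightarrow> ('a \<Rightarrow> 'b::euclidean_space) set" where
  "Linf \<Omega> = {f. f \<in> borel_measurable (lebesgue_on \<Omega>) \<and>
                 (\<exists>C. AE x in lebesgue_on \<Omega>. norm (f x) \<le> C)}"

definition test_functions :: "'a::euclidean_space set \<Rightarrow> ('a \<Rightarrow> real) set" where
  "test_functions \<Omega> =
     {\<phi>. smooth \<phi> \<and> compact (closure {x. \<phi> x \<noteq> 0}) \<and> closure {x. \<phi> x \<noteq> 0} \<subseteq> \<Omega>}"

definition locally_integrable ::
  "'a::euclidean_space set \<Rightarrow> ('a \<Rightarrow> 'b::euclidean_space) \<Rightarrow> bool" where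
  "locally_integrable \<Omega> f \<longleftrightarrow> (\<forall>K. compact K \<and> K \<subseteq> \<Omega> \<longrightarrow> integrable (lebesgue_on K) f)"

definition is_weak_gradient ::
  "'a::euclidean_space set \<Rightarrow> ('a \<Rightarrow> real) \<Rightarrow> ('a \<Rightarrow> 'a) \<Rightarrow> bool" where
  "is_weak_gradient \<Omega> u g \<longleftrightarrow>
     locally_integrable \<Omega> u \<and> locally_integrable \<Omega> g \<and>
     (\<forall>\<phi>\<in>test_functions \<Omega>. \<forall>b\<in>Basis.
        (LINT x|lebesgue_on \<Omega>. u x * frechet_derivative \<phi> (at x) b)
          = - (LINT x|lebesgue_on \<Omega>. (g x \<bullet> b) * \<phi> x))"

definition weak_gradient :: "'a::euclidean_space set \<Rightarrow> ('a \<Rightarrow> real) \<Rightarrow> 'a \<Rightarrow> 'a" where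
  "weak_gradient \<Omega> u = (SOME g. is_weak_gradient \<Omega> u g)"

definition W1 :: "'a::euclidean_space set \<Rightarrow> real \<Rightarrow> ('a \<Rightarrow> real) set" where
  "W1 \<Omega> q = {u \<in> Lp \<Omega> q. \<exists>g\<in>Lp \<Omega> q. is_weak_gradient \<Omega> u g}"

definition W1_norm :: "'a::euclidean_space set \<Rightarrow> real \<Rightarrow> ('a \<Rightarrow> real) \<Rightarrow> real" where
  "W1_norm \<Omega> q u =
     (Lp_norm \<Omega> q u powr q + Lp_norm \<Omega> q (weak_gradient \<Omega> u) powr q) powr (1 / q)"

text \<open>The dual of \<open>W1 \<Omega> q\<close>. Functionals are \<open>undefined\<close> outside \<open>W1 \<Omega> q\<close>, so that each element of
  the dual is one HOL function. Boundedness forces them to agree on functions that are equal almost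
  everywhere.\<close>

definition W1_dual :: "'a::euclidean_space set \<Rightarrow> real \<Rightarrow> (('a \<Rightarrow> real) \<Rightarrow> real) set" where
  "W1_dual \<Omega> q =
     {F \<in> extensional (W1 \<Omega> q).
        (\<forall>u\<in>W1 \<Omega> q. \<forall>v\<in>W1 \<Omega> q. \<forall>a b. F (\<lambda>x. a * u x + b * v x) = a * F u + b * F v) \<and>
        (\<exists>C. \<forall>u\<in>W1 \<Omega> q. \<bar>F u\<bar> \<le> C * W1_norm \<Omega> q u)}"

definition W1_dual_norm ::
  "'a::euclidean_space set \<Rightarrow> real \<Rightarrow> (('a \<Rightarrow> real) \<Rightarrow> real) \<Rightarrow> real" where
  "W1_dual_norm \<Omega> q F = (SUP u\<in>{u \<in> W1 \<Omega> q. W1_norm \<Omega> q u \<le> 1}. \<bar>F u\<bar>)"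

text \<open>Representative in \<open>C(closure \<Omega>)\<close>; for open \<open>\<Omega>\<close> its values on \<open>closure \<Omega>\<close> are unique.\<close>

definition cont_rep :: "'a::euclidean_space set \<Rightarrow> ('a \<Rightarrow> real) \<Rightarrow> 'a \<Rightarrow> real" where
  "cont_rep \<Omega> u =
     (SOME f. continuous_on (closure \<Omega>) f \<and> (AE x in lebesgue_on \<Omega>. f x = u x))"

section \<open>Signed measures\<close>

abbreviation borel_subsets :: "'a::euclidean_space set \<Rightarrow> 'a set set" where
  "borel_subsets K \<equiv> sets (restrict_space borel K)"

text \<open>Finite signed Borel measures on \<open>K\<close>, as set functions of which only the values on Borel subsets
  of \<open>K\<close> matter. For compact \<open>K\<close>, the only case used, they are automatically Radon.\<close>

definition signed_radon :: "'a::euclidean_space set \<Rightarrow> ('a set \<Rightarrow> real) \<Rightarrow> bool" where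
  "signed_radon K \<alpha> \<longleftrightarrow>
     (\<forall>A :: nat \<Rightarrow> 'a set. range A \<subseteq> borel_subsets K \<and> disjoint_family A \<longrightarrow>
        (\<lambda>n. \<alpha> (A n)) sums \<alpha> (\<Union>n. A n))"

text \<open>Positive part of the Jordan decomposition. Negative values of \<open>\<alpha>\<close> are truncated to \<open>0\<close> by
  \<open>ennreal\<close>, which does not affect the supremum since \<open>\<alpha> {} = 0\<close>.\<close>

definition pos_part :: "'a::euclidean_space set \<Rightarrow> ('a set \<Rightarrow> real) \<Rightarrow> 'a measure" where
  "pos_part K \<alpha> = measure_of K (borel_subsets K)
     (\<lambda>B. SUP C\<in>{C \<in> borel_subsets K. C \<subseteq> B}. ennreal (\<alpha> C))"

definition signed_integral ::
  "'a::euclidean_space set \<Rightarrow> ('a set \<Rightarrow> real) \<Rightarrow> ('a \<Rightarrow> real) \<Rightarrow> real" where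
  "signed_integral K \<alpha> f =
     (LINT x|pos_part K \<alpha>. f x) - (LINT x|pos_part K (\<lambda>B. - \<alpha> B). f x)"

text \<open>The restriction of \<open>\<alpha>\<close> to \<open>E\<close> is absolutely continuous with density \<open>f\<close> on \<open>E\<close>. Here \<open>f\<close> is only
  given almost everywhere in \<open>\<Omega>\<close>; the boundary of a smooth domain is a Lebesgue null set.\<close>

definition restriction_has_density ::
  "'a::euclidean_space set \<Rightarrow> ('a set \<Rightarrow> real) \<Rightarrow> 'a set \<Rightarrow> ('a \<Rightarrow> real) \<Rightarrow> bool" where
  "restriction_has_density \<Omega> \<alpha> E f \<longleftrightarrow>
     set_integrable lebesgue (E \<inter> \<Omega>) f \<and>
     (\<forall>B\<in>borel_subsets (closure \<Omega>). \<alpha> (E \<inter> B) = (LINT x:E \<inter> B \<inter> \<Omega>|lebesgue. f x))"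

definition lebesgue_decomposition ::
  "'a::euclidean_space set \<Rightarrow> ('a set \<Rightarrow> real) \<Rightarrow> ('a set \<Rightarrow> real) \<Rightarrow> ('a set \<Rightarrow> real) \<Rightarrow> bool" where
  "lebesgue_decomposition K \<alpha> \<alpha>a \<alpha>s \<longleftrightarrow>
     signed_radon K \<alpha>a \<and> signed_radon K \<alpha>s \<and>
     (\<forall>B\<in>borel_subsets K. \<alpha> B = \<alpha>a B + \<alpha>s B) \<and>
     (\<forall>B\<in>borel_subsets K. emeasure lborel B = 0 \<longrightarrow> \<alpha>a B = 0) \<and>
     (\<exists>N\<in>borel_subsets K. emeasure lborel N = 0 \<and> (\<forall>B\<in>borel_subsets K. \<alpha>s B = \<alpha>s (B \<inter> N)))"

definition concentrated_in ::
  "'a::euclidean_space set \<Rightarrow> ('a set \<Rightarrow> real) \<Rightarrow> 'a set \<Rightarrow> bool" where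
  "concentrated_in K \<alpha> E \<longleftrightarrow> (\<forall>B\<in>borel_subsets K. B \<inter> E = {} \<longrightarrow> \<alpha> B = 0)"

section \<open>Measures and functions as elements of the dual\<close>

definition measure_functional ::
  "'a::euclidean_space set \<Rightarrow> real \<Rightarrow> ('a set \<Rightarrow> real) \<Rightarrow> ('a \<Rightarrow> real) \<Rightarrow> real" where
  "measure_functional \<Omega> q \<alpha> =
     (\<lambda>u\<in>W1 \<Omega> q. signed_integral (closure \<Omega>) \<alpha> (cont_rep \<Omega> u))"

definition function_functional ::
  "'a::euclidean_space set \<Rightarrow> real \<Rightarrow> ('a \<Rightarrow> real) \<Rightarrow> ('a \<Rightarrow> real) \<Rightarrow> real" where
  "function_functional \<Omega> q a = (\<lambda>u\<in>W1 \<Omega> q. LINT x|lebesgue_on \<Omega>. a x * u x)"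

section \<open>The functional and its subdifferential\<close>

definition ell :: "real \<Rightarrow> real \<Rightarrow> 'a::euclidean_space \<Rightarrow> ereal" where
  "ell r a b =
     (if a > 0 then ereal (1 / r * (norm b powr r / a powr (r - 1)))
      else if a = 0 \<and> b = 0 then 0 else \<infinity>)"

text \<open>The integrand is non-negative, so this is its integral in \<open>[0, \<infinity>]\<close>.\<close>

definition Lfun ::
  "'a::euclidean_space set \<Rightarrow> real \<Rightarrow> ('a \<Rightarrow> real) \<Rightarrow> ('a \<Rightarrow> 'a) \<Rightarrow> ereal" where
  "Lfun \<Omega> r m w = enn2ereal (\<integral>\<^sup>+x. e2ennreal (ell r (m x) (w x)) \<partial>lebesgue_on \<Omega>)"

definition subdifferential ::
  "'a::euclidean_space set \<Rightarrow> real \<Rightarrow> (('a \<Rightarrow> real) \<Rightarrow> ('a \<Rightarrow> 'a) \<Rightarrow> ereal) \<Rightarrow>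
   ('a \<Rightarrow> real) \<Rightarrow> ('a \<Rightarrow> 'a) \<Rightarrow> ((('a \<Rightarrow> real) \<Rightarrow> real) \<times> ('a \<Rightarrow> 'a)) set" where
  "subdifferential \<Omega> q J m w =
     {(F, \<beta>). F \<in> W1_dual \<Omega> q \<and> \<beta> \<in> Lp \<Omega> (conj_exp q) \<and> J m w < \<infinity> \<and>
        (\<forall>m'\<in>W1 \<Omega> q. \<forall>w'\<in>Lp \<Omega> q.
           J m' w' \<ge> J m w +
             ereal (F (\<lambda>x. m' x - m x) + (LINT x|lebesgue_on \<Omega>. \<beta> x \<bullet> (w' x - w x))))}"

text \<open>The parameter \<open>s\<close> plays the role of \<open>r'\<close>.\<close>

definition A_set ::
  "'a::euclidean_space set \<Rightarrow> real \<Rightarrow> (('a \<Rightarrow> real) \<times> ('a \<Rightarrow> 'a)) set" where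
  "A_set \<Omega> s =
     {(a, b). a \<in> Linf \<Omega> \<and> b \<in> Linf \<Omega> \<and>
        (AE x in lebesgue_on \<Omega>. a x + 1 / s * norm (b x) powr s \<le> 0)}"

text \<open>Norm closure in the product of \<open>W1_dual \<Omega> q\<close> and \<open>Lp \<Omega> (conj_exp q)\<close>.\<close>

definition A_closure ::
  "'a::euclidean_space set \<Rightarrow> real \<Rightarrow> real \<Rightarrow> ((('a \<Rightarrow> real) \<Rightarrow> real) \<times> ('a \<Rightarrow> 'a)) set" where
  "A_closure \<Omega> q s =
     {(F, \<beta>). F \<in> W1_dual \<Omega> q \<and> \<beta> \<in> Lp \<Omega> (conj_exp q) \<and>
        (\<forall>\<epsilon>>0. \<exists>(a, b)\<in>A_set \<Omega> s.
           W1_dual_norm \<Omega> q (\<lambda>u. F u - function_functional \<Omega> q a u) < \<epsilon> \<and>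
           Lp_norm \<Omega> (conj_exp q) (\<lambda>x. \<beta> x - b x) < \<epsilon>)}"

definition E0 :: "'a::euclidean_space set \<Rightarrow> ('a \<Rightarrow> real) \<Rightarrow> 'a set" where
  "E0 \<Omega> m = {x \<in> closure \<Omega>. m x = 0}"

definition E1 :: "'a::euclidean_space set \<Rightarrow> ('a \<Rightarrow> real) \<Rightarrow> 'a set" where
  "E1 \<Omega> m = {x \<in> closure \<Omega>. m x > 0}"

definition velocity ::
  "'a::euclidean_space set \<Rightarrow> ('a \<Rightarrow> real) \<Rightarrow> ('a \<Rightarrow> 'a) \<Rightarrow> 'a \<Rightarrow> 'a" where
  "velocity \<Omega> m w x = (if x \<in> E1 \<Omega> m then (1 / m x) *\<^sub>R w x else 0)"

end

theory Submission
  imports Defs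
begin

text \<open>The integrand is the support function of a convex set: for \<open>a \<ge> 0\<close>, \<open>ell r a b\<close> is the supremum of
  \<open>\<alpha> * a + \<beta> \<bullet> b\<close> over the pairs with \<open>\<alpha> + |\<beta>|\<^sup>s / s \<le> 0\<close>, where \<open>s\<close> is the exponent conjugate to \<open>r\<close>.
  Hence \<open>Lfun\<close> is positively homogeneous and lies above every pairing with an element of
  \<open>A_closure\<close> (\<open>A_closure_pairing_le\<close>). Because of the homogeneity, \<open>(F, \<beta>)\<close> is a
  subgradient at \<open>(m, w)\<close> exactly when the pairing with \<open>(F, \<beta>)\<close> is below \<open>Lfun\<close> everywhere and equal
  to it at \<open>(m, w)\<close> (\<open>subdifferential_pairing\<close>). Both inclusions rest on this.

  For the inclusion into the explicit set, the inequality is tested with \<open>(u, u *\<^sub>R y)\<close> where \<open>u \<ge> 0\<close> and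
  \<open>y\<close> is the vector field dual to a truncation of \<open>\<beta>\<close>. It says that \<open>F u + \<integral> |\<beta>|\<^sup>s u / s \<le> 0\<close>. With \<open>u = 1\<close> this
  gives \<open>\<beta> \<in> L\<^sup>s\<close> (\<open>beta_in_Lp\<close>); for general \<open>u\<close> it says that \<open>- F - |\<beta>|\<^sup>s / s\<close> is a positive
  functional, hence, by the Riesz representation theorem, integration against a finite measure \<open>M\<close>
  on the closure of \<open>\<Omega>\<close> (\<open>functional_representation\<close>). With \<open>v\<close> for the velocity and
  \<open>w = m *\<^sub>R v\<close>, the equality at \<open>(m, w)\<close> becomes
  \<open>\<integral> m \<partial>M + \<integral> m (|v|\<^sup>r / r + |\<beta>|\<^sup>s / s - \<beta> \<bullet> v) = 0\<close>. Both terms are non-negative, so \<open>M\<close> does not charge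
  \<open>{m > 0}\<close>, and equality holds in Young's inequality almost everywhere on that set, which means that
  \<open>\<beta> = |v|\<^bsup>r-2\<^esup> v\<close> there. In particular \<open>|v|\<^sup>r = |\<beta>|\<^sup>s\<close> on \<open>{m > 0}\<close>, so that \<open>v \<in> L\<^sup>r\<close> as soon as there is a
  subgradient, and \<open>F\<close> is integration against the signed measure \<open>- M - |\<beta>|\<^sup>s / s\<close>, whose restriction to
  \<open>{m > 0}\<close> has the density \<open>- |v|\<^sup>r / s\<close> (\<open>subdifferential_forward\<close>, \<open>representation_membership\<close>).

  Conversely, for an element of the explicit set the pairing at \<open>(m, w)\<close> only sees \<open>{m > 0}\<close>, where
  everything is known, and is \<open>\<integral> m |v|\<^sup>r (1 - 1 / s) = Lfun \<Omega> r m w\<close> (\<open>subdifferential_backward\<close>).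
  If \<open>v \<in> L\<^sup>r\<close>, the choice \<open>M = 0\<close>, \<open>\<beta> = |v|\<^bsup>r-2\<^esup> v\<close> is such an element. A measure is determined
  by the functional that it induces, so every measure that represents \<open>F\<close> is absolutely continuous on
  \<open>{m > 0}\<close>, and its singular part lives on \<open>{m = 0}\<close> (\<open>singular_part_concentrated\<close>).

  The analytic input is Morrey's embedding on a domain with smooth boundary: for \<open>q\<close> larger than the
  dimension the functions in the unit ball of \<open>W1 \<Omega> q\<close> have continuous representatives on the closure
  that are uniformly bounded and equicontinuous (\<open>W1_bounded\<close>, \<open>W1_equicontinuous\<close>). It makes
  measures on the closure act on \<open>W1 \<Omega> q\<close>, and equicontinuity shows that they are limits, in the dual
  norm, of bounded functions (\<open>smear_measure\<close>), which puts \<open>(F, \<beta>)\<close> into \<open>A_closure\<close>. The embedding is proved by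
  averaging over balls inside the cones with vertex \<open>y\<close> that a smooth boundary provides; the
  derivative of such an average in the radius is an integral of the gradient
  (\<open>kernel_average_DERIV\<close>).\<close>

section \<open>Smooth functions and a smooth cut-off\<close>

lemma frechet_derivative_eqI:
  "(f has_derivative f') (at x) \<Longrightarrow> frechet_derivative f (at x) = f'"
  using frechet_derivative_at by metis

lemma Ck_on_SucI:
  assumes "\<And>x. (f has_derivative D x) (at x)" and "\<And>b. b \<in> Basis \<Longrightarrow> Ck_on k UNIV (\<lambda>x. D x b)"
  shows "Ck_on (Suc k) UNIV f"
proof -
  have "frechet_derivative f (at x) = D x" for x
    using assms(1) by (rule frechet_derivative_eqI)
  then show ?thesis using assms by (auto simp: differentiable_def)
qed

lemma Ck_on_SucD:
  assumes "Ck_on (Suc k) UNIV f"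
  shows "(f has_derivative frechet_derivative f (at x)) (at x)"
    and "b \<in> Basis \<Longrightarrow> Ck_on k UNIV (\<lambda>x. frechet_derivative f (at x) b)"
  using assms by (auto simp: frechet_derivative_works)

lemma Ck_on_mono_Suc: "Ck_on (Suc k) UNIV f \<Longrightarrow> Ck_on k UNIV f"
proof (induction k arbitrary: f)
  case 0
  then show ?case
    by (auto intro!: differentiable_imp_continuous_on simp: differentiable_on_def)
next
  case (Suc k)
  show ?case
    by (rule Ck_on_SucI[OF Ck_on_SucD(1)[OF Suc.prems]])
       (rule Suc.IH[OF Ck_on_SucD(2)[OF Suc.prems]])
qed

lemma Ck_on_const: "Ck_on k UNIV (\<lambda>x. c)"
proof (induction k arbitrary: c)
  case (Suc k)
  show ?case by (rule Ck_on_SucI[OF has_derivative_const Suc.IH])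
qed auto

lemma Ck_on_add: "Ck_on k UNIV f \<Longrightarrow> Ck_on k UNIV g \<Longrightarrow> Ck_on k UNIV (\<lambda>x. f x + g x)"
proof (induction k arbitrary: f g)
  case (Suc k)
  note F = Ck_on_SucD[OF Suc.prems(1)] and G = Ck_on_SucD[OF Suc.prems(2)]
  show ?case
    by (rule Ck_on_SucI[OF has_derivative_add[OF F(1) G(1)]]) (intro Suc.IH F(2) G(2))
qed (auto intro!: continuous_intros)

lemma Ck_on_mult: "Ck_on k UNIV f \<Longrightarrow> Ck_on k UNIV g \<Longrightarrow> Ck_on k UNIV (\<lambda>x. f x * g x)"
proof (induction k arbitrary: f g)
  case (Suc k)
  note F = Ck_on_SucD[OF Suc.prems(1)] and G = Ck_on_SucD[OF Suc.prems(2)]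
  show ?case
    by (rule Ck_on_SucI[OF has_derivative_mult[OF F(1) G(1)]])
       (intro Ck_on_add Suc.IH F(2) G(2) Suc.prems Ck_on_mono_Suc)
qed (auto intro!: continuous_intros)

lemma Ck_on_inner: "Ck_on k UNIV (\<lambda>x. x \<bullet> v)"
proof (cases k)
  case (Suc j)
  show ?thesis unfolding Suc
    by (rule Ck_on_SucI[where D="\<lambda>x b. b \<bullet> v"])
       (auto intro!: derivative_eq_intros Ck_on_const)
qed (auto intro!: continuous_intros)

lemma Ck_on_compose_real:
  "Ck_on k UNIV (g::real \<Rightarrow> real) \<Longrightarrow> Ck_on k UNIV f \<Longrightarrow> Ck_on k UNIV (\<lambda>x. g (f x))"
proof (induction k arbitrary: f g)
  case 0
  then show ?case using continuous_on_compose2[of UNIV g UNIV f] by auto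
next
  case (Suc k)
  note F = Ck_on_SucD[OF Suc.prems(2)] and G = Ck_on_SucD[OF Suc.prems(1)]
  define g' where "g' y = frechet_derivative g (at y) 1" for y
  have lin: "frechet_derivative g (at y) h = g' y * h" for y h
  proof -
    have "linear (frechet_derivative g (at y))"
      using G(1) has_derivative_linear by blast
    from linear_scale[OF this, of h 1] show ?thesis by (simp add: g'_def mult.commute)
  qed
  have "((\<lambda>x. g (f x)) has_derivative (\<lambda>h. g' (f x) * frechet_derivative f (at x) h)) (at x)" for x
    using diff_chain_at[OF F(1)[of x] G(1)[of "f x"]] by (simp add: o_def lin)
  moreover have "Ck_on k UNIV g'"
    unfolding g'_def using G(2)[of 1] by simp
  moreover have "Ck_on k UNIV (\<lambda>x. g' (f x))"
    using Suc.IH[OF \<open>Ck_on k UNIV g'\<close> Ck_on_mono_Suc[OF Suc.prems(2)]] .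
  ultimately show ?case
    by (intro Ck_on_SucI[where D="\<lambda>x h. g' (f x) * frechet_derivative f (at x) h"] Ck_on_mult F(2))
qed

lemma smooth_const: "smooth (\<lambda>x. c)"
  by (simp add: smooth_def Ck_on_const)
lemma smooth_add: "smooth f \<Longrightarrow> smooth g \<Longrightarrow> smooth (\<lambda>x. f x + g x)"
  by (simp add: smooth_def Ck_on_add)
lemma smooth_mult: "smooth f \<Longrightarrow> smooth g \<Longrightarrow> smooth (\<lambda>x. f x * g x)"
  by (simp add: smooth_def Ck_on_mult)
lemma smooth_inner: "smooth (\<lambda>x. x \<bullet> v)"
  by (simp add: smooth_def Ck_on_inner)
lemma smooth_compose_real: "smooth (g::real \<Rightarrow> real) \<Longrightarrow> smooth f \<Longrightarrow> smooth (\<lambda>x. g (f x))"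
  by (simp add: smooth_def Ck_on_compose_real)
lemma smooth_cmult: "smooth f \<Longrightarrow> smooth (\<lambda>x. c * f x)"
  by (intro smooth_mult smooth_const)
lemma smooth_diff: "smooth f \<Longrightarrow> smooth g \<Longrightarrow> smooth (\<lambda>x. f x - g x)"
  using smooth_add[of f "\<lambda>x. (-1) * g x"] smooth_cmult[of g "-1"] by simp
lemma smooth_sum:
  "finite I \<Longrightarrow> (\<And>i. i \<in> I \<Longrightarrow> smooth (f i)) \<Longrightarrow> smooth (\<lambda>x. \<Sum>i\<in>I. f i x)"
  by (induction I rule: finite_induct) (auto intro!: smooth_const smooth_add)
lemma smooth_prod:
  "finite I \<Longrightarrow> (\<And>i. i \<in> I \<Longrightarrow> smooth (f i)) \<Longrightarrow> smooth (\<lambda>x. \<Prod>i\<in>I. f i x)"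
  by (induction I rule: finite_induct) (auto intro!: smooth_const smooth_mult)
lemma smooth_inner_affine: "smooth (\<lambda>x. (s *\<^sub>R x + v) \<bullet> w)"
  by (simp add: inner_add_left smooth_add smooth_cmult smooth_inner smooth_const)

lemma smooth_has_derivative: "smooth f \<Longrightarrow> (f has_derivative frechet_derivative f (at x)) (at x)"
  unfolding smooth_def using Ck_on_SucD(1) by blast
lemma smooth_partial: "smooth f \<Longrightarrow> b \<in> Basis \<Longrightarrow> smooth (\<lambda>x. frechet_derivative f (at x) b)"
  unfolding smooth_def using Ck_on_SucD(2) by blast
lemma smooth_continuous: "smooth f \<Longrightarrow> continuous_on S f"
  unfolding smooth_def using continuous_on_subset[of UNIV f S] Ck_on.simps(1) by blast

text \<open>The functions \<open>exp (- 1 / t) / t\<^sup>j\<close>, extended by \<open>0\<close>. The family in \<open>j\<close> is closed under differentiation up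
  to linear combinations, so that smoothness of its members can be shown for all of them
  simultaneously by induction on the order.\<close>
definition flat_exp :: "nat \<Rightarrow> real \<Rightarrow> real" where
  "flat_exp j t = (if t > 0 then exp (- (1 / t)) / t ^ j else 0)"

lemma flat_exp_tendsto_0: "(flat_exp j \<longlongrightarrow> 0) (at 0)"
proof -
  have "((\<lambda>t::real. (inverse t)^j / exp (inverse t)) \<longlongrightarrow> 0) (at_right 0)"
    by (rule filterlim_compose[OF tendsto_power_div_exp_0 filterlim_inverse_at_top_right])
  then have R: "(flat_exp j \<longlongrightarrow> 0) (at_right 0)"
    by (rule Lim_transform_eventually)
       (auto simp: eventually_at_filter flat_exp_def exp_minus field_simps)
  have L: "(flat_exp j \<longlongrightarrow> 0) (at_left 0)"
    by (rule Lim_transform_eventually[OF tendsto_const])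
       (auto simp: eventually_at_filter flat_exp_def)
  show ?thesis using L R by (simp add: filterlim_split_at_real)
qed

lemma flat_exp_DERIV:
  "(flat_exp j has_real_derivative (flat_exp (j+2) t - real j * flat_exp (j+1) t)) (at t)"
proof (cases "t = 0")
  case True
  have "((\<lambda>h. (flat_exp j (0 + h) - flat_exp j 0) / h) \<longlongrightarrow> 0) (at 0)"
    by (rule Lim_transform_eventually[OF flat_exp_tendsto_0[of "j+1"]])
       (auto simp: eventually_at_filter flat_exp_def)
  then show ?thesis using True by (simp add: DERIV_def flat_exp_def)
next
  case False
  show ?thesis
  proof (cases "t > 0")
    case True
    have "((\<lambda>t. exp (- (1 / t)) / t ^ j) has_real_derivative
        (exp (- (1/t)) / t^(j+2) - real j * (exp (-(1/t)) / t^(j+1)))) (at t)"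
    proof -
      have d1: "((\<lambda>t. exp (- (1 / t))) has_real_derivative exp (- (1/t)) / t^2) (at t)"
        using True by (auto intro!: derivative_eq_intros simp: power2_eq_square)
      have d2: "((\<lambda>t. t ^ j) has_real_derivative real j * t ^ (j - 1)) (at t)"
        using DERIV_pow[of j t] by simp
      show ?thesis
      proof (rule DERIV_cong[OF DERIV_divide[OF d1 d2]])
        have "real j * t ^ (j - 1) * t = real j * t ^ j" by (cases j) auto
        then have "real j * t ^ (j - 1) = real j * t ^ j / t" using True by (simp add: field_simps)
        then show "(exp (- (1 / t)) / t\<^sup>2 * t ^ j - exp (- (1 / t)) * (real j * t ^ (j - 1))) / (t ^ j * t ^ j)
            = exp (- (1/t)) / t^(j+2) - real j * (exp (-(1/t)) / t^(j+1))"
          using True by (simp only:) (simp add: field_simps power2_eq_square)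
      qed (use True in simp)
    qed
    then have "((\<lambda>t. exp (- (1 / t)) / t ^ j) has_real_derivative
        (flat_exp (j+2) t - real j * flat_exp (j+1) t)) (at t)"
      using True by (simp add: flat_exp_def)
    then show ?thesis
      by (rule has_field_derivative_transform_within_open[where S="{0<..}"])
         (use True in \<open>auto simp: flat_exp_def\<close>)
  next
    case F: False
    have "((\<lambda>t. 0) has_real_derivative (flat_exp (j+2) t - real j * flat_exp (j+1) t)) (at t)"
      using F by (simp add: flat_exp_def)
    then show ?thesis
      by (rule has_field_derivative_transform_within_open[where S="{..<0}"])
         (use F False in \<open>auto simp: flat_exp_def\<close>)
  qed
qed

lemma smooth_flat_exp: "smooth (flat_exp j)"
proof -
  have "Ck_on k UNIV (flat_exp j)" for k
  proof (induction k arbitrary: j)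
    case 0
    show ?case
      by (auto intro!: DERIV_continuous_on has_field_derivative_at_within[OF flat_exp_DERIV])
  next
    case (Suc k)
    have "Ck_on k UNIV (\<lambda>x. (flat_exp (j+2) x + (- real j) * flat_exp (j+1) x) * b)" for b
      by (intro Ck_on_mult Ck_on_const Ck_on_add Suc.IH)
    then show ?case
      using flat_exp_DERIV[of j]
      by (intro Ck_on_SucI[where D="\<lambda>x h. (flat_exp (j+2) x + (- real j) * flat_exp (j+1) x) * h"])
         (simp_all add: has_field_derivative_def del: Basis_real_def)
  qed
  then show ?thesis by (simp add: smooth_def)
qed

lemma flat_exp_bounds: "0 \<le> flat_exp 0 t" "flat_exp 0 t \<le> 1" "t > 0 \<Longrightarrow> 0 < flat_exp 0 t"
  "t \<le> 0 \<Longrightarrow> flat_exp 0 t = 0"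
  by (auto simp: flat_exp_def)

lemma integral_lebesgue_on_eq:
  fixes f :: "'a::euclidean_space \<Rightarrow> 'b::euclidean_space"
  assumes "open S" "\<And>x. x \<notin> S \<Longrightarrow> f x = 0"
  shows "(LINT x|lebesgue_on S. f x) = (LINT x|lebesgue. f x)"
proof -
  have "(\<lambda>x. indicator S x *\<^sub>R f x) = f" using assms(2) by (intro ext) (auto simp: indicator_def)
  then show ?thesis using assms(1) by (subst integral_restrict_space) auto
qed

lemma integrable_lebesgue_on_eq:
  fixes f :: "'a::euclidean_space \<Rightarrow> 'b::euclidean_space"
  assumes "S \<in> sets lebesgue" "\<And>x. x \<notin> S \<Longrightarrow> f x = 0"
  shows "integrable (lebesgue_on S) f \<longleftrightarrow> integrable lebesgue f"
proof -
  have "(\<lambda>x. indicator S x *\<^sub>R f x) = f" using assms(2) by (intro ext) (auto simp: indicator_def)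
  then show ?thesis using assms(1) by (subst integrable_restrict_space) auto
qed

text \<open>Integration by parts in its simplest form: the one-dimensional integral along each line in the
  direction \<open>b\<close> vanishes.\<close>
lemma integral_partial_compact_support:
  fixes \<psi> :: "'a::euclidean_space \<Rightarrow> real"
  assumes d: "\<And>x. (\<psi> has_derivative \<psi>' x) (at x)"
    and c: "continuous_on UNIV (\<lambda>x. \<psi>' x b)"
    and K: "compact K" "\<And>x. x \<notin> K \<Longrightarrow> \<psi> x = 0"
  shows "(LINT x|lebesgue. \<psi>' x b) = 0"
proof -
  have z: "\<psi>' x b = 0" if "x \<notin> K" for x
  proof -
    have "(\<psi> has_derivative (\<lambda>h. 0)) (at x)"
      by (rule has_derivative_transform_within_open[OF has_derivative_const, of "- K"])
         (use that K compact_imp_closed in \<open>auto\<close>)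
    from has_derivative_unique[OF d this] show ?thesis by simp
  qed
  have cont: "continuous_on UNIV \<psi>"
    using d by (meson continuous_at_imp_continuous_on has_derivative_continuous)
  obtain M where M: "\<And>x. x \<in> K \<Longrightarrow> norm (\<psi>' x b) \<le> M"
    using compact_imp_bounded[OF compact_continuous_image[OF continuous_on_subset[OF c] K(1)]]
    by (auto simp: bounded_iff)
  define M' where "M' = max M 0"
  have M': "norm (\<psi>' x b) \<le> M'" for x
    using M[of x] z[of x] by (cases "x \<in> K") (auto simp: M'_def)
  define K' where "K' = {x + y |x y. x \<in> K \<and> y \<in> cball 0 (norm b)}"
  have "compact K'" unfolding K'_def
    by (rule compact_sums[OF K(1) compact_cball])
  have K'I: "y + v \<in> K'" if "y \<in> K" "norm v \<le> norm b" for y v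
    using that unfolding K'_def by auto
  define q where "q n x = real (Suc n) * (\<psi> (x + (1 / real (Suc n)) *\<^sub>R b) - \<psi> x)" for n x
  have q0: "q n x = 0" if "x \<notin> K'" for n x
  proof -
    have "x \<notin> K"
    proof
      assume "x \<in> K"
      then have "x + 0 \<in> K'" by (rule K'I) simp
      with that show False by simp
    qed
    moreover have "x + (1 / real (Suc n)) *\<^sub>R b \<notin> K"
    proof
      assume *: "x + (1 / real (Suc n)) *\<^sub>R b \<in> K"
      have "(x + (1 / real (Suc n)) *\<^sub>R b) + (- (1 / real (Suc n)) *\<^sub>R b) \<in> K'"
        by (rule K'I[OF *]) (auto simp: field_simps mult_left_le)
      with that show False by simp
    qed
    ultimately show ?thesis using K(2) by (simp add: q_def)
  qed
  have dq: "((\<lambda>t. \<psi> (x + t *\<^sub>R b)) has_real_derivative \<psi>' (x + t *\<^sub>R b) b) (at t)" for x t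
  proof -
    have "((\<lambda>t. x + t *\<^sub>R b) has_derivative (\<lambda>h. h *\<^sub>R b)) (at t)"
      by (auto intro!: derivative_eq_intros)
    from diff_chain_at[OF this d]
    have "((\<lambda>t. \<psi> (x + t *\<^sub>R b)) has_derivative (\<lambda>h. \<psi>' (x + t *\<^sub>R b) (h *\<^sub>R b))) (at t)"
      by (simp add: o_def)
    moreover have "\<psi>' (x + t *\<^sub>R b) (h *\<^sub>R b) = \<psi>' (x + t *\<^sub>R b) b * h" for h
      using linear_scale[OF has_derivative_linear[OF d]] by (simp add: mult.commute)
    ultimately show ?thesis by (simp add: has_field_derivative_def mult_commute_abs)
  qed
  have qb: "norm (q n x) \<le> M' * indicator K' x" for n x
  proof (cases "x \<in> K'")
    case True
    have "\<exists>z>0. z < 1 / real (Suc n) \<and> \<psi> (x + (1 / real (Suc n)) *\<^sub>R b) - \<psi> (x + 0 *\<^sub>R b)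
        = (1 / real (Suc n) - 0) * \<psi>' (x + z *\<^sub>R b) b"
      by (rule MVT2) (auto intro: dq)
    then obtain z where "\<psi> (x + (1 / real (Suc n)) *\<^sub>R b) - \<psi> x
        = (1 / real (Suc n)) * \<psi>' (x + z *\<^sub>R b) b" by auto
    then have "q n x = \<psi>' (x + z *\<^sub>R b) b" unfolding q_def by (simp add: field_simps)
    then show ?thesis using M' True by simp
  qed (simp add: q0)
  have lim: "(\<lambda>n. q n x) \<longlonglongrightarrow> \<psi>' x b" for x
  proof -
    have "((\<lambda>h. (\<psi> (x + (0+h) *\<^sub>R b) - \<psi> (x + 0 *\<^sub>R b)) / h) \<longlongrightarrow> \<psi>' (x + 0 *\<^sub>R b) b) (at 0)"
      using dq[of x 0] unfolding DERIV_def by simp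
    moreover have "filterlim (\<lambda>n. 1 / real (Suc n)) (at 0) sequentially"
      using LIMSEQ_Suc[OF lim_1_over_n] unfolding filterlim_at by (auto simp: field_simps)
    ultimately have "(\<lambda>n. (\<psi> (x + (0 + 1 / real (Suc n)) *\<^sub>R b) - \<psi> (x + 0 *\<^sub>R b)) / (1 / real (Suc n)))
        \<longlonglongrightarrow> \<psi>' (x + 0 *\<^sub>R b) b"
      by (rule filterlim_compose)
    then show ?thesis by (simp add: q_def field_simps)
  qed
  have int\<psi>: "integrable lborel \<psi>"
  proof -
    have "integrable lborel (\<lambda>x. indicator K x *\<^sub>R \<psi> x)"
      by (rule borel_integrable_compact[OF K(1)]) (rule continuous_on_subset[OF cont], simp)
    moreover have "(\<lambda>x. indicator K x *\<^sub>R \<psi> x) = \<psi>" using K(2) by (intro ext) (auto simp: indicator_def)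
    ultimately show ?thesis by simp
  qed
  have "integral\<^sup>L lborel (q n) = 0" for n
  proof -
    have "integrable lborel (\<lambda>x. \<psi> (x + (1 / real (Suc n)) *\<^sub>R b))"
      and "(LINT x|lborel. \<psi> (x + (1 / real (Suc n)) *\<^sub>R b)) = integral\<^sup>L lborel \<psi>"
    proof -
      let ?v = "(1 / real (Suc n)) *\<^sub>R b"
      have *: "distr lborel borel ((+) ?v) = lborel" by (rule lborel_distr_plus)
      show "integrable lborel (\<lambda>x. \<psi> (x + ?v))"
        using int\<psi> integrable_distr_eq[of "(+) ?v" lborel borel \<psi>] * cont
        by (simp add: borel_measurable_continuous_onI add.commute)
      show "(LINT x|lborel. \<psi> (x + ?v)) = integral\<^sup>L lborel \<psi>"
        using integral_distr[of "(+) ?v" lborel borel \<psi>] * cont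
        by (simp add: borel_measurable_continuous_onI add.commute)
    qed
    then show ?thesis using int\<psi> unfolding q_def by simp
  qed
  moreover have "(\<lambda>n. integral\<^sup>L lborel (q n)) \<longlonglongrightarrow> (LINT x|lborel. \<psi>' x b)"
  proof (rule integral_dominated_convergence[where w="\<lambda>x. M' * indicator K' x"])
    show "(\<lambda>x. \<psi>' x b) \<in> borel_measurable lborel" using c by (simp add: borel_measurable_continuous_onI)
    have [measurable]: "\<psi> \<in> borel_measurable borel" using cont by (simp add: borel_measurable_continuous_onI)
    show "q n \<in> borel_measurable lborel" for n unfolding q_def by measurable
    show "integrable lborel (\<lambda>x. M' * indicator K' x)"
      using borel_integrable_compact[OF \<open>compact K'\<close> continuous_on_const, of M']
      by (simp add: mult.commute)
  qed (use qb lim in auto)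
  ultimately have "(LINT x|lborel. \<psi>' x b) = 0" by (simp add: LIMSEQ_const_iff)
  then show ?thesis
    using c by (subst integral_completion) (auto simp: borel_measurable_continuous_onI)
qed

section \<open>The fundamental lemma of the calculus of variations\<close>

lemma smooth_borel_measurable: "smooth f \<Longrightarrow> f \<in> borel_measurable borel"
  using smooth_continuous borel_measurable_continuous_onI by blast
lemma smooth_lebesgue_measurable: "smooth f \<Longrightarrow> f \<in> borel_measurable lebesgue"
  using smooth_borel_measurable by (intro measurable_completion) simp

text \<open>The positive and the negative part of \<open>h\<close> are densities of measures that agree on the boxes, a
  generating family closed under intersection.\<close>
lemma integral_boxes_zero_imp_AE_zero:
  fixes h :: "'a::euclidean_space \<Rightarrow> real"
  assumes h: "integrable lborel h"
    and z: "\<And>a b. (LINT x|lborel. indicator (box a b) x * h x) = 0"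
  shows "AE x in lborel. h x = 0"
proof -
  have [measurable]: "h \<in> borel_measurable borel" using h by auto
  define p where "p x = ennreal (h x)" for x
  define n where "n x = ennreal (- h x)" for x
  have [measurable]: "p \<in> borel_measurable borel" "n \<in> borel_measurable borel"
    unfolding p_def n_def by measurable
  have i: "integrable lborel (\<lambda>x. indicator (box a b) x * h x)" for a b
    using integrable_mult_indicator[OF _ h, of "box a b"] by simp
  have emp: "emeasure (density lborel p) (box a b) = \<integral>\<^sup>+ x. ennreal (indicator (box a b) x * h x) \<partial>lborel"
    and emn: "emeasure (density lborel n) (box a b) = \<integral>\<^sup>+ x. ennreal (- (indicator (box a b) x * h x)) \<partial>lborel" for a b
    by (auto simp: emeasure_density p_def n_def indicator_def intro!: nn_integral_cong)
  have fin: "(\<integral>\<^sup>+ x. ennreal (indicator (box a b) x * h x) \<partial>lborel) \<noteq> \<infinity>"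
    "(\<integral>\<^sup>+ x. ennreal (- (indicator (box a b) x * h x)) \<partial>lborel) \<noteq> \<infinity>" for a b
    using i[of a b] unfolding real_integrable_def by auto
  have eq: "emeasure (density lborel p) (box a b) = emeasure (density lborel n) (box a b)" for a b
  proof -
    have "enn2real (\<integral>\<^sup>+ x. ennreal (indicator (box a b) x * h x) \<partial>lborel) =
       enn2real (\<integral>\<^sup>+ x. ennreal (- (indicator (box a b) x * h x)) \<partial>lborel)"
      using real_lebesgue_integral_def[OF i[of a b]] z[of a b] by simp
    from arg_cong[OF this, of ennreal] show ?thesis unfolding emp emn using fin[of a b]
      by (simp add: ennreal_enn2real_if)
  qed
  have "density lborel p = density lborel n"
  proof (rule measure_eqI_generator_eq[where E="range (\<lambda>(a, b). box a b)" and \<Omega>=UNIV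
        and A="\<lambda>i. box (- real i *\<^sub>R One) (real i *\<^sub>R One)"])
    show "Int_stable (range (\<lambda>(a, b). box a b :: 'a set))"
      by (auto simp: Int_stable_def box_Int_box)
    show "sets (density lborel p) = sigma_sets UNIV (range (\<lambda>(a, b). box a b))"
      "sets (density lborel n) = sigma_sets UNIV (range (\<lambda>(a, b). box a b))"
      by (auto simp: borel_eq_box)
    show "(\<Union>i::nat. box (- real i *\<^sub>R One) (real i *\<^sub>R One)) = (UNIV :: 'a set)"
      using UN_box_eq_UNIV by auto
    show "emeasure (density lborel p) (box (- real i *\<^sub>R One) (real i *\<^sub>R One)) \<noteq> \<infinity>" for i
      using fin(1) unfolding emp by blast
  qed (use eq in auto)
  then have "AE x in lborel. p x = n x"
    by (intro sigma_finite_measure.density_unique) (auto intro: sigma_finite_lborel)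
  then show ?thesis
  proof eventually_elim
    case (elim x)
    show ?case
    proof (cases "h x \<ge> 0")
      case True
      then show ?thesis using elim by (simp add: p_def n_def ennreal_neg)
    next
      case False
      then show ?thesis using elim ennreal_eq_0_iff[of "- h x"] by (simp add: p_def n_def ennreal_neg)
    qed
  qed
qed

lemma integral_boxes_zero_imp_AE_zero_lebesgue:
  fixes h :: "'a::euclidean_space \<Rightarrow> real"
  assumes h: "integrable lebesgue h"
    and z: "\<And>a b. (LINT x|lebesgue. indicator (box a b) x * h x) = 0"
  shows "AE x in lebesgue. h x = 0"
proof -
  have hm: "h \<in> borel_measurable lebesgue" using h by auto
  obtain h' where h'[measurable]: "h' \<in> borel_measurable lborel" and ae: "AE x in lborel. h x = h' x"
    using completion_ex_borel_measurable_real[OF hm] by blast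
  have ae': "AE x in lebesgue. h x = h' x" using ae by (rule AE_completion)
  have h'l: "h' \<in> borel_measurable lebesgue" using h' by (rule measurable_completion)
  have "integrable lebesgue h'"
    using integrable_cong_AE[OF hm h'l ae'] h by simp
  then have i: "integrable lborel h'" by (simp add: integrable_completion)
  have "(LINT x|lborel. indicator (box a b) x * h' x) = 0" for a b
  proof -
    have "(LINT x|lborel. indicator (box a b) x * h' x) = (LINT x|lebesgue. indicator (box a b) x * h' x)"
      by (rule integral_completion[symmetric]) measurable
    also have "\<dots> = (LINT x|lebesgue. indicator (box a b) x * h x)"
      using ae' hm h'l
      by (intro integral_cong_AE borel_measurable_times borel_measurable_indicator) auto
    finally show ?thesis using z by simp
  qed
  from integral_boxes_zero_imp_AE_zero[OF i this] have "AE x in lebesgue. h' x = 0"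
    by (rule AE_completion)
  with ae' show ?thesis by eventually_elim simp
qed

lemma flat_exp_tendsto_indicator:
  "(\<lambda>n. flat_exp 0 (real (Suc n) * s)) \<longlonglongrightarrow> (if s > 0 then 1 else 0)"
proof (cases "s > 0")
  case True
  have "(\<lambda>n. exp (- ((1/s) * (1 / real (Suc n))))) \<longlonglongrightarrow> exp (- ((1/s) * 0))"
    by (intro tendsto_intros LIMSEQ_Suc[OF lim_1_over_n])
  moreover have "flat_exp 0 (real (Suc n) * s) = exp (- ((1/s) * (1 / real (Suc n))))" for n
    using True by (simp add: flat_exp_def field_simps add_pos_nonneg)
  ultimately show ?thesis using True by simp
next
  case False
  then have "flat_exp 0 (real (Suc n) * s) = 0" for n
    by (intro flat_exp_bounds(4)) (auto simp: mult_nonneg_nonpos)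
  then show ?thesis using False by simp
qed

text \<open>Smooth approximations of the indicator of a box: each factor tends to the indicator of a half line.\<close>
definition box_bump :: "'a::euclidean_space \<Rightarrow> 'a \<Rightarrow> nat \<Rightarrow> 'a \<Rightarrow> real" where
  "box_bump c d n x = (\<Prod>b\<in>Basis. flat_exp 0 (real (Suc n) * (x \<bullet> b - c \<bullet> b)) *
      flat_exp 0 (real (Suc n) * (d \<bullet> b - x \<bullet> b)))"

lemma smooth_box_bump: "smooth (box_bump c d n)"
  unfolding box_bump_def
  by (intro smooth_prod smooth_mult smooth_compose_real[OF smooth_flat_exp] smooth_cmult
      smooth_diff smooth_inner smooth_const finite_Basis)

lemma box_bump_bounds: "0 \<le> box_bump c d n x" "box_bump c d n x \<le> 1"
  unfolding box_bump_def
  by (auto intro!: prod_nonneg prod_le_1 mult_nonneg_nonneg mult_le_one flat_exp_bounds)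

lemma box_bump_outside: "x \<notin> box c d \<Longrightarrow> box_bump c d n x = 0"
proof -
  assume "x \<notin> box c d"
  then obtain b where b: "b \<in> Basis" "x \<bullet> b - c \<bullet> b \<le> 0 \<or> d \<bullet> b - x \<bullet> b \<le> 0"
    by (auto simp: mem_box not_less)
  then have "flat_exp 0 (real (Suc n) * (x \<bullet> b - c \<bullet> b)) = 0 \<or> flat_exp 0 (real (Suc n) * (d \<bullet> b - x \<bullet> b)) = 0"
    by (metis flat_exp_bounds(4) mult_nonneg_nonpos of_nat_0_le_iff)
  then show ?thesis
    unfolding box_bump_def by (intro prod_zero) (use b in auto)
qed

lemma box_bump_tendsto: "(\<lambda>n. box_bump c d n x) \<longlonglongrightarrow> indicator (box c d) x"
proof -
  have "(\<lambda>n. box_bump c d n x) \<longlonglongrightarrow> (\<Prod>b\<in>Basis. (if x \<bullet> b - c \<bullet> b > 0 then 1 else 0) *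
     (if d \<bullet> b - x \<bullet> b > 0 then 1 else 0))"
    unfolding box_bump_def by (intro tendsto_prod tendsto_mult flat_exp_tendsto_indicator)
  moreover have "(\<Prod>b\<in>Basis. (if x \<bullet> b - c \<bullet> b > 0 then 1 else 0) *
     (if d \<bullet> b - x \<bullet> b > 0 then 1 else (0::real))) = indicator (box c d) x"
    by (auto simp: indicator_def mem_box)
  ultimately show ?thesis by simp
qed

lemma test_functionsI:
  assumes "smooth \<phi>" "compact K" "K \<subseteq> \<Omega>" "\<And>x. x \<notin> K \<Longrightarrow> \<phi> x = 0"
  shows "\<phi> \<in> test_functions \<Omega>"
proof -
  have "closure {x. \<phi> x \<noteq> 0} \<subseteq> K"
    using assms by (intro closure_minimal) (auto intro: compact_imp_closed)
  then have "compact (closure {x. \<phi> x \<noteq> 0})"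
    using assms(2) by (metis bounded_subset closed_closure compact_eq_bounded_closed)
  then show ?thesis using assms \<open>closure {x. \<phi> x \<noteq> 0} \<subseteq> K\<close> by (auto simp: test_functions_def)
qed

lemma box_bump_test: "cbox c d \<subseteq> \<Omega> \<Longrightarrow> box_bump c d n \<in> test_functions \<Omega>"
  using box_subset_cbox
  by (intro test_functionsI[OF smooth_box_bump, of "cbox c d"] box_bump_outside) auto

lemma locally_integrable_cbox:
  assumes "locally_integrable \<Omega> f" "compact K" "K \<subseteq> \<Omega>"
  shows "integrable lebesgue (\<lambda>x. indicator K x *\<^sub>R f x)"
proof -
  have "K \<in> sets lebesgue" using assms(2) by (simp add: compact_imp_closed)
  moreover have "integrable (lebesgue_on K) f" using assms unfolding locally_integrable_def by blast
  ultimately show ?thesis by (subst (asm) integrable_restrict_space) auto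
qed

text \<open>The indicator of a box with closure inside \<open>\<Omega>\<close> is a bounded pointwise limit of test functions, so the integrals of \<open>f\<close> over
  all such boxes vanish; countably many of them cover \<open>\<Omega>\<close>.\<close>
lemma test_orthogonal_imp_AE_zero:
  fixes f :: "'a::euclidean_space \<Rightarrow> real"
  assumes op: "open \<Omega>" and li: "locally_integrable \<Omega> f"
    and z: "\<And>\<phi>. \<phi> \<in> test_functions \<Omega> \<Longrightarrow> (LINT x|lebesgue_on \<Omega>. f x * \<phi> x) = 0"
  shows "AE x in lebesgue_on \<Omega>. f x = 0"
proof -
  have box0: "(LINT x|lebesgue. indicator (box c d) x * f x) = 0" if cd: "cbox c d \<subseteq> \<Omega>" for c d
  proof -
    have I: "integrable lebesgue (\<lambda>x. indicator (cbox c d) x * f x)"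
      using locally_integrable_cbox[OF li compact_cbox cd] by simp
    have I2: "integrable lebesgue (\<lambda>x. indicator (box c d) x * (indicator (cbox c d) x * f x))"
      using integrable_mult_indicator[OF _ I, of "box c d"] by simp
    have e1: "(\<lambda>x. indicator (box c d) x * (indicator (cbox c d) x * f x)) = (\<lambda>x. indicator (box c d) x * f x)"
      using box_subset_cbox[of c d] by (intro ext) (auto simp: indicator_def)
    have e2: "box_bump c d n x * (indicator (cbox c d) x * f x) = f x * box_bump c d n x" for n x
      using box_bump_outside[of x c d n] subsetD[OF box_subset_cbox, of x c d] by (cases "x \<in> cbox c d") auto
    have "(\<lambda>n. LINT x|lebesgue. box_bump c d n x * (indicator (cbox c d) x * f x)) \<longlonglongrightarrow>
        (LINT x|lebesgue. indicator (box c d) x * (indicator (cbox c d) x * f x))"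
    proof (rule integral_dominated_convergence[where w="\<lambda>x. \<bar>indicator (cbox c d) x * f x\<bar>"])
      show "(\<lambda>x. indicator (box c d) x * (indicator (cbox c d) x * f x)) \<in> borel_measurable lebesgue"
        using I2 by auto
      have "box_bump c d n \<in> borel_measurable lebesgue" for n
        by (rule smooth_lebesgue_measurable[OF smooth_box_bump])
      then show "(\<lambda>x. box_bump c d n x * (indicator (cbox c d) x * f x)) \<in> borel_measurable lebesgue" for n
        by (rule borel_measurable_times[OF _ borel_measurable_integrable[OF I]])
      show "integrable lebesgue (\<lambda>x. \<bar>indicator (cbox c d) x * f x\<bar>)" using I by auto
      show "AE x in lebesgue. (\<lambda>n. box_bump c d n x * (indicator (cbox c d) x * f x))
          \<longlonglongrightarrow> indicator (box c d) x * (indicator (cbox c d) x * f x)"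
        by (intro AE_I2 tendsto_mult box_bump_tendsto tendsto_const)
      show "AE x in lebesgue. norm (box_bump c d n x * (indicator (cbox c d) x * f x)) \<le> \<bar>indicator (cbox c d) x * f x\<bar>" for n
        using box_bump_bounds[of c d n] by (auto simp: abs_mult intro!: mult_left_le_one_le)
    qed
    moreover have "(LINT x|lebesgue. box_bump c d n x * (indicator (cbox c d) x * f x)) = 0" for n
    proof -
      have "(LINT x|lebesgue_on \<Omega>. f x * box_bump c d n x) = (LINT x|lebesgue. f x * box_bump c d n x)"
        using box_bump_outside[of _ c d n] box_subset_cbox[of c d] cd
        by (intro integral_lebesgue_on_eq[OF op]) (metis mult_zero_right subsetD)
      then show ?thesis using z[OF box_bump_test[OF cd, of n]] by (simp add: e2)
    qed
    ultimately show ?thesis by (simp add: LIMSEQ_const_iff e1)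
  qed
  have ae_box: "AE x in lebesgue. x \<in> cbox c d \<longrightarrow> f x = 0" if cd: "cbox c d \<subseteq> \<Omega>" for c d
  proof -
    let ?h = "\<lambda>x. indicator (box c d) x * f x"
    have I: "integrable lebesgue (\<lambda>x. indicator (cbox c d) x * f x)"
      using locally_integrable_cbox[OF li compact_cbox cd] by simp
    have e1: "(\<lambda>x. indicator (box c d) x * (indicator (cbox c d) x * f x)) = ?h"
      using box_subset_cbox[of c d] by (intro ext) (auto simp: indicator_def)
    have I2: "integrable lebesgue ?h"
      using integrable_mult_indicator[OF _ I, of "box c d"] by (simp add: e1)
    have "(LINT x|lebesgue. indicator (box a b) x * ?h x) = 0" for a b
    proof -
      obtain c' d' where c'd': "box a b \<inter> box c d = box c' d'" 
        by (rule that) (rule box_Int_box)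
      show ?thesis
      proof (cases "box c' d' = {}")
        case True
        then have "(\<lambda>x. indicator (box a b) x * ?h x) = (\<lambda>x. 0)" using c'd'
          by (intro ext) (auto simp: indicator_def)
        then show ?thesis by simp
      next
        case False
        have "box c' d' \<subseteq> cbox c d" using c'd' box_subset_cbox[of c d] by auto
        then have "cbox c' d' \<subseteq> cbox c d"
          using closure_minimal[of "box c' d'" "cbox c d"] closure_box[OF False] by auto
        then have "(LINT x|lebesgue. indicator (box c' d') x * f x) = 0" using box0 cd by blast
        moreover have "(\<lambda>x. indicator (box a b) x * ?h x) = (\<lambda>x. indicator (box c' d') x * f x)"
          using c'd' by (intro ext) (auto simp: indicator_def)
        ultimately show ?thesis by simp
      qed
    qed
    from integral_boxes_zero_imp_AE_zero_lebesgue[OF I2 this]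
    have 1: "AE x in lebesgue. ?h x = 0" .
    have "cbox c d - box c d \<in> null_sets lebesgue"
      using negligible_frontier_interval[of c d] by (simp add: negligible_iff_null_sets)
    then have "AE x in lebesgue. x \<notin> cbox c d - box c d" by (rule AE_not_in)
    with 1 show ?thesis by eventually_elim (auto simp: indicator_def split: if_splits)
  qed
  obtain D where D: "countable D" "\<And>X. X \<in> D \<Longrightarrow> X \<subseteq> \<Omega>" "\<And>X. X \<in> D \<Longrightarrow> \<exists>a b. X = cbox a b" "\<Union>D = \<Omega>"
    using open_countable_Union_open_cbox[OF op] by (metis PowD subsetD)
  have "AE x in lebesgue. \<forall>X\<in>D. x \<in> X \<longrightarrow> f x = 0"
    using D ae_box by (intro AE_ball_countable'[OF _ D(1)]) metis
  then have "AE x in lebesgue. x \<in> \<Omega> \<longrightarrow> f x = 0"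
    by eventually_elim (use D(4) in auto)
  then show ?thesis using op by (subst AE_restrict_space_iff) auto
qed

section \<open>Lebesgue and Sobolev spaces\<close>

lemma bounded_open_lmeasurable: "bounded \<Omega> \<Longrightarrow> open \<Omega> \<Longrightarrow> \<Omega> \<in> lmeasurable"
  using bounded_set_imp_lmeasurable borel_open sets_completionI_sets sets_lborel by (metis lmeasurable_open)

lemma lebesgue_on_measurable_AE:
  fixes f g :: "'a::euclidean_space \<Rightarrow> 'b::euclidean_space"
  assumes S: "S \<in> sets lebesgue" and f: "f \<in> borel_measurable (lebesgue_on S)"
    and ae: "AE x in lebesgue_on S. f x = g x"
  shows "g \<in> borel_measurable (lebesgue_on S)"
proof -
  have 1: "(\<lambda>x. if x \<in> S then f x else 0) \<in> borel_measurable lebesgue"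
    using f S by (simp add: borel_measurable_if)
  have "AE x in lebesgue. x \<in> S \<longrightarrow> f x = g x"
    using ae S by (subst (asm) AE_restrict_space_iff) auto
  then have 2: "AE x in lebesgue. (if x \<in> S then f x else 0) = (if x \<in> S then g x else 0)"
    by eventually_elim auto
  show ?thesis using borel_measurable_AE[OF 1 2] S by (simp add: borel_measurable_if)
qed

lemma norm_add_powr_le:
  fixes x y :: "'b::real_normed_vector"
  assumes "p \<ge> 0"
  shows "norm (x + y) powr p \<le> 2 powr p * (norm x powr p + norm y powr p)"
proof -
  have "norm (x + y) powr p \<le> (2 * max (norm x) (norm y)) powr p"
    using norm_triangle_ineq[of x y] assms by (intro powr_mono2) auto
  also have "\<dots> = 2 powr p * max (norm x) (norm y) powr p" by (simp add: powr_mult)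
  also have "max (norm x) (norm y) powr p \<le> norm x powr p + norm y powr p" by (auto simp: max_def)
  finally show ?thesis by (simp add: mult_left_mono)
qed

lemma Lp_add:
  assumes "p \<ge> 0" "f \<in> Lp \<Omega> p" "g \<in> Lp \<Omega> p" shows "(\<lambda>x. f x + g x) \<in> Lp \<Omega> p"
proof -
  have [measurable]: "f \<in> borel_measurable (lebesgue_on \<Omega>)" "g \<in> borel_measurable (lebesgue_on \<Omega>)"
    using assms by (auto simp: Lp_def)
  have "integrable (lebesgue_on \<Omega>) (\<lambda>x. 2 powr p * (norm (f x) powr p + norm (g x) powr p))"
    using assms by (auto simp: Lp_def)
  then have "integrable (lebesgue_on \<Omega>) (\<lambda>x. norm (f x + g x) powr p)"
    by (rule Bochner_Integration.integrable_bound) (use norm_add_powr_le[OF assms(1)] in auto)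
  then show ?thesis by (simp add: Lp_def)
qed

lemma Lp_scaleR:
  assumes "f \<in> Lp \<Omega> p" shows "(\<lambda>x. c *\<^sub>R f x) \<in> Lp \<Omega> p"
  using assms by (auto simp: Lp_def powr_mult)

lemma Lp_bounded:
  assumes "\<Omega> \<in> lmeasurable" "f \<in> borel_measurable (lebesgue_on \<Omega>)" "\<And>x. x \<in> \<Omega> \<Longrightarrow> norm (f x) \<le> C" "p \<ge> 0"
  shows "f \<in> Lp \<Omega> p"
proof -
  interpret finite_measure "lebesgue_on \<Omega>" using assms(1) by (rule finite_measure_lebesgue_on)
  have [measurable]: "f \<in> borel_measurable (lebesgue_on \<Omega>)" by fact
  have "integrable (lebesgue_on \<Omega>) (\<lambda>x. norm (f x) powr p)"
    using assms(3) assms(4)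
    by (intro integrable_const_bound[where B="C powr p"]) (auto intro!: powr_mono2)
  then show ?thesis using assms by (simp add: Lp_def)
qed

lemma Lp_integrable:
  assumes "\<Omega> \<in> lmeasurable" "p \<ge> 1" "f \<in> Lp \<Omega> p"
  shows "integrable (lebesgue_on \<Omega>) f"
proof -
  interpret finite_measure "lebesgue_on \<Omega>" using assms(1) by (rule finite_measure_lebesgue_on)
  have i: "integrable (lebesgue_on \<Omega>) (\<lambda>x. 1 + norm (f x) powr p)"
    using assms by (auto simp: Lp_def)
  have b: "norm (f x) \<le> norm (1 + norm (f x) powr p)" for x
  proof (cases "norm (f x) \<le> 1")
    case False
    then have "norm (f x) powr 1 \<le> norm (f x) powr p" using assms by (intro powr_mono) auto
    then show ?thesis using False by simp
  next
    case True
    then show ?thesis by (smt (verit) real_norm_def powr_ge_zero)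
  qed
  show ?thesis
    by (rule Bochner_Integration.integrable_bound[OF i]) (use b assms in \<open>auto simp: Lp_def\<close>)
qed

lemma Lp_mono_exponent:
  assumes "\<Omega> \<in> lmeasurable" "0 \<le> p" "p \<le> s" "f \<in> Lp \<Omega> s"
  shows "f \<in> Lp \<Omega> p"
proof -
  interpret finite_measure "lebesgue_on \<Omega>" using assms(1) by (rule finite_measure_lebesgue_on)
  have [measurable]: "f \<in> borel_measurable (lebesgue_on \<Omega>)" using assms by (simp add: Lp_def)
  have i: "integrable (lebesgue_on \<Omega>) (\<lambda>x. 1 + norm (f x) powr s)"
    using assms by (auto simp: Lp_def)
  have b: "norm (norm (f x) powr p) \<le> norm (1 + norm (f x) powr s)" for x
  proof (cases "norm (f x) \<le> 1")
    case True
    then have "norm (f x) powr p \<le> 1" using assms by (intro powr_le1) auto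
    then show ?thesis by (simp add: add_increasing2)
  next
    case False
    then have "norm (f x) powr p \<le> norm (f x) powr s" using assms by (intro powr_mono) auto
    then show ?thesis by simp
  qed
  have "integrable (lebesgue_on \<Omega>) (\<lambda>x. norm (f x) powr p)"
    by (rule Bochner_Integration.integrable_bound[OF i]) (use b in auto)
  then show ?thesis by (simp add: Lp_def)
qed

lemma Lp_cong_AE:
  assumes S: "\<Omega> \<in> sets lebesgue" and f: "f \<in> Lp \<Omega> p" and ae: "AE x in lebesgue_on \<Omega>. f x = g x"
  shows "g \<in> Lp \<Omega> p"
proof -
  have m: "f \<in> borel_measurable (lebesgue_on \<Omega>)" using f by (simp add: Lp_def)
  have g: "g \<in> borel_measurable (lebesgue_on \<Omega>)" by (rule lebesgue_on_measurable_AE[OF S m ae])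
  have ae': "AE x in lebesgue_on \<Omega>. norm (f x) powr p = norm (g x) powr p" using ae by eventually_elim simp
  have "integrable (lebesgue_on \<Omega>) (\<lambda>x. norm (g x) powr p)"
    using integrable_cong_AE[OF _ _ ae'] m g f by (simp add: Lp_def)
  then show ?thesis using g by (simp add: Lp_def)
qed

lemma Lp_norm_powr: "p > 0 \<Longrightarrow> Lp_norm \<Omega> p f powr p = (LINT x|lebesgue_on \<Omega>. norm (f x) powr p)"
  by (simp add: Lp_norm_def powr_powr)

lemma integrable_imp_locally_integrable:
  assumes "\<Omega> \<in> sets lebesgue" "integrable (lebesgue_on \<Omega>) f"
  shows "locally_integrable \<Omega> f"
  unfolding locally_integrable_def
proof safe
  fix K assume K: "compact K" "K \<subseteq> \<Omega>"
  have K': "K \<in> sets lebesgue" using K by (simp add: compact_imp_closed)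
  have "integrable lebesgue (\<lambda>x. indicator \<Omega> x *\<^sub>R f x)"
    using assms by (subst (asm) integrable_restrict_space) auto
  from integrable_mult_indicator[OF K' this]
  have "integrable lebesgue (\<lambda>x. indicator K x *\<^sub>R indicator \<Omega> x *\<^sub>R f x)" .
  moreover have "(\<lambda>x. indicator K x *\<^sub>R indicator \<Omega> x *\<^sub>R f x) = (\<lambda>x. indicator K x *\<^sub>R f x)"
    using K by (intro ext) (auto simp: indicator_def)
  ultimately show "integrable (lebesgue_on K) f"
    using K' by (subst integrable_restrict_space) auto
qed

lemma test_function_smooth: "\<phi> \<in> test_functions \<Omega> \<Longrightarrow> smooth \<phi>"
  by (simp add: test_functions_def)

lemma test_function_outside:
  assumes "\<phi> \<in> test_functions \<Omega>" "x \<notin> closure {x. \<phi> x \<noteq> 0}" shows "\<phi> x = 0"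
  using assms closure_subset[of "{x. \<phi> x \<noteq> 0}"] by auto

lemma test_function_zero: "\<phi> \<in> test_functions \<Omega> \<Longrightarrow> x \<notin> \<Omega> \<Longrightarrow> \<phi> x = 0"
  using test_function_outside[of \<phi> \<Omega> x] unfolding test_functions_def by blast

lemma test_function_partial:
  assumes "\<phi> \<in> test_functions \<Omega>" "b \<in> Basis"
  shows "(\<lambda>x. frechet_derivative \<phi> (at x) b) \<in> test_functions \<Omega>"
proof (rule test_functionsI[where K="closure {x. \<phi> x \<noteq> 0}"])
  show "smooth (\<lambda>x. frechet_derivative \<phi> (at x) b)" using assms by (intro smooth_partial test_function_smooth)
  fix x assume x: "x \<notin> closure {x. \<phi> x \<noteq> 0}"
  have op: "open (- closure {x. \<phi> x \<noteq> 0})" by (rule open_Compl) (rule closed_closure)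
  have xc: "x \<in> - closure {x. \<phi> x \<noteq> 0}" using x by (simp only: Compl_iff not_False_eq_True)
  have eq: "0 = \<phi> y" if "y \<in> - closure {x. \<phi> x \<noteq> 0}" for y
    using test_function_outside[OF assms(1)] that by (metis ComplD)
  have "(\<phi> has_derivative (\<lambda>h. 0)) (at x)"
    by (rule has_derivative_transform_within_open[OF has_derivative_const[of 0] op xc eq])
  then show "frechet_derivative \<phi> (at x) b = 0" by (simp add: frechet_derivative_eqI)
qed (use assms in \<open>auto simp: test_functions_def\<close>)

lemma test_function_bounded:
  assumes "\<phi> \<in> test_functions \<Omega>" shows "\<exists>C. \<forall>x. \<bar>\<phi> x\<bar> \<le> C"
proof -
  let ?K = "closure {x. \<phi> x \<noteq> 0}"
  have "compact (\<phi> ` ?K)"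
    using assms by (intro compact_continuous_image smooth_continuous) (auto simp: test_functions_def)
  then obtain C where C: "\<And>x. x \<in> ?K \<Longrightarrow> \<bar>\<phi> x\<bar> \<le> C"
    using compact_imp_bounded by (fastforce simp: bounded_iff)
  have *: "\<bar>\<phi> x\<bar> \<le> max C 0" for x
    using C[of x] test_function_outside[OF assms, of x] by (cases "x \<in> ?K") auto
  then show ?thesis by blast
qed

lemma integrable_times_test:
  fixes f :: "'a::euclidean_space \<Rightarrow> real"
  assumes op: "open \<Omega>" and li: "locally_integrable \<Omega> f" and t: "\<phi> \<in> test_functions \<Omega>"
  shows "integrable (lebesgue_on \<Omega>) (\<lambda>x. f x * \<phi> x)"
proof -
  let ?K = "closure {x. \<phi> x \<noteq> 0}"
  have K: "compact ?K" "?K \<subseteq> \<Omega>" using t by (auto simp: test_functions_def)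
  obtain C where C: "\<And>x. \<bar>\<phi> x\<bar> \<le> C" using test_function_bounded[OF t] by blast
  have I: "integrable lebesgue (\<lambda>x. indicator ?K x *\<^sub>R f x)" by (rule locally_integrable_cbox[OF li K])
  have I': "integrable lebesgue (\<lambda>x. C * \<bar>indicator ?K x *\<^sub>R f x\<bar>)" using I by auto
  have [measurable]: "\<phi> \<in> borel_measurable lebesgue"
    using smooth_lebesgue_measurable[OF test_function_smooth[OF t]] .
  have "integrable lebesgue (\<lambda>x. (indicator ?K x *\<^sub>R f x) * \<phi> x)"
  proof (rule Bochner_Integration.integrable_bound[OF I'])
    show "AE x in lebesgue. norm ((indicator ?K x *\<^sub>R f x) * \<phi> x) \<le> norm (C * \<bar>indicator ?K x *\<^sub>R f x\<bar>)"
      using C by (intro AE_I2) (auto simp: abs_mult mult.commute order_trans[OF abs_ge_zero C] intro!: mult_right_mono)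
  qed (use I in measurable)
  moreover have "(\<lambda>x. (indicator ?K x *\<^sub>R f x) * \<phi> x) = (\<lambda>x. f x * \<phi> x)"
  proof
    fix x show "(indicator ?K x *\<^sub>R f x) * \<phi> x = f x * \<phi> x"
      using test_function_outside[OF t, of x] by (cases "x \<in> ?K") simp_all
  qed
  moreover have "f x * \<phi> x = 0" if "x \<notin> \<Omega>" for x
    using test_function_zero[OF t that] by simp
  ultimately show ?thesis using op integrable_lebesgue_on_eq[of \<Omega> "\<lambda>x. f x * \<phi> x"] by simp
qed

lemma locally_integrable_add:
  "locally_integrable \<Omega> f \<Longrightarrow> locally_integrable \<Omega> g \<Longrightarrow> locally_integrable \<Omega> (\<lambda>x. f x + g x)"
  by (auto simp: locally_integrable_def)
lemma locally_integrable_scaleR: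
  "locally_integrable \<Omega> f \<Longrightarrow> locally_integrable \<Omega> (\<lambda>x. c *\<^sub>R f x)"
  by (auto simp: locally_integrable_def)
lemma locally_integrable_inner:
  "locally_integrable \<Omega> f \<Longrightarrow> locally_integrable \<Omega> (\<lambda>x. f x \<bullet> b)"
  by (auto simp: locally_integrable_def)

lemma is_weak_gradient_lincomb:
  assumes op: "open \<Omega>" and "is_weak_gradient \<Omega> u g" "is_weak_gradient \<Omega> v h"
  shows "is_weak_gradient \<Omega> (\<lambda>x. a * u x + b * v x) (\<lambda>x. a *\<^sub>R g x + b *\<^sub>R h x)"
proof -
  have li: "locally_integrable \<Omega> u" "locally_integrable \<Omega> v" "locally_integrable \<Omega> g" "locally_integrable \<Omega> h"
    using assms by (auto simp: is_weak_gradient_def)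
  show ?thesis unfolding is_weak_gradient_def
  proof (intro conjI ballI)
    show "locally_integrable \<Omega> (\<lambda>x. a * u x + b * v x)"
      using locally_integrable_add[OF locally_integrable_scaleR[OF li(1)] locally_integrable_scaleR[OF li(2)]]
      by simp
    show "locally_integrable \<Omega> (\<lambda>x. a *\<^sub>R g x + b *\<^sub>R h x)"
      using locally_integrable_add[OF locally_integrable_scaleR[OF li(3)] locally_integrable_scaleR[OF li(4)]] .
    fix \<phi> e assume t: "\<phi> \<in> test_functions \<Omega>" and e: "e \<in> (Basis :: 'a set)"
    let ?d = "\<lambda>x. frechet_derivative \<phi> (at x) e"
    note t' = test_function_partial[OF t e]
    have "(LINT x|lebesgue_on \<Omega>. (a * u x + b * v x) * ?d x) =
      a * (LINT x|lebesgue_on \<Omega>. u x * ?d x) + b * (LINT x|lebesgue_on \<Omega>. v x * ?d x)"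
      using integrable_times_test[OF op li(1) t'] integrable_times_test[OF op li(2) t']
      by (simp add: algebra_simps)
    also have "\<dots> = a * - (LINT x|lebesgue_on \<Omega>. (g x \<bullet> e) * \<phi> x) + b * - (LINT x|lebesgue_on \<Omega>. (h x \<bullet> e) * \<phi> x)"
      using assms t e by (simp add: is_weak_gradient_def)
    also have "\<dots> = - (LINT x|lebesgue_on \<Omega>. ((a *\<^sub>R g x + b *\<^sub>R h x) \<bullet> e) * \<phi> x)"
      using integrable_times_test[OF op locally_integrable_inner[OF li(3)] t]
        integrable_times_test[OF op locally_integrable_inner[OF li(4)] t]
      by (simp add: inner_add_left algebra_simps)
    finally show "(LINT x|lebesgue_on \<Omega>. (a * u x + b * v x) * ?d x) =
      - (LINT x|lebesgue_on \<Omega>. ((a *\<^sub>R g x + b *\<^sub>R h x) \<bullet> e) * \<phi> x)" .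
  qed
qed

text \<open>Integrating by parts, the difference of two weak gradients is orthogonal to all test functions.\<close>
lemma weak_gradient_unique:
  assumes op: "open \<Omega>" and g: "is_weak_gradient \<Omega> u g" and h: "is_weak_gradient \<Omega> u h"
  shows "AE x in lebesgue_on \<Omega>. g x = h x"
proof -
  have li: "locally_integrable \<Omega> g" "locally_integrable \<Omega> h"
    using assms by (auto simp: is_weak_gradient_def)
  have "AE x in lebesgue_on \<Omega>. g x \<bullet> e - h x \<bullet> e = 0" if e: "e \<in> Basis" for e
  proof (rule test_orthogonal_imp_AE_zero[OF op])
    show "locally_integrable \<Omega> (\<lambda>x. g x \<bullet> e - h x \<bullet> e)"
      using locally_integrable_add[OF locally_integrable_inner[OF li(1), of e]
        locally_integrable_scaleR[OF locally_integrable_inner[OF li(2), of e], of "-1"]] by simp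
    fix \<phi> assume t: "\<phi> \<in> test_functions \<Omega>"
    have "(LINT x|lebesgue_on \<Omega>. (g x \<bullet> e) * \<phi> x) = (LINT x|lebesgue_on \<Omega>. (h x \<bullet> e) * \<phi> x)"
    proof -
      have "(LINT x|lebesgue_on \<Omega>. u x * frechet_derivative \<phi> (at x) e) = - (LINT x|lebesgue_on \<Omega>. (g x \<bullet> e) * \<phi> x)"
        using g t e unfolding is_weak_gradient_def by blast
      moreover have "(LINT x|lebesgue_on \<Omega>. u x * frechet_derivative \<phi> (at x) e) = - (LINT x|lebesgue_on \<Omega>. (h x \<bullet> e) * \<phi> x)"
        using h t e unfolding is_weak_gradient_def by blast
      ultimately show ?thesis by linarith
    qed
    then show "(LINT x|lebesgue_on \<Omega>. (g x \<bullet> e - h x \<bullet> e) * \<phi> x) = 0"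
      using integrable_times_test[OF op locally_integrable_inner[OF li(1)] t]
        integrable_times_test[OF op locally_integrable_inner[OF li(2)] t]
      by (simp add: left_diff_distrib)
  qed
  then have "AE x in lebesgue_on \<Omega>. \<forall>e\<in>Basis. g x \<bullet> e - h x \<bullet> e = 0"
    by (intro AE_finite_allI) auto
  then show ?thesis by eventually_elim (auto intro: euclidean_eqI)
qed

lemma is_weak_gradient_cong_AE:
  assumes op: "open \<Omega>" and ae: "AE x in lebesgue_on \<Omega>. u x = v x" and g: "is_weak_gradient \<Omega> u g"
  shows "is_weak_gradient \<Omega> v g"
proof -
  have S: "\<Omega> \<in> sets lebesgue" using op by auto
  have li: "locally_integrable \<Omega> u" using g by (simp add: is_weak_gradient_def)
  have ael: "AE x in lebesgue. x \<in> \<Omega> \<longrightarrow> u x = v x"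
    using ae S by (subst (asm) AE_restrict_space_iff) auto
  have li': "locally_integrable \<Omega> v" unfolding locally_integrable_def
  proof safe
    fix K assume K: "compact K" "K \<subseteq> \<Omega>"
    have K': "K \<in> sets lebesgue" using K by (simp add: compact_imp_closed)
    have iu: "integrable (lebesgue_on K) u" using li K by (auto simp: locally_integrable_def)
    have aeK: "AE x in lebesgue_on K. u x = v x"
      using ael K K' by (subst AE_restrict_space_iff) auto
    have "v \<in> borel_measurable (lebesgue_on K)"
      using lebesgue_on_measurable_AE[OF K' _ aeK] iu by auto
    then show "integrable (lebesgue_on K) v"
      using integrable_cong_AE[OF _ _ aeK] iu by auto
  qed
  have "(LINT x|lebesgue_on \<Omega>. v x * \<phi> x) = (LINT x|lebesgue_on \<Omega>. u x * \<phi> x)" if t: "\<phi> \<in> test_functions \<Omega>" for \<phi>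
    using integrable_times_test[OF op li t] integrable_times_test[OF op li' t] ae
    by (intro integral_cong_AE) auto
  then have "(LINT x|lebesgue_on \<Omega>. v x * frechet_derivative \<phi> (at x) b) =
      (LINT x|lebesgue_on \<Omega>. u x * frechet_derivative \<phi> (at x) b)"
    if "\<phi> \<in> test_functions \<Omega>" "b \<in> Basis" for \<phi> b
    using test_function_partial[OF that] by blast
  then show ?thesis using g li' unfolding is_weak_gradient_def by simp
qed

lemma W1_D:
  assumes "open \<Omega>" "u \<in> W1 \<Omega> q"
  shows "u \<in> Lp \<Omega> q" "is_weak_gradient \<Omega> u (weak_gradient \<Omega> u)" "weak_gradient \<Omega> u \<in> Lp \<Omega> q"
proof -
  obtain g where g: "g \<in> Lp \<Omega> q" "is_weak_gradient \<Omega> u g" using assms by (auto simp: W1_def)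
  show *: "is_weak_gradient \<Omega> u (weak_gradient \<Omega> u)"
    using someI[of "is_weak_gradient \<Omega> u", OF g(2)] by (simp add: weak_gradient_def)
  show "weak_gradient \<Omega> u \<in> Lp \<Omega> q"
    using assms(1) by (intro Lp_cong_AE[OF _ g(1) weak_gradient_unique[OF assms(1) g(2) *]]) auto
qed (use assms in \<open>auto simp: W1_def\<close>)

lemma W1_lincomb:
  assumes "open \<Omega>" "q \<ge> 0" "u \<in> W1 \<Omega> q" "v \<in> W1 \<Omega> q"
  shows "(\<lambda>x. a * u x + b * v x) \<in> W1 \<Omega> q"
proof -
  note U = W1_D[OF assms(1,3)] and V = W1_D[OF assms(1,4)]
  have "(\<lambda>x. a * u x + b * v x) \<in> Lp \<Omega> q"
    using Lp_add[OF assms(2) Lp_scaleR[OF U(1), of a] Lp_scaleR[OF V(1), of b]] by simp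
  then show ?thesis
    unfolding W1_def using is_weak_gradient_lincomb[OF assms(1) U(2) V(2)]
      Lp_add[OF assms(2) Lp_scaleR[OF U(3), of a] Lp_scaleR[OF V(3), of b]] by blast
qed

lemma W1_cong_AE:
  assumes op: "open \<Omega>" and u: "u \<in> W1 \<Omega> q" and ae: "AE x in lebesgue_on \<Omega>. u x = v x"
  shows "v \<in> W1 \<Omega> q" "W1_norm \<Omega> q v = W1_norm \<Omega> q u"
proof -
  have S: "\<Omega> \<in> sets lebesgue" using op by auto
  have ae': "AE x in lebesgue_on \<Omega>. v x = u x" using ae by eventually_elim simp
  have eq: "is_weak_gradient \<Omega> v g = is_weak_gradient \<Omega> u g" for g
    using is_weak_gradient_cong_AE[OF op ae] is_weak_gradient_cong_AE[OF op ae'] by blast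
  have v: "v \<in> Lp \<Omega> q" using Lp_cong_AE[OF S W1_D(1)[OF op u] ae] .
  then show "v \<in> W1 \<Omega> q" using u eq by (auto simp: W1_def)
  have "Lp_norm \<Omega> q v = Lp_norm \<Omega> q u"
    unfolding Lp_norm_def using v W1_D(1)[OF op u] ae
    by (intro arg_cong[where f="\<lambda>x. x powr (1/q)"] integral_cong_AE) (auto simp: Lp_def)
  then show "W1_norm \<Omega> q v = W1_norm \<Omega> q u"
    by (simp add: W1_norm_def weak_gradient_def eq)
qed

lemma W1_norm_powr:
  assumes "q > 0"
  shows "W1_norm \<Omega> q u powr q = (LINT x|lebesgue_on \<Omega>. \<bar>u x\<bar> powr q) + (LINT x|lebesgue_on \<Omega>. norm (weak_gradient \<Omega> u x) powr q)"
  using assms by (simp add: W1_norm_def powr_powr Lp_norm_powr)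

lemma W1_norm_nonneg: "0 \<le> W1_norm \<Omega> q u"
  by (simp add: W1_norm_def)

text \<open>The chosen weak gradient of \<open>c * u\<close> need not be \<open>c\<close> times the one chosen for \<open>u\<close>; they agree almost everywhere by
  uniqueness.\<close>
lemma W1_norm_scale:
  assumes op: "open \<Omega>" and q: "q > 0" and u: "u \<in> W1 \<Omega> q"
  shows "W1_norm \<Omega> q (\<lambda>x. c * u x) = \<bar>c\<bar> * W1_norm \<Omega> q u"
proof -
  note U = W1_D[OF op u]
  have cu: "(\<lambda>x. c * u x) \<in> W1 \<Omega> q" using W1_lincomb[OF op _ u u, of c 0] q by simp
  have "is_weak_gradient \<Omega> (\<lambda>x. c * u x) (\<lambda>x. c *\<^sub>R weak_gradient \<Omega> u x)"
    using is_weak_gradient_lincomb[OF op U(2) U(2), of c 0] by simp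
  from weak_gradient_unique[OF op W1_D(2)[OF op cu] this]
  have ae: "AE x in lebesgue_on \<Omega>. weak_gradient \<Omega> (\<lambda>x. c * u x) x = c *\<^sub>R weak_gradient \<Omega> u x" .
  have "(LINT x|lebesgue_on \<Omega>. norm (weak_gradient \<Omega> (\<lambda>x. c * u x) x) powr q) =
     (LINT x|lebesgue_on \<Omega>. norm (c *\<^sub>R weak_gradient \<Omega> u x) powr q)"
    using W1_D(3)[OF op cu] Lp_scaleR[OF U(3), of c] ae by (intro integral_cong_AE) (auto simp: Lp_def)
  then have "W1_norm \<Omega> q (\<lambda>x. c * u x) powr q = \<bar>c\<bar> powr q * W1_norm \<Omega> q u powr q"
    using q by (simp add: W1_norm_powr abs_mult powr_mult distrib_left)
  also have "\<dots> = (\<bar>c\<bar> * W1_norm \<Omega> q u) powr q" by (simp add: powr_mult W1_norm_nonneg)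
  finally have "W1_norm \<Omega> q (\<lambda>x. c * u x) powr q = (\<bar>c\<bar> * W1_norm \<Omega> q u) powr q" .
  from arg_cong[OF this, of "\<lambda>y. y powr (1 / q)"] show ?thesis
    using q by (simp add: powr_powr W1_norm_nonneg)
qed

lemma smooth_in_W1:
  assumes op: "open \<Omega>" and bd: "bounded \<Omega>" and q: "q \<ge> 1" and f: "smooth f"
  shows "f \<in> W1 \<Omega> q"
proof -
  have lm: "\<Omega> \<in> lmeasurable" using op bd by (simp add: bounded_open_lmeasurable)
  have S: "\<Omega> \<in> sets lebesgue" using op by auto
  have Lp: "h \<in> Lp \<Omega> q" if c: "continuous_on UNIV h" for h :: "'a \<Rightarrow> 'b::euclidean_space"
  proof -
    have "compact (h ` closure \<Omega>)"
      using bd by (intro compact_continuous_image continuous_on_subset[OF c]) auto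
    then obtain C where C: "\<And>x. x \<in> closure \<Omega> \<Longrightarrow> norm (h x) \<le> C"
      using compact_imp_bounded by (fastforce simp: bounded_iff)
    show ?thesis
      using C closure_subset[of \<Omega>] q continuous_imp_measurable_on_sets_lebesgue[OF continuous_on_subset[OF c] S]
      by (intro Lp_bounded[OF lm, of _ C]) auto
  qed
  define g where "g x = (\<Sum>b\<in>Basis. frechet_derivative f (at x) b *\<^sub>R b)" for x
  have gb: "g x \<bullet> b = frechet_derivative f (at x) b" if "b \<in> Basis" for x b
    unfolding g_def using that by (simp add: inner_sum_left_Basis)
  have gL: "g \<in> Lp \<Omega> q" unfolding g_def
    by (intro Lp continuous_intros smooth_continuous smooth_partial[OF f])
  have fL: "f \<in> Lp \<Omega> q" by (intro Lp smooth_continuous f)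
  have "is_weak_gradient \<Omega> f g" unfolding is_weak_gradient_def
  proof (intro conjI ballI)
    show "locally_integrable \<Omega> f" "locally_integrable \<Omega> g"
      using integrable_imp_locally_integrable[OF S Lp_integrable[OF lm q fL]]
        integrable_imp_locally_integrable[OF S Lp_integrable[OF lm q gL]] .
    then have li: "locally_integrable \<Omega> f" "locally_integrable \<Omega> g" .
    fix \<phi> b assume t: "\<phi> \<in> test_functions \<Omega>" and b: "b \<in> (Basis :: 'a set)"
    let ?K = "closure {x. \<phi> x \<noteq> 0}"
    let ?d = "\<lambda>x. frechet_derivative \<phi> (at x) b"
    note s = test_function_smooth[OF t]
    note t' = test_function_partial[OF t b]
    have "(LINT x|lebesgue. f x * ?d x + frechet_derivative f (at x) b * \<phi> x) = 0"
    proof (rule integral_partial_compact_support[where \<psi>="\<lambda>x. f x * \<phi> x" and K = ?K and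
          \<psi>'="\<lambda>x h. f x * frechet_derivative \<phi> (at x) h + frechet_derivative f (at x) h * \<phi> x"])
      show "((\<lambda>x. f x * \<phi> x) has_derivative
         (\<lambda>h. f x * frechet_derivative \<phi> (at x) h + frechet_derivative f (at x) h * \<phi> x)) (at x)" for x
        by (rule has_derivative_mult[OF smooth_has_derivative[OF f] smooth_has_derivative[OF s]])
      show "continuous_on UNIV (\<lambda>x. f x * frechet_derivative \<phi> (at x) b + frechet_derivative f (at x) b * \<phi> x)"
        by (intro continuous_intros smooth_continuous f s smooth_partial b)
      show "compact ?K" using t by (simp add: test_functions_def)
      show "f x * \<phi> x = 0" if "x \<notin> ?K" for x
        by (simp only: test_function_outside[OF t that] mult_zero_right)
    qed
    moreover have "(LINT x|lebesgue_on \<Omega>. f x * ?d x + (g x \<bullet> b) * \<phi> x) =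
      (LINT x|lebesgue. f x * ?d x + frechet_derivative f (at x) b * \<phi> x)"
    proof (subst integral_lebesgue_on_eq[OF op])
      fix x assume "x \<notin> \<Omega>"
      then have "\<phi> x = 0" "?d x = 0"
        using test_function_zero[OF t] test_function_zero[OF t'] by blast+
      then show "f x * ?d x + (g x \<bullet> b) * \<phi> x = 0" by simp
    qed (simp add: gb b)
    ultimately show "(LINT x|lebesgue_on \<Omega>. f x * ?d x) = - (LINT x|lebesgue_on \<Omega>. (g x \<bullet> b) * \<phi> x)"
      using integrable_times_test[OF op li(1) t'] integrable_times_test[OF op locally_integrable_inner[OF li(2)] t]
      by simp
  qed
  then show ?thesis using fL gL by (auto simp: W1_def)
qed

section \<open>Averages over shrinking balls\<close>

definition bump :: "real \<Rightarrow> 'a::euclidean_space \<Rightarrow> real" where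
  "bump R \<xi> = flat_exp 0 (R\<^sup>2 - \<xi> \<bullet> \<xi>)"

lemma bump_bounds: "0 \<le> bump R \<xi>" "bump R \<xi> \<le> 1"
  by (simp_all add: bump_def flat_exp_bounds)

lemma bump_zero: "R > 0 \<Longrightarrow> norm \<xi> \<ge> R \<Longrightarrow> bump R \<xi> = 0"
  unfolding bump_def
  by (intro flat_exp_bounds(4)) (simp add: dot_square_norm power_mono)

lemma bump_pos: "norm \<xi> < R \<Longrightarrow> bump R \<xi> > 0"
  unfolding bump_def
  by (intro flat_exp_bounds(3)) (simp add: dot_square_norm power_strict_mono)

lemma bump_minus: "bump R (- \<xi>) = bump R \<xi>"
  by (simp add: bump_def)

lemma smooth_inner_self: "smooth (\<lambda>x::'a::euclidean_space. x \<bullet> x)"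
proof -
  have "smooth (\<lambda>x::'a. \<Sum>b\<in>Basis. (x \<bullet> b) * (x \<bullet> b))"
    by (intro smooth_sum smooth_mult smooth_inner finite_Basis)
  then show ?thesis by (simp add: euclidean_inner[symmetric])
qed

lemma smooth_bump: "smooth (bump R)"
  unfolding bump_def
  by (intro smooth_compose_real[OF smooth_flat_exp] smooth_diff smooth_const smooth_inner_self)

lemma continuous_flat_exp: "continuous_on S f \<Longrightarrow> continuous_on S (\<lambda>x. flat_exp j (f x))"
  using continuous_on_compose2[OF smooth_continuous[OF smooth_flat_exp, of UNIV]] by blast

lemma flat_exp_has_derivative:
  "(f has_derivative f') (at x) \<Longrightarrow> ((\<lambda>x. flat_exp 0 (f x)) has_derivative (\<lambda>h. flat_exp 2 (f x) * f' h)) (at x)"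
  using DERIV_compose_FDERIV[of "flat_exp 0" "flat_exp 2 (f x)" f x f' UNIV] flat_exp_DERIV[of 0 "f x"]
  by (simp add: mult.commute numeral_2_eq_2)

lemma bump_has_derivative:
  "(bump R has_derivative (\<lambda>h. - 2 * (\<xi> \<bullet> h) * flat_exp 2 (R\<^sup>2 - \<xi> \<bullet> \<xi>))) (at \<xi>)"
proof -
  have "((\<lambda>\<xi>. R\<^sup>2 - \<xi> \<bullet> \<xi>) has_derivative (\<lambda>h. - 2 * (\<xi> \<bullet> h))) (at \<xi>)"
    by (auto intro!: derivative_eq_intros simp: inner_commute)
  from flat_exp_has_derivative[OF this] show ?thesis
    by (simp add: bump_def[abs_def] mult.commute)
qed

lemma bump_lipschitz:
  assumes "R > 0"
  shows "\<exists>L\<ge>0. \<forall>\<xi> \<xi>'. \<bar>bump R (\<xi>::'a::euclidean_space) - bump R \<xi>'\<bar> \<le> L * norm (\<xi> - \<xi>')"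
proof -
  have "compact (flat_exp 2 ` {0..R\<^sup>2})"
    by (intro compact_continuous_image continuous_flat_exp continuous_on_id compact_Icc smooth_continuous smooth_flat_exp)
  then obtain M where M: "\<And>t. t \<in> {0..R\<^sup>2} \<Longrightarrow> \<bar>flat_exp 2 t\<bar> \<le> M"
    using compact_imp_bounded by (fastforce simp: bounded_iff)
  have M0: "M \<ge> 0" using M[of 0] by fastforce
  have on: "onorm (\<lambda>h. - 2 * (\<xi> \<bullet> h) * flat_exp 2 (R\<^sup>2 - \<xi> \<bullet> \<xi>)) \<le> 2 * R * M" for \<xi> :: 'a
  proof (rule onorm_le)
    fix h
    show "norm (- 2 * (\<xi> \<bullet> h) * flat_exp 2 (R\<^sup>2 - \<xi> \<bullet> \<xi>)) \<le> 2 * R * M * norm h"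
    proof (cases "norm \<xi> \<le> R")
      case True
      then have "\<xi> \<bullet> \<xi> \<le> R\<^sup>2" by (simp add: dot_square_norm power_mono)
      then have "\<bar>flat_exp 2 (R\<^sup>2 - \<xi> \<bullet> \<xi>)\<bar> \<le> M" by (intro M) auto
      moreover have "\<bar>\<xi> \<bullet> h\<bar> \<le> R * norm h"
        using Cauchy_Schwarz_ineq2[of \<xi> h] True by (meson mult_right_mono norm_ge_zero order_trans)
      ultimately have "\<bar>\<xi> \<bullet> h\<bar> * \<bar>flat_exp 2 (R\<^sup>2 - \<xi> \<bullet> \<xi>)\<bar> \<le> (R * norm h) * M"
        using assms by (intro mult_mono) auto
      then show ?thesis by (simp add: abs_mult algebra_simps)
    next
      case False
      then have "R\<^sup>2 < \<xi> \<bullet> \<xi>" using assms by (simp add: dot_square_norm power_strict_mono)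
      then show ?thesis using assms M0 by (simp add: flat_exp_def)
    qed
  qed
  have "norm (bump R \<xi> - bump R \<xi>') \<le> 2 * R * M * norm (\<xi> - \<xi>')" for \<xi> \<xi>' :: 'a
    by (rule differentiable_bound[OF convex_UNIV]) (use bump_has_derivative on in auto)
  then show ?thesis using assms M0 by (intro exI[of _ "2 * R * M"]) auto
qed

text \<open>The average kernels below are not normalised: this constant is their common integral.\<close>
definition bump_mass :: "'a::euclidean_space itself \<Rightarrow> real \<Rightarrow> real" where
  "bump_mass _ R = (LINT z|lborel. bump R (z::'a))"

lemma bump_integrable: "R > 0 \<Longrightarrow> integrable lborel (bump R)"
proof -
  assume R: "R > 0"
  have "integrable lborel (\<lambda>x::'a. indicator (cball 0 R) x *\<^sub>R bump R x)"
    by (rule borel_integrable_compact) (auto intro: smooth_continuous smooth_bump)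
  moreover have "(\<lambda>x::'a. indicator (cball 0 R) x *\<^sub>R bump R x) = bump R"
  proof
    fix x :: 'a show "indicator (cball 0 R) x *\<^sub>R bump R x = bump R x"
      using bump_zero[OF R, of x] by (cases "norm x \<le> R") auto
  qed
  ultimately show ?thesis by simp
qed

lemma bump_mass_pos:
  assumes "R > 0" shows "bump_mass TYPE('a::euclidean_space) R > 0"
proof -
  have "bump_mass TYPE('a) R \<ge> 0" unfolding bump_mass_def by (simp add: bump_bounds)
  moreover have "bump_mass TYPE('a) R \<noteq> 0"
  proof
    assume "bump_mass TYPE('a) R = 0"
    then have "AE x in lborel. bump R (x::'a) = 0"
      using bump_integrable[OF assms] unfolding bump_mass_def
      by (subst (asm) integral_nonneg_eq_0_iff_AE) (auto simp: bump_bounds)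
    then have "AE x in lborel. (x::'a) \<notin> ball 0 R"
      by eventually_elim (use bump_pos in force)
    then have "emeasure lborel (ball (0::'a) R) = 0"
      by (subst (asm) AE_iff_measurable[OF _ refl]) (auto simp: ball_def dist_norm)
    moreover have "emeasure lborel (ball (0::'a) R) \<noteq> 0"
      using emeasure_lborel_ball_finite[of "0::'a" R] content_ball_pos[OF assms, of "0::'a"]
      by (auto simp: measure_def)
    ultimately show False by simp
  qed
  ultimately show ?thesis by linarith
qed

text \<open>Supported in the ball of radius \<open>R * t\<close> around \<open>y + t *\<^sub>R e\<close>. As \<open>t\<close> runs through an interval \<open>(0, T)\<close>, these
  balls fill a cone with vertex \<open>y\<close> and axis \<open>e\<close>, so that averages against the kernel approach the value
  at \<open>y\<close> from within the cone. For \<open>e = 0\<close> and \<open>R = 1\<close> the kernel is an ordinary mollifier.\<close>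
definition kernel :: "real \<Rightarrow> 'a::euclidean_space \<Rightarrow> 'a \<Rightarrow> real \<Rightarrow> 'a \<Rightarrow> real" where
  "kernel R e y t z = (1 / t) ^ DIM('a) * bump R ((1 / t) *\<^sub>R (z - y) - e)"

lemma kernel_bounds: "t > 0 \<Longrightarrow> 0 \<le> kernel R e y t z" "t > 0 \<Longrightarrow> kernel R e y t (z::'a) \<le> (1 / t) ^ DIM('a::euclidean_space)"
  using bump_bounds[of R "(1 / t) *\<^sub>R (z - y) - e"]
  by (auto simp: kernel_def intro!: mult_left_le divide_right_mono)

lemma kernel_zero:
  assumes "R > 0" "t > 0" "z \<notin> cball (y + t *\<^sub>R e) (R * t)" shows "kernel R e y t z = 0"
proof -
  have "(1 / t) *\<^sub>R (z - y) - e = (1 / t) *\<^sub>R (z - (y + t *\<^sub>R e))"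
    using assms by (simp add: algebra_simps)
  then have "norm ((1 / t) *\<^sub>R (z - y) - e) = dist (y + t *\<^sub>R e) z / t"
    using assms by (simp add: dist_norm norm_minus_commute)
  moreover have "dist (y + t *\<^sub>R e) z / t \<ge> R" using assms by (simp add: field_simps)
  ultimately have "norm ((1 / t) *\<^sub>R (z - y) - e) \<ge> R" by simp
  then show ?thesis using bump_zero assms by (simp add: kernel_def)
qed

lemma smooth_bump_affine: "smooth (\<lambda>z. bump R (s *\<^sub>R (z - y) - e))"
proof -
  let ?v = "- (s *\<^sub>R y) - e"
  have "(s *\<^sub>R (z - y) - e) \<bullet> (s *\<^sub>R (z - y) - e) = (\<Sum>b\<in>Basis. ((s *\<^sub>R z + ?v) \<bullet> b) * ((s *\<^sub>R z + ?v) \<bullet> b))" for z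
    by (subst euclidean_inner) (simp add: algebra_simps)
  then show ?thesis unfolding bump_def
    by (simp only:) (intro smooth_compose_real[OF smooth_flat_exp] smooth_diff smooth_const smooth_sum smooth_mult smooth_inner_affine finite_Basis)
qed

lemma smooth_kernel: "smooth (kernel R e y t)"
  unfolding kernel_def by (intro smooth_cmult smooth_bump_affine)

lemma kernel_integral:
  assumes R: "R > 0" and t: "t > 0"
  shows "has_bochner_integral lborel (kernel R e (y::'a::euclidean_space) t) (bump_mass TYPE('a) R)"
proof -
  let ?T = "\<lambda>x::'a. (y + t *\<^sub>R e) + t *\<^sub>R x"
  let ?d = "\<lambda>x::'a. ennreal (\<bar>t\<bar> ^ DIM('a))"
  have L: "lborel = density (distr lborel borel ?T) ?d"
    using lborel_affine[of t "y + t *\<^sub>R e"] t by simp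
  have [measurable]: "kernel R e y t \<in> borel_measurable borel"
    by (rule smooth_borel_measurable[OF smooth_kernel])
  have k: "t ^ DIM('a) * kernel R e y t (?T x) = bump R x" for x
    using t by (simp add: kernel_def power_divide scaleR_add_right)
  have "has_bochner_integral lborel (\<lambda>x. t ^ DIM('a) * kernel R e y t (?T x)) (bump_mass TYPE('a) R)"
    unfolding k bump_mass_def using bump_integrable[OF R] by (rule has_bochner_integral_integrable)
  then have "has_bochner_integral (distr lborel borel ?T) (\<lambda>x. t ^ DIM('a) * kernel R e y t x) (bump_mass TYPE('a) R)"
    by (intro has_bochner_integral_distr) auto
  then have "has_bochner_integral (density (distr lborel borel ?T) ?d) (kernel R e y t) (bump_mass TYPE('a) R)"
    using t by (intro has_bochner_integral_density) (auto simp: mult.commute)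
  then show ?thesis using L by simp
qed

text \<open>Differentiation under the integral sign, by dominated convergence of the difference quotients.\<close>
lemma DERIV_integral:
  fixes f :: "real \<Rightarrow> 'b \<Rightarrow> real"
  assumes t0: "a < t0" "t0 < b"
    and i: "\<And>t. a < t \<Longrightarrow> t < b \<Longrightarrow> integrable M (f t)"
    and d: "\<And>t x. a < t \<Longrightarrow> t < b \<Longrightarrow> x \<in> space M \<Longrightarrow> ((\<lambda>t. f t x) has_real_derivative f' t x) (at t)"
    and bd: "\<And>t x. a < t \<Longrightarrow> t < b \<Longrightarrow> x \<in> space M \<Longrightarrow> \<bar>f' t x\<bar> \<le> W x" and w: "integrable M W"
  shows "((\<lambda>t. \<integral>x. f t x \<partial>M) has_real_derivative (\<integral>x. f' t0 x \<partial>M)) (at t0)" "integrable M (f' t0)"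
proof -
  let ?q = "\<lambda>h x. (f (t0 + h) x - f t0 x) / h"
  have lim: "((\<lambda>h. ?q h x) \<longlongrightarrow> f' t0 x) (at 0)" if "x \<in> space M" for x
    using d[OF t0 that] by (simp add: DERIV_def)
  have seq: "(\<lambda>n. \<integral>x. ?q (X n) x \<partial>M) \<longlonglongrightarrow> (\<integral>x. f' t0 x \<partial>M) \<and> f' t0 \<in> borel_measurable M"
    if X: "\<And>n. X n \<noteq> 0" "X \<longlonglongrightarrow> 0" and XI: "\<And>n. a < t0 + X n" "\<And>n. t0 + X n < b" for X :: "nat \<Rightarrow> real"
  proof -
    have L: "(\<lambda>n. ?q (X n) x) \<longlonglongrightarrow> f' t0 x" if "x \<in> space M" for x
      using lim[OF that] X unfolding tendsto_at_iff_sequentially by (auto simp: o_def)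
    have m: "(\<lambda>x. ?q (X n) x) \<in> borel_measurable M" for n
      using i[OF XI] i[OF t0] by (auto intro!: borel_measurable_divide borel_measurable_diff)
    have m': "f' t0 \<in> borel_measurable M"
      by (rule borel_measurable_LIMSEQ_real[OF L m])
    have b: "norm (?q (X n) x) \<le> W x" if x: "x \<in> space M" for n x
    proof -
      have "\<exists>z. z \<in> {min t0 (t0 + X n) <..< max t0 (t0 + X n)} \<and>
         f (max t0 (t0 + X n)) x - f (min t0 (t0 + X n)) x = (max t0 (t0 + X n) - min t0 (t0 + X n)) * f' z x"
      proof -
        have "\<exists>z>min t0 (t0 + X n). z < max t0 (t0 + X n) \<and>
         f (max t0 (t0 + X n)) x - f (min t0 (t0 + X n)) x = (max t0 (t0 + X n) - min t0 (t0 + X n)) * f' z x"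
          by (rule MVT2) (use X(1)[of n] d x XI[of n] t0 in \<open>auto simp: min_def max_def split: if_splits\<close>)
        then show ?thesis by auto
      qed
      then obtain z where z: "min t0 (t0 + X n) < z" "z < max t0 (t0 + X n)"
         "f (max t0 (t0 + X n)) x - f (min t0 (t0 + X n)) x = (max t0 (t0 + X n) - min t0 (t0 + X n)) * f' z x"
        by auto
      have "?q (X n) x = f' z x"
        using z(3) X(1)[of n] by (cases "X n > 0") (auto simp: min_def max_def field_simps)
      moreover have "a < z" "z < b" using z t0 XI[of n] by (auto simp: min_def max_def split: if_splits)
      ultimately show ?thesis using bd x by simp
    qed
    have "(\<lambda>n. \<integral>x. ?q (X n) x \<partial>M) \<longlonglongrightarrow> (\<integral>x. f' t0 x \<partial>M)"
      by (rule integral_dominated_convergence[OF m' m w]) (use L b in auto)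
    with m' show ?thesis by simp
  qed
  obtain \<delta> where \<delta>: "\<delta> > 0" "a < t0 - \<delta>" "t0 + \<delta> < b"
  proof
    show "min (t0 - a) (b - t0) / 2 > 0" using t0 by simp
  qed (use t0 in \<open>auto simp: min_def field_simps split: if_splits\<close>)
  have eqn: "(\<integral>x. ?q h x \<partial>M) = ((\<integral>x. f (t0 + h) x \<partial>M) - (\<integral>x. f t0 x \<partial>M)) / h" if "\<bar>h\<bar> < \<delta>" for h
    using i[of "t0 + h"] i[OF t0] that \<delta> by simp
  have "(\<lambda>n. \<delta> / 2 * (1 / real (Suc n))) \<longlonglongrightarrow> \<delta> / 2 * 0"
    by (intro tendsto_intros LIMSEQ_Suc[OF lim_1_over_n])
  moreover have "0 < \<delta> / 2 * (1 / real (Suc n))" "\<delta> / 2 * (1 / real (Suc n)) < \<delta>" for n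
    using \<delta>(1) by (simp_all add: field_simps add_strict_increasing)
  ultimately have "f' t0 \<in> borel_measurable M"
    using \<delta> t0
  proof (intro seq[THEN conjunct2, of "\<lambda>n. \<delta> / 2 * (1 / real (Suc n))"])
    show "a < t0 + \<delta> / 2 * (1 / real (Suc n))" "t0 + \<delta> / 2 * (1 / real (Suc n)) < b" for n
      using \<delta> \<open>0 < \<delta> / 2 * (1 / real (Suc n))\<close> \<open>\<delta> / 2 * (1 / real (Suc n)) < \<delta>\<close> by linarith+
  qed auto
  then show "integrable M (f' t0)"
    by (rule Bochner_Integration.integrable_bound[OF w]) (use bd[OF t0] in \<open>force intro!: AE_I2\<close>)
  show "((\<lambda>t. \<integral>x. f t x \<partial>M) has_real_derivative (\<integral>x. f' t0 x \<partial>M)) (at t0)"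
    unfolding DERIV_def tendsto_at_iff_sequentially
  proof (intro allI impI)
    fix X :: "nat \<Rightarrow> real" assume X: "\<forall>i. X i \<in> UNIV - {0}" "X \<longlonglongrightarrow> 0"
    obtain N where N: "\<And>n. n \<ge> N \<Longrightarrow> \<bar>X n\<bar> < \<delta>"
      using X(2) \<delta>(1) unfolding LIMSEQ_def by (metis dist_0_norm dist_commute real_norm_def)
    have "(\<lambda>n. \<integral>x. ?q (X (n + N)) x \<partial>M) \<longlonglongrightarrow> (\<integral>x. f' t0 x \<partial>M)"
    proof (rule seq[THEN conjunct1])
      show "(\<lambda>n. X (n + N)) \<longlonglongrightarrow> 0" using X(2) by (rule LIMSEQ_ignore_initial_segment)
      show "a < t0 + X (n + N)" "t0 + X (n + N) < b" for n using N[of "n + N"] \<delta> by auto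
    qed (use X in auto)
    moreover have "(\<lambda>n. \<integral>x. ?q (X (n + N)) x \<partial>M) = (\<lambda>n. ((\<integral>x. f (t0 + X (n + N)) x \<partial>M) - (\<integral>x. f t0 x \<partial>M)) / X (n + N))"
      by (rule ext, rule eqn, rule N) simp
    ultimately have "(\<lambda>n. ((\<integral>x. f (t0 + X (n + N)) x \<partial>M) - (\<integral>x. f t0 x \<partial>M)) / X (n + N)) \<longlonglongrightarrow> (\<integral>x. f' t0 x \<partial>M)"
      by (simp only:)
    then show "((\<lambda>h. ((\<integral>x. f (t0 + h) x \<partial>M) - (\<integral>x. f t0 x \<partial>M)) / h) \<circ> X) \<longlonglongrightarrow> (\<integral>x. f' t0 x \<partial>M)"
      unfolding o_def by (rule LIMSEQ_offset)
  qed
qed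


definition kernel_dt :: "real \<Rightarrow> 'a::euclidean_space \<Rightarrow> 'a \<Rightarrow> real \<Rightarrow> 'a \<Rightarrow> real" where
  "kernel_dt R e y t z = - real DIM('a) * (1 / t) ^ (DIM('a) + 1) * bump R ((1 / t) *\<^sub>R (z - y) - e)
     + 2 * (1 / t) ^ (DIM('a) + 2) * (((1 / t) *\<^sub>R (z - y) - e) \<bullet> (z - y))
       * flat_exp 2 (R\<^sup>2 - ((1 / t) *\<^sub>R (z - y) - e) \<bullet> ((1 / t) *\<^sub>R (z - y) - e))"

lemma kernel_DERIV:
  fixes z :: "'a::euclidean_space"
  assumes t: "t > 0"
  shows "((\<lambda>t. kernel R e y t z) has_real_derivative kernel_dt R e y t z) (at t)"
proof -
  define \<xi> where "\<xi> = (1 / t) *\<^sub>R (z - y) - e"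
  have "((\<lambda>t. (1 / t) *\<^sub>R (z - y) - e) has_derivative (\<lambda>h. (- (h / t\<^sup>2)) *\<^sub>R (z - y))) (at t)"
    using t by (auto intro!: derivative_eq_intros simp: power2_eq_square field_simps)
  from diff_chain_at[OF this bump_has_derivative[of R]]
  have "((\<lambda>t. bump R ((1 / t) *\<^sub>R (z - y) - e)) has_derivative
     (\<lambda>h. - 2 * (\<xi> \<bullet> ((- (h / t\<^sup>2)) *\<^sub>R (z - y))) * flat_exp 2 (R\<^sup>2 - \<xi> \<bullet> \<xi>))) (at t)"
    by (simp add: o_def \<xi>_def)
  then have 1: "((\<lambda>t. bump R ((1 / t) *\<^sub>R (z - y) - e)) has_real_derivative
     2 * (1 / t)\<^sup>2 * (\<xi> \<bullet> (z - y)) * flat_exp 2 (R\<^sup>2 - \<xi> \<bullet> \<xi>)) (at t)"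
    unfolding has_field_derivative_def
    by (rule has_derivative_eq_rhs) (use t in \<open>auto simp: power_divide fun_eq_iff\<close>)
  have 2: "((\<lambda>t. (1 / t) ^ DIM('a)) has_real_derivative - real DIM('a) * (1 / t) ^ (DIM('a) + 1)) (at t)"
  proof -
    have "((\<lambda>t. 1 / t) has_real_derivative - (1 / t)\<^sup>2) (at t)"
      using t by (auto intro!: derivative_eq_intros simp: power2_eq_square)
    from DERIV_power[OF this, of "DIM('a)"]
    have "((\<lambda>t. (1 / t) ^ DIM('a)) has_real_derivative real DIM('a) * (- (1 / t)\<^sup>2 * (1 / t) ^ (DIM('a) - Suc 0))) (at t)"
      by simp
    moreover have "(1 / t)\<^sup>2 * (1 / t) ^ (DIM('a) - Suc 0) = (1 / t) ^ (DIM('a) + 1)"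
      using DIM_positive[where 'a='a] by (simp add: power_add[symmetric] del: power_Suc) 
    ultimately show ?thesis by simp
  qed
  have "((\<lambda>t. (1 / t) ^ DIM('a) * bump R ((1 / t) *\<^sub>R (z - y) - e)) has_real_derivative
     (- real DIM('a) * (1 / t) ^ (DIM('a) + 1)) * bump R \<xi> +
     (2 * (1 / t)\<^sup>2 * (\<xi> \<bullet> (z - y)) * flat_exp 2 (R\<^sup>2 - \<xi> \<bullet> \<xi>)) * (1 / t) ^ DIM('a)) (at t)"
    using DERIV_mult[OF 2 1] by (simp add: \<xi>_def)
  moreover have "(- real DIM('a) * (1 / t) ^ (DIM('a) + 1)) * bump R \<xi> +
     (2 * (1 / t)\<^sup>2 * (\<xi> \<bullet> (z - y)) * flat_exp 2 (R\<^sup>2 - \<xi> \<bullet> \<xi>)) * (1 / t) ^ DIM('a) = kernel_dt R e y t z"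
    unfolding kernel_dt_def \<xi>_def[symmetric] by (simp add: power_add power2_eq_square)
  ultimately show ?thesis by (simp add: kernel_def)
qed

lemma kernel_has_derivative:
  fixes y e z :: "'a::euclidean_space"
  defines "\<xi> \<equiv> \<lambda>z t. (1 / t) *\<^sub>R (z - y) - e"
  assumes t: "t > 0"
  shows "(kernel R e y t has_derivative (\<lambda>h. (1 / t) ^ DIM('a) *
     (- 2 * (\<xi> z t \<bullet> ((1 / t) *\<^sub>R h)) * flat_exp 2 (R\<^sup>2 - \<xi> z t \<bullet> \<xi> z t)))) (at z)"
proof -
  have "((\<lambda>z. \<xi> z t) has_derivative (\<lambda>h. (1 / t) *\<^sub>R h)) (at z)"
    unfolding \<xi>_def using t by (auto intro!: derivative_eq_intros)
  from diff_chain_at[OF this bump_has_derivative[of R]]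
  have "((\<lambda>z. bump R (\<xi> z t)) has_derivative
    (\<lambda>h. - 2 * (\<xi> z t \<bullet> ((1 / t) *\<^sub>R h)) * flat_exp 2 (R\<^sup>2 - \<xi> z t \<bullet> \<xi> z t))) (at z)"
    by (simp add: o_def)
  from has_derivative_mult_right[OF this] show ?thesis
    by (simp add: kernel_def[abs_def] \<xi>_def)
qed

text \<open>The kernel is transported by the velocity field \<open>(z - y) / t\<close>, which moves the balls of the cone into each other
  and preserves the integral; this is the continuity equation of that motion.\<close>
lemma kernel_dt_eq_divergence:
  fixes y e z :: "'a::euclidean_space"
  assumes t: "t > 0"
  shows "(\<Sum>b\<in>Basis. frechet_derivative (\<lambda>z. (1 / t) * ((z - y) \<bullet> b) * kernel R e y t z) (at z) b) = - kernel_dt R e y t z"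
proof -
  define \<xi> where "\<xi> = (1 / t) *\<^sub>R (z - y) - e"
  let ?k = "kernel R e y t z" and ?f = "flat_exp 2 (R\<^sup>2 - \<xi> \<bullet> \<xi>)"
  have "frechet_derivative (\<lambda>z. (1 / t) * ((z - y) \<bullet> b) * kernel R e y t z) (at z) b =
     (1 / t) * ?k + - 2 * (1 / t) ^ (DIM('a) + 2) * ?f * (((z - y) \<bullet> b) * (\<xi> \<bullet> b))" if b: "b \<in> Basis" for b
  proof -
    have "((\<lambda>z. (1 / t) * ((z - y) \<bullet> b)) has_derivative (\<lambda>h. (1 / t) * (h \<bullet> b))) (at z)"
      using t by (auto intro!: derivative_eq_intros)
    from fun_cong[OF frechet_derivative_eqI[OF has_derivative_mult[OF this kernel_has_derivative[OF t, of R e y z]]], of b]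
    have "frechet_derivative (\<lambda>z. (1 / t) * ((z - y) \<bullet> b) * kernel R e y t z) (at z) b =
      (1 / t) * ((z - y) \<bullet> b) * ((1 / t) ^ DIM('a) * (- 2 * (\<xi> \<bullet> ((1 / t) *\<^sub>R b)) * ?f)) + (1 / t) * (b \<bullet> b) * ?k"
      unfolding \<xi>_def .
    then show ?thesis using b by (simp add: power_add power2_eq_square mult_ac)
  qed
  then have "(\<Sum>b\<in>Basis. frechet_derivative (\<lambda>z. (1 / t) * ((z - y) \<bullet> b) * kernel R e y t z) (at z) b) =
     (\<Sum>b\<in>Basis. (1 / t) * ?k + - 2 * (1 / t) ^ (DIM('a) + 2) * ?f * (((z - y) \<bullet> b) * (\<xi> \<bullet> b)))"
    by (intro sum.cong refl)
  also have "\<dots> = real DIM('a) * ((1 / t) * ?k) + - 2 * (1 / t) ^ (DIM('a) + 2) * ?f * (\<Sum>b\<in>Basis. ((z - y) \<bullet> b) * (\<xi> \<bullet> b))"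
    by (simp only: sum.distrib sum_distrib_left[symmetric] sum_constant) (simp add: mult.left_commute)
  also have "\<dots> = real DIM('a) * ((1 / t) * ?k) + - 2 * (1 / t) ^ (DIM('a) + 2) * ?f * (\<xi> \<bullet> (z - y))"
    by (simp add: euclidean_inner[of \<xi> "z - y"] mult.commute)
  also have "\<dots> = - kernel_dt R e y t z"
    unfolding kernel_dt_def kernel_def \<xi>_def[symmetric] by (simp add: algebra_simps)
  finally show ?thesis .
qed

lemma kernel_test:
  assumes "R > 0" "t > 0" "cball (y + t *\<^sub>R e) (R * t) \<subseteq> \<Omega>"
  shows "kernel R e y t \<in> test_functions \<Omega>"
    "(\<lambda>z. (1 / t) * ((z - y) \<bullet> b) * kernel R e y t z) \<in> test_functions \<Omega>"
proof -
  show "kernel R e y t \<in> test_functions \<Omega>"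
    by (rule test_functionsI[OF smooth_kernel compact_cball assms(3)]) (rule kernel_zero[OF assms(1,2)])
  have "smooth (\<lambda>z. (1 / t) * ((z - y) \<bullet> b) * kernel R e y t z)"
    unfolding inner_diff_left by (intro smooth_mult smooth_kernel smooth_const smooth_diff smooth_inner)
  then show "(\<lambda>z. (1 / t) * ((z - y) \<bullet> b) * kernel R e y t z) \<in> test_functions \<Omega>"
    by (rule test_functionsI[OF _ compact_cball assms(3)]) (simp add: kernel_zero[OF assms(1,2)])
qed

lemma kernel_dt_bounded:
  fixes y e :: "'a::euclidean_space"
  assumes "0 < a" "bounded \<Omega>"
  shows "\<exists>M. \<forall>t z. a \<le> t \<longrightarrow> t \<le> T \<longrightarrow> z \<in> \<Omega> \<longrightarrow> \<bar>kernel_dt R e y t z\<bar> \<le> M"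
proof -
  let ?S = "{a..T} \<times> closure \<Omega>"
  have "continuous_on ?S (\<lambda>p. kernel_dt R e y (fst p) (snd p))"
    unfolding kernel_dt_def bump_def
    by (intro continuous_intros continuous_flat_exp) (use assms in auto)
  moreover have "compact ?S" using assms by (intro compact_Times) auto
  ultimately have "compact ((\<lambda>p. kernel_dt R e y (fst p) (snd p)) ` ?S)"
    by (rule compact_continuous_image)
  then obtain M where "\<And>p. p \<in> ?S \<Longrightarrow> \<bar>kernel_dt R e y (fst p) (snd p)\<bar> \<le> M"
    using compact_imp_bounded by (fastforce simp: bounded_iff)
  then have "\<bar>kernel_dt R e y t z\<bar> \<le> M" if "a \<le> t" "t \<le> T" "z \<in> \<Omega>" for t z
    using that closure_subset[of \<Omega>] by (metis SigmaI atLeastAtMost_iff fst_conv snd_conv subsetD)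
  then show ?thesis by blast
qed

text \<open>By the continuity equation the derivative in \<open>t\<close> of the average is minus the integral of \<open>u\<close> against
  the divergence of the field \<open>(z - y) / t\<close> times the kernel. Its components are test functions because the ball of
  radius \<open>R * t\<close> lies in \<open>\<Omega>\<close>, and the definition of the weak gradient moves the divergence onto \<open>u\<close>.\<close>
lemma kernel_average_DERIV:
  fixes y e :: "'a::euclidean_space"
  assumes op: "open \<Omega>" and bd: "bounded \<Omega>" and R: "R > 0"
    and incl: "\<And>t. 0 < t \<Longrightarrow> t \<le> T \<Longrightarrow> cball (y + t *\<^sub>R e) (R * t) \<subseteq> \<Omega>"
    and u: "is_weak_gradient \<Omega> u g" "integrable (lebesgue_on \<Omega>) u"
    and t: "0 < t" "t < T"
  shows "((\<lambda>t. LINT z|lebesgue_on \<Omega>. u z * kernel R e y t z) has_real_derivative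
     (LINT z|lebesgue_on \<Omega>. (1 / t) * (g z \<bullet> (z - y)) * kernel R e y t z)) (at t)"
proof -
  have li: "locally_integrable \<Omega> u" "locally_integrable \<Omega> g" using u by (auto simp: is_weak_gradient_def)
  obtain M where M: "\<And>s z. t / 2 \<le> s \<Longrightarrow> s \<le> T \<Longrightarrow> z \<in> \<Omega> \<Longrightarrow> \<bar>kernel_dt R e y s z\<bar> \<le> M"
    using kernel_dt_bounded[of "t/2" \<Omega> T R e y] t bd by (metis half_gt_zero)
  note D = DERIV_integral[where a="t/2" and b=T and ?t0.0=t and M="lebesgue_on \<Omega>" and
      f="\<lambda>t z. u z * kernel R e y t z" and f'="\<lambda>t z. u z * kernel_dt R e y t z" and W="\<lambda>z. \<bar>u z\<bar> * M"]
  have D1: "((\<lambda>t. LINT z|lebesgue_on \<Omega>. u z * kernel R e y t z) has_real_derivative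
     (LINT z|lebesgue_on \<Omega>. u z * kernel_dt R e y t z)) (at t)"
  proof (rule D(1))
    fix s assume s: "t / 2 < s" "s < T"
    show "integrable (lebesgue_on \<Omega>) (\<lambda>z. u z * kernel R e y s z)"
      using s t by (intro integrable_times_test[OF op li(1)] kernel_test(1) R incl) auto
    fix z assume z: "z \<in> space (lebesgue_on \<Omega>)"
    show "((\<lambda>s. u z * kernel R e y s z) has_real_derivative u z * kernel_dt R e y s z) (at s)"
      using s t by (intro DERIV_cmult kernel_DERIV) auto
    show "\<bar>u z * kernel_dt R e y s z\<bar> \<le> \<bar>u z\<bar> * M"
      using M[of s z] s z by (auto simp: abs_mult intro!: mult_left_mono)
  qed (use t u in auto)
  let ?\<psi> = "\<lambda>b z. (1 / t) * ((z - y) \<bullet> b) * kernel R e y t z"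
  have T: "?\<psi> b \<in> test_functions \<Omega>" for b using t by (intro kernel_test R incl) auto
  have I1: "integrable (lebesgue_on \<Omega>) (\<lambda>z. u z * frechet_derivative (?\<psi> b) (at z) b)" if "b \<in> Basis" for b
    by (rule integrable_times_test[OF op li(1) test_function_partial[OF T that]])
  have I2: "integrable (lebesgue_on \<Omega>) (\<lambda>z. (g z \<bullet> b) * ?\<psi> b z)" for b
    by (rule integrable_times_test[OF op locally_integrable_inner[OF li(2)] T])
  have "(LINT z|lebesgue_on \<Omega>. u z * kernel_dt R e y t z) =
      (LINT z|lebesgue_on \<Omega>. - (\<Sum>b\<in>Basis. u z * frechet_derivative (?\<psi> b) (at z) b))"
    using kernel_dt_eq_divergence[OF t(1), of y R e] by (simp add: sum_distrib_left[symmetric])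
  also have "\<dots> = - (\<Sum>b\<in>Basis. LINT z|lebesgue_on \<Omega>. u z * frechet_derivative (?\<psi> b) (at z) b)"
    by (subst integral_minus, subst Bochner_Integration.integral_sum[OF I1]) (assumption, rule refl)
  also have "\<dots> = (\<Sum>b\<in>Basis. LINT z|lebesgue_on \<Omega>. (g z \<bullet> b) * ?\<psi> b z)"
  proof -
    have "(LINT z|lebesgue_on \<Omega>. u z * frechet_derivative (?\<psi> b) (at z) b) = - (LINT z|lebesgue_on \<Omega>. (g z \<bullet> b) * ?\<psi> b z)"
      if "b \<in> Basis" for b
      using u(1) T[of b] that unfolding is_weak_gradient_def by blast
    then show ?thesis by (simp only: sum_negf minus_minus cong: sum.cong)
  qed
  also have "\<dots> = (LINT z|lebesgue_on \<Omega>. (\<Sum>b\<in>Basis. (g z \<bullet> b) * ?\<psi> b z))"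
    by (rule Bochner_Integration.integral_sum[OF I2, symmetric])
  also have "(\<lambda>z. \<Sum>b\<in>Basis. (g z \<bullet> b) * ?\<psi> b z) = (\<lambda>z. (1 / t) * (g z \<bullet> (z - y)) * kernel R e y t z)"
  proof
    fix z
    have "(\<Sum>b\<in>Basis. (g z \<bullet> b) * ?\<psi> b z) = (\<Sum>b\<in>Basis. (g z \<bullet> b) * ((z - y) \<bullet> b)) * ((1 / t) * kernel R e y t z)"
      unfolding sum_distrib_right by (intro sum.cong refl) simp
    then show "(\<Sum>b\<in>Basis. (g z \<bullet> b) * ?\<psi> b z) = (1 / t) * (g z \<bullet> (z - y)) * kernel R e y t z"
      by (simp only: euclidean_inner[of "g z" "z - y"] mult_ac)
  qed
  finally show ?thesis using D1 by simp
qed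

text \<open>A substitute for Hoelder's inequality that keeps the estimates below linear in the integral of \<open>|g|\<^sup>q\<close>; the
  parameter \<open>k\<close> balances the two terms.\<close>
lemma le_add_powr_scaled:
  fixes A k q :: real
  assumes "A \<ge> 0" "k > 0" "q \<ge> 1"
  shows "A \<le> k + A powr q * k powr (1 - q)"
proof (cases "A \<le> k")
  case False
  then have "A powr q * A powr (1 - q) = A" using assms by (simp add: powr_add[symmetric])
  moreover have "A powr (1 - q) \<le> k powr (1 - q)" using False assms by (intro powr_mono2') auto
  ultimately have "A \<le> A powr q * k powr (1 - q)"
    by (metis mult_left_mono powr_ge_zero)
  then show ?thesis using assms by simp
qed (simp add: add_increasing2)

text \<open>On the support \<open>|z - y| \<le> 2 t\<close>, and the kernel is at most \<open>t\<^bsup>-d\<^esup>\<close>, where \<open>d\<close> is the dimension. So it remains to bound \<open>2 t\<^bsup>-d\<^esup>\<close>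
  times the integral of \<open>|g|\<close> over a ball of volume at most \<open>unit_ball_vol d * t\<^sup>d\<close>, and the inequality \<open>|g| \<le> k + |g|\<^sup>q k\<^bsup>1-q\<^esup>\<close> with
  \<open>k = t\<^bsup>-d/q\<^esup>\<close> makes both contributions of the order \<open>t\<^bsup>-d/q\<^esup>\<close>.\<close>
lemma kernel_average_DERIV_bound:
  fixes y e :: "'a::euclidean_space"
  assumes op: "open \<Omega>" and bd: "bounded \<Omega>" and R: "0 < R" "R \<le> 1" and e: "norm e \<le> 1"
    and g: "g \<in> Lp \<Omega> q" and q: "q > 1" and t: "0 < t"
  shows "\<bar>LINT z|lebesgue_on \<Omega>. (1 / t) * (g z \<bullet> (z - y)) * kernel R e y t z\<bar>
    \<le> 2 * (unit_ball_vol (real DIM('a)) + (LINT z|lebesgue_on \<Omega>. norm (g z) powr q)) * t powr (- (real DIM('a) / q))"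
    (is "_ \<le> 2 * (?V + ?I) * _")
proof -
  let ?d = "real DIM('a)"
  let ?B = "cball (y + t *\<^sub>R e) (R * t)"
  define k where "k = t powr (- (?d / q))"
  have k: "k > 0" using t by (simp add: k_def)
  have S: "\<Omega> \<in> sets lebesgue" using op by auto
  interpret finite_measure "lebesgue_on \<Omega>"
    by (rule finite_measure_lebesgue_on[OF bounded_open_lmeasurable[OF bd op]])
  have Bm: "?B \<inter> \<Omega> \<in> sets (lebesgue_on \<Omega>)" using S sets.Int[OF fmeasurableD[OF lmeasurable_cball] S] by (simp add: sets_restrict_space_iff)
  have gi: "integrable (lebesgue_on \<Omega>) (\<lambda>z. norm (g z) powr q)" using g by (simp add: Lp_def)
  have pw: "\<bar>(1 / t) * (g z \<bullet> (z - y)) * kernel R e y t z\<bar> \<le>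
     2 * (1 / t) ^ DIM('a) * (k * indicator (?B \<inter> \<Omega>) z + norm (g z) powr q * k powr (1 - q))" if z: "z \<in> \<Omega>" for z
  proof (cases "z \<in> ?B")
    case False
    then show ?thesis using kernel_zero[OF R(1) t False] k t by simp
  next
    case True
    have "norm (z - y) \<le> norm (z - (y + t *\<^sub>R e)) + norm (t *\<^sub>R e)"
      using norm_triangle_ineq[of "z - (y + t *\<^sub>R e)" "t *\<^sub>R e"] by simp
    also have "\<dots> \<le> R * t + t"
      using True t e by (intro add_mono) (auto simp: dist_norm norm_minus_commute)
    also have "\<dots> \<le> 2 * t" using R t by simp
    finally have zy: "norm (z - y) \<le> 2 * t" .
    have "\<bar>(1 / t) * (g z \<bullet> (z - y)) * kernel R e y t z\<bar> = (1 / t) * \<bar>g z \<bullet> (z - y)\<bar> * kernel R e y t z"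
      using t kernel_bounds[OF t, of R e y z] by (simp add: abs_mult)
    also have "\<dots> \<le> (1 / t) * (norm (g z) * (2 * t)) * (1 / t) ^ DIM('a)"
    proof (intro mult_mono)
      show "\<bar>g z \<bullet> (z - y)\<bar> \<le> norm (g z) * (2 * t)"
        using Cauchy_Schwarz_ineq2[of "g z" "z - y"] zy by (meson mult_left_mono norm_ge_zero order_trans)
    qed (use t kernel_bounds[OF t, of R e y z] in auto)
    also have "\<dots> = 2 * (1 / t) ^ DIM('a) * norm (g z)" using t by simp
    also have "\<dots> \<le> 2 * (1 / t) ^ DIM('a) * (k + norm (g z) powr q * k powr (1 - q))"
      using t k q by (intro mult_left_mono le_add_powr_scaled) auto
    finally show ?thesis using True z by simp
  qed
  have dom: "integrable (lebesgue_on \<Omega>) (\<lambda>z. 2 * (1 / t) ^ DIM('a) * (k * indicator (?B \<inter> \<Omega>) z + norm (g z) powr q * k powr (1 - q)))"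
    using Bm gi by (intro integrable_mult_right integrable_add integrable_mult_left) (auto simp: emeasure_eq_measure)
  have "\<bar>LINT z|lebesgue_on \<Omega>. (1 / t) * (g z \<bullet> (z - y)) * kernel R e y t z\<bar> \<le>
      (LINT z|lebesgue_on \<Omega>. 2 * (1 / t) ^ DIM('a) * (k * indicator (?B \<inter> \<Omega>) z + norm (g z) powr q * k powr (1 - q)))"
  proof -
    have gm: "g \<in> borel_measurable (lebesgue_on \<Omega>)" using g by (simp add: Lp_def)
    have zm: "(\<lambda>z. z - y) \<in> borel_measurable (lebesgue_on \<Omega>)"
      by (intro continuous_imp_measurable_on_sets_lebesgue continuous_intros S)
    have km: "kernel R e y t \<in> borel_measurable (lebesgue_on \<Omega>)"
      by (intro continuous_imp_measurable_on_sets_lebesgue smooth_continuous smooth_kernel S)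
    have int: "integrable (lebesgue_on \<Omega>) (\<lambda>z. (1 / t) * (g z \<bullet> (z - y)) * kernel R e y t z)"
    proof (rule Bochner_Integration.integrable_bound[OF dom])
      show "(\<lambda>z. (1 / t) * (g z \<bullet> (z - y)) * kernel R e y t z) \<in> borel_measurable (lebesgue_on \<Omega>)"
        by (intro borel_measurable_times borel_measurable_const borel_measurable_inner gm zm km)
      show "AE z in lebesgue_on \<Omega>. norm ((1 / t) * (g z \<bullet> (z - y)) * kernel R e y t z) \<le>
        norm (2 * (1 / t) ^ DIM('a) * (k * indicator (?B \<inter> \<Omega>) z + norm (g z) powr q * k powr (1 - q)))"
        unfolding real_norm_def by (intro AE_I2 order_trans[OF pw abs_ge_self]) simp
    qed
    have "\<bar>LINT z|lebesgue_on \<Omega>. (1 / t) * (g z \<bullet> (z - y)) * kernel R e y t z\<bar> \<le>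
      (LINT z|lebesgue_on \<Omega>. \<bar>(1 / t) * (g z \<bullet> (z - y)) * kernel R e y t z\<bar>)"
      by (rule integral_abs_bound)
    also have "\<dots> \<le> (LINT z|lebesgue_on \<Omega>. 2 * (1 / t) ^ DIM('a) * (k * indicator (?B \<inter> \<Omega>) z + norm (g z) powr q * k powr (1 - q)))"
      using pw by (intro integral_mono[OF integrable_abs[OF int] dom]) auto
    finally show ?thesis .
  qed
  also have "\<dots> = 2 * (1 / t) ^ DIM('a) * (k * measure (lebesgue_on \<Omega>) (?B \<inter> \<Omega>) + ?I * k powr (1 - q))"
    using Bm gi by (simp add: emeasure_eq_measure)
  also have "\<dots> \<le> 2 * (1 / t) ^ DIM('a) * (k * (?V * t powr ?d) + ?I * k powr (1 - q))"
  proof -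
    have "measure (lebesgue_on \<Omega>) (?B \<inter> \<Omega>) = measure lebesgue (?B \<inter> \<Omega>)"
      using S by (subst measure_restrict_space) auto
    also have "\<dots> \<le> measure lebesgue ?B"
      using S by (intro measure_mono_fmeasurable) auto
    also have "\<dots> = ?V * (R * t) ^ DIM('a)"
      using R t content_cball[of "R * t" "y + t *\<^sub>R e"] by simp
    also have "\<dots> \<le> ?V * t ^ DIM('a)"
      using R t by (intro mult_left_mono power_mono) (auto simp: mult_left_le_one_le)
    finally show ?thesis using t k by (intro mult_left_mono add_mono) (auto simp: powr_realpow)
  qed
  also have "\<dots> = 2 * (?V + ?I) * k"
  proof -
    have a: "(1 / t) ^ DIM('a) = t powr (- ?d)" using t by (simp add: powr_minus powr_realpow power_one_over inverse_eq_divide)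
    have b: "t powr (- ?d) * t powr ?d = 1" using t by (simp add: powr_add[symmetric])
    have "t powr (- ?d) * k powr (1 - q) = k"
      using t q unfolding k_def by (simp add: powr_powr powr_add[symmetric] field_simps)
    then show ?thesis unfolding a using b by (simp add: algebra_simps)
  qed
  finally show ?thesis by (simp add: k_def)
qed

text \<open>The bound \<open>t\<^bsup>-d/q\<^esup>\<close> of the derivative is integrable at \<open>0\<close> because the dimension \<open>d\<close> is less than \<open>q\<close>.
  This is the place where the exponent must exceed the dimension.\<close>
lemma kernel_average_oscillation:
  fixes y e :: "'a::euclidean_space"
  assumes op: "open \<Omega>" and bd: "bounded \<Omega>" and R: "0 < R" "R \<le> 1" and e: "norm e \<le> 1"
    and incl: "\<And>t. 0 < t \<Longrightarrow> t \<le> T \<Longrightarrow> cball (y + t *\<^sub>R e) (R * t) \<subseteq> \<Omega>"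
    and u: "is_weak_gradient \<Omega> u g" "integrable (lebesgue_on \<Omega>) u"
    and g: "g \<in> Lp \<Omega> q" and q: "q > real DIM('a)" and st: "0 < s" "s \<le> t" "t < T"
  shows "\<bar>(LINT z|lebesgue_on \<Omega>. u z * kernel R e y t z) - (LINT z|lebesgue_on \<Omega>. u z * kernel R e y s z)\<bar>
    \<le> 2 * (unit_ball_vol (real DIM('a)) + (LINT z|lebesgue_on \<Omega>. norm (g z) powr q)) / (1 - real DIM('a) / q)
        * t powr (1 - real DIM('a) / q)"
proof -
  let ?U = "\<lambda>t. LINT z|lebesgue_on \<Omega>. u z * kernel R e y t z"
  define C where "C = 2 * (unit_ball_vol (real DIM('a)) + (LINT z|lebesgue_on \<Omega>. norm (g z) powr q))"
  define \<gamma> where "\<gamma> = 1 - real DIM('a) / q"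
  have q1: "q > 1" using q DIM_positive[where 'a='a] by linarith
  have \<gamma>: "\<gamma> > 0" using q q1 by (simp add: \<gamma>_def)
  have C0: "C \<ge> 0" unfolding C_def by (intro mult_nonneg_nonneg add_nonneg_nonneg integral_nonneg) auto
  let ?W = "\<lambda>t. C / \<gamma> * t powr \<gamma>"
  let ?D = "\<lambda>t. LINT z|lebesgue_on \<Omega>. (1 / t) * (g z \<bullet> (z - y)) * kernel R e y t z"
  have dU: "(?U has_real_derivative ?D x) (at x)" if "0 < x" "x < T" for x
    using kernel_average_DERIV[OF op bd R(1) incl u that] by simp
  have dW: "(?W has_real_derivative C * x powr (- (real DIM('a) / q))) (at x)" if "0 < x" for x
  proof -
    have "(?W has_real_derivative C / \<gamma> * (\<gamma> * x powr (\<gamma> - 1))) (at x)"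
      using that by (intro DERIV_cmult has_real_derivative_powr)
    moreover have "C / \<gamma> * (\<gamma> * x powr (\<gamma> - 1)) = C * x powr (- (real DIM('a) / q))"
    proof -
      have "\<gamma> - 1 = - (real DIM('a) / q)" by (simp add: \<gamma>_def)
      then show ?thesis using \<gamma> by simp
    qed
    ultimately show ?thesis by (simp only:)
  qed
  have b: "\<bar>?D x\<bar> \<le> C * x powr (- (real DIM('a) / q))" if "0 < x" for x
    using kernel_average_DERIV_bound[OF op bd R e g q1 that] unfolding C_def .
  have 1: "?W s - ?U s \<le> ?W t - ?U t"
  proof (rule DERIV_nonneg_imp_nondecreasing[OF st(2)])
    fix x assume x: "s \<le> x" "x \<le> t"
    have "0 \<le> C * x powr (- (real DIM('a) / q)) - ?D x" using b[of x] x st by linarith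
    then show "\<exists>y. ((\<lambda>x. ?W x - ?U x) has_real_derivative y) (at x) \<and> 0 \<le> y"
      using st x by (intro exI[of _ "C * x powr (- (real DIM('a) / q)) - ?D x"] conjI DERIV_diff dW dU) linarith+
  qed
  have 2: "?W s + ?U s \<le> ?W t + ?U t"
  proof (rule DERIV_nonneg_imp_nondecreasing[OF st(2)])
    fix x assume x: "s \<le> x" "x \<le> t"
    have "0 \<le> C * x powr (- (real DIM('a) / q)) + ?D x" using b[of x] x st by linarith
    then show "\<exists>y. ((\<lambda>x. ?W x + ?U x) has_real_derivative y) (at x) \<and> 0 \<le> y"
      using st x by (intro exI[of _ "C * x powr (- (real DIM('a) / q)) + ?D x"] conjI DERIV_add dW dU) linarith+
  qed
  have "?W s \<ge> 0" using C0 \<gamma> by simp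
  then show ?thesis using 1 2 unfolding C_def[symmetric] \<gamma>_def[symmetric] by linarith
qed

section \<open>Uniform interior cones\<close>

lemma smooth_lipschitz_on_cball:
  fixes f :: "'a::euclidean_space \<Rightarrow> real"
  assumes "smooth f"
  shows "\<exists>L\<ge>0. \<forall>x\<in>cball 0 B. \<forall>y\<in>cball 0 B. \<bar>f x - f y\<bar> \<le> L * norm (x - y)"
proof -
  have "\<exists>M. \<forall>x\<in>cball 0 B. \<bar>frechet_derivative f (at x) b\<bar> \<le> M" if "b \<in> Basis" for b :: 'a
  proof -
    have "compact ((\<lambda>x. frechet_derivative f (at x) b) ` cball 0 B)"
      by (intro compact_continuous_image smooth_continuous smooth_partial assms that compact_cball)
    then show ?thesis using compact_imp_bounded by (fastforce simp: bounded_iff)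
  qed
  then obtain M where M: "\<And>b x. b \<in> Basis \<Longrightarrow> x \<in> cball 0 B \<Longrightarrow> \<bar>frechet_derivative f (at x) b\<bar> \<le> M b"
    by metis
  define L where "L = (\<Sum>b\<in>(Basis::'a set). \<bar>M b\<bar>)"
  have on: "onorm (frechet_derivative f (at x)) \<le> L" if x: "x \<in> cball 0 B" for x
  proof (rule onorm_le)
    fix h :: 'a
    have lin: "linear (frechet_derivative f (at x))"
      using smooth_has_derivative[OF assms] has_derivative_linear by blast
    have "frechet_derivative f (at x) h = frechet_derivative f (at x) (\<Sum>b\<in>Basis. (h \<bullet> b) *\<^sub>R b)"
      by (simp only: euclidean_representation)
    also have "\<dots> = (\<Sum>b\<in>Basis. (h \<bullet> b) * frechet_derivative f (at x) b)"
      by (simp only: linear_sum[OF lin] linear_scale[OF lin] real_scaleR_def)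
    finally have "\<bar>frechet_derivative f (at x) h\<bar> \<le> (\<Sum>b\<in>Basis. \<bar>(h \<bullet> b) * frechet_derivative f (at x) b\<bar>)"
      by (simp only: sum_abs)
    also have "\<dots> \<le> (\<Sum>b\<in>Basis. norm h * \<bar>M b\<bar>)"
      unfolding abs_mult
      by (intro sum_mono mult_mono Basis_le_norm) (use M[OF _ x] in force)+
    also have "\<dots> = L * norm h" unfolding L_def by (simp add: sum_distrib_left[symmetric] mult.commute)
    finally show "norm (frechet_derivative f (at x) h) \<le> L * norm h" by simp
  qed
  have "norm (f x - f y) \<le> L * norm (x - y)" if "x \<in> cball 0 B" "y \<in> cball 0 B" for x y
    by (rule differentiable_bound[OF convex_cball, of 0 B f "\<lambda>x. frechet_derivative f (at x)"])
       (use that on in \<open>auto intro: has_derivative_at_withinI smooth_has_derivative[OF assms]\<close>)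
  moreover have "L \<ge> 0" unfolding L_def by (intro sum_nonneg) auto
  ultimately show ?thesis by auto
qed

text \<open>The ball condition that is needed to average with the kernels at \<open>y\<close>: a truncated cone with vertex \<open>y\<close> and axis
  \<open>e\<close> lies inside \<open>\<Omega>\<close>. For \<open>e = 0\<close> it describes a ball around \<open>y\<close>.\<close>
definition has_cone :: "'a::euclidean_space set \<Rightarrow> real \<Rightarrow> 'a \<Rightarrow> 'a \<Rightarrow> bool" where
  "has_cone \<Omega> R e y \<longleftrightarrow> (\<forall>t. 0 < t \<and> t \<le> R \<longrightarrow> cball (y + t *\<^sub>R e) (R * t) \<subseteq> \<Omega>)"

lemma has_cone_mono:
  assumes "has_cone \<Omega> R e y" "R' \<le> R" shows "has_cone \<Omega> R' e y"
  unfolding has_cone_def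
proof (intro allI impI)
  fix t assume t: "0 < t \<and> t \<le> R'"
  then have "R' * t \<le> R * t" using assms by (intro mult_right_mono) auto
  then have "cball (y + t *\<^sub>R e) (R' * t) \<subseteq> cball (y + t *\<^sub>R e) (R * t)" by (rule subset_cball)
  then show "cball (y + t *\<^sub>R e) (R' * t) \<subseteq> \<Omega>" using assms t unfolding has_cone_def by (meson order_trans)
qed

text \<open>At a boundary point \<open>\<Omega>\<close> is the region above the graph of a function that is \<open>L\<close>-Lipschitz near the point, and moving up along
  the axis by \<open>t\<close> cannot be undone by a perturbation of size \<open>R * t\<close> if \<open>R * (2 * L + 1) \<le> 1\<close>: the
  height changes by at most \<open>R * t\<close>, and the graph by at most \<open>2 * L * R * t\<close>.\<close>
lemma local_cone:
  fixes \<Omega> :: "'a::euclidean_space set"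
  assumes op: "open \<Omega>" and sb: "smooth_boundary \<Omega>" and x0: "x0 \<in> closure \<Omega>"
  shows "\<exists>R>0. R \<le> 1 \<and> (\<exists>e. norm e \<le> 1 \<and> (\<forall>y\<in>\<Omega> \<inter> ball x0 (2 * R). has_cone \<Omega> R e y))"
proof (cases "x0 \<in> \<Omega>")
  case True
  then obtain \<rho> where \<rho>: "\<rho> > 0" "ball x0 \<rho> \<subseteq> \<Omega>" using op open_contains_ball by blast
  define R where "R = min 1 (\<rho> / 4)"
  have R: "0 < R" "R \<le> 1" "4 * R \<le> \<rho>" using \<rho> by (auto simp: R_def)
  have "has_cone \<Omega> R 0 y" if y: "y \<in> ball x0 (2 * R)" for y
    unfolding has_cone_def
  proof (intro allI impI)
    fix t assume t: "0 < t \<and> t \<le> R"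
    have "R * t \<le> R * 1" using t R by (intro mult_left_mono) auto
    then have "cball y (R * t) \<subseteq> ball x0 \<rho>" using y R
    proof (intro subsetI)
      fix z assume "z \<in> cball y (R * t)"
      then show "z \<in> ball x0 \<rho>"
        using dist_triangle[of x0 z y] y R \<open>R * t \<le> R * 1\<close> unfolding mem_ball mem_cball by linarith
    qed
    then show "cball (y + t *\<^sub>R 0) (R * t) \<subseteq> \<Omega>" using \<rho> by auto
  qed
  then show ?thesis using R by (intro exI[of _ R] conjI exI[of _ 0]) auto
next
  case False
  then have "x0 \<in> frontier \<Omega>" using x0 op by (simp add: frontier_def interior_open)
  from bspec[OF sb[unfolded smooth_boundary_def] this] obtain \<rho> e \<gamma> where \<rho>: "\<rho> > 0" and e: "norm e = 1" and \<gamma>: "smooth \<gamma>"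
    and eq: "\<Omega> \<inter> ball x0 \<rho> = {x \<in> ball x0 \<rho>. x \<bullet> e > \<gamma> (x - (x \<bullet> e) *\<^sub>R e)}"
    by (elim exE conjE)
  \<comment> \<open>The projection onto the hyperplane at most doubles the norm, so it maps the ball around \<open>x0\<close> into \<open>cball 0 B\<close>.\<close>
  define B where "B = 2 * (norm x0 + \<rho>)"
  obtain L where L: "L \<ge> 0" "\<And>x y. x \<in> cball 0 B \<Longrightarrow> y \<in> cball 0 B \<Longrightarrow> \<bar>\<gamma> x - \<gamma> y\<bar> \<le> L * norm (x - y)"
    using smooth_lipschitz_on_cball[OF \<gamma>, of B] by metis
  define R where "R = min (\<rho> / 4) (1 / (2 * L + 1))"
  have R: "0 < R" "R \<le> 1" "4 * R \<le> \<rho>" and RL: "R * (2 * L + 1) \<le> 1"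
  proof -
    show "0 < R" "4 * R \<le> \<rho>" using \<rho> L by (auto simp: R_def)
    have "R \<le> 1 / (2 * L + 1)" by (simp add: R_def)
    then show 1: "R * (2 * L + 1) \<le> 1" using L by (simp add: field_simps)
    have "R * 1 \<le> R * (2 * L + 1)" using \<open>0 < R\<close> L by (intro mult_left_mono) auto
    then show "R \<le> 1" using 1 by simp
  qed
  let ?P = "\<lambda>x. x - (x \<bullet> e) *\<^sub>R e"
  have P: "norm (?P x) \<le> 2 * norm x" for x
    using norm_triangle_ineq4[of x "(x \<bullet> e) *\<^sub>R e"] Cauchy_Schwarz_ineq2[of x e] e by simp
  have PB: "?P x \<in> cball 0 B" if "x \<in> ball x0 \<rho>" for x
  proof -
    have "norm x \<le> norm x0 + \<rho>" using that norm_triangle_sub[of x x0] by (simp add: dist_norm norm_minus_commute)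
    then show ?thesis using P[of x] by (simp add: B_def)
  qed
  have "has_cone \<Omega> R e y" if y: "y \<in> \<Omega> \<inter> ball x0 (2 * R)" for y
    unfolding has_cone_def
  proof (intro allI impI subsetI)
    fix t z assume t: "0 < t \<and> t \<le> R" and z: "z \<in> cball (y + t *\<^sub>R e) (R * t)"
    define h where "h = z - (y + t *\<^sub>R e)"
    have h: "norm h \<le> R * t" using z by (simp add: h_def dist_norm norm_minus_commute)
    have zh: "z = y + t *\<^sub>R e + h" by (simp add: h_def)
    have Rt: "R * t \<le> 1 * t" "t \<le> R" using R t by (auto intro!: mult_right_mono)
    have yb: "y \<in> ball x0 \<rho>" using y R by auto
    have "dist x0 z \<le> dist x0 y + norm (t *\<^sub>R e + h)"
    proof -
      have "dist z y = norm (t *\<^sub>R e + h)" by (simp add: zh dist_norm add.assoc)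
      then show ?thesis using dist_triangle[of x0 z y] dist_commute[of y z] by simp
    qed
    also have "norm (t *\<^sub>R e + h) \<le> t + R * t" using norm_triangle_ineq[of "t *\<^sub>R e" h] h e t by simp
    finally have zb: "z \<in> ball x0 \<rho>" using y R Rt by simp
    have ee: "e \<bullet> e = 1" using e by (simp add: dot_square_norm)
    have "?P z - ?P y = ?P h" unfolding zh by (simp add: inner_add_left algebra_simps ee)
    then have "norm (?P z - ?P y) \<le> 2 * (R * t)" using P[of h] h by simp
    then have "\<bar>\<gamma> (?P z) - \<gamma> (?P y)\<bar> \<le> L * (2 * (R * t))"
      using L(2)[OF PB[OF zb] PB[OF yb]] L(1) by (meson mult_left_mono order_trans)
    moreover have "\<gamma> (?P y) < y \<bullet> e" using y yb eq by blast
    moreover have "z \<bullet> e \<ge> y \<bullet> e + t - R * t"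
      using Cauchy_Schwarz_ineq2[of h e] h e by (simp add: zh inner_add_left ee)
    moreover have "R * (2 * L + 1) * t \<le> 1 * t" using RL t by (intro mult_right_mono) auto
    ultimately have "z \<bullet> e > \<gamma> (?P z)" by (simp add: algebra_simps)
    then show "z \<in> \<Omega>" using eq zb by blast
  qed
  then show ?thesis using R e by (intro exI[of _ R] conjI exI[of _ e]) auto
qed

text \<open>Compactness of the closure reduces to finitely many of the local cones. The axis depends on \<open>x\<close> but is common
  to all points of \<open>\<Omega>\<close> near \<open>x\<close>, so that averages at neighbouring points can be compared.\<close>
lemma uniform_cone:
  fixes \<Omega> :: "'a::euclidean_space set"
  assumes op: "open \<Omega>" and bd: "bounded \<Omega>" and sb: "smooth_boundary \<Omega>"
  shows "\<exists>R>0. R \<le> 1 \<and> (\<forall>x\<in>closure \<Omega>. \<exists>e. norm e \<le> 1 \<and> (\<forall>y\<in>\<Omega> \<inter> ball x R. has_cone \<Omega> R e y))"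
proof -
  obtain r e where r: "\<And>x. x \<in> closure \<Omega> \<Longrightarrow> 0 < r x \<and> r x \<le> 1 \<and> norm (e x) \<le> 1 \<and> (\<forall>y\<in>\<Omega> \<inter> ball x (2 * r x). has_cone \<Omega> (r x) (e x) y)"
    using local_cone[OF op sb] by metis
  have c: "compact (closure \<Omega>)" using bd by simp
  have sub: "closure \<Omega> \<subseteq> (\<Union>x\<in>closure \<Omega>. ball x (r x))"
  proof
    fix x assume x: "x \<in> closure \<Omega>"
    then have "x \<in> ball x (r x)" using r by simp
    with x show "x \<in> (\<Union>x\<in>closure \<Omega>. ball x (r x))" by blast
  qed
  obtain D where D: "D \<subseteq> closure \<Omega>" "finite D" "closure \<Omega> \<subseteq> (\<Union>x\<in>D. ball x (r x))"
    using compactE_image[OF c _ sub] by (metis open_ball)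
  define R where "R = Min (insert 1 (r ` D))"
  have R: "R > 0" "R \<le> 1" "\<And>x. x \<in> D \<Longrightarrow> R \<le> r x"
    using D r by (auto simp: R_def Min_gr_iff)
  have "\<exists>e. norm e \<le> 1 \<and> (\<forall>y\<in>\<Omega> \<inter> ball x R. has_cone \<Omega> R e y)" if x: "x \<in> closure \<Omega>" for x
  proof -
    obtain x0 where x0: "x0 \<in> D" "x \<in> ball x0 (r x0)" using x D by blast
    have "has_cone \<Omega> R (e x0) y" if y: "y \<in> \<Omega> \<inter> ball x R" for y
    proof (rule has_cone_mono[OF _ R(3)[OF x0(1)]])
      have "y \<in> ball x0 (2 * r x0)" using dist_triangle[of x0 y x] y x0 R(3)[OF x0(1)] by simp
      then show "has_cone \<Omega> (r x0) (e x0) y" using r[of x0] x0 D y by blast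
    qed
    then show ?thesis using r[of x0] x0 D by blast
  qed
  then show ?thesis using R by blast
qed

lemma kernel_integral_on:
  fixes y e :: "'a::euclidean_space"
  assumes op: "open \<Omega>" and R: "R > 0" and t: "t > 0" and incl: "cball (y + t *\<^sub>R e) (R * t) \<subseteq> \<Omega>"
  shows "integrable (lebesgue_on \<Omega>) (kernel R e y t)" "(LINT z|lebesgue_on \<Omega>. kernel R e y t z) = bump_mass TYPE('a) R"
proof -
  have z: "kernel R e y t z = 0" if "z \<notin> \<Omega>" for z using kernel_zero[OF R t, of z y e] incl that by blast
  have h: "has_bochner_integral lborel (kernel R e y t) (bump_mass TYPE('a) R)" by (rule kernel_integral[OF R t])
  have m: "kernel R e y t \<in> borel_measurable lborel" using smooth_borel_measurable[OF smooth_kernel] by simp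
  have S: "\<Omega> \<in> sets lebesgue" using op by auto
  show "integrable (lebesgue_on \<Omega>) (kernel R e y t)"
    using h m z integrable_lebesgue_on_eq[OF S, of "kernel R e y t"]
    by (simp add: integrable_completion has_bochner_integral_iff)
  show "(LINT z|lebesgue_on \<Omega>. kernel R e y t z) = bump_mass TYPE('a) R"
    using h m z integral_lebesgue_on_eq[OF op, of "kernel R e y t"]
    by (simp add: integral_completion has_bochner_integral_iff)
qed

lemma kernel_average_close:
  fixes y e :: "'a::euclidean_space"
  assumes op: "open \<Omega>" and R: "R > 0" and t: "t > 0" and incl: "cball (y + t *\<^sub>R e) (R * t) \<subseteq> \<Omega>"
    and li: "locally_integrable \<Omega> u" and ae: "AE z in lebesgue_on \<Omega>. f z = u z"
    and close: "\<And>z. z \<in> cball (y + t *\<^sub>R e) (R * t) \<Longrightarrow> \<bar>f z - c\<bar> \<le> \<epsilon>"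
  shows "\<bar>(LINT z|lebesgue_on \<Omega>. u z * kernel R e y t z) - bump_mass TYPE('a) R * c\<bar> \<le> \<epsilon> * bump_mass TYPE('a) R"
proof -
  note k = kernel_integral_on[OF op R t incl]
  have iu: "integrable (lebesgue_on \<Omega>) (\<lambda>z. u z * kernel R e y t z)"
    by (rule integrable_times_test[OF op li kernel_test(1)[OF R t incl]])
  have i: "integrable (lebesgue_on \<Omega>) (\<lambda>z. (u z - c) * kernel R e y t z)"
    using iu k(1) by (simp add: left_diff_distrib)
  have "(LINT z|lebesgue_on \<Omega>. u z * kernel R e y t z) - bump_mass TYPE('a) R * c = (LINT z|lebesgue_on \<Omega>. (u z - c) * kernel R e y t z)"
    using iu k by (simp add: left_diff_distrib)
  also have "\<bar>\<dots>\<bar> \<le> (LINT z|lebesgue_on \<Omega>. \<bar>(u z - c) * kernel R e y t z\<bar>)" by (rule integral_abs_bound)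
  also have "\<dots> \<le> (LINT z|lebesgue_on \<Omega>. \<epsilon> * kernel R e y t z)"
  proof (rule integral_mono_AE[OF integrable_abs[OF i]])
    show "AE z in lebesgue_on \<Omega>. \<bar>(u z - c) * kernel R e y t z\<bar> \<le> \<epsilon> * kernel R e y t z"
      using ae
    proof eventually_elim
      case (elim z)
      then show ?case using close[of z] kernel_zero[OF R t, of z y e] kernel_bounds(1)[OF t, of R e y z]
        by (cases "z \<in> cball (y + t *\<^sub>R e) (R * t)") (auto simp: abs_mult intro!: mult_right_mono)
    qed
  qed (use k in auto)
  also have "\<dots> = \<epsilon> * bump_mass TYPE('a) R" using k by simp
  finally show ?thesis .
qed

lemma kernel_lipschitz:
  assumes R: "R > 0"
  shows "\<exists>L\<ge>0. \<forall>t>0. \<forall>e y y' z. \<bar>kernel R e (y::'a::euclidean_space) t z - kernel R e y' t z\<bar> \<le> (1 / t) ^ (DIM('a) + 1) * L * norm (y - y')"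
proof -
  obtain L where L: "L \<ge> 0" "\<And>\<xi> \<xi>' :: 'a. \<bar>bump R \<xi> - bump R \<xi>'\<bar> \<le> L * norm (\<xi> - \<xi>')"
    using bump_lipschitz[OF R] by blast
  have "\<bar>kernel R e y t z - kernel R e y' t z\<bar> \<le> (1 / t) ^ (DIM('a) + 1) * L * norm (y - y')" if t: "t > 0" for t and e y y' z :: 'a
  proof -
    have "\<bar>kernel R e y t z - kernel R e y' t z\<bar> = (1 / t) ^ DIM('a) * \<bar>bump R ((1 / t) *\<^sub>R (z - y) - e) - bump R ((1 / t) *\<^sub>R (z - y') - e)\<bar>"
      using t by (simp add: kernel_def right_diff_distrib[symmetric] abs_mult del: power_one_over)
    also have "\<dots> \<le> (1 / t) ^ DIM('a) * (L * norm (((1 / t) *\<^sub>R (z - y) - e) - ((1 / t) *\<^sub>R (z - y') - e)))"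
      using t by (intro mult_left_mono L) auto
    also have "((1 / t) *\<^sub>R (z - y) - e) - ((1 / t) *\<^sub>R (z - y') - e) = (1 / t) *\<^sub>R (y' - y)"
      by (simp add: algebra_simps)
    also have "norm ((1 / t) *\<^sub>R (y' - y)) = (1 / t) * norm (y - y')" using t by (simp add: norm_minus_commute)
    finally show ?thesis by (simp add: mult_ac)
  qed
  then show ?thesis using L(1) by blast
qed

text \<open>For fixed \<open>t\<close> the averages depend on \<open>y\<close> in a Lipschitz way, uniformly in the axis and with a constant controlled by the
  integral of \<open>|u|\<close>.\<close>
lemma kernel_average_lipschitz:
  assumes R: "R > 0" and S: "\<Omega> \<in> sets lebesgue" and t: "t > 0"
  shows "\<exists>L\<ge>0. \<forall>u e y y'. integrable (lebesgue_on \<Omega>) u \<longrightarrow>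
    \<bar>(LINT z|lebesgue_on \<Omega>. u z * kernel R e (y::'a::euclidean_space) t z) - (LINT z|lebesgue_on \<Omega>. u z * kernel R e y' t z)\<bar>
      \<le> (1 / t) ^ (DIM('a) + 1) * L * norm (y - y') * (LINT z|lebesgue_on \<Omega>. \<bar>u z\<bar>)"
proof -
  obtain L where L: "L \<ge> 0" "\<And>t e (y::'a) y' z. t > 0 \<Longrightarrow> \<bar>kernel R e y t z - kernel R e y' t z\<bar> \<le> (1 / t) ^ (DIM('a) + 1) * L * norm (y - y')"
    using kernel_lipschitz[OF R] by blast
  show ?thesis
  proof (intro exI[of _ L] conjI L(1) allI impI)
    fix u :: "'a \<Rightarrow> real" and e y y' :: 'a
    assume u: "integrable (lebesgue_on \<Omega>) u"
    let ?K = "(1 / t) ^ (DIM('a) + 1) * L * norm (y - y')"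
    have i: "integrable (lebesgue_on \<Omega>) (\<lambda>z. u z * kernel R e y t z)" for y
    proof (rule Bochner_Integration.integrable_bound)
      show "integrable (lebesgue_on \<Omega>) (\<lambda>z. (1 / t) ^ DIM('a) * u z)" using u by simp
      have "kernel R e y t \<in> borel_measurable (lebesgue_on \<Omega>)"
        by (intro continuous_imp_measurable_on_sets_lebesgue smooth_continuous smooth_kernel S)
      then show "(\<lambda>z. u z * kernel R e y t z) \<in> borel_measurable (lebesgue_on \<Omega>)" using u by auto
      show "AE z in lebesgue_on \<Omega>. norm (u z * kernel R e y t z) \<le> norm ((1 / t) ^ DIM('a) * u z)"
      proof (rule AE_I2)
        fix z
        have "\<bar>u z\<bar> * kernel R e y t z \<le> \<bar>u z\<bar> * (1 / t) ^ DIM('a)"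
          using kernel_bounds(2)[OF t] by (rule mult_left_mono) simp
        then show "norm (u z * kernel R e y t z) \<le> norm ((1 / t) ^ DIM('a) * u z)"
          using kernel_bounds(1)[OF t, of R e y z] t by (simp add: abs_mult mult.commute)
      qed
    qed
    have "(LINT z|lebesgue_on \<Omega>. u z * kernel R e y t z) - (LINT z|lebesgue_on \<Omega>. u z * kernel R e y' t z) =
      (LINT z|lebesgue_on \<Omega>. u z * (kernel R e y t z - kernel R e y' t z))"
      using i[of y] i[of y'] by (simp add: right_diff_distrib)
    also have "\<bar>\<dots>\<bar> \<le> (LINT z|lebesgue_on \<Omega>. \<bar>u z * (kernel R e y t z - kernel R e y' t z)\<bar>)" by (rule integral_abs_bound)
    also have "\<dots> \<le> (LINT z|lebesgue_on \<Omega>. ?K * \<bar>u z\<bar>)"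
    proof (rule integral_mono)
      show "integrable (lebesgue_on \<Omega>) (\<lambda>z. \<bar>u z * (kernel R e y t z - kernel R e y' t z)\<bar>)"
        using i[of y] i[of y'] by (simp add: right_diff_distrib)
      show "\<bar>u z * (kernel R e y t z - kernel R e y' t z)\<bar> \<le> ?K * \<bar>u z\<bar>" for z
        unfolding abs_mult[of "u z"] mult.commute[of "\<bar>u z\<bar>"] using L(2)[OF t] by (rule mult_right_mono) simp
    qed (use u in auto)
    finally show "\<bar>(LINT z|lebesgue_on \<Omega>. u z * kernel R e y t z) - (LINT z|lebesgue_on \<Omega>. u z * kernel R e y' t z)\<bar>
      \<le> ?K * (LINT z|lebesgue_on \<Omega>. \<bar>u z\<bar>)" using u by simp
  qed
qed

section \<open>Morrey's embedding\<close>

lemma continuous_on_near: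
  fixes f :: "'a::euclidean_space \<Rightarrow> real"
  assumes "open \<Omega>" "continuous_on \<Omega> f" "y \<in> \<Omega>" "\<epsilon> > 0"
  shows "\<exists>\<delta>>0. cball y \<delta> \<subseteq> \<Omega> \<and> (\<forall>z\<in>cball y \<delta>. \<bar>f z - f y\<bar> \<le> \<epsilon>)"
proof -
  obtain d1 where d1: "d1 > 0" "cball y d1 \<subseteq> \<Omega>" using assms open_contains_cball by blast
  obtain d2 where d2: "d2 > 0" "\<And>z. z \<in> \<Omega> \<Longrightarrow> dist z y < d2 \<Longrightarrow> dist (f z) (f y) < \<epsilon>"
    using assms unfolding continuous_on_iff by metis
  define \<delta> where "\<delta> = min d1 (d2 / 2)"
  have "\<delta> > 0" "\<delta> \<le> d1" "\<delta> < d2" using d1 d2 by (auto simp: \<delta>_def)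
  moreover have "\<bar>f z - f y\<bar> \<le> \<epsilon>" if "z \<in> cball y \<delta>" for z
    using d2(2)[of z] that d1 calculation by (auto simp: dist_commute dist_real_def subset_iff less_imp_le)
  ultimately show ?thesis using d1 by (meson order_trans subset_cball)
qed

lemma kernel_ball_subset:
  assumes "0 < R" "R \<le> 1" "norm e \<le> 1" "0 < s"
  shows "cball (y + s *\<^sub>R e) (R * s) \<subseteq> cball y (2 * s)"
proof
  fix z assume z: "z \<in> cball (y + s *\<^sub>R e) (R * s)"
  have "dist y (y + s *\<^sub>R e) \<le> s" using assms by (simp add: dist_norm)
  moreover have "R * s \<le> 1 * s" using assms by (intro mult_right_mono) auto
  ultimately show "z \<in> cball y (2 * s)" using z dist_triangle[of y z "y + s *\<^sub>R e"] by simp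
qed

text \<open>The \<open>q\<close>-th power of the norm; the estimates are stated for it to avoid roots.\<close>
definition energy :: "'a::euclidean_space set \<Rightarrow> real \<Rightarrow> ('a \<Rightarrow> real) \<Rightarrow> real" where
  "energy \<Omega> q u = (LINT x|lebesgue_on \<Omega>. \<bar>u x\<bar> powr q) + (LINT x|lebesgue_on \<Omega>. norm (weak_gradient \<Omega> u x) powr q)"

lemma energy_eq: "q > 0 \<Longrightarrow> energy \<Omega> q u = W1_norm \<Omega> q u powr q"
  by (simp add: energy_def W1_norm_powr)

lemma energy_bounds: "(LINT x|lebesgue_on \<Omega>. \<bar>u x\<bar> powr q) \<le> energy \<Omega> q u"
  "(LINT x|lebesgue_on \<Omega>. norm (weak_gradient \<Omega> u x) powr q) \<le> energy \<Omega> q u" "0 \<le> energy \<Omega> q u"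
  by (simp_all add: energy_def)

text \<open>The constant of the oscillation bound when the energy is at most \<open>B\<close>.\<close>
definition osc_const :: "'a::euclidean_space itself \<Rightarrow> real \<Rightarrow> real \<Rightarrow> real" where
  "osc_const _ q B = 2 * (unit_ball_vol (real DIM('a)) + B) / (1 - real DIM('a) / q)"

lemma osc_exponent_pos: "q > real DIM('a::euclidean_space) \<Longrightarrow> 0 < 1 - real DIM('a) / q"
proof -
  assume "q > real DIM('a)"
  moreover have "real DIM('a) > 0" using DIM_positive by simp
  ultimately show ?thesis by (simp add: field_simps)
qed

lemma osc_const_nonneg: "q > real DIM('a::euclidean_space) \<Longrightarrow> B \<ge> 0 \<Longrightarrow> osc_const TYPE('a) q B \<ge> 0"
  using osc_exponent_pos[of q, where 'a='a] unfolding osc_const_def by (intro divide_nonneg_pos) auto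

lemma W1_integrable:
  assumes "open \<Omega>" "bounded \<Omega>" "q \<ge> 1" "u \<in> W1 \<Omega> q"
  shows "integrable (lebesgue_on \<Omega>) u"
    "(LINT x|lebesgue_on \<Omega>. \<bar>u x\<bar>) \<le> measure lebesgue \<Omega> + energy \<Omega> q u"
proof -
  have lm: "\<Omega> \<in> lmeasurable" using assms by (simp add: bounded_open_lmeasurable)
  interpret finite_measure "lebesgue_on \<Omega>" by (rule finite_measure_lebesgue_on[OF lm])
  have uL: "u \<in> Lp \<Omega> q" using W1_D(1)[OF assms(1,4)] .
  show i: "integrable (lebesgue_on \<Omega>) u" using Lp_integrable[OF lm assms(3) uL] .
  have iq: "integrable (lebesgue_on \<Omega>) (\<lambda>x. \<bar>u x\<bar> powr q)" using uL by (simp add: Lp_def)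
  have "(LINT x|lebesgue_on \<Omega>. \<bar>u x\<bar>) \<le> (LINT x|lebesgue_on \<Omega>. 1 + \<bar>u x\<bar> powr q)"
  proof (rule integral_mono)
    fix x show "\<bar>u x\<bar> \<le> 1 + \<bar>u x\<bar> powr q"
      using le_add_powr_scaled[of "\<bar>u x\<bar>" 1 q] assms by simp
  qed (use i iq in auto)
  also have "\<dots> = measure (lebesgue_on \<Omega>) \<Omega> + (LINT x|lebesgue_on \<Omega>. \<bar>u x\<bar> powr q)"
    using iq by simp
  also have "measure (lebesgue_on \<Omega>) \<Omega> = measure lebesgue \<Omega>"
    using lm by (subst measure_restrict_space) auto
  finally show "(LINT x|lebesgue_on \<Omega>. \<bar>u x\<bar>) \<le> measure lebesgue \<Omega> + energy \<Omega> q u"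
    using energy_bounds(1)[of \<Omega> u q] by linarith
qed

lemma W1_kernel_oscillation:
  fixes y e :: "'a::euclidean_space"
  assumes op: "open \<Omega>" and bd: "bounded \<Omega>" and R: "0 < R" "R \<le> 1" and e: "norm e \<le> 1"
    and incl: "\<And>t. 0 < t \<Longrightarrow> t \<le> T \<Longrightarrow> cball (y + t *\<^sub>R e) (R * t) \<subseteq> \<Omega>"
    and u: "u \<in> W1 \<Omega> q" and q: "q > real DIM('a)" and B: "energy \<Omega> q u \<le> B" and st: "0 < s" "s \<le> t" "t < T"
  shows "\<bar>(LINT z|lebesgue_on \<Omega>. u z * kernel R e y t z) - (LINT z|lebesgue_on \<Omega>. u z * kernel R e y s z)\<bar>
    \<le> osc_const TYPE('a) q B * t powr (1 - real DIM('a) / q)"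
proof -
  have q1: "q \<ge> 1" using q DIM_ge_Suc0[where 'a='a] by linarith
  note U = W1_D[OF op u]
  have "(LINT z|lebesgue_on \<Omega>. norm (weak_gradient \<Omega> u z) powr q) \<le> B"
    using energy_bounds(2)[of \<Omega> u q] B by linarith
  then have "2 * (unit_ball_vol (real DIM('a)) + (LINT z|lebesgue_on \<Omega>. norm (weak_gradient \<Omega> u z) powr q)) / (1 - real DIM('a) / q)
      * t powr (1 - real DIM('a) / q) \<le> osc_const TYPE('a) q B * t powr (1 - real DIM('a) / q)"
    unfolding osc_const_def using osc_exponent_pos[OF q] by (intro mult_right_mono divide_right_mono) auto
  with kernel_average_oscillation[OF op bd R e incl U(2) W1_integrable(1)[OF op bd q1 u] U(3) q st]
  show ?thesis by linarith
qed

text \<open>Let the smaller radius tend to \<open>0\<close> in the oscillation bound: the averages of a continuous function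
  tend to the mass of the kernel times its value at the vertex.\<close>
lemma kernel_average_limit:
  fixes y e :: "'a::euclidean_space"
  assumes op: "open \<Omega>" and bd: "bounded \<Omega>" and R: "0 < R" "R \<le> 1" and e: "norm e \<le> 1"
    and cone: "has_cone \<Omega> R e y" and y: "y \<in> \<Omega>"
    and u: "u \<in> W1 \<Omega> q" and q: "q > real DIM('a)" and B: "energy \<Omega> q u \<le> B" and t: "0 < t" "t < R"
    and f: "continuous_on \<Omega> f" "AE z in lebesgue_on \<Omega>. f z = u z"
  shows "\<bar>(LINT z|lebesgue_on \<Omega>. u z * kernel R e y t z) - bump_mass TYPE('a) R * f y\<bar>
    \<le> osc_const TYPE('a) q B * t powr (1 - real DIM('a) / q)"
proof (rule field_le_epsilon)
  fix \<epsilon> :: real assume \<epsilon>: "\<epsilon> > 0"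
  let ?J = "bump_mass TYPE('a) R"
  have J: "?J > 0" by (rule bump_mass_pos[OF R(1)])
  obtain \<delta> where \<delta>: "\<delta> > 0" "\<And>z. z \<in> cball y \<delta> \<Longrightarrow> \<bar>f z - f y\<bar> \<le> \<epsilon> / ?J"
    using continuous_on_near[OF op f(1) y, of "\<epsilon> / ?J"] J \<epsilon> by auto
  define s where "s = min t (\<delta> / 2)"
  have s: "0 < s" "s \<le> t" "2 * s \<le> \<delta>" using t \<delta> by (auto simp: s_def)
  have incl: "\<And>t. 0 < t \<Longrightarrow> t \<le> R \<Longrightarrow> cball (y + t *\<^sub>R e) (R * t) \<subseteq> \<Omega>" using cone by (auto simp: has_cone_def)
  have li: "locally_integrable \<Omega> u" using W1_D(2)[OF op u] by (simp add: is_weak_gradient_def)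
  have "\<bar>(LINT z|lebesgue_on \<Omega>. u z * kernel R e y s z) - ?J * f y\<bar> \<le> \<epsilon> / ?J * ?J"
  proof (rule kernel_average_close[OF op R(1) s(1) _ li f(2)])
    show "cball (y + s *\<^sub>R e) (R * s) \<subseteq> \<Omega>" using s t by (intro incl) auto
    show "\<bar>f z - f y\<bar> \<le> \<epsilon> / ?J" if "z \<in> cball (y + s *\<^sub>R e) (R * s)" for z
      using kernel_ball_subset[OF R e s(1), of y] that s(3) by (intro \<delta>(2)) auto
  qed
  then have 1: "\<bar>(LINT z|lebesgue_on \<Omega>. u z * kernel R e y s z) - ?J * f y\<bar> \<le> \<epsilon>" using J by simp
  have 2: "\<bar>(LINT z|lebesgue_on \<Omega>. u z * kernel R e y t z) - (LINT z|lebesgue_on \<Omega>. u z * kernel R e y s z)\<bar>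
    \<le> osc_const TYPE('a) q B * t powr (1 - real DIM('a) / q)"
    by (rule W1_kernel_oscillation[OF op bd R e incl u q B s(1,2) t(2)])
  show "\<bar>(LINT z|lebesgue_on \<Omega>. u z * kernel R e y t z) - ?J * f y\<bar>
    \<le> osc_const TYPE('a) q B * t powr (1 - real DIM('a) / q) + \<epsilon>"
    using 1 2 by linarith
qed

lemma powr_small:
  assumes "\<gamma> > 0" "\<epsilon> > 0" "C \<ge> 0" "R > 0"
  shows "\<exists>t>0. t < R \<and> C * t powr \<gamma> \<le> (\<epsilon>::real)"
proof -
  define t where "t = min (R / 2) ((\<epsilon> / (C + 1)) powr (1 / \<gamma>))"
  have t: "0 < t" "t < R" using assms by (auto simp: t_def)
  have "t powr \<gamma> \<le> ((\<epsilon> / (C + 1)) powr (1 / \<gamma>)) powr \<gamma>" using assms t by (intro powr_mono2) (auto simp: t_def)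
  also have "\<dots> = \<epsilon> / (C + 1)" using assms by (simp add: powr_powr)
  finally have "C * t powr \<gamma> \<le> C * (\<epsilon> / (C + 1))" using assms by (intro mult_left_mono) auto
  also have "\<dots> \<le> \<epsilon>" using assms by (simp add: field_simps)
  finally show ?thesis using t by blast
qed

text \<open>The value at \<open>x\<close> is replaced, uniformly in \<open>u\<close>, by an average at a fixed small scale \<open>t\<close>, and these averages are
  Lipschitz in the point. Both points use cones with the same axis.\<close>
lemma W1_equicontinuous_inside:
  fixes \<Omega> :: "'a::euclidean_space set"
  assumes op: "open \<Omega>" and bd: "bounded \<Omega>" and sb: "smooth_boundary \<Omega>" and q: "q > real DIM('a)" and \<epsilon>: "\<epsilon> > 0" and B: "B \<ge> 0"
  shows "\<exists>\<delta>>0. \<forall>u f. u \<in> W1 \<Omega> q \<longrightarrow> energy \<Omega> q u \<le> B \<longrightarrow> continuous_on \<Omega> f \<longrightarrow> (AE z in lebesgue_on \<Omega>. f z = u z) \<longrightarrow>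
    (\<forall>x\<in>\<Omega>. \<forall>y\<in>\<Omega>. dist x y < \<delta> \<longrightarrow> \<bar>f x - f y\<bar> \<le> \<epsilon>)"
proof -
  have q1: "q \<ge> 1" using q DIM_ge_Suc0[where 'a='a] by linarith
  have S: "\<Omega> \<in> sets lebesgue" using op by auto
  obtain R where R: "0 < R" "R \<le> 1" and cone: "\<And>x. x \<in> closure \<Omega> \<Longrightarrow> \<exists>e. norm e \<le> 1 \<and> (\<forall>y\<in>\<Omega> \<inter> ball x R. has_cone \<Omega> R e y)"
    using uniform_cone[OF op bd sb] by blast
  let ?J = "bump_mass TYPE('a) R"
  let ?C = "osc_const TYPE('a) q B"
  let ?\<gamma> = "1 - real DIM('a) / q"
  have J: "?J > 0" by (rule bump_mass_pos[OF R(1)])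
  obtain t where t: "0 < t" "t < R" "?C * t powr ?\<gamma> \<le> ?J * \<epsilon> / 4"
    using powr_small[OF osc_exponent_pos[OF q], of "?J * \<epsilon> / 4" ?C R] J \<epsilon> R osc_const_nonneg[OF q B] by auto
  obtain L where L: "L \<ge> 0" "\<And>u e y y'. integrable (lebesgue_on \<Omega>) u \<Longrightarrow>
    \<bar>(LINT z|lebesgue_on \<Omega>. u z * kernel R e (y::'a) t z) - (LINT z|lebesgue_on \<Omega>. u z * kernel R e y' t z)\<bar>
      \<le> (1 / t) ^ (DIM('a) + 1) * L * norm (y - y') * (LINT z|lebesgue_on \<Omega>. \<bar>u z\<bar>)"
    using kernel_average_lipschitz[OF R(1) S t(1)] by blast
  define A where "A = (1 / t) ^ (DIM('a) + 1) * L * (measure lebesgue \<Omega> + B)"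
  have A: "A \<ge> 0" unfolding A_def using t L B by (intro mult_nonneg_nonneg) auto
  define \<delta> where "\<delta> = min R (?J * \<epsilon> / 2 / (A + 1))"
  have \<delta>: "0 < \<delta>" "\<delta> \<le> R" "A * \<delta> \<le> ?J * \<epsilon> / 2"
  proof -
    show "0 < \<delta>" "\<delta> \<le> R" using R J \<epsilon> A by (auto simp: \<delta>_def)
    have "A * \<delta> \<le> A * (?J * \<epsilon> / 2 / (A + 1))" using A by (intro mult_left_mono) (auto simp: \<delta>_def)
    also have "\<dots> = ?J * \<epsilon> / 2 * (A / (A + 1))" by simp
    also have "\<dots> \<le> ?J * \<epsilon> / 2 * 1" using J \<epsilon> A by (intro mult_left_mono) auto
    finally show "A * \<delta> \<le> ?J * \<epsilon> / 2" by simp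
  qed
  have "\<bar>f x - f y\<bar> \<le> \<epsilon>"
    if u: "u \<in> W1 \<Omega> q" "energy \<Omega> q u \<le> B" and f: "continuous_on \<Omega> f" "AE z in lebesgue_on \<Omega>. f z = u z"
      and xy: "x \<in> \<Omega>" "y \<in> \<Omega>" "dist x y < \<delta>" for u f x y
  proof -
    obtain e where e: "norm e \<le> 1" "\<And>y. y \<in> \<Omega> \<inter> ball x R \<Longrightarrow> has_cone \<Omega> R e y"
      using cone[of x] xy closure_subset by blast
    have cx: "has_cone \<Omega> R e x" and cy: "has_cone \<Omega> R e y" using e(2)[of x] e(2)[of y] xy R \<delta> by auto
    note lx = kernel_average_limit[OF op bd R e(1) cx xy(1) u(1) q u(2) t(1,2) f]
    note ly = kernel_average_limit[OF op bd R e(1) cy xy(2) u(1) q u(2) t(1,2) f]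
    have "(1 / t) ^ (DIM('a) + 1) * L * norm (x - y) * (LINT z|lebesgue_on \<Omega>. \<bar>u z\<bar>) \<le> (1 / t) ^ (DIM('a) + 1) * L * \<delta> * (measure lebesgue \<Omega> + B)"
    proof (intro mult_mono)
      show "(LINT z|lebesgue_on \<Omega>. \<bar>u z\<bar>) \<le> measure lebesgue \<Omega> + B"
        using W1_integrable(2)[OF op bd q1 u(1)] u(2) by linarith
    qed (use t L xy \<delta> in \<open>auto simp: dist_norm\<close>)
    also have "\<dots> = A * \<delta>" by (simp add: A_def mult_ac)
    finally have "\<bar>(LINT z|lebesgue_on \<Omega>. u z * kernel R e x t z) - (LINT z|lebesgue_on \<Omega>. u z * kernel R e y t z)\<bar> \<le> ?J * \<epsilon> / 2"
      using L(2)[OF W1_integrable(1)[OF op bd q1 u(1)], of e x y] \<delta>(3) by linarith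
    then have "\<bar>?J * f x - ?J * f y\<bar> \<le> ?J * \<epsilon>" using lx ly t(3) by linarith
    then have "?J * \<bar>f x - f y\<bar> \<le> ?J * \<epsilon>" using J by (simp add: right_diff_distrib[symmetric] abs_mult)
    then show ?thesis using J by simp
  qed
  then show ?thesis using \<delta>(1) by blast
qed

text \<open>An average at a fixed scale is bounded by the integral of \<open>|u|\<close>, and it differs from the value at the vertex by
  a controlled amount.\<close>
lemma W1_bounded_inside:
  fixes \<Omega> :: "'a::euclidean_space set"
  assumes op: "open \<Omega>" and bd: "bounded \<Omega>" and sb: "smooth_boundary \<Omega>" and q: "q > real DIM('a)" and B: "B \<ge> 0"
  shows "\<exists>C. \<forall>u f. u \<in> W1 \<Omega> q \<longrightarrow> energy \<Omega> q u \<le> B \<longrightarrow> continuous_on \<Omega> f \<longrightarrow> (AE z in lebesgue_on \<Omega>. f z = u z) \<longrightarrow>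
    (\<forall>x\<in>\<Omega>. \<bar>f x\<bar> \<le> C)"
proof -
  have q1: "q \<ge> 1" using q DIM_ge_Suc0[where 'a='a] by linarith
  have S: "\<Omega> \<in> sets lebesgue" using op by auto
  obtain R where R: "0 < R" "R \<le> 1" and cone: "\<And>x. x \<in> closure \<Omega> \<Longrightarrow> \<exists>e. norm e \<le> 1 \<and> (\<forall>y\<in>\<Omega> \<inter> ball x R. has_cone \<Omega> R e y)"
    using uniform_cone[OF op bd sb] by blast
  let ?J = "bump_mass TYPE('a) R"
  let ?C = "osc_const TYPE('a) q B"
  let ?\<gamma> = "1 - real DIM('a) / q"
  have J: "?J > 0" by (rule bump_mass_pos[OF R(1)])
  define t where "t = R / 2"
  have t: "0 < t" "t < R" using R by (auto simp: t_def)
  have "\<bar>f x\<bar> \<le> ((1 / t) ^ DIM('a) * (measure lebesgue \<Omega> + B) + ?C * t powr ?\<gamma>) / ?J"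
    if u: "u \<in> W1 \<Omega> q" "energy \<Omega> q u \<le> B" and f: "continuous_on \<Omega> f" "AE z in lebesgue_on \<Omega>. f z = u z"
      and x: "x \<in> \<Omega>" for u f x
  proof -
    obtain e where e: "norm e \<le> 1" "\<And>y. y \<in> \<Omega> \<inter> ball x R \<Longrightarrow> has_cone \<Omega> R e y"
      using cone[of x] x closure_subset by blast
    have cx: "has_cone \<Omega> R e x" using e(2)[of x] x R by auto
    note lx = kernel_average_limit[OF op bd R e(1) cx x u(1) q u(2) t f]
    have iu: "integrable (lebesgue_on \<Omega>) u" by (rule W1_integrable(1)[OF op bd q1 u(1)])
    have "\<bar>LINT z|lebesgue_on \<Omega>. u z * kernel R e x t z\<bar> \<le> (LINT z|lebesgue_on \<Omega>. (1 / t) ^ DIM('a) * \<bar>u z\<bar>)"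
    proof (rule order_trans[OF integral_abs_bound])
      have "cball (x + t *\<^sub>R e) (R * t) \<subseteq> \<Omega>" using cx t by (auto simp: has_cone_def)
      then have i: "integrable (lebesgue_on \<Omega>) (\<lambda>z. u z * kernel R e x t z)"
        using W1_D(2)[OF op u(1)] by (intro integrable_times_test[OF op _ kernel_test(1)[OF R(1) t(1)]]) (auto simp: is_weak_gradient_def)
      show "(LINT z|lebesgue_on \<Omega>. \<bar>u z * kernel R e x t z\<bar>) \<le> (LINT z|lebesgue_on \<Omega>. (1 / t) ^ DIM('a) * \<bar>u z\<bar>)"
      proof (rule integral_mono[OF integrable_abs[OF i]])
        fix z
        have "\<bar>u z\<bar> * kernel R e x t z \<le> \<bar>u z\<bar> * (1 / t) ^ DIM('a)"
          using kernel_bounds(2)[OF t(1)] by (rule mult_left_mono) simp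
        then show "\<bar>u z * kernel R e x t z\<bar> \<le> (1 / t) ^ DIM('a) * \<bar>u z\<bar>"
          using kernel_bounds(1)[OF t(1), of R e x z] by (simp add: abs_mult mult.commute)
      qed (use iu in auto)
    qed
    also have "\<dots> \<le> (1 / t) ^ DIM('a) * (measure lebesgue \<Omega> + B)"
    proof -
      have "(LINT z|lebesgue_on \<Omega>. \<bar>u z\<bar>) \<le> measure lebesgue \<Omega> + B"
        using W1_integrable(2)[OF op bd q1 u(1)] u(2) by linarith
      then show ?thesis using t by (subst integral_mult_right_zero) (intro mult_left_mono, auto)
    qed
    finally have "\<bar>?J * f x\<bar> \<le> (1 / t) ^ DIM('a) * (measure lebesgue \<Omega> + B) + ?C * t powr ?\<gamma>" using lx by linarith
    then show ?thesis using J by (simp add: abs_mult pos_le_divide_eq mult.commute)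
  qed
  then show ?thesis by blast
qed

lemma continuous_on_locally_integrable:
  fixes f :: "'a::euclidean_space \<Rightarrow> real"
  assumes "continuous_on \<Omega> f" shows "locally_integrable \<Omega> f"
  unfolding locally_integrable_def
proof safe
  fix K assume K: "compact K" "K \<subseteq> \<Omega>"
  have "integrable lborel (\<lambda>x. indicator K x *\<^sub>R f x)"
    by (rule borel_integrable_compact[OF K(1) continuous_on_subset[OF assms K(2)]])
  then have "integrable lebesgue (\<lambda>x. indicator K x *\<^sub>R f x)"
    by (subst integrable_completion) auto
  then show "integrable (lebesgue_on K) f"
    using K by (subst integrable_restrict_space) (auto simp: compact_imp_closed)
qed

text \<open>By Fubini and the symmetry of the bump the mollification is moved from \<open>u\<close> to the test function, whose
  mollifications converge to it.\<close>
lemma mollified_pairing_tendsto: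
  fixes u \<phi> :: "'a::euclidean_space \<Rightarrow> real"
  assumes op: "open \<Omega>" and u: "integrable (lebesgue_on \<Omega>) u" and \<phi>: "\<phi> \<in> test_functions \<Omega>"
    and s: "\<And>n. s n > 0" "s \<longlonglongrightarrow> 0"
  shows "(\<lambda>n. LINT x|lebesgue. (LINT z|lebesgue_on \<Omega>. u z * kernel 1 0 x (s n) z) * \<phi> x)
    \<longlonglongrightarrow> bump_mass TYPE('a) 1 * (LINT x|lebesgue_on \<Omega>. u x * \<phi> x)"
proof -
  have S: "\<Omega> \<in> sets lebesgue" using op by auto
  let ?J = "bump_mass TYPE('a) 1"
  define u0 where "u0 x = indicator \<Omega> x * u x" for x
  have iu0: "integrable lebesgue u0"
    using u S unfolding u0_def by (subst (asm) integrable_restrict_space) auto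
  have u0m: "u0 \<in> borel_measurable lebesgue" using iu0 by auto
  obtain v where v[measurable]: "v \<in> borel_measurable lborel" and ae: "AE x in lborel. u0 x = v x"
    using completion_ex_borel_measurable_real[OF u0m] by blast
  have vm: "v \<in> borel_measurable lebesgue" by (rule measurable_completion[OF v])
  have ae': "AE x in lebesgue. u0 x = v x" by (rule AE_completion[OF ae])
  have iv: "integrable lborel v"
    using iu0 integrable_cong_AE[OF u0m vm ae'] integrable_completion[OF v] by simp
  have conv: "(LINT z|lebesgue_on \<Omega>. u z * h z) = (LINT z|lborel. v z * h z)"
    if h: "h \<in> borel_measurable borel" for h
  proof -
    have hl: "h \<in> borel_measurable lebesgue" using h by (intro measurable_completion) simp
    have "(LINT z|lebesgue_on \<Omega>. u z * h z) = (LINT z|lebesgue. u0 z * h z)"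
      using S unfolding u0_def by (subst integral_restrict_space) (auto simp: mult_ac)
    also have "\<dots> = (LINT z|lebesgue. v z * h z)"
      using ae' by (intro integral_cong_AE borel_measurable_times u0m vm hl) auto
    also have "\<dots> = (LINT z|lborel. v z * h z)"
      using h by (intro integral_completion) auto
    finally show ?thesis .
  qed
  note s\<phi> = test_function_smooth[OF \<phi>]
  have [measurable]: "\<phi> \<in> borel_measurable borel" by (rule smooth_borel_measurable[OF s\<phi>])
  obtain C where C: "\<And>x. \<bar>\<phi> x\<bar> \<le> C" using test_function_bounded[OF \<phi>] by blast
  have C0: "C \<ge> 0" using C[of 0] by linarith
  have i\<phi>: "integrable lborel \<phi>"
  proof -
    let ?K = "closure {x. \<phi> x \<noteq> 0}"
    have "integrable lborel (\<lambda>x. indicator ?K x *\<^sub>R \<phi> x)"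
      using \<phi> by (intro borel_integrable_compact smooth_continuous s\<phi>) (simp add: test_functions_def)
    moreover have "(\<lambda>x. indicator ?K x *\<^sub>R \<phi> x) = \<phi>"
    proof
      fix x show "indicator ?K x *\<^sub>R \<phi> x = \<phi> x"
        using test_function_outside[OF \<phi>, of x] by (cases "x \<in> ?K") simp_all
    qed
    ultimately show ?thesis by simp
  qed
  define G where "G n z = (LINT x|lborel. \<phi> x * kernel 1 0 z (s n) x)" for n z
  have ksym: "kernel 1 0 x t z = kernel 1 0 z t x" for t and x z :: 'a
    unfolding kernel_def using bump_minus[of 1 "(1 / t) *\<^sub>R (x - z)"] by (simp add: scaleR_right_diff_distrib)
  have kb: "kernel 1 0 x t \<in> borel_measurable borel" for x :: 'a and t
    by (rule smooth_borel_measurable[OF smooth_kernel])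
  have km: "(\<lambda>p. kernel 1 0 (fst p) t (snd p)) \<in> borel_measurable (borel \<Otimes>\<^sub>M (borel :: 'a measure))" for t
  proof -
    have "continuous_on UNIV (\<lambda>p::'a\<times>'a. kernel 1 0 (fst p) t (snd p))"
      unfolding kernel_def bump_def by (intro continuous_intros continuous_flat_exp)
    then show ?thesis by (simp add: borel_prod borel_measurable_continuous_onI)
  qed
  have fub: "(LINT x|lebesgue. (LINT z|lebesgue_on \<Omega>. u z * kernel 1 0 x (s n) z) * \<phi> x) = (LINT z|lborel. v z * G n z)" for n
  proof -
    let ?t = "s n"
    have t: "?t > 0" by (rule s)
    let ?F = "\<lambda>x z. v z * kernel 1 0 x ?t z * \<phi> x"
    have Fm: "case_prod ?F \<in> borel_measurable (lborel \<Otimes>\<^sub>M lborel)"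
    proof -
      have [measurable]: "(\<lambda>p::'a\<times>'a. kernel 1 0 (fst p) ?t (snd p)) \<in> borel_measurable (lborel \<Otimes>\<^sub>M lborel)"
        using km[of ?t] by (simp cong: measurable_cong_sets sets_pair_measure_cong)
      have "(\<lambda>p. v (snd p) * kernel 1 0 (fst p) ?t (snd p) * \<phi> (fst p)) \<in> borel_measurable (lborel \<Otimes>\<^sub>M lborel)"
        by measurable
      then show ?thesis by (simp add: case_prod_beta')
    qed
    have prod: "integrable (lborel \<Otimes>\<^sub>M lborel) (\<lambda>(x, z). (1 / ?t) ^ DIM('a) * (\<bar>\<phi> x\<bar> * \<bar>v z\<bar>))"
    proof (rule lborel_pair.Fubini_integrable)
      show "(\<lambda>(x, z). (1 / ?t) ^ DIM('a) * (\<bar>\<phi> x\<bar> * \<bar>v z\<bar>)) \<in> borel_measurable (lborel \<Otimes>\<^sub>M lborel)" by measurable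
    qed (use iv i\<phi> t in \<open>auto simp: abs_mult\<close>)
    have intF: "integrable (lborel \<Otimes>\<^sub>M lborel) (case_prod ?F)"
    proof (rule Bochner_Integration.integrable_bound[OF prod Fm], rule AE_I2)
      fix p :: "'a \<times> 'a"
      obtain x z where p: "p = (x, z)" by (cases p)
      have "\<bar>v z\<bar> * \<bar>\<phi> x\<bar> * kernel 1 0 x ?t z \<le> \<bar>v z\<bar> * \<bar>\<phi> x\<bar> * (1 / ?t) ^ DIM('a)"
        using kernel_bounds(2)[OF t] by (rule mult_left_mono) simp
      then show "norm (case_prod ?F p) \<le> norm (case p of (x, z) \<Rightarrow> (1 / ?t) ^ DIM('a) * (\<bar>\<phi> x\<bar> * \<bar>v z\<bar>))"
        unfolding p using kernel_bounds(1)[OF t, of 1 0 x z] t by (simp add: abs_mult mult_ac)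
    qed
    have "(LINT x|lebesgue. (LINT z|lebesgue_on \<Omega>. u z * kernel 1 0 x ?t z) * \<phi> x) = (LINT x|lebesgue. (LINT z|lborel. ?F x z))"
      using conv[OF kb] by simp
    also have "\<dots> = (LINT x|lborel. (LINT z|lborel. ?F x z))"
      using Fm by (intro integral_completion lborel.borel_measurable_lebesgue_integral) auto
    also have "\<dots> = (LINT z|lborel. (LINT x|lborel. ?F x z))"
      by (rule lborel_pair.Fubini_integral[OF intF, symmetric])
    also have "\<dots> = (LINT z|lborel. v z * G n z)"
      unfolding G_def by (simp add: ksym[of _ ?t] mult_ac flip: integral_mult_right_zero)
    finally show ?thesis .
  qed
  have Gb: "\<bar>G n z\<bar> \<le> C * ?J" and Gm: "G n \<in> borel_measurable borel" for n z
  proof -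
    note k = kernel_integral[OF _ s(1)[of n], of 1 0 z]
    have ik: "integrable lborel (kernel 1 0 z (s n))" using k by (simp add: has_bochner_integral_iff)
    have i: "integrable lborel (\<lambda>x. \<phi> x * kernel 1 0 z (s n) x)"
      by (rule Bochner_Integration.integrable_bound[where f="\<lambda>x. C * kernel 1 0 z (s n) x"])
         (use ik kb C C0 kernel_bounds(1)[OF s(1)] in \<open>auto simp: abs_mult intro!: mult_right_mono\<close>)
    have "\<bar>G n z\<bar> \<le> (LINT x|lborel. \<bar>\<phi> x * kernel 1 0 z (s n) x\<bar>)" unfolding G_def by (rule integral_abs_bound)
    also have "\<dots> \<le> (LINT x|lborel. C * kernel 1 0 z (s n) x)"
    proof (rule integral_mono[OF integrable_abs[OF i]])
      fix x
      show "\<bar>\<phi> x * kernel 1 0 z (s n) x\<bar> \<le> C * kernel 1 0 z (s n) x"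
        using mult_right_mono[OF C kernel_bounds(1)[OF s(1)], of x 1 0 z n x] kernel_bounds(1)[OF s(1), of 1 0 z n x]
        by (simp add: abs_mult)
    qed (use ik in auto)
    also have "\<dots> = C * ?J" using k by (simp add: has_bochner_integral_iff)
    finally show "\<bar>G n z\<bar> \<le> C * ?J" .
    have [measurable]: "(\<lambda>p::'a\<times>'a. kernel 1 0 (fst p) (s n) (snd p)) \<in> borel_measurable (borel \<Otimes>\<^sub>M lborel)"
      using km[of "s n"] by (simp cong: measurable_cong_sets sets_pair_measure_cong)
    have "(\<lambda>p. \<phi> (snd p) * kernel 1 0 (fst p) (s n) (snd p)) \<in> borel_measurable (borel \<Otimes>\<^sub>M lborel)" by measurable
    then show "G n \<in> borel_measurable borel" unfolding G_def
      by (intro lborel.borel_measurable_lebesgue_integral) (simp add: case_prod_beta')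
  qed
  have Glim: "(\<lambda>n. G n z) \<longlonglongrightarrow> ?J * \<phi> z" for z
  proof (rule LIMSEQ_I)
    fix r :: real assume r: "r > 0"
    have J: "?J > 0" by (rule bump_mass_pos) simp
    obtain \<delta> where \<delta>: "\<delta> > 0" "\<And>x. x \<in> cball z \<delta> \<Longrightarrow> \<bar>\<phi> x - \<phi> z\<bar> \<le> r / 2 / ?J"
      using continuous_on_near[OF open_UNIV smooth_continuous[OF s\<phi>], of z "r / 2 / ?J"] r J by auto
    obtain N where N: "\<And>n. n \<ge> N \<Longrightarrow> s n < \<delta>"
      using s(2) \<delta>(1) s(1) unfolding LIMSEQ_def by (metis abs_of_pos dist_0_norm dist_commute real_norm_def)
    have li: "locally_integrable UNIV \<phi>"
      by (rule continuous_on_locally_integrable[OF smooth_continuous[OF s\<phi>]])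
    have "norm (G n z - ?J * \<phi> z) < r" if n: "n \<ge> N" for n
    proof -
      have "\<bar>(LINT x|lebesgue_on UNIV. \<phi> x * kernel 1 0 z (s n) x) - ?J * \<phi> z\<bar> \<le> r / 2 / ?J * ?J"
        by (rule kernel_average_close[OF open_UNIV _ s(1) _ li]) (use N[OF n] \<delta>(2) in auto)
      moreover have "(LINT x|lebesgue_on UNIV. \<phi> x * kernel 1 0 z (s n) x) = G n z"
        unfolding G_def lebesgue_on_UNIV_eq using kb by (intro integral_completion) auto
      ultimately show ?thesis using r J by simp
    qed
    then show "\<exists>no. \<forall>n\<ge>no. norm (G n z - ?J * \<phi> z) < r" by blast
  qed
  have "(\<lambda>n. LINT z|lborel. v z * G n z) \<longlonglongrightarrow> (LINT z|lborel. v z * (?J * \<phi> z))"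
  proof (rule integral_dominated_convergence[where w="\<lambda>z. (C * ?J) * \<bar>v z\<bar>"])
    show "AE z in lborel. (\<lambda>n. v z * G n z) \<longlonglongrightarrow> v z * (?J * \<phi> z)"
      by (intro AE_I2 tendsto_mult tendsto_const Glim)
    show "AE z in lborel. norm (v z * G n z) \<le> (C * ?J) * \<bar>v z\<bar>" for n
    proof (rule AE_I2)
      fix z
      have "\<bar>G n z\<bar> * \<bar>v z\<bar> \<le> (C * ?J) * \<bar>v z\<bar>" using Gb by (rule mult_right_mono) simp
      then show "norm (v z * G n z) \<le> (C * ?J) * \<bar>v z\<bar>" by (simp add: abs_mult mult.commute)
    qed
  qed (use iv Gm in auto)
  moreover have "(LINT z|lborel. v z * (?J * \<phi> z)) = ?J * (LINT x|lebesgue_on \<Omega>. u x * \<phi> x)"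
  proof -
    have "(LINT z|lborel. v z * (?J * \<phi> z)) = (LINT z|lborel. ?J * (v z * \<phi> z))"
      by (intro Bochner_Integration.integral_cong refl) (simp only: mult.left_commute)
    then show ?thesis using conv[of \<phi>] by (simp only: integral_mult_right_zero) simp
  qed
  ultimately show ?thesis by (simp only: fub)
qed


text \<open>By the oscillation bound with \<open>e = 0\<close> the mollifications converge locally uniformly in \<open>\<Omega>\<close>, hence to a continuous function.
  It agrees with \<open>u\<close> because the mollifications also converge to \<open>u\<close> when tested.\<close>
lemma W1_continuous_inside:
  fixes \<Omega> :: "'a::euclidean_space set"
  assumes op: "open \<Omega>" and bd: "bounded \<Omega>" and q: "q > real DIM('a)" and u: "u \<in> W1 \<Omega> q"
  shows "\<exists>f. continuous_on \<Omega> f \<and> (AE x in lebesgue_on \<Omega>. f x = u x)"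
proof -
  have q1: "q \<ge> 1" using q DIM_ge_Suc0[where 'a='a] by linarith
  have S: "\<Omega> \<in> sets lebesgue" using op by auto
  have iu: "integrable (lebesgue_on \<Omega>) u" by (rule W1_integrable(1)[OF op bd q1 u])
  have li: "locally_integrable \<Omega> u" by (rule integrable_imp_locally_integrable[OF S iu])
  let ?J = "bump_mass TYPE('a) 1"
  have J: "?J > 0" by (rule bump_mass_pos) simp
  define s where "s n = 1 / real (Suc n)" for n
  have s: "s n > 0" "m \<ge> n \<Longrightarrow> s m \<le> s n" for m n by (auto simp: s_def frac_le)
  have slim: "s \<longlonglongrightarrow> 0" unfolding s_def by (rule LIMSEQ_Suc[OF lim_1_over_n])
  define U where "U n x = (LINT z|lebesgue_on \<Omega>. u z * kernel 1 0 x (s n) z)" for n x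
  define C where "C = osc_const TYPE('a) q (energy \<Omega> q u)"
  define \<gamma> where "\<gamma> = 1 - real DIM('a) / q"
  have \<gamma>: "\<gamma> > 0" unfolding \<gamma>_def by (rule osc_exponent_pos[OF q])
  have C: "C \<ge> 0" unfolding C_def by (rule osc_const_nonneg[OF q energy_bounds(3)])
  define r where "r n = C * s n powr \<gamma>" for n
  have rlim: "r \<longlonglongrightarrow> 0"
  proof -
    have "(\<lambda>n. s n powr \<gamma>) \<longlonglongrightarrow> 0"
      using s(1) \<gamma> by (intro tendsto_zero_powrI[OF slim tendsto_const]) (auto intro: always_eventually less_imp_le)
    from tendsto_mult_left[OF this, of C] show ?thesis by (simp add: r_def[abs_def])
  qed
  have osc: "\<bar>U n x - U m x\<bar> \<le> r n" if "cball x \<delta> \<subseteq> \<Omega>" "s n < \<delta>" "n \<le> m" for x \<delta> n m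
    unfolding U_def r_def C_def \<gamma>_def
  proof (rule W1_kernel_oscillation[OF op bd, where T=\<delta>])
    show "cball (x + t *\<^sub>R 0) (1 * t) \<subseteq> \<Omega>" if "0 < t" "t \<le> \<delta>" for t
      using subset_cball[OF that(2), of x] \<open>cball x \<delta> \<subseteq> \<Omega>\<close> by simp
  qed (use that s u q in auto)
  define g where "g x = lim (\<lambda>n. U n x)" for x
  have bnd: "\<bar>U n x - g x\<bar> \<le> r n" if x: "cball x \<delta> \<subseteq> \<Omega>" "s n < \<delta>" for x \<delta> n
  proof -
    have sm: "s m < \<delta>" if "m \<ge> n" for m using s(2)[OF that] x(2) by linarith
    have "Cauchy (\<lambda>n. U n x)"
    proof (rule CauchyI)
      fix e :: real assume e: "e > 0"
      obtain N where N: "\<And>k. k \<ge> N \<Longrightarrow> \<bar>r k\<bar> < e / 2"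
        using rlim e unfolding LIMSEQ_def by (metis dist_0_norm dist_commute half_gt_zero real_norm_def)
      define M where "M = max N n"
      have "norm (U k x - U l x) < e" if "k \<ge> M" "l \<ge> M" for k l
      proof -
        have "\<bar>U M x - U k x\<bar> \<le> r M" "\<bar>U M x - U l x\<bar> \<le> r M"
          using that by (auto intro!: osc[OF x(1)] sm simp: M_def)
        then show ?thesis using N[of M] by (simp add: M_def)
      qed
      then show "\<exists>M. \<forall>m\<ge>M. \<forall>n\<ge>M. norm (U m x - U n x) < e" by blast
    qed
    then have "(\<lambda>m. U m x) \<longlonglongrightarrow> g x"
      unfolding g_def by (simp add: Cauchy_convergent_iff convergent_LIMSEQ_iff)
    then have "(\<lambda>m. \<bar>U n x - U m x\<bar>) \<longlonglongrightarrow> \<bar>U n x - g x\<bar>" by (intro tendsto_intros)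
    then show ?thesis
      by (rule LIMSEQ_le_const2) (use osc[OF x] in blast)
  qed
  have Ucont: "continuous_on T (U n)" for T n
  proof -
    obtain L where L: "L \<ge> 0" "\<And>x y. \<bar>U n x - U n y\<bar> \<le> (1 / s n) ^ (DIM('a) + 1) * L * norm (x - y) * (LINT z|lebesgue_on \<Omega>. \<bar>u z\<bar>)"
      using kernel_average_lipschitz[OF zero_less_one S s(1)[of n]] iu unfolding U_def by blast
    have "((1 / s n) ^ (DIM('a) + 1) * L * (LINT z|lebesgue_on \<Omega>. \<bar>u z\<bar>))-lipschitz_on T (U n)"
    proof (rule lipschitz_onI)
      show "dist (U n x) (U n y) \<le> (1 / s n) ^ (DIM('a) + 1) * L * (LINT z|lebesgue_on \<Omega>. \<bar>u z\<bar>) * dist x y" for x y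
        using L(2)[of x y] by (simp add: dist_norm mult_ac)
      show "0 \<le> (1 / s n) ^ (DIM('a) + 1) * L * (LINT z|lebesgue_on \<Omega>. \<bar>u z\<bar>)"
        using L(1) s(1)[of n] by (intro mult_nonneg_nonneg) auto
    qed
    then show ?thesis by (rule lipschitz_on_continuous_on)
  qed
  have gcont: "continuous_on \<Omega> g"
  proof (rule continuous_at_imp_continuous_on, rule ballI)
    fix x assume "x \<in> \<Omega>"
    then obtain d where d: "d > 0" "cball x d \<subseteq> \<Omega>" using op open_contains_cball by blast
    define \<delta> where "\<delta> = d / 2"
    have sub: "cball y \<delta> \<subseteq> \<Omega>" if "y \<in> ball x \<delta>" for y
    proof -
      have "cball y \<delta> \<subseteq> cball x d"
      proof
        fix z assume "z \<in> cball y \<delta>"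
        then show "z \<in> cball x d" using that dist_triangle[of x z y] by (simp add: \<delta>_def)
      qed
      then show ?thesis using d by blast
    qed
    have "uniform_limit (ball x \<delta>) U g sequentially"
    proof (rule uniform_limitI)
      fix e :: real assume e: "e > 0"
      have "\<forall>\<^sub>F n in sequentially. r n < e" using rlim e by (rule order_tendstoD)
      moreover have "\<forall>\<^sub>F n in sequentially. s n < \<delta>" using slim d by (intro order_tendstoD) (auto simp: \<delta>_def)
      ultimately show "\<forall>\<^sub>F n in sequentially. \<forall>y\<in>ball x \<delta>. dist (U n y) (g y) < e"
      proof eventually_elim
        case (elim n)
        then show ?case using bnd[OF sub elim(2)] by (force simp: dist_real_def)
      qed
    qed
    then have "continuous_on (ball x \<delta>) g"
      by (rule uniform_limit_theorem[rotated]) (auto intro: always_eventually Ucont)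
    then show "isCont g x"
      using d by (auto simp: continuous_on_eq_continuous_at \<delta>_def)
  qed
  have "AE x in lebesgue_on \<Omega>. g x / ?J - u x = 0"
  proof (rule test_orthogonal_imp_AE_zero[OF op])
    have fc: "continuous_on \<Omega> (\<lambda>x. g x / ?J)" using gcont J by (intro continuous_intros) auto
    note lig = continuous_on_locally_integrable[OF gcont]
    note lif = continuous_on_locally_integrable[OF fc]
    show "locally_integrable \<Omega> (\<lambda>x. g x / ?J - u x)"
      using locally_integrable_add[OF lif locally_integrable_scaleR[OF li, of "-1"]] by simp
    fix \<phi> assume \<phi>: "\<phi> \<in> test_functions \<Omega>"
    let ?K = "closure {x. \<phi> x \<noteq> 0}"
    have K: "compact ?K" "?K \<subseteq> \<Omega>" using \<phi> by (auto simp: test_functions_def)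
    obtain \<delta> where \<delta>: "\<delta> > 0" "(\<Union>x\<in>?K. cball x \<delta>) \<subseteq> \<Omega>"
      using compact_subset_open_imp_cball_epsilon_subset[OF K(1) op K(2)] by blast
    note tz = test_function_zero[OF \<phi>]
    have i\<phi>: "integrable (lebesgue_on \<Omega>) \<phi>"
      using integrable_times_test[OF op continuous_on_locally_integrable[OF continuous_on_const[of _ 1]] \<phi>] by simp
    have iU: "integrable (lebesgue_on \<Omega>) (\<lambda>x. U n x * \<phi> x)" for n
      by (rule integrable_times_test[OF op continuous_on_locally_integrable[OF Ucont] \<phi>])
    have ig: "integrable (lebesgue_on \<Omega>) (\<lambda>x. g x * \<phi> x)" by (rule integrable_times_test[OF op lig \<phi>])
    have est: "\<bar>(LINT x|lebesgue_on \<Omega>. U n x * \<phi> x) - (LINT x|lebesgue_on \<Omega>. g x * \<phi> x)\<bar> \<le> r n * (LINT x|lebesgue_on \<Omega>. \<bar>\<phi> x\<bar>)"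
      if n: "s n < \<delta>" for n
    proof -
      have "(LINT x|lebesgue_on \<Omega>. U n x * \<phi> x) - (LINT x|lebesgue_on \<Omega>. g x * \<phi> x) = (LINT x|lebesgue_on \<Omega>. U n x * \<phi> x - g x * \<phi> x)"
        using iU ig by simp
      also have "\<bar>\<dots>\<bar> \<le> (LINT x|lebesgue_on \<Omega>. \<bar>U n x * \<phi> x - g x * \<phi> x\<bar>)" by (rule integral_abs_bound)
      also have "\<dots> \<le> (LINT x|lebesgue_on \<Omega>. r n * \<bar>\<phi> x\<bar>)"
      proof (rule integral_mono)
        fix x
        show "\<bar>U n x * \<phi> x - g x * \<phi> x\<bar> \<le> r n * \<bar>\<phi> x\<bar>"
        proof (cases "x \<in> ?K")
          case True
          then have "\<bar>U n x - g x\<bar> \<le> r n" using \<delta>(2) by (intro bnd[OF _ n]) blast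
          then show ?thesis by (simp add: left_diff_distrib[symmetric] abs_mult mult_right_mono)
        next
          case False
          then show ?thesis using test_function_outside[OF \<phi> False] by simp
        qed
      qed (use iU ig i\<phi> in auto)
      finally show ?thesis by simp
    qed
    have "(\<lambda>n. (LINT x|lebesgue_on \<Omega>. U n x * \<phi> x) - (LINT x|lebesgue_on \<Omega>. g x * \<phi> x)) \<longlonglongrightarrow> 0"
    proof (rule Lim_null_comparison)
      have "\<forall>\<^sub>F n in sequentially. s n < \<delta>" using slim \<delta>(1) by (rule order_tendstoD)
      then show "\<forall>\<^sub>F n in sequentially. norm ((LINT x|lebesgue_on \<Omega>. U n x * \<phi> x) - (LINT x|lebesgue_on \<Omega>. g x * \<phi> x))
          \<le> r n * (LINT x|lebesgue_on \<Omega>. \<bar>\<phi> x\<bar>)"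
        by eventually_elim (use est in auto)
      show "(\<lambda>n. r n * (LINT x|lebesgue_on \<Omega>. \<bar>\<phi> x\<bar>)) \<longlonglongrightarrow> 0"
        using tendsto_mult_right[OF rlim] by simp
    qed
    then have l1: "(\<lambda>n. LINT x|lebesgue_on \<Omega>. U n x * \<phi> x) \<longlonglongrightarrow> (LINT x|lebesgue_on \<Omega>. g x * \<phi> x)"
      by (simp add: LIM_zero_iff)
    have "(LINT x|lebesgue. U n x * \<phi> x) = (LINT x|lebesgue_on \<Omega>. U n x * \<phi> x)" for n
      by (rule integral_lebesgue_on_eq[OF op, symmetric]) (simp add: tz)
    then have l2: "(\<lambda>n. LINT x|lebesgue_on \<Omega>. U n x * \<phi> x) \<longlonglongrightarrow> ?J * (LINT x|lebesgue_on \<Omega>. u x * \<phi> x)"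
      using mollified_pairing_tendsto[OF op iu \<phi> s(1) slim] unfolding U_def by simp
    have "(LINT x|lebesgue_on \<Omega>. g x * \<phi> x) = ?J * (LINT x|lebesgue_on \<Omega>. u x * \<phi> x)"
      by (rule LIMSEQ_unique[OF l1 l2])
    then show "(LINT x|lebesgue_on \<Omega>. (g x / ?J - u x) * \<phi> x) = 0"
      using ig integrable_times_test[OF op li \<phi>] J by (simp add: left_diff_distrib)
  qed
  then have "AE x in lebesgue_on \<Omega>. g x / ?J = u x" by eventually_elim simp
  moreover have "continuous_on \<Omega> (\<lambda>x. g x / ?J)" using gcont J by (intro continuous_intros) auto
  ultimately show ?thesis by blast
qed

lemma continuous_AE_eq_imp_eq:
  fixes f g :: "'a::euclidean_space \<Rightarrow> real"
  assumes op: "open \<Omega>" and f: "continuous_on (closure \<Omega>) f" and g: "continuous_on (closure \<Omega>) g"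
    and ae: "AE x in lebesgue_on \<Omega>. f x = g x" and x: "x \<in> closure \<Omega>"
  shows "f x = g x"
proof -
  have S: "\<Omega> \<in> sets lebesgue" using op by auto
  have fO: "continuous_on \<Omega> (\<lambda>x. f x - g x)"
    using continuous_on_subset[OF f closure_subset] continuous_on_subset[OF g closure_subset] by (intro continuous_intros)
  have "f y - g y = 0" if y: "y \<in> \<Omega>" for y
  proof (rule ccontr)
    assume ne: "f y - g y \<noteq> 0"
    obtain \<delta> where \<delta>: "\<delta> > 0" "cball y \<delta> \<subseteq> \<Omega>" "\<And>z. z \<in> cball y \<delta> \<Longrightarrow> \<bar>(f z - g z) - (f y - g y)\<bar> \<le> \<bar>f y - g y\<bar> / 2"
      using continuous_on_near[OF op fO y, of "\<bar>f y - g y\<bar> / 2"] ne by auto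
    have "AE x in lebesgue. x \<in> \<Omega> \<longrightarrow> f x = g x"
      using ae S by (subst (asm) AE_restrict_space_iff) auto
    then have "AE x in lebesgue. x \<notin> cball y \<delta>"
    proof eventually_elim
      case (elim z)
      show ?case
      proof
        assume z: "z \<in> cball y \<delta>"
        then have "f z = g z" using elim \<delta>(2) by blast
        then show False using \<delta>(3)[OF z] ne abs_minus_commute[of "f y" "g y"] by simp
      qed
    qed
    then have "cball y \<delta> \<in> null_sets lebesgue"
      by (subst completion.null_sets_iff_AE) auto
    then have "negligible (cball y \<delta>)" by (simp add: negligible_iff_null_sets)
    then have "negligible (ball y \<delta>)" by (rule negligible_subset) (rule ball_subset_cball)
    then show False using open_not_negligible[OF open_ball, of y \<delta>] \<delta>(1) by simp
  qed
  then have "\<forall>y\<in>\<Omega>. norm (f y - g y) \<le> 0" by simp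
  from continuous_on_closure_norm_le[OF continuous_on_diff[OF f g] this x] show ?thesis by simp
qed

text \<open>The representative in \<open>\<Omega>\<close> is uniformly continuous by the equicontinuity estimate for a single function, and therefore extends
  to the closure.\<close>
lemma W1_has_continuous_representative:
  fixes \<Omega> :: "'a::euclidean_space set"
  assumes op: "open \<Omega>" and bd: "bounded \<Omega>" and sb: "smooth_boundary \<Omega>" and q: "q > real DIM('a)" and u: "u \<in> W1 \<Omega> q"
  shows "\<exists>f. continuous_on (closure \<Omega>) f \<and> (AE x in lebesgue_on \<Omega>. f x = u x)"
proof -
  obtain f where f: "continuous_on \<Omega> f" "AE x in lebesgue_on \<Omega>. f x = u x"
    using W1_continuous_inside[OF op bd q u] by blast
  have "uniformly_continuous_on \<Omega> f"
    unfolding uniformly_continuous_on_def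
  proof (intro allI impI)
    fix e :: real assume e: "e > 0"
    obtain \<delta> where \<delta>: "\<delta> > 0" "\<And>x y. x \<in> \<Omega> \<Longrightarrow> y \<in> \<Omega> \<Longrightarrow> dist x y < \<delta> \<Longrightarrow> \<bar>f x - f y\<bar> \<le> e / 2"
      using W1_equicontinuous_inside[OF op bd sb q half_gt_zero[OF e] energy_bounds(3)[of \<Omega> q u]] u f by blast
    then show "\<exists>d>0. \<forall>x\<in>\<Omega>. \<forall>x'\<in>\<Omega>. dist x' x < d \<longrightarrow> dist (f x') (f x) < e"
    proof (intro exI[of _ \<delta>] conjI ballI impI \<delta>(1))
      fix x x' assume "x \<in> \<Omega>" "x' \<in> \<Omega>" "dist x' x < \<delta>"
      from \<delta>(2)[OF this(2,1,3)] e show "dist (f x') (f x) < e" unfolding dist_real_def by linarith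
    qed
  qed
  then obtain g where g: "uniformly_continuous_on (closure \<Omega>) g" "\<And>x. x \<in> \<Omega> \<Longrightarrow> f x = g x"
    using uniformly_continuous_on_extension_on_closure[of \<Omega> f] by metis
  have "AE x in lebesgue_on \<Omega>. g x = u x"
  proof -
    have "AE x in lebesgue_on \<Omega>. x \<in> \<Omega>" by (rule AE_I2) simp
    with f(2) show ?thesis by eventually_elim (use g(2) in auto)
  qed
  then show ?thesis using uniformly_continuous_imp_continuous[OF g(1)] by blast
qed

lemma cont_rep:
  fixes \<Omega> :: "'a::euclidean_space set"
  assumes op: "open \<Omega>" and bd: "bounded \<Omega>" and sb: "smooth_boundary \<Omega>" and q: "q > real DIM('a)" and u: "u \<in> W1 \<Omega> q"
  shows "continuous_on (closure \<Omega>) (cont_rep \<Omega> u)" "AE x in lebesgue_on \<Omega>. cont_rep \<Omega> u x = u x"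
  using someI_ex[OF W1_has_continuous_representative[OF assms]] unfolding cont_rep_def by auto

lemma cont_rep_unique:
  fixes \<Omega> :: "'a::euclidean_space set"
  assumes op: "open \<Omega>" and f: "continuous_on (closure \<Omega>) f" "AE x in lebesgue_on \<Omega>. f x = u x" and x: "x \<in> closure \<Omega>"
  shows "cont_rep \<Omega> u x = f x"
proof -
  have "continuous_on (closure \<Omega>) (cont_rep \<Omega> u) \<and> (AE x in lebesgue_on \<Omega>. cont_rep \<Omega> u x = u x)"
    unfolding cont_rep_def by (rule someI[of _ f]) (use f in simp)
  then have c: "continuous_on (closure \<Omega>) (cont_rep \<Omega> u)" and a: "AE x in lebesgue_on \<Omega>. cont_rep \<Omega> u x = u x" by auto
  have "AE x in lebesgue_on \<Omega>. cont_rep \<Omega> u x = f x" using a f(2) by eventually_elim simp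
  then show ?thesis by (rule continuous_AE_eq_imp_eq[OF op c f(1) _ x])
qed

lemma W1_equicontinuous:
  fixes \<Omega> :: "'a::euclidean_space set"
  assumes op: "open \<Omega>" and bd: "bounded \<Omega>" and sb: "smooth_boundary \<Omega>" and q: "q > real DIM('a)" and \<epsilon>: "\<epsilon> > 0" and B: "B \<ge> 0"
  shows "\<exists>\<delta>>0. \<forall>u. u \<in> W1 \<Omega> q \<longrightarrow> energy \<Omega> q u \<le> B \<longrightarrow>
    (\<forall>x\<in>closure \<Omega>. \<forall>y\<in>closure \<Omega>. dist x y < \<delta> \<longrightarrow> \<bar>cont_rep \<Omega> u x - cont_rep \<Omega> u y\<bar> \<le> \<epsilon>)"
proof -
  obtain \<delta> where \<delta>: "\<delta> > 0" "\<And>u f x y. u \<in> W1 \<Omega> q \<Longrightarrow> energy \<Omega> q u \<le> B \<Longrightarrow> continuous_on \<Omega> f \<Longrightarrow> (AE z in lebesgue_on \<Omega>. f z = u z) \<Longrightarrow>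
     x \<in> \<Omega> \<Longrightarrow> y \<in> \<Omega> \<Longrightarrow> dist x y < \<delta> \<Longrightarrow> \<bar>f x - f y\<bar> \<le> \<epsilon>"
    using W1_equicontinuous_inside[OF op bd sb q \<epsilon> B] by blast
  have "\<bar>cont_rep \<Omega> u x - cont_rep \<Omega> u y\<bar> \<le> \<epsilon>"
    if u: "u \<in> W1 \<Omega> q" "energy \<Omega> q u \<le> B" and xy: "x \<in> closure \<Omega>" "y \<in> closure \<Omega>" "dist x y < \<delta>" for u x y
  proof -
    note c = cont_rep[OF op bd sb q u(1)]
    obtain X where X: "\<And>n. X n \<in> \<Omega>" "X \<longlonglongrightarrow> x" using xy(1) closure_sequential by metis
    obtain Y where Y: "\<And>n. Y n \<in> \<Omega>" "Y \<longlonglongrightarrow> y" using xy(2) closure_sequential by metis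
    have "(\<lambda>n. cont_rep \<Omega> u (X n)) \<longlonglongrightarrow> cont_rep \<Omega> u x"
      using continuous_on_tendsto_compose[OF c(1) X(2) xy(1)] X(1) closure_subset by (auto intro: always_eventually)
    moreover have "(\<lambda>n. cont_rep \<Omega> u (Y n)) \<longlonglongrightarrow> cont_rep \<Omega> u y"
      using continuous_on_tendsto_compose[OF c(1) Y(2) xy(2)] Y(1) closure_subset by (auto intro: always_eventually)
    ultimately have l: "(\<lambda>n. \<bar>cont_rep \<Omega> u (X n) - cont_rep \<Omega> u (Y n)\<bar>) \<longlonglongrightarrow> \<bar>cont_rep \<Omega> u x - cont_rep \<Omega> u y\<bar>"
      by (intro tendsto_intros)
    have "\<forall>\<^sub>F n in sequentially. dist (X n) (Y n) < \<delta>"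
      using tendsto_dist[OF X(2) Y(2)] xy(3) by (rule order_tendstoD)
    then have "\<forall>\<^sub>F n in sequentially. \<bar>cont_rep \<Omega> u (X n) - cont_rep \<Omega> u (Y n)\<bar> \<le> \<epsilon>"
      by eventually_elim (rule \<delta>(2)[OF u continuous_on_subset[OF c(1) closure_subset] c(2) X(1) Y(1)])
    with l show ?thesis by (rule tendsto_upperbound) simp
  qed
  then show ?thesis using \<delta>(1) by blast
qed

lemma W1_bounded:
  fixes \<Omega> :: "'a::euclidean_space set"
  assumes op: "open \<Omega>" and bd: "bounded \<Omega>" and sb: "smooth_boundary \<Omega>" and q: "q > real DIM('a)" and B: "B \<ge> 0"
  shows "\<exists>C. \<forall>u. u \<in> W1 \<Omega> q \<longrightarrow> energy \<Omega> q u \<le> B \<longrightarrow> (\<forall>x\<in>closure \<Omega>. \<bar>cont_rep \<Omega> u x\<bar> \<le> C)"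
proof -
  obtain C where C: "\<And>u f x. u \<in> W1 \<Omega> q \<Longrightarrow> energy \<Omega> q u \<le> B \<Longrightarrow> continuous_on \<Omega> f \<Longrightarrow> (AE z in lebesgue_on \<Omega>. f z = u z) \<Longrightarrow>
     x \<in> \<Omega> \<Longrightarrow> \<bar>f x\<bar> \<le> C"
    using W1_bounded_inside[OF op bd sb q B] by blast
  have "\<bar>cont_rep \<Omega> u x\<bar> \<le> C" if u: "u \<in> W1 \<Omega> q" "energy \<Omega> q u \<le> B" and x: "x \<in> closure \<Omega>" for u x
  proof -
    note c = cont_rep[OF op bd sb q u(1)]
    have "\<forall>y\<in>\<Omega>. norm (cont_rep \<Omega> u y) \<le> C"
      using C[OF u continuous_on_subset[OF c(1) closure_subset] c(2)] by simp
    from continuous_on_closure_norm_le[OF c(1) this x] show ?thesis by simp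
  qed
  then show ?thesis by blast
qed

section \<open>Signed measures\<close>

lemma signed_radon_empty:
  fixes K :: "'a::euclidean_space set"
  assumes "signed_radon K \<alpha>" shows "\<alpha> {} = 0"
proof -
  have "range (\<lambda>n::nat. {}) \<subseteq> borel_subsets K \<and> disjoint_family (\<lambda>n::nat. {} :: 'a set)"
    by (auto simp: disjoint_family_on_def)
  from assms[unfolded signed_radon_def, rule_format, OF this]
  have "summable (\<lambda>n::nat. \<alpha> {})" by (rule sums_summable)
  then show ?thesis by (simp add: summable_const_iff)
qed

lemma signed_radon_Un:
  assumes s: "signed_radon K \<alpha>" and A: "A \<in> borel_subsets K" "B \<in> borel_subsets K" "A \<inter> B = {}"
  shows "\<alpha> (A \<union> B) = \<alpha> A + \<alpha> B"
proof -
  have "range (binaryset A B) \<subseteq> borel_subsets K" using A by (auto simp: binaryset_def)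
  moreover have "disjoint_family (binaryset A B)" using A by (auto simp: disjoint_family_on_def binaryset_def)
  ultimately have "(\<lambda>n. \<alpha> (binaryset A B n)) sums \<alpha> (\<Union>n. binaryset A B n)"
    using s unfolding signed_radon_def by blast
  moreover have "(\<lambda>n. \<alpha> (binaryset A B n)) sums (\<alpha> A + \<alpha> B)"
    by (rule binaryset_sums) (rule signed_radon_empty[OF s])
  ultimately show ?thesis using sums_unique2 by (metis UN_binaryset_eq)
qed

lemma signed_radon_Diff:
  assumes s: "signed_radon K \<alpha>" and A: "A \<in> borel_subsets K" "B \<in> borel_subsets K" "B \<subseteq> A"
  shows "\<alpha> (A - B) = \<alpha> A - \<alpha> B"
proof -
  have "\<alpha> ((A - B) \<union> B) = \<alpha> (A - B) + \<alpha> B"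
    by (rule signed_radon_Un[OF s]) (use A in auto)
  moreover have "(A - B) \<union> B = A" using A by blast
  ultimately show ?thesis by simp
qed

lemma signed_radon_uminus: "signed_radon K \<alpha> \<Longrightarrow> signed_radon K (\<lambda>B. - \<alpha> B)"
  unfolding signed_radon_def by (auto intro: sums_minus)

text \<open>If the values were unbounded on the subsets of \<open>E\<close>, then \<open>E\<close> could be split in two parts such that \<open>\<alpha>\<close> is
  larger than \<open>1\<close> in absolute value on one of them and unbounded on the other. Repeating this produces a
  disjoint sequence on which the values of \<open>\<alpha>\<close> do not tend to \<open>0\<close>, against countable additivity.\<close>
lemma signed_radon_bounded:
  assumes s: "signed_radon K \<alpha>"
  shows "\<exists>M. \<forall>B\<in>borel_subsets K. \<bar>\<alpha> B\<bar> \<le> M"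
proof (rule ccontr)
  define unb where "unb E \<longleftrightarrow> (\<forall>M. \<exists>C\<in>borel_subsets K. C \<subseteq> E \<and> \<bar>\<alpha> C\<bar> > M)" for E
  assume "\<not> ?thesis"
  then have uK: "unb K" unfolding unb_def
    using sets.sets_into_space[of _ "restrict_space borel K"] by (force simp: space_restrict_space not_le)
  have Km: "K \<in> borel_subsets K" using sets.top[of "restrict_space borel K"] by (simp add: space_restrict_space)
  have step: "\<exists>E'. (E' \<in> borel_subsets K \<and> unb E') \<and> E' \<subseteq> E \<and> \<bar>\<alpha> (E - E')\<bar> > 1" if E: "E \<in> borel_subsets K \<and> unb E" for E
  proof -
    obtain A where A: "A \<in> borel_subsets K" "A \<subseteq> E" "\<bar>\<alpha> A\<bar> > 1 + \<bar>\<alpha> E\<bar>"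
      using E unfolding unb_def by blast
    have EA: "E - A \<in> borel_subsets K" using A E by auto
    have d: "\<alpha> (E - A) = \<alpha> E - \<alpha> A" using signed_radon_Diff[OF s _ A(1,2)] E by blast
    have "unb A \<or> unb (E - A)"
    proof (rule ccontr)
      assume "\<not> ?thesis"
      then obtain M1 M2 where M: "\<And>C. C \<in> borel_subsets K \<Longrightarrow> C \<subseteq> A \<Longrightarrow> \<bar>\<alpha> C\<bar> \<le> M1"
         "\<And>C. C \<in> borel_subsets K \<Longrightarrow> C \<subseteq> E - A \<Longrightarrow> \<bar>\<alpha> C\<bar> \<le> M2"
        unfolding unb_def by (meson not_le)
      obtain C where C: "C \<in> borel_subsets K" "C \<subseteq> E" "\<bar>\<alpha> C\<bar> > M1 + M2" using E unfolding unb_def by blast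
      have "\<alpha> C = \<alpha> ((C \<inter> A) \<union> (C - A))" by (simp add: Int_Diff_Un)
      also have "\<dots> = \<alpha> (C \<inter> A) + \<alpha> (C - A)"
        by (rule signed_radon_Un[OF s]) (use A C in auto)
      finally have "\<bar>\<alpha> C\<bar> \<le> M1 + M2"
        using M(1)[of "C \<inter> A"] M(2)[of "C - A"] A C by (smt (verit) Diff_mono Int_lower2 order_refl sets.Diff sets.Int)
      then show False using C by simp
    qed
    then show ?thesis
    proof
      assume "unb A"
      then show ?thesis using A d by (intro exI[of _ A]) auto
    next
      assume "unb (E - A)"
      moreover have "E - (E - A) = A" using A by blast
      ultimately show ?thesis using A EA by (intro exI[of _ "E - A"]) auto
    qed
  qed
  have "\<exists>E. \<forall>n. (E n \<in> borel_subsets K \<and> unb (E n)) \<and> (E (Suc n) \<subseteq> E n \<and> \<bar>\<alpha> (E n - E (Suc n))\<bar> > 1)"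
    using step Km uK by (intro dependent_nat_choice) auto
  then obtain E where E: "\<And>n. E n \<in> borel_subsets K" "\<And>n. E (Suc n) \<subseteq> E n" "\<And>n. \<bar>\<alpha> (E n - E (Suc n))\<bar> > 1"
    by blast
  have dec: "E m \<subseteq> E n" if "n \<le> m" for m n using E(2) that by (rule lift_Suc_antimono_le)
  have "disjoint_family (\<lambda>n. E n - E (Suc n))"
    unfolding disjoint_family_on_def
  proof (intro ballI impI)
    fix m n :: nat assume "m \<noteq> n"
    then have "Suc m \<le> n \<or> Suc n \<le> m" by auto
    then show "(E m - E (Suc m)) \<inter> (E n - E (Suc n)) = {}" using dec by blast
  qed
  moreover have "range (\<lambda>n. E n - E (Suc n)) \<subseteq> borel_subsets K" using E(1) by auto
  ultimately have "(\<lambda>n. \<alpha> (E n - E (Suc n))) sums \<alpha> (\<Union>n. E n - E (Suc n))"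
    using s unfolding signed_radon_def by blast
  then have "(\<lambda>n. \<alpha> (E n - E (Suc n))) \<longlonglongrightarrow> 0" by (intro summable_LIMSEQ_zero sums_summable)
  then have "\<exists>n. \<bar>\<alpha> (E n - E (Suc n))\<bar> < 1" unfolding LIMSEQ_def by (metis dist_0_norm dist_commute real_norm_def order_refl zero_less_one)
  then show False using E(3) by (meson not_less_iff_gr_or_eq)
qed

lemma ennreal_sums_le:
  assumes "x sums a" shows "ennreal a \<le> (\<Sum>n. ennreal (x n))"
proof -
  have "(\<lambda>N. ennreal (\<Sum>n<N. x n)) \<longlonglongrightarrow> ennreal a"
    using assms unfolding sums_def by (rule tendsto_ennrealI)
  moreover have "ennreal (\<Sum>n<N. x n) \<le> (\<Sum>n. ennreal (x n))" for N
  proof -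
    have "ennreal (\<Sum>n<N. x n) \<le> ennreal (\<Sum>n<N. max 0 (x n))" by (intro ennreal_leI sum_mono) auto
    also have "\<dots> = (\<Sum>n<N. ennreal (max 0 (x n)))" by (intro sum_ennreal[symmetric]) auto
    also have "\<dots> = (\<Sum>n<N. ennreal (x n))" by (simp add: ennreal_max_0)
    also have "\<dots> \<le> (\<Sum>n. ennreal (x n))" by (rule sum_le_suminf) auto
    finally show ?thesis .
  qed
  ultimately show ?thesis by (intro LIMSEQ_le_const2) auto
qed

lemma sets_pos_part: "sets (pos_part K \<alpha>) = borel_subsets K"
proof -
  have sub: "borel_subsets K \<subseteq> Pow K" using sets.space_closed[of "restrict_space borel K"] by (simp add: space_restrict_space)
  have "sigma_sets K (borel_subsets K) = borel_subsets K"
    using sets.sigma_sets_eq[of "restrict_space borel K"] by (simp add: space_restrict_space)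
  then show ?thesis unfolding pos_part_def by (simp add: sets_measure_of[OF sub])
qed

lemma emeasure_pos_part:
  assumes s: "signed_radon K \<alpha>" and B: "B \<in> borel_subsets K"
  shows "emeasure (pos_part K \<alpha>) B = (SUP C\<in>{C \<in> borel_subsets K. C \<subseteq> B}. ennreal (\<alpha> C))"
proof -
  let ?\<mu> = "\<lambda>B. SUP C\<in>{C \<in> borel_subsets K. C \<subseteq> B}. ennreal (\<alpha> C)"
  have up: "ennreal (\<alpha> C) \<le> ?\<mu> B" if "C \<in> borel_subsets K" "C \<subseteq> B" for C B
    using that by (intro SUP_upper) auto
  have sub: "borel_subsets K \<subseteq> Pow K" using sets.space_closed[of "restrict_space borel K"] by (simp add: space_restrict_space)
  have e0: "\<alpha> {} = 0" by (rule signed_radon_empty[OF s])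
  have pos: "positive (borel_subsets K) ?\<mu>"
    unfolding positive_def by (auto simp: e0 intro!: SUP_eq_const)
  have add: "?\<mu> A + ?\<mu> B \<le> ?\<mu> (A \<union> B)" if AB: "A \<in> borel_subsets K" "B \<in> borel_subsets K" "A \<inter> B = {}" for A B
  proof -
    have 1: "ennreal (\<alpha> C) + ennreal (\<alpha> D) \<le> ?\<mu> (A \<union> B)"
      if C: "C \<in> borel_subsets K" "C \<subseteq> A" and D: "D \<in> borel_subsets K" "D \<subseteq> B" for C D
    proof -
      have CD: "\<alpha> (C \<union> D) = \<alpha> C + \<alpha> D" by (rule signed_radon_Un[OF s C(1) D(1)]) (use C D AB in auto)
      consider "\<alpha> C < 0" | "\<alpha> D < 0" | "\<alpha> C \<ge> 0" "\<alpha> D \<ge> 0" by linarith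
      then show ?thesis
      proof cases
        case 1
        then show ?thesis using up[of D "A \<union> B"] D by (simp add: ennreal_neg sup.coboundedI2)
      next
        case 2
        then show ?thesis using up[of C "A \<union> B"] C by (simp add: ennreal_neg sup.coboundedI1)
      next
        case 3
        then have "ennreal (\<alpha> C) + ennreal (\<alpha> D) = ennreal (\<alpha> (C \<union> D))" by (simp add: CD ennreal_plus)
        also have "\<dots> \<le> ?\<mu> (A \<union> B)" by (rule up) (use C D in auto)
        finally show ?thesis .
      qed
    qed
    have ne: "{C \<in> borel_subsets K. C \<subseteq> X} \<noteq> {}" for X by auto
    have "?\<mu> A + ?\<mu> B = (SUP C\<in>{C \<in> borel_subsets K. C \<subseteq> A}. ennreal (\<alpha> C) + ?\<mu> B)"
      by (rule ennreal_SUP_add_left[OF ne, symmetric])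
    also have "\<dots> = (SUP C\<in>{C \<in> borel_subsets K. C \<subseteq> A}. SUP D\<in>{C \<in> borel_subsets K. C \<subseteq> B}. ennreal (\<alpha> C) + ennreal (\<alpha> D))"
      by (intro SUP_cong refl ennreal_SUP_add_right[OF ne])
    also have "\<dots> \<le> ?\<mu> (A \<union> B)"
      by (intro SUP_least) (use 1 in blast)
    finally show ?thesis .
  qed
  have ca: "countably_additive (borel_subsets K) ?\<mu>"
    unfolding countably_additive_def
  proof (intro allI impI antisym)
    fix A :: "nat \<Rightarrow> 'a set" assume A: "range A \<subseteq> borel_subsets K" "disjoint_family A" "(\<Union>n. A n) \<in> borel_subsets K"
    have Am: "A n \<in> borel_subsets K" for n using A by auto
    have fin: "(\<Sum>n<N. ?\<mu> (A n)) \<le> ?\<mu> (\<Union>n<N. A n)" for N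
    proof (induction N)
      case (Suc N)
      have "(\<Sum>n<Suc N. ?\<mu> (A n)) \<le> ?\<mu> (\<Union>n<N. A n) + ?\<mu> (A N)" using Suc by (simp add: add_right_mono)
      also have "\<dots> \<le> ?\<mu> ((\<Union>n<N. A n) \<union> A N)"
      proof (rule add)
        show "(\<Union>n<N. A n) \<in> borel_subsets K" using Am by auto
        have "A n \<inter> A N = {}" if "n < N" for n
          using disjoint_family_onD[OF A(2), of n N] that by simp
        then show "(\<Union>n<N. A n) \<inter> A N = {}" by auto
      qed (rule Am)
      also have "(\<Union>n<N. A n) \<union> A N = (\<Union>n<Suc N. A n)" by (auto simp: lessThan_Suc)
      finally show ?case .
    qed simp
    show "(\<Sum>n. ?\<mu> (A n)) \<le> ?\<mu> (\<Union>n. A n)"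
    proof (rule suminf_le_const)
      fix N
      have "?\<mu> (\<Union>n<N. A n) \<le> ?\<mu> (\<Union>n. A n)" by (intro SUP_subset_mono) auto
      then show "(\<Sum>n<N. ?\<mu> (A n)) \<le> ?\<mu> (\<Union>n. A n)" using fin[of N] by (rule order_trans[rotated])
    qed auto
    show "?\<mu> (\<Union>n. A n) \<le> (\<Sum>n. ?\<mu> (A n))"
    proof (rule SUP_least)
      fix C assume C: "C \<in> {C \<in> borel_subsets K. C \<subseteq> (\<Union>n. A n)}"
      have "range (\<lambda>n. C \<inter> A n) \<subseteq> borel_subsets K" using C Am by auto
      moreover have "disjoint_family (\<lambda>n. C \<inter> A n)" using A(2) by (auto simp: disjoint_family_on_def)
      ultimately have "(\<lambda>n. \<alpha> (C \<inter> A n)) sums \<alpha> (\<Union>n. C \<inter> A n)" using s unfolding signed_radon_def by blast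
      moreover have "(\<Union>n. C \<inter> A n) = C" using C by auto
      ultimately have "ennreal (\<alpha> C) \<le> (\<Sum>n. ennreal (\<alpha> (C \<inter> A n)))" using ennreal_sums_le by metis
      also have "\<dots> \<le> (\<Sum>n. ?\<mu> (A n))" by (intro suminf_le up) (use C Am in auto)
      finally show "ennreal (\<alpha> C) \<le> (\<Sum>n. ?\<mu> (A n))" .
    qed
  qed
  show ?thesis
    by (rule emeasure_measure_of[OF pos_part_def sub]) (use pos ca B in \<open>simp_all only: sets_pos_part\<close>)
qed

lemma pos_part_facts:
  assumes s: "signed_radon K \<alpha>"
  shows "finite_measure (pos_part K \<alpha>)"
    and "B \<in> borel_subsets K \<Longrightarrow> C \<in> borel_subsets K \<Longrightarrow> C \<subseteq> B \<Longrightarrow> \<alpha> C \<le> measure (pos_part K \<alpha>) B"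
    and "B \<in> borel_subsets K \<Longrightarrow> (\<And>C. C \<in> borel_subsets K \<Longrightarrow> C \<subseteq> B \<Longrightarrow> \<alpha> C \<le> x) \<Longrightarrow> measure (pos_part K \<alpha>) B \<le> x"
proof -
  have sp: "space (pos_part K \<alpha>) = K"
    using sets_eq_imp_space_eq[OF sets_pos_part[of K \<alpha>]] by (simp add: space_restrict_space)
  have Km: "K \<in> borel_subsets K" using sets.top[of "restrict_space borel K"] by (simp add: space_restrict_space)
  obtain M where M: "\<And>B. B \<in> borel_subsets K \<Longrightarrow> \<bar>\<alpha> B\<bar> \<le> M" using signed_radon_bounded[OF s] by blast
  have "emeasure (pos_part K \<alpha>) K \<le> ennreal M"
    unfolding emeasure_pos_part[OF s Km] by (intro SUP_least ennreal_leI) (use M abs_le_D1 in blast)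
  then show fin: "finite_measure (pos_part K \<alpha>)"
    by (intro finite_measureI) (auto simp: sp top_unique)
  interpret finite_measure "pos_part K \<alpha>" by (rule fin)
  show "\<alpha> C \<le> measure (pos_part K \<alpha>) B" if "B \<in> borel_subsets K" "C \<in> borel_subsets K" "C \<subseteq> B"
  proof -
    have "ennreal (\<alpha> C) \<le> emeasure (pos_part K \<alpha>) B"
      unfolding emeasure_pos_part[OF s that(1)] using that by (intro SUP_upper) auto
    then show ?thesis by (simp add: emeasure_eq_measure)
  qed
  show "measure (pos_part K \<alpha>) B \<le> x" if B: "B \<in> borel_subsets K" and x: "\<And>C. C \<in> borel_subsets K \<Longrightarrow> C \<subseteq> B \<Longrightarrow> \<alpha> C \<le> x"
  proof -
    have "0 \<le> x" using x[of "{}"] by (simp add: signed_radon_empty[OF s])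
    have "emeasure (pos_part K \<alpha>) B \<le> ennreal x"
      unfolding emeasure_pos_part[OF s B] by (intro SUP_least ennreal_leI) (use x in blast)
    then show ?thesis using \<open>0 \<le> x\<close> by (simp add: emeasure_eq_measure)
  qed
qed

text \<open>For \<open>C \<subseteq> B\<close> one has \<open>\<alpha> C = \<alpha> B - \<alpha> (B - C)\<close>, and the second term is at most the negative variation of \<open>B\<close>. Taking the supremum over \<open>C\<close>
  gives one inequality, and the other is the same for \<open>- \<alpha>\<close>.\<close>
lemma jordan_decomposition:
  assumes s: "signed_radon K \<alpha>" and B: "B \<in> borel_subsets K"
  shows "\<alpha> B = measure (pos_part K \<alpha>) B - measure (pos_part K (\<lambda>B. - \<alpha> B)) B"
proof -
  have half: "measure (pos_part K \<alpha>) B \<le> \<alpha> B + measure (pos_part K (\<lambda>B. - \<alpha> B)) B" if s: "signed_radon K \<alpha>" for \<alpha>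
  proof (rule pos_part_facts(3)[OF s B])
    fix C assume C: "C \<in> borel_subsets K" "C \<subseteq> B"
    have "- \<alpha> (B - C) \<le> measure (pos_part K (\<lambda>B. - \<alpha> B)) B"
      using pos_part_facts(2)[OF signed_radon_uminus[OF s] B, of "B - C"] B C by auto
    then show "\<alpha> C \<le> \<alpha> B + measure (pos_part K (\<lambda>B. - \<alpha> B)) B"
      using signed_radon_Diff[OF s B C] by simp
  qed
  show ?thesis using half[OF s] half[OF signed_radon_uminus[OF s]] by simp
qed

lemma signed_radon_diff_measures:
  assumes "finite_measure P" "finite_measure Q" "sets P = borel_subsets K" "sets Q = borel_subsets K"
  shows "signed_radon K (\<lambda>B. measure P B - measure Q B)"
  unfolding signed_radon_def
proof (intro allI impI sums_diff)
  fix A :: "nat \<Rightarrow> 'a set" assume A: "range A \<subseteq> borel_subsets K \<and> disjoint_family A"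
  show "(\<lambda>n. measure P (A n)) sums measure P (\<Union>n. A n)"
    using A assms by (intro finite_measure.finite_measure_UNION) auto
  show "(\<lambda>n. measure Q (A n)) sums measure Q (\<Union>n. A n)"
    using A assms by (intro finite_measure.finite_measure_UNION) auto
qed

lemma nn_integral_add_cong:
  assumes se: "sets M1 = sets N" "sets M2 = sets N" "sets M3 = sets N" "sets M4 = sets N"
    and eq: "\<And>B. B \<in> sets N \<Longrightarrow> emeasure M1 B + emeasure M2 B = emeasure M3 B + emeasure M4 B"
    and f: "f \<in> borel_measurable N"
  shows "(\<integral>\<^sup>+x. f x \<partial>M1) + (\<integral>\<^sup>+x. f x \<partial>M2) = (\<integral>\<^sup>+x. f x \<partial>M3) + (\<integral>\<^sup>+x. f x \<partial>M4)"
proof -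
  have m: "g \<in> borel_measurable M1" "g \<in> borel_measurable M2" "g \<in> borel_measurable M3" "g \<in> borel_measurable M4"
    if "g \<in> borel_measurable N" for g :: "'a \<Rightarrow> ennreal"
    using that se by (simp_all cong: measurable_cong_sets)
  show ?thesis
    using f
  proof (induction rule: borel_measurable_induct)
    case (cong f g)
    have "(\<integral>\<^sup>+x. f x \<partial>M) = (\<integral>\<^sup>+x. g x \<partial>M)" if "sets M = sets N" for M
      using cong(3) sets_eq_imp_space_eq[OF that] by (intro nn_integral_cong) auto
    then show ?case using cong(4) se by simp
  next
    case (set A)
    then show ?case using eq[of A] se by simp
  next
    case (mult u c)
    then show ?case
      using m[OF mult(2)] by (simp only: nn_integral_cmult distrib_left[symmetric])
  next
    case (add u v)
    have "(\<integral>\<^sup>+x. v x + u x \<partial>M1) + (\<integral>\<^sup>+x. v x + u x \<partial>M2) =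
      ((\<integral>\<^sup>+x. u x \<partial>M1) + (\<integral>\<^sup>+x. u x \<partial>M2)) + ((\<integral>\<^sup>+x. v x \<partial>M1) + (\<integral>\<^sup>+x. v x \<partial>M2))"
      using m[OF add(1)] m[OF add(3)] by (simp only: nn_integral_add add_ac)
    also have "\<dots> = ((\<integral>\<^sup>+x. u x \<partial>M3) + (\<integral>\<^sup>+x. u x \<partial>M4)) + ((\<integral>\<^sup>+x. v x \<partial>M3) + (\<integral>\<^sup>+x. v x \<partial>M4))"
      by (simp only: add.IH)
    also have "\<dots> = (\<integral>\<^sup>+x. v x + u x \<partial>M3) + (\<integral>\<^sup>+x. v x + u x \<partial>M4)"
      using m[OF add(1)] m[OF add(3)] by (simp only: nn_integral_add add_ac)
    finally show ?case .
  next
    case (seq U)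
    have inc: "incseq (\<lambda>i. \<integral>\<^sup>+x. U i x \<partial>M)" for M
      using seq(3) by (auto simp: incseq_def le_fun_def intro!: nn_integral_mono)
    have sup: "(\<integral>\<^sup>+x. (SUP i. U i) x \<partial>M) = (SUP i. \<integral>\<^sup>+x. U i x \<partial>M)" if "\<And>i. U i \<in> borel_measurable M" for M
      unfolding SUP_apply using seq(3) that by (intro nn_integral_monotone_convergence_SUP) auto
    show ?case
      unfolding sup[OF m(1)[OF seq(1)]] sup[OF m(2)[OF seq(1)]] sup[OF m(3)[OF seq(1)]] sup[OF m(4)[OF seq(1)]]
        ennreal_SUP_add[OF inc inc, symmetric] by (simp only: seq.IH)
  qed
qed

text \<open>Written with sums instead of differences, so that all four measures stay positive and finite.\<close>
lemma integral_diff_cong: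
  fixes f :: "'a \<Rightarrow> real"
  assumes fm: "finite_measure M1" "finite_measure M2" "finite_measure M3" "finite_measure M4"
    and se: "sets M1 = sets N" "sets M2 = sets N" "sets M3 = sets N" "sets M4 = sets N"
    and eq: "\<And>B. B \<in> sets N \<Longrightarrow> measure M1 B + measure M2 B = measure M3 B + measure M4 B"
    and f: "f \<in> borel_measurable N" "\<And>x. x \<in> space N \<Longrightarrow> \<bar>f x\<bar> \<le> c"
  shows "(LINT x|M1. f x) + (LINT x|M2. f x) = (LINT x|M3. f x) + (LINT x|M4. f x)"
proof -
  have e: "emeasure M1 B + emeasure M2 B = emeasure M3 B + emeasure M4 B" if "B \<in> sets N" for B
    using eq[OF that] by (simp add: finite_measure.emeasure_eq_measure fm ennreal_plus[symmetric] del: ennreal_plus)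
  have "(\<integral>\<^sup>+x. ennreal (f x + c) \<partial>M1) + (\<integral>\<^sup>+x. ennreal (f x + c) \<partial>M2) = (\<integral>\<^sup>+x. ennreal (f x + c) \<partial>M3) + (\<integral>\<^sup>+x. ennreal (f x + c) \<partial>M4)"
  proof (rule nn_integral_add_cong[OF se])
    have [measurable]: "f \<in> borel_measurable N" by (rule f(1))
    show "(\<lambda>x. ennreal (f x + c)) \<in> borel_measurable N" by measurable
  qed (rule e)
  moreover have conv: "(\<integral>\<^sup>+x. ennreal (f x + c) \<partial>M) = ennreal ((LINT x|M. f x) + c * measure M (space N))"
      "0 \<le> (LINT x|M. f x) + c * measure M (space N)"
    if "finite_measure M" "sets M = sets N" for M
  proof -
    interpret finite_measure M by fact
    have sp: "space M = space N" using sets_eq_imp_space_eq[OF that(2)] .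
    have fM: "f \<in> borel_measurable M" using f(1) that(2) by (simp cong: measurable_cong_sets)
    have i: "integrable M f" by (rule integrable_const_bound[where B=c]) (use fM f(2) sp in auto)
    have nn: "AE x in M. 0 \<le> f x + c"
    proof (rule AE_I2)
      fix x assume "x \<in> space M" then show "0 \<le> f x + c" using f(2)[of x] sp by simp
    qed
    have l: "(LINT x|M. f x + c) = (LINT x|M. f x) + c * measure M (space N)" using i sp by simp
    show "(\<integral>\<^sup>+x. ennreal (f x + c) \<partial>M) = ennreal ((LINT x|M. f x) + c * measure M (space N))"
      using nn_integral_eq_integral[OF _ nn] i l by simp
    show "0 \<le> (LINT x|M. f x) + c * measure M (space N)"
      using integral_nonneg_AE[OF nn] l by simp
  qed
  ultimately have "((LINT x|M1. f x) + c * measure M1 (space N)) + ((LINT x|M2. f x) + c * measure M2 (space N)) =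
    ((LINT x|M3. f x) + c * measure M3 (space N)) + ((LINT x|M4. f x) + c * measure M4 (space N))"
    using conv[OF fm(1) se(1)] conv[OF fm(2) se(2)] conv[OF fm(3) se(3)] conv[OF fm(4) se(4)]
    by (simp add: ennreal_plus[symmetric] del: ennreal_plus)
  moreover have "c * measure M1 (space N) + c * measure M2 (space N) = c * measure M3 (space N) + c * measure M4 (space N)"
    using eq[of "space N"] by (simp add: distrib_left[symmetric])
  ultimately show ?thesis by linarith
qed

text \<open>Any representation as a difference of finite measures computes the integral, not only the Jordan decomposition.\<close>
lemma signed_integral_eq:
  assumes s: "signed_radon K \<alpha>" and fm: "finite_measure P" "finite_measure Q"
    and se: "sets P = borel_subsets K" "sets Q = borel_subsets K"
    and eq: "\<And>B. B \<in> borel_subsets K \<Longrightarrow> \<alpha> B = measure P B - measure Q B"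
    and f: "f \<in> borel_measurable (restrict_space borel K)" "\<And>x. x \<in> K \<Longrightarrow> \<bar>f x\<bar> \<le> c"
  shows "signed_integral K \<alpha> f = (LINT x|P. f x) - (LINT x|Q. f x)"
proof -
  note p = pos_part_facts(1)[OF s] and n = pos_part_facts(1)[OF signed_radon_uminus[OF s]]
  have "(LINT x|pos_part K \<alpha>. f x) + (LINT x|Q. f x) = (LINT x|pos_part K (\<lambda>B. - \<alpha> B). f x) + (LINT x|P. f x)"
  proof (rule integral_diff_cong[OF p fm(2) n fm(1), where N="restrict_space borel K"])
    show "measure (pos_part K \<alpha>) B + measure Q B = measure (pos_part K (\<lambda>B. - \<alpha> B)) B + measure P B"
      if "B \<in> borel_subsets K" for B using eq[OF that] jordan_decomposition[OF s that] by linarith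
  qed (use f se in \<open>simp_all add: sets_pos_part space_restrict_space\<close>)
  then show ?thesis by (simp add: signed_integral_def)
qed

text \<open>A continuous function that is positive exactly on the open set \<open>U\<close>. The case distinction is needed since
  \<open>infdist\<close> to the empty set is \<open>0\<close>.\<close>
definition dist_out :: "'a::euclidean_space set \<Rightarrow> 'a \<Rightarrow> real" where
  "dist_out U x = (if U = UNIV then 1 else infdist x (- U))"

lemma continuous_dist_out: "continuous_on S (dist_out U)"
  unfolding dist_out_def by (cases "U = UNIV") (auto intro!: continuous_intros)

lemma dist_out_nonneg: "dist_out U x \<ge> 0"
  by (simp add: dist_out_def infdist_nonneg)

lemma dist_out_pos_iff: "open U \<Longrightarrow> dist_out U x > 0 \<longleftrightarrow> x \<in> U"
proof (cases "U = UNIV")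
  case False
  assume "open U"
  then have "x \<in> - U \<longleftrightarrow> infdist x (- U) = 0" using False by (intro in_closed_iff_infdist_zero) auto
  then show ?thesis using False infdist_nonneg[of x "- U"] by (auto simp: dist_out_def)
qed (simp add: dist_out_def)

text \<open>The indicator of a relatively open set is the increasing limit of the functions \<open>min 1 (n * dist_out U x)\<close>, and
  these sets form a generating family closed under intersection.\<close>
lemma measure_eqI_continuous:
  fixes K :: "'a::euclidean_space set"
  assumes K: "compact K" and fm: "finite_measure M" "finite_measure N"
    and se: "sets M = borel_subsets K" "sets N = borel_subsets K"
    and eq: "\<And>f :: 'a \<Rightarrow> real. continuous_on K f \<Longrightarrow> (LINT x|M. f x) = (LINT x|N. f x)"
  shows "M = N"
proof -
  have sp: "space M = K" "space N = K" using se sets_eq_imp_space_eq[of _ "restrict_space borel K"] by (auto simp: space_restrict_space)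
  have op: "emeasure M (U \<inter> K) = emeasure N (U \<inter> K)" if U: "open U" for U
  proof -
    define f where "f n x = min 1 (real n * dist_out U x)" for n x
    have fc: "continuous_on K (f n)" for n unfolding f_def by (intro continuous_intros continuous_dist_out)
    have lim: "(\<lambda>n. LINT x|M. f n x) \<longlonglongrightarrow> measure M (U \<inter> K)" if M: "finite_measure M" "sets M = borel_subsets K" for M
    proof -
      interpret finite_measure M by fact
      have sp: "space M = K" using sets_eq_imp_space_eq[OF M(2)] by (simp add: space_restrict_space)
      have UK: "U \<inter> K \<in> sets M" using U M(2) by (auto simp: sets_restrict_space)
      have fM: "f n \<in> borel_measurable M" for n
        using borel_measurable_continuous_on_restrict[OF fc[of n]] M(2) by (simp cong: measurable_cong_sets)
      have "(\<lambda>n. LINT x|M. f n x) \<longlonglongrightarrow> (LINT x|M. indicator (U \<inter> K) x)"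
      proof (rule integral_dominated_convergence[where w="\<lambda>x. 1"])
        show "AE x in M. (\<lambda>n. f n x) \<longlonglongrightarrow> indicator (U \<inter> K) x"
        proof (rule AE_I2)
          fix x assume x: "x \<in> space M"
          show "(\<lambda>n. f n x) \<longlonglongrightarrow> indicator (U \<inter> K) x"
          proof (cases "x \<in> U")
            case True
            then have d: "dist_out U x > 0" using dist_out_pos_iff[OF U] by simp
            obtain n0 where n0: "1 < real n0 * dist_out U x" using reals_Archimedean3[OF d] by blast
            have "f n x = 1" if "n \<ge> n0" for n
            proof -
              have "real n0 * dist_out U x \<le> real n * dist_out U x" using d that by (intro mult_right_mono) auto
              then show ?thesis using n0 by (simp add: f_def)
            qed
            then have "(\<lambda>n. f n x) \<longlonglongrightarrow> 1" by (intro tendsto_eventually eventually_sequentiallyI[of n0])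
            then show ?thesis using True x sp by simp
          next
            case False
            then have "dist_out U x = 0" using dist_out_pos_iff[OF U, of x] dist_out_nonneg[of U x] by linarith
            then show ?thesis using False by (simp add: f_def)
          qed
        qed
        show "AE x in M. norm (f n x) \<le> 1" for n
          using dist_out_nonneg[of U] by (intro AE_I2) (simp add: f_def)
      qed (use fM UK in auto)
      then show ?thesis using UK by simp
    qed
    have "measure M (U \<inter> K) = measure N (U \<inter> K)"
      using lim[OF fm(1) se(1)] lim[OF fm(2) se(2)] eq[OF fc] by (simp add: LIMSEQ_unique)
    then show ?thesis using fm by (simp add: finite_measure.emeasure_eq_measure)
  qed
  have Kb: "K \<inter> space borel \<in> sets borel" using K by (simp add: compact_imp_closed)
  have idm: "(\<lambda>x. x) \<in> measurable M borel" "(\<lambda>x. x) \<in> measurable N borel"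
    using se measurable_restrict_space1[of "\<lambda>x. x" borel borel K] by (simp_all cong: measurable_cong_sets)
  have "distr M borel (\<lambda>x. x) = distr N borel (\<lambda>x. x)"
  proof (rule measure_eqI_generator_eq[where E="Collect open" and \<Omega>=UNIV and A="\<lambda>i. UNIV"])
    show "Int_stable (Collect open :: 'a set set)" by (auto simp: Int_stable_def)
    show "emeasure (distr M borel (\<lambda>x. x)) X = emeasure (distr N borel (\<lambda>x. x)) X" if "X \<in> Collect open" for X
      using that op[of X] idm by (simp add: emeasure_distr sp)
    show "emeasure (distr M borel (\<lambda>x. x)) UNIV \<noteq> \<infinity>" for i :: nat
      using idm fm by (simp add: emeasure_distr sp finite_measure.emeasure_eq_measure)
  qed (auto simp: borel_def)
  then have *: "emeasure (distr M borel (\<lambda>x. x)) X = emeasure (distr N borel (\<lambda>x. x)) X" for X by simp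
  show ?thesis
  proof (rule measure_eqI)
    fix A assume A: "A \<in> sets M"
    then obtain C where C: "C \<in> sets borel" "A = K \<inter> C" using se by (auto simp: sets_restrict_space)
    then show "emeasure M A = emeasure N A"
      using *[of C] idm by (simp add: emeasure_distr sp Int_commute)
  qed (use se in simp)
qed

section \<open>The Riesz representation theorem\<close>

definition band :: "'a set \<Rightarrow> ('a \<Rightarrow> real) \<Rightarrow> ('a \<Rightarrow> real) \<Rightarrow> ('a \<times> real) set" where
  "band K f g = {(x, t). x \<in> K \<and> f x \<le> t \<and> t < g x}"

text \<open>A semiring on which a positive functional \<open>\<Lambda>\<close> defines a volume, namely \<open>\<Lambda> (g - f)\<close> for the region between the
  graphs of \<open>f\<close> and \<open>g\<close>. This is the product of the measure to be constructed with Lebesgue measure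
  on the line, and it is available without knowing the measure of any subset of \<open>K\<close>.\<close>
definition bands :: "'a::euclidean_space set \<Rightarrow> ('a \<times> real) set set" where
  "bands K = {band K f g | f g. continuous_on K f \<and> continuous_on K g \<and> (\<forall>x\<in>K. f x \<le> g x)}"

lemma band_in_bands:
  assumes "continuous_on K f" "continuous_on K g" shows "band K f g \<in> bands K"
proof -
  have eq: "band K f g = band K f (\<lambda>x. max (f x) (g x))" by (auto simp: band_def)
  have "\<forall>x\<in>K. f x \<le> max (f x) (g x)" by simp
  with continuous_on_max[OF assms] assms(1) show ?thesis unfolding eq bands_def by blast
qed

lemma semiring_bands: "semiring_of_sets (K \<times> UNIV) (bands K)"
proof
  show "bands K \<subseteq> Pow (K \<times> UNIV)" by (auto simp: bands_def band_def)
  have "band K (\<lambda>x. 0) (\<lambda>x. 0) = {}" by (auto simp: band_def)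
  then show "{} \<in> bands K" using band_in_bands[of K "\<lambda>x. 0" "\<lambda>x. 0"] by (simp add: continuous_on_const)
next
  fix a b assume "a \<in> bands K" "b \<in> bands K"
  then obtain f g f' g' where a: "a = band K f g" "continuous_on K f" "continuous_on K g"
    and b: "b = band K f' g'" "continuous_on K f'" "continuous_on K g'" unfolding bands_def by blast
  have "a \<inter> b = band K (\<lambda>x. max (f x) (f' x)) (\<lambda>x. min (g x) (g' x))" by (auto simp: a b band_def)
  then show "a \<inter> b \<in> bands K" using a b by (simp add: band_in_bands continuous_on_max continuous_on_min)
  let ?c = "band K f (\<lambda>x. min (g x) (f' x))" and ?d = "band K (\<lambda>x. max (max (f x) (f' x)) (g' x)) g"
  have c: "?c \<in> bands K" "?d \<in> bands K" using a b by (auto intro!: band_in_bands continuous_on_max continuous_on_min)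
  have d: "a - b = \<Union>{?c, ?d}" by (auto simp: a b band_def)
  have "?c \<inter> ?d = {}" by (auto simp: band_def)
  then have "disjoint {?c, ?d}" by (auto simp: disjoint_def)
  then show "\<exists>C\<subseteq>bands K. finite C \<and> disjoint C \<and> a - b = \<Union>C" using c d by (intro exI[of _ "{?c, ?d}"]) auto
qed

lemma dini:
  fixes S :: "nat \<Rightarrow> 'a::euclidean_space \<Rightarrow> real"
  assumes K: "compact K" and S: "\<And>n. continuous_on K (S n)" and h: "continuous_on K h"
    and mono: "\<And>n m x. x \<in> K \<Longrightarrow> n \<le> m \<Longrightarrow> S n x \<le> S m x"
    and lim: "\<And>x. x \<in> K \<Longrightarrow> (\<lambda>n. S n x) \<longlonglongrightarrow> h x" and \<epsilon>: "\<epsilon> > 0"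
  shows "\<exists>N. \<forall>n\<ge>N. \<forall>x\<in>K. \<bar>h x - S n x\<bar> \<le> \<epsilon>"
proof (rule ccontr)
  have le: "S n x \<le> h x" if "x \<in> K" for n x
    using lim[OF that] mono[OF that] by (intro LIMSEQ_le_const) auto
  assume "\<not> ?thesis"
  then have "\<forall>N. \<exists>x\<in>K. h x - S N x > \<epsilon>"
    using mono le by (smt (verit))
  then obtain X where X: "\<And>n. X n \<in> K" "\<And>n. h (X n) - S n (X n) > \<epsilon>" by metis
  obtain l r where l: "l \<in> K" "strict_mono (r :: nat \<Rightarrow> nat)" "(X \<circ> r) \<longlonglongrightarrow> l"
    using K X(1) unfolding compact_def by metis
  have "\<epsilon> \<le> h l - S M l" for M
  proof -
    have "continuous_on K (\<lambda>x. h x - S M x)" using h S by (intro continuous_intros)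
    from continuous_on_tendsto_compose[OF this l(3) l(1)]
    have "(\<lambda>n. h ((X \<circ> r) n) - S M ((X \<circ> r) n)) \<longlonglongrightarrow> h l - S M l"
      using X(1) by (simp add: always_eventually)
    moreover have "\<epsilon> \<le> h ((X \<circ> r) n) - S M ((X \<circ> r) n)" if "n \<ge> M" for n
    proof -
      have "M \<le> r n" using seq_suble[OF l(2), of n] that by linarith
      then show ?thesis using X(2)[of "r n"] mono[OF X(1), of M "r n" "r n"] by simp
    qed
    ultimately show ?thesis by (intro LIMSEQ_le_const) auto
  qed
  moreover have "(\<lambda>M. h l - S M l) \<longlonglongrightarrow> h l - h l" by (intro tendsto_intros lim l)
  ultimately have "\<epsilon> \<le> h l - h l" by (intro LIMSEQ_le_const) auto
  then show False using \<epsilon> by simp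
qed

text \<open>Countable additivity of the volume on the bands follows from Dini's theorem, so that Caratheodory's theorem
  gives a measure \<open>N\<close> on \<open>K \<times> UNIV\<close>. The representing measure is the image of its restriction to \<open>K \<times> {0..<1}\<close> under the first
  projection. To compare \<open>\<Lambda>\<close> with the integral, a non-negative function is cut into layers of height \<open>1 / n\<close>; for each
  layer both values lie between the measures of two consecutive superlevel sets, and the differences telescope.\<close>
lemma riesz_continuous:
  fixes K :: "'a::euclidean_space set" and \<Lambda> :: "('a \<Rightarrow> real) \<Rightarrow> real"
  assumes K: "compact K"
    and lin: "\<And>f g a b. continuous_on K f \<Longrightarrow> continuous_on K g \<Longrightarrow> \<Lambda> (\<lambda>x. a * f x + b * g x) = a * \<Lambda> f + b * \<Lambda> g"
    and pos: "\<And>f. continuous_on K f \<Longrightarrow> (\<And>x. x \<in> K \<Longrightarrow> 0 \<le> f x) \<Longrightarrow> 0 \<le> \<Lambda> f"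
  shows "\<exists>M. finite_measure M \<and> sets M = borel_subsets K \<and> (\<forall>f. continuous_on K f \<longrightarrow> \<Lambda> f = (LINT x|M. f x))"
proof -
  have cc: "continuous_on K (\<lambda>x. c)" for c :: real by (rule continuous_on_const)
  have diff: "\<Lambda> (\<lambda>x. f x - g x) = \<Lambda> f - \<Lambda> g" if "continuous_on K f" "continuous_on K g" for f g
    using lin[OF that, of 1 "-1"] by simp
  have mono: "\<Lambda> f \<le> \<Lambda> g" if "continuous_on K f" "continuous_on K g" "\<And>x. x \<in> K \<Longrightarrow> f x \<le> g x" for f g
    using pos[of "\<lambda>x. g x - f x"] that diff[of g f] by (auto intro: continuous_intros)
  have cong: "\<Lambda> f = \<Lambda> g" if "continuous_on K f" "\<And>x. x \<in> K \<Longrightarrow> f x = g x" for f g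
  proof -
    have "continuous_on K g" using that by (metis continuous_on_cong)
    then show ?thesis using mono[of f g] mono[of g f] that by (simp add: antisym)
  qed
  have scale: "\<Lambda> (\<lambda>x. c * f x) = c * \<Lambda> f" if "continuous_on K f" for f c
    using lin[OF that that, of c 0] by simp
  have zero: "\<Lambda> (\<lambda>x. 0) = 0" using scale[OF cc, of 0 0] by simp
  have add: "\<Lambda> (\<lambda>x. f x + g x) = \<Lambda> f + \<Lambda> g" if "continuous_on K f" "continuous_on K g" for f g
    using lin[OF that, of 1 1] by simp
  have sum: "\<Lambda> (\<lambda>x. \<Sum>i<n. f i x) = (\<Sum>i<n. \<Lambda> (f i))" if "\<And>i. continuous_on K (f i)" for f and n :: nat
  proof (induction n)
    case (Suc n)
    have "continuous_on K (\<lambda>x. \<Sum>i<n. f i x)" by (intro continuous_on_sum that)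
    then show ?case using add[OF _ that[of n]] Suc by simp
  qed (simp add: zero)
  have bound: "\<bar>\<Lambda> f\<bar> \<le> e * \<Lambda> (\<lambda>x. 1)" if f: "continuous_on K f" "\<And>x. x \<in> K \<Longrightarrow> \<bar>f x\<bar> \<le> e" for f e
  proof -
    have "\<Lambda> f \<le> \<Lambda> (\<lambda>x. e * 1)" "\<Lambda> (\<lambda>x. - e * 1) \<le> \<Lambda> f"
      using f(2) by (auto intro!: mono f(1) cc simp: abs_le_iff minus_le_iff)
    then show ?thesis using scale[OF cc[of 1], of e] scale[OF cc[of 1], of "-e"] by simp
  qed
  define \<nu> where "\<nu> A = ennreal (\<Lambda> (\<lambda>x. measure lborel {t. (x, t) \<in> A}))" for A :: "('a \<times> real) set"
  have \<nu>band: "\<nu> (band K f g) = ennreal (\<Lambda> (\<lambda>x. g x - f x))" if fg: "continuous_on K f" "continuous_on K g" "\<And>x. x \<in> K \<Longrightarrow> f x \<le> g x" for f g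
  proof -
    have "\<Lambda> (\<lambda>x. g x - f x) = \<Lambda> (\<lambda>x. measure lborel {t. (x, t) \<in> band K f g})"
    proof (rule cong)
      fix x assume x: "x \<in> K"
      then have "{t. (x, t) \<in> band K f g} = {f x..<g x}" by (auto simp: band_def)
      then show "g x - f x = measure lborel {t. (x, t) \<in> band K f g}" using fg(3)[OF x] by simp
    qed (intro continuous_intros fg)
    then show ?thesis by (simp add: \<nu>_def)
  qed
  interpret semiring_of_sets "K \<times> UNIV" "bands K" by (rule semiring_bands)
  have "\<exists>\<mu>. (\<forall>s\<in>bands K. \<mu> s = \<nu> s) \<and> measure_space (K \<times> UNIV) (sigma_sets (K \<times> UNIV) (bands K)) \<mu>"
  proof (rule caratheodory)
    show "positive (bands K) \<nu>" by (simp add: positive_def \<nu>_def zero)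
    show "countably_additive (bands K) \<nu>"
      unfolding countably_additive_def
    proof (intro allI impI)
      fix A :: "nat \<Rightarrow> ('a \<times> real) set" assume A: "range A \<subseteq> bands K" "disjoint_family A" "(\<Union>n. A n) \<in> bands K"
      have "\<forall>n. \<exists>f g. A n = band K f g \<and> continuous_on K f \<and> continuous_on K g \<and> (\<forall>x\<in>K. f x \<le> g x)"
        using A(1) unfolding bands_def by blast
      then obtain f g where fg: "\<And>n. A n = band K (f n) (g n)" "\<And>n. continuous_on K (f n)" "\<And>n. continuous_on K (g n)"
         "\<And>n x. x \<in> K \<Longrightarrow> f n x \<le> g n x" by metis
      obtain F G where FG: "(\<Union>n. A n) = band K F G" "continuous_on K F" "continuous_on K G" "\<And>x. x \<in> K \<Longrightarrow> F x \<le> G x"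
        using A(3) unfolding bands_def by blast
      have sums: "(\<lambda>n. g n x - f n x) sums (G x - F x)" if x: "x \<in> K" for x
      proof -
        have "disjoint_family (\<lambda>n. {f n x..<g n x})"
          unfolding disjoint_family_on_def
        proof (intro ballI impI equals0I)
          fix m n :: nat and t assume mn: "m \<noteq> n" and t: "t \<in> {f m x..<g m x} \<inter> {f n x..<g n x}"
          have "(x, t) \<in> A m" "(x, t) \<in> A n" using x t by (simp_all add: fg(1) band_def)
          then show False using disjoint_family_onD[OF A(2), of m n] mn by blast
        qed
        moreover have U: "(\<Union>n. {f n x..<g n x}) = {F x..<G x}"
        proof (rule set_eqI)
          fix t
          have "(x, t) \<in> (\<Union>n. A n) \<longleftrightarrow> (x, t) \<in> band K F G" using FG(1) by simp
          then show "t \<in> (\<Union>n. {f n x..<g n x}) \<longleftrightarrow> t \<in> {F x..<G x}"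
            using x by (simp add: fg(1) band_def)
        qed
        ultimately have "(\<lambda>n. measure lborel {f n x..<g n x}) sums measure lborel (\<Union>n. {f n x..<g n x})"
          using FG(4)[OF x] by (intro measure_UNION) auto
        then show ?thesis using U fg(4)[OF x] FG(4)[OF x] by simp
      qed
      define S where "S n x = (\<Sum>i<n. g i x - f i x)" for n x
      have Sc: "continuous_on K (S n)" for n unfolding S_def by (intro continuous_intros fg)
      have hc: "continuous_on K (\<lambda>x. G x - F x)" by (intro continuous_intros FG)
      have "(\<lambda>n. \<Lambda> (S n)) \<longlonglongrightarrow> \<Lambda> (\<lambda>x. G x - F x)"
      proof (rule LIMSEQ_I)
        fix e :: real assume e: "e > 0"
        define \<Lambda>1 where "\<Lambda>1 = \<Lambda> (\<lambda>x. 1)"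
        have c: "\<Lambda>1 \<ge> 0" unfolding \<Lambda>1_def by (rule pos[OF cc]) simp
        have "\<exists>N. \<forall>n\<ge>N. \<forall>x\<in>K. \<bar>(G x - F x) - S n x\<bar> \<le> e / (\<Lambda>1 + 1)"
        proof (rule dini[OF K Sc hc])
          show "S n x \<le> S m x" if "x \<in> K" "n \<le> m" for n m x
            unfolding S_def using that fg(4)[OF that(1)] by (intro sum_mono2) auto
          show "(\<lambda>n. S n x) \<longlonglongrightarrow> G x - F x" if "x \<in> K" for x
            using sums[OF that] unfolding S_def sums_def .
        qed (use e c in simp)
        then obtain N where N: "\<And>n x. n \<ge> N \<Longrightarrow> x \<in> K \<Longrightarrow> \<bar>(G x - F x) - S n x\<bar> \<le> e / (\<Lambda>1 + 1)" by blast
        have "norm (\<Lambda> (S n) - \<Lambda> (\<lambda>x. G x - F x)) < e" if n: "n \<ge> N" for n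
        proof -
          have "\<bar>\<Lambda> (\<lambda>x. (G x - F x) - S n x)\<bar> \<le> e / (\<Lambda>1 + 1) * \<Lambda>1"
          proof -
            have "continuous_on K (\<lambda>x. (G x - F x) - S n x)" by (intro continuous_on_diff[OF hc Sc])
            from bound[OF this N[OF n]] show ?thesis by (simp only: \<Lambda>1_def)
          qed
          also have "\<dots> < e" using e c by (simp add: field_simps)
          finally show ?thesis using diff[OF hc Sc[of n]] by simp
        qed
        then show "\<exists>N. \<forall>n\<ge>N. norm (\<Lambda> (S n) - \<Lambda> (\<lambda>x. G x - F x)) < e" by blast
      qed
      moreover have "\<Lambda> (S n) = (\<Sum>i<n. \<Lambda> (\<lambda>x. g i x - f i x))" for n
        unfolding S_def by (rule sum) (intro continuous_intros fg)
      ultimately have "(\<lambda>i. \<Lambda> (\<lambda>x. g i x - f i x)) sums \<Lambda> (\<lambda>x. G x - F x)" by (simp add: sums_def)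
      moreover have nn: "0 \<le> \<Lambda> (\<lambda>x. g i x - f i x)" for i
        by (rule pos) (use fg in \<open>auto intro: continuous_intros\<close>)
      ultimately have "(\<Sum>i. ennreal (\<Lambda> (\<lambda>x. g i x - f i x))) = ennreal (\<Lambda> (\<lambda>x. G x - F x))"
        by (intro suminf_ennreal_eq)
      then show "(\<Sum>n. \<nu> (A n)) = \<nu> (\<Union>n. A n)" using fg FG by (simp add: \<nu>band)
    qed
  qed
  then obtain \<mu> where \<mu>: "\<And>s. s \<in> bands K \<Longrightarrow> \<mu> s = \<nu> s" "measure_space (K \<times> UNIV) (sigma_sets (K \<times> UNIV) (bands K)) \<mu>" by blast
  define N where "N = measure_of (K \<times> UNIV) (bands K) \<mu>"
  have bs: "bands K \<subseteq> Pow (K \<times> UNIV)" by (auto simp: bands_def band_def)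
  have Ns: "sets N = sigma_sets (K \<times> UNIV) (bands K)" "space N = K \<times> UNIV"
    unfolding N_def using bs by (auto simp: sets_measure_of space_measure_of)
  have bm: "band K f g \<in> sets N" if "continuous_on K f" "continuous_on K g" for f g
    unfolding Ns(1) by (rule sigma_sets.Basic) (rule band_in_bands[OF that])
  have Nband: "emeasure N (band K f g) = ennreal (\<Lambda> (\<lambda>x. g x - f x))" if "continuous_on K f" "continuous_on K g" "\<And>x. x \<in> K \<Longrightarrow> f x \<le> g x" for f g
  proof -
    have "emeasure N (band K f g) = \<mu> (band K f g)"
      by (rule emeasure_measure_of[OF N_def bs])
         (use \<mu>(2) bm[OF that(1,2)] in \<open>simp_all add: measure_space_def Ns(1)\<close>)
    then show ?thesis using \<mu>(1)[OF band_in_bands[OF that(1,2)]] \<nu>band[OF that] by simp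
  qed
  have fstm: "fst \<in> measurable N (restrict_space borel K)"
  proof (rule measurable_restrict_space2)
    show "fst \<in> measurable N borel"
    proof (rule borel_measurableI)
      fix U :: "'a set" assume U: "open U"
      have "fst -` U \<inter> space N = (\<Union>n::nat. band K (\<lambda>x. - real n * dist_out U x) (\<lambda>x. real n * dist_out U x))"
      proof (intro set_eqI iffI)
        fix p assume p: "p \<in> fst -` U \<inter> space N"
        then have d: "dist_out U (fst p) > 0" using dist_out_pos_iff[OF U] by auto
        obtain n where "\<bar>snd p\<bar> < real n * dist_out U (fst p)" using reals_Archimedean3[OF d] by blast
        then have "p \<in> band K (\<lambda>x. - real n * dist_out U x) (\<lambda>x. real n * dist_out U x)"
          using p Ns(2) by (auto simp: band_def abs_less_iff)
        then show "p \<in> (\<Union>n::nat. band K (\<lambda>x. - real n * dist_out U x) (\<lambda>x. real n * dist_out U x))" by blast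
      next
        fix p assume "p \<in> (\<Union>n::nat. band K (\<lambda>x. - real n * dist_out U x) (\<lambda>x. real n * dist_out U x))"
        then obtain n :: nat where n: "fst p \<in> K" "- real n * dist_out U (fst p) \<le> snd p" "snd p < real n * dist_out U (fst p)"
          by (auto simp: band_def)
        have "dist_out U (fst p) \<noteq> 0" using n by auto
        then have "fst p \<in> U" using dist_out_pos_iff[OF U, of "fst p"] dist_out_nonneg[of U "fst p"] by linarith
        then show "p \<in> fst -` U \<inter> space N" using n Ns(2) by (cases p) auto
      qed
      moreover have "band K (\<lambda>x. - real n * dist_out U x) (\<lambda>x. real n * dist_out U x) \<in> sets N" for n
        by (intro bm continuous_intros continuous_dist_out)
      ultimately show "fst -` U \<inter> space N \<in> sets N" by auto
    qed
  qed (auto simp: Ns(2))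
  define slab where "slab = band K (\<lambda>x. 0) (\<lambda>x. 1)"
  have slab: "slab \<in> sets N" unfolding slab_def by (rule bm[OF cc cc])
  define M where "M = distr (density N (indicator slab)) (restrict_space borel K) fst"
  have Ms: "sets M = borel_subsets K" "space M = K" by (auto simp: M_def space_restrict_space)
  have em: "emeasure M B = emeasure N (fst -` B \<inter> slab)" if B: "B \<in> borel_subsets K" for B
  proof -
    have m: "fst -` B \<inter> space N \<in> sets N" using fstm B by (rule measurable_sets)
    have "emeasure M B = emeasure (density N (indicator slab)) (fst -` B \<inter> space N)"
      unfolding M_def using fstm B by (subst emeasure_distr) auto
    also have "\<dots> = emeasure N (slab \<inter> (fst -` B \<inter> space N))"
      using slab m by (simp add: emeasure_restricted)
    also have "slab \<inter> (fst -` B \<inter> space N) = fst -` B \<inter> slab" using sets.sets_into_space[OF slab] by blast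
    finally show ?thesis .
  qed
  have Km: "K \<in> borel_subsets K" using sets.top[of "restrict_space borel K"] by (simp add: space_restrict_space)
  have "fst -` K \<inter> slab = slab" by (auto simp: slab_def band_def)
  then have emK: "emeasure M K = ennreal (\<Lambda> (\<lambda>x. 1))"
    using em[OF Km] Nband[OF cc[of 0] cc[of 1]] by (simp add: slab_def)
  have fin: "finite_measure M" by (rule finite_measureI) (simp add: Ms emK)
  interpret finite_measure M by (rule fin)
  have c1: "0 \<le> \<Lambda> (\<lambda>x. 1)" by (rule pos[OF cc]) simp
  have m1: "measure M K = \<Lambda> (\<lambda>x. 1)" using emK c1 by (simp add: emeasure_eq_measure)
  have fm: "f \<in> borel_measurable M" if "continuous_on K f" for f :: "'a \<Rightarrow> real"
    using borel_measurable_continuous_on_restrict[OF that] Ms by (simp cong: measurable_cong_sets)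
  have fi: "integrable M f" if f: "continuous_on K f" for f :: "'a \<Rightarrow> real"
  proof -
    obtain C where "\<And>x. x \<in> K \<Longrightarrow> \<bar>f x\<bar> \<le> C"
      using compact_imp_bounded[OF compact_continuous_image[OF f K]] by (fastforce simp: bounded_iff)
    then show ?thesis by (intro integrable_const_bound[where B=C] fm[OF f]) (auto simp: Ms)
  qed
  have sand: "measure M A \<le> \<Lambda> \<psi>" "\<Lambda> \<psi> \<le> measure M B" "measure M A \<le> (LINT x|M. \<psi> x)" "(LINT x|M. \<psi> x) \<le> measure M B"
    if \<psi>: "continuous_on K \<psi>" "\<And>x. x \<in> K \<Longrightarrow> 0 \<le> \<psi> x" "\<And>x. x \<in> K \<Longrightarrow> \<psi> x \<le> 1"
      and AB: "A \<in> borel_subsets K" "B \<in> borel_subsets K" "\<And>x. x \<in> A \<Longrightarrow> \<psi> x = 1" "\<And>x. x \<in> K \<Longrightarrow> x \<notin> B \<Longrightarrow> \<psi> x = 0" for \<psi> A B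
  proof -
    have AK: "A \<subseteq> K" "B \<subseteq> K" using AB sets.sets_into_space[of _ "restrict_space borel K"] by (auto simp: space_restrict_space)
    have N\<psi>: "emeasure N (band K (\<lambda>x. 0) \<psi>) = ennreal (\<Lambda> \<psi>)" using Nband[OF cc[of 0] \<psi>(1)] \<psi>(2) by simp
    have p\<psi>: "0 \<le> \<Lambda> \<psi>" by (rule pos[OF \<psi>(1,2)])
    have Bm: "fst -` B \<inter> slab \<in> sets N"
      using sets.Int[OF measurable_sets[OF fstm AB(2)] slab] sets.sets_into_space[OF slab]
      by (metis Int_assoc inf.absorb_iff2)
    have "emeasure N (fst -` A \<inter> slab) \<le> emeasure N (band K (\<lambda>x. 0) \<psi>)"
      using AB(3) AK by (intro emeasure_mono bm[OF cc \<psi>(1)]) (auto simp: slab_def band_def)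
    then have "emeasure M A \<le> ennreal (\<Lambda> \<psi>)" using em[OF AB(1)] N\<psi> by simp
    then show "measure M A \<le> \<Lambda> \<psi>" using p\<psi> by (simp add: emeasure_eq_measure)
    have "band K (\<lambda>x. 0) \<psi> \<subseteq> fst -` B \<inter> slab"
    proof
      fix p assume "p \<in> band K (\<lambda>x. 0) \<psi>"
      then have p: "fst p \<in> K" "0 \<le> snd p" "snd p < \<psi> (fst p)" by (auto simp: band_def)
      then have "fst p \<in> B" using AB(4)[OF p(1)] by force
      then show "p \<in> fst -` B \<inter> slab" using p \<psi>(3)[OF p(1)] by (cases p) (auto simp: slab_def band_def)
    qed
    then have "emeasure N (band K (\<lambda>x. 0) \<psi>) \<le> emeasure N (fst -` B \<inter> slab)" by (rule emeasure_mono[OF _ Bm])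
    then have "ennreal (\<Lambda> \<psi>) \<le> emeasure M B" using em[OF AB(2)] N\<psi> by simp
    then show "\<Lambda> \<psi> \<le> measure M B" by (simp add: emeasure_eq_measure)
    have iA: "integrable M (indicator A :: 'a \<Rightarrow> real)" and iB: "integrable M (indicator B :: 'a \<Rightarrow> real)"
      using AB Ms by (auto intro!: integrable_real_indicator simp: emeasure_eq_measure)
    have "(LINT x|M. indicator A x) \<le> (LINT x|M. \<psi> x)"
    proof (rule integral_mono[OF iA fi[OF \<psi>(1)]])
      fix x assume "x \<in> space M"
      then show "indicator A x \<le> \<psi> x" using AB(3)[of x] \<psi>(2)[of x] Ms(2) by (cases "x \<in> A") auto
    qed
    then show "measure M A \<le> (LINT x|M. \<psi> x)" using AB(1) AK Ms by (simp add: Int_absorb2)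
    have "(LINT x|M. \<psi> x) \<le> (LINT x|M. indicator B x)"
    proof (rule integral_mono[OF fi[OF \<psi>(1)] iB])
      fix x assume "x \<in> space M"
      then show "\<psi> x \<le> indicator B x" using AB(4)[of x] \<psi>(3)[of x] Ms(2) by (cases "x \<in> B") auto
    qed
    then show "(LINT x|M. \<psi> x) \<le> measure M B" using AB(2) AK Ms by (simp add: Int_absorb2)
  qed
  have main: "\<Lambda> \<phi> = (LINT x|M. \<phi> x)" if \<phi>: "continuous_on K \<phi>" "\<And>x. x \<in> K \<Longrightarrow> 0 \<le> \<phi> x" for \<phi>
  proof -
    obtain C where C: "\<And>x. x \<in> K \<Longrightarrow> \<bar>\<phi> x\<bar> \<le> C"
      using compact_imp_bounded[OF compact_continuous_image[OF \<phi>(1) K]] by (fastforce simp: bounded_iff)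
    obtain L :: nat where L: "C \<le> real L" using real_arch_simple by blast
    \<comment> \<open>The error in layer \<open>k\<close> is at most \<open>measure M (A k) - measure M (A (Suc k))\<close>, so the total is bounded independently of \<open>n\<close>.\<close>
    have est: "real n * \<bar>\<Lambda> \<phi> - (LINT x|M. \<phi> x)\<bar> \<le> measure M K" if n: "n > 0" for n :: nat
    proof -
      define \<psi> where "\<psi> k x = real n * (min (\<phi> x) (real (Suc k) / real n) - min (\<phi> x) (real k / real n))" for k x
      define A where "A k = {x \<in> K. real k / real n < \<phi> x}" for k
      have \<psi>c: "continuous_on K (\<psi> k)" for k unfolding \<psi>_def by (intro continuous_intros \<phi>)
      have step: "real k / real n < real (Suc k) / real n" "real n * (real (Suc k) / real n - real k / real n) = 1" for k
        using n by (auto simp: field_simps)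
      have \<psi>0: "0 \<le> \<psi> k x" for k x unfolding \<psi>_def using step(1)[of k] by (intro mult_nonneg_nonneg) auto
      have \<psi>1: "\<psi> k x \<le> 1" for k x
      proof -
        have "\<psi> k x \<le> real n * (real (Suc k) / real n - real k / real n)"
          unfolding \<psi>_def using step(1)[of k] by (intro mult_left_mono) (auto simp: min_def)
        then show ?thesis using step(2)[of k] by simp
      qed
      have Am: "A k \<in> borel_subsets K" for k
      proof -
        have "{x \<in> space (restrict_space borel K). real k / real n < \<phi> x} \<in> sets (restrict_space borel K)"
          using borel_measurable_continuous_on_restrict[OF \<phi>(1)] by measurable
        then show ?thesis by (simp add: A_def space_restrict_space)
      qed
      have \<psi>A: "\<psi> k x = 1" if "x \<in> A (Suc k)" for k x
        using that step[of k] unfolding \<psi>_def A_def by (auto simp: min_def)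
      have \<psi>Z: "\<psi> k x = 0" if "x \<in> K" "x \<notin> A k" for k x
        using that step(1)[of k] unfolding \<psi>_def A_def by (auto simp: min_def)
      have sd: "measure M (A (Suc k)) \<le> \<Lambda> (\<psi> k)" "\<Lambda> (\<psi> k) \<le> measure M (A k)"
          "measure M (A (Suc k)) \<le> (LINT x|M. \<psi> k x)" "(LINT x|M. \<psi> k x) \<le> measure M (A k)" for k
        by (rule sand[OF \<psi>c \<psi>0 \<psi>1 Am Am \<psi>A \<psi>Z]; assumption)+
      have tot: "(\<Sum>k<n * L. \<psi> k x) = real n * \<phi> x" if x: "x \<in> K" for x
      proof -
        have "(\<Sum>k<n * L. \<psi> k x) = real n * (min (\<phi> x) (real (n * L) / real n) - min (\<phi> x) (real 0 / real n))"
          unfolding \<psi>_def sum_distrib_left[symmetric] by (subst sum_lessThan_telescope) simp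
        moreover have "\<phi> x \<le> real (n * L) / real n" using C[OF x] L n by simp
        ultimately show ?thesis using \<phi>(2)[OF x] by simp
      qed
      have "real n * \<Lambda> \<phi> = \<Lambda> (\<lambda>x. \<Sum>k<n * L. \<psi> k x)"
      proof -
        have sc: "continuous_on K (\<lambda>x. \<Sum>k<n * L. \<psi> k x)" by (intro continuous_on_sum \<psi>c)
        show ?thesis using cong[OF sc tot] scale[OF \<phi>(1), of "real n"] by simp
      qed
      then have e1: "real n * \<Lambda> \<phi> = (\<Sum>k<n * L. \<Lambda> (\<psi> k))" by (simp only: sum[OF \<psi>c])
      have "real n * (LINT x|M. \<phi> x) = (LINT x|M. real n * \<phi> x)" by simp
      also have "\<dots> = (LINT x|M. (\<Sum>k<n * L. \<psi> k x))"
        using tot by (intro Bochner_Integration.integral_cong refl) (simp add: Ms)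
      also have "\<dots> = (\<Sum>k<n * L. (LINT x|M. \<psi> k x))" by (intro Bochner_Integration.integral_sum fi \<psi>c)
      finally have e2: "real n * (LINT x|M. \<phi> x) = (\<Sum>k<n * L. (LINT x|M. \<psi> k x))" .
      have "real n * \<bar>\<Lambda> \<phi> - (LINT x|M. \<phi> x)\<bar> = \<bar>real n * \<Lambda> \<phi> - real n * (LINT x|M. \<phi> x)\<bar>"
        by (simp add: right_diff_distrib[symmetric] abs_mult)
      also have "\<dots> = \<bar>\<Sum>k<n * L. \<Lambda> (\<psi> k) - (LINT x|M. \<psi> k x)\<bar>" by (simp only: e1 e2 sum_subtractf)
      also have "\<dots> \<le> (\<Sum>k<n * L. \<bar>\<Lambda> (\<psi> k) - (LINT x|M. \<psi> k x)\<bar>)" by (rule sum_abs)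
      also have "\<dots> \<le> (\<Sum>k<n * L. measure M (A k) - measure M (A (Suc k)))"
      proof (rule sum_mono)
        fix k show "\<bar>\<Lambda> (\<psi> k) - (LINT x|M. \<psi> k x)\<bar> \<le> measure M (A k) - measure M (A (Suc k))"
          using sd(1)[where k=k] sd(2)[where k=k] sd(3)[where k=k] sd(4)[where k=k] by linarith
      qed
      also have "\<dots> = measure M (A 0) - measure M (A (n * L))" by (rule sum_lessThan_telescope')
      also have "\<dots> \<le> measure M K" 
      proof -
        have "A 0 \<subseteq> K" by (auto simp: A_def)
        then have "measure M (A 0) \<le> measure M K" using Ms(1) Km by (intro finite_measure_mono) simp_all
        then show ?thesis using measure_nonneg[of M "A (n * L)"] by linarith
      qed
      finally show ?thesis .
    qed
    show ?thesis
    proof (rule ccontr)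
      assume "\<Lambda> \<phi> \<noteq> (LINT x|M. \<phi> x)"
      then have d: "\<bar>\<Lambda> \<phi> - (LINT x|M. \<phi> x)\<bar> > 0" by simp
      obtain n where n: "measure M K < real n * \<bar>\<Lambda> \<phi> - (LINT x|M. \<phi> x)\<bar>" using reals_Archimedean3[OF d] by blast
      have "n > 0" using n measure_nonneg[of M K] by (cases n) auto
      with est[of n] n show False by simp
    qed
  qed
  have "\<Lambda> f = (LINT x|M. f x)" if f: "continuous_on K f" for f
  proof -
    obtain C where C: "\<And>x. x \<in> K \<Longrightarrow> \<bar>f x\<bar> \<le> C"
      using compact_imp_bounded[OF compact_continuous_image[OF f K]] by (fastforce simp: bounded_iff)
    have "\<Lambda> (\<lambda>x. f x + C) = (LINT x|M. f x + C)"
    proof (rule main)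
      show "0 \<le> f x + C" if "x \<in> K" for x using C[OF that] by linarith
    qed (intro continuous_intros f)
    moreover have "\<Lambda> (\<lambda>x. f x + C) = \<Lambda> f + C * \<Lambda> (\<lambda>x. 1)"
      using add[OF f cc[of C]] scale[OF cc[of 1], of C] by simp
    moreover have "(LINT x|M. f x + C) = (LINT x|M. f x) + C * \<Lambda> (\<lambda>x. 1)"
      using fi[OF f] m1 Ms by simp
    ultimately show ?thesis by simp
  qed
  then show ?thesis using fin Ms by blast
qed

text \<open>A positive functional on a subspace that contains the constants is bounded for the supremum norm, and
  therefore extends from a dense subspace to all continuous functions. Adding a small constant to the approximations shows
  that the extension is still positive.\<close>
theorem riesz_dense:
  fixes K :: "'a::euclidean_space set" and \<Lambda> :: "('a \<Rightarrow> real) \<Rightarrow> real" and V :: "('a \<Rightarrow> real) set"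
  assumes K: "compact K" and Vc: "\<And>f. f \<in> V \<Longrightarrow> continuous_on K f" and V1: "(\<lambda>x. 1) \<in> V"
    and Vl: "\<And>f g a b. f \<in> V \<Longrightarrow> g \<in> V \<Longrightarrow> (\<lambda>x. a * f x + b * g x) \<in> V"
    and dense: "\<And>f \<epsilon>. continuous_on K f \<Longrightarrow> \<epsilon> > 0 \<Longrightarrow> \<exists>g\<in>V. \<forall>x\<in>K. \<bar>f x - g x\<bar> \<le> \<epsilon>"
    and lin: "\<And>f g a b. f \<in> V \<Longrightarrow> g \<in> V \<Longrightarrow> \<Lambda> (\<lambda>x. a * f x + b * g x) = a * \<Lambda> f + b * \<Lambda> g"
    and pos: "\<And>f. f \<in> V \<Longrightarrow> (\<And>x. x \<in> K \<Longrightarrow> 0 \<le> f x) \<Longrightarrow> 0 \<le> \<Lambda> f"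
  shows "\<exists>M. finite_measure M \<and> sets M = borel_subsets K \<and> (\<forall>f\<in>V. \<Lambda> f = (LINT x|M. f x))"
proof -
  define c where "c = \<Lambda> (\<lambda>x. 1)"
  have c: "c \<ge> 0" unfolding c_def by (rule pos[OF V1]) simp
  have bound: "\<bar>\<Lambda> f\<bar> \<le> c * e" if f: "f \<in> V" "\<And>x. x \<in> K \<Longrightarrow> \<bar>f x\<bar> \<le> e" for f e
  proof -
    have "0 \<le> \<Lambda> (\<lambda>x. e * 1 + (-1) * f x)" "0 \<le> \<Lambda> (\<lambda>x. e * 1 + 1 * f x)"
    proof -
      have b: "- e \<le> f x \<and> f x \<le> e" if "x \<in> K" for x using f(2)[OF that] by (simp add: abs_le_iff minus_le_iff)
      show "0 \<le> \<Lambda> (\<lambda>x. e * 1 + (-1) * f x)" by (rule pos[OF Vl[OF V1 f(1)]]) (use b in force)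
      show "0 \<le> \<Lambda> (\<lambda>x. e * 1 + 1 * f x)" by (rule pos[OF Vl[OF V1 f(1)]]) (use b in force)
    qed
    then show ?thesis unfolding lin[OF V1 f(1)] c_def[symmetric] by (simp add: abs_le_iff mult.commute)
  qed
  have close: "\<bar>\<Lambda> f - \<Lambda> g\<bar> \<le> c * e" if fg: "f \<in> V" "g \<in> V" "\<And>x. x \<in> K \<Longrightarrow> \<bar>f x - g x\<bar> \<le> e" for f g e
  proof -
    have "(\<lambda>x. 1 * f x + (-1) * g x) \<in> V" by (rule Vl[OF fg(1,2)])
    from bound[OF this, of e] fg(3) show ?thesis using lin[OF fg(1,2), of 1 "-1"] by simp
  qed
  define ext where "ext f l \<longleftrightarrow> (\<forall>e>0. \<forall>g\<in>V. (\<forall>x\<in>K. \<bar>f x - g x\<bar> \<le> e) \<longrightarrow> \<bar>\<Lambda> g - l\<bar> \<le> c * e)" for f l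
  have ex: "\<exists>l. ext f l" if f: "continuous_on K f" for f
  proof -
    have "\<forall>n. \<exists>g\<in>V. \<forall>x\<in>K. \<bar>f x - g x\<bar> \<le> 1 / real (Suc n)" using dense[OF f] by simp
    then obtain G where G: "\<And>n. G n \<in> V" "\<And>n x. x \<in> K \<Longrightarrow> \<bar>f x - G n x\<bar> \<le> 1 / real (Suc n)" by metis
    have est: "\<bar>\<Lambda> g - \<Lambda> (G n)\<bar> \<le> c * (e + 1 / real (Suc n))" if g: "g \<in> V" "\<And>x. x \<in> K \<Longrightarrow> \<bar>f x - g x\<bar> \<le> e" for g e n
    proof (rule close[OF g(1) G(1)])
      fix x assume x: "x \<in> K"
      show "\<bar>g x - G n x\<bar> \<le> e + 1 / real (Suc n)" using g(2)[OF x] G(2)[OF x, of n] by linarith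
    qed
    have lim0: "(\<lambda>n. 1 / real (Suc n)) \<longlonglongrightarrow> 0" by (rule LIMSEQ_Suc[OF lim_1_over_n])
    have "Cauchy (\<lambda>n. \<Lambda> (G n))"
    proof (rule CauchyI)
      fix e :: real assume e: "e > 0"
      have "(\<lambda>n. c * (2 * (1 / real (Suc n)))) \<longlonglongrightarrow> c * (2 * 0)" by (intro tendsto_intros lim0)
      then have "\<forall>\<^sub>F n in sequentially. c * (2 * (1 / real (Suc n))) < e" using e by (intro order_tendstoD) auto
      then obtain N where N: "c * (2 * (1 / real (Suc N))) < e" by (auto simp: eventually_sequentially)
      have "norm (\<Lambda> (G m) - \<Lambda> (G n)) < e" if mn: "m \<ge> N" "n \<ge> N" for m n
      proof -
        have "1 / real (Suc m) \<le> 1 / real (Suc N)" "1 / real (Suc n) \<le> 1 / real (Suc N)" using mn by (auto simp: frac_le)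
        then have "c * (1 / real (Suc m) + 1 / real (Suc n)) \<le> c * (2 * (1 / real (Suc N)))" using c by (intro mult_left_mono) auto
        then show ?thesis using est[OF G(1) G(2), of m n] N by simp
      qed
      then show "\<exists>M. \<forall>m\<ge>M. \<forall>n\<ge>M. norm (\<Lambda> (G m) - \<Lambda> (G n)) < e" by blast
    qed
    then obtain l where l: "(\<lambda>n. \<Lambda> (G n)) \<longlonglongrightarrow> l" by (auto simp: Cauchy_convergent_iff convergent_def)
    have "ext f l" unfolding ext_def
    proof (intro allI impI ballI)
      fix e g assume g: "(e::real) > 0" "g \<in> V" "\<forall>x\<in>K. \<bar>f x - g x\<bar> \<le> e"
      have "(\<lambda>n. \<bar>\<Lambda> g - \<Lambda> (G n)\<bar>) \<longlonglongrightarrow> \<bar>\<Lambda> g - l\<bar>" by (intro tendsto_intros l)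
      moreover have "(\<lambda>n. c * (e + 1 / real (Suc n))) \<longlonglongrightarrow> c * (e + 0)" by (intro tendsto_intros lim0)
      ultimately show "\<bar>\<Lambda> g - l\<bar> \<le> c * e"
        using est[OF g(2), of e] g(3) by (intro LIMSEQ_le[of _ _ "\<lambda>n. c * (e + 1 / real (Suc n))" "c * e"]) auto
    qed
    then show ?thesis by blast
  qed
  define \<Lambda>' where "\<Lambda>' f = (SOME l. ext f l)" for f
  have ext: "\<bar>\<Lambda> g - \<Lambda>' f\<bar> \<le> c * e" if "continuous_on K f" "e > 0" "g \<in> V" "\<And>x. x \<in> K \<Longrightarrow> \<bar>f x - g x\<bar> \<le> e" for f g e
  proof -
    have "ext f (\<Lambda>' f)" unfolding \<Lambda>'_def by (rule someI_ex[OF ex[OF that(1)]])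
    from this[unfolded ext_def, rule_format, OF that(2,3,4)] show ?thesis .
  qed
  have small: "x = 0" if x: "\<And>e. e > 0 \<Longrightarrow> \<bar>x\<bar> \<le> C * e" for x C :: real
  proof (rule ccontr)
    assume "x \<noteq> 0"
    then have p: "\<bar>x\<bar> / (2 * (\<bar>C\<bar> + 1)) > 0" by simp
    have "C * (\<bar>x\<bar> / (2 * (\<bar>C\<bar> + 1))) \<le> (\<bar>C\<bar> + 1) * (\<bar>x\<bar> / (2 * (\<bar>C\<bar> + 1)))" by (intro mult_right_mono) auto
    also have "\<dots> = \<bar>x\<bar> / 2" by (simp add: field_simps)
    finally show False using x[OF p] \<open>x \<noteq> 0\<close> by linarith
  qed
  have agree: "\<Lambda>' f = \<Lambda> f" if "f \<in> V" for f
  proof -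
    have "\<bar>\<Lambda> f - \<Lambda>' f\<bar> \<le> c * e" if "e > 0" for e
      by (rule ext[OF Vc[OF \<open>f \<in> V\<close>] that \<open>f \<in> V\<close>]) (use that in simp)
    from small[OF this] show ?thesis by simp
  qed
  have lin': "\<Lambda>' (\<lambda>x. a * f x + b * g x) = a * \<Lambda>' f + b * \<Lambda>' g" if f: "continuous_on K f" and g: "continuous_on K g" for f g a b
  proof -
    have "\<bar>\<Lambda>' (\<lambda>x. a * f x + b * g x) - (a * \<Lambda>' f + b * \<Lambda>' g)\<bar> \<le> (2 * c * (\<bar>a\<bar> + \<bar>b\<bar> + 1)) * e" if e: "e > 0" for e
    proof -
      obtain f1 where f1: "f1 \<in> V" "\<And>x. x \<in> K \<Longrightarrow> \<bar>f x - f1 x\<bar> \<le> e" using dense[OF f e] by blast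
      obtain g1 where g1: "g1 \<in> V" "\<And>x. x \<in> K \<Longrightarrow> \<bar>g x - g1 x\<bar> \<le> e" using dense[OF g e] by blast
      have cfg: "continuous_on K (\<lambda>x. a * f x + b * g x)" using f g by (intro continuous_intros)
      have pe: "(\<bar>a\<bar> + \<bar>b\<bar> + 1) * e > 0" using e by (intro mult_pos_pos) auto
      have "\<bar>\<Lambda> (\<lambda>x. a * f1 x + b * g1 x) - \<Lambda>' (\<lambda>x. a * f x + b * g x)\<bar> \<le> c * ((\<bar>a\<bar> + \<bar>b\<bar> + 1) * e)"
      proof (rule ext[OF cfg pe Vl[OF f1(1) g1(1)]])
        fix x assume x: "x \<in> K"
        have "(a * f x + b * g x) - (a * f1 x + b * g1 x) = a * (f x - f1 x) + b * (g x - g1 x)" by (simp add: algebra_simps)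
        also have "\<bar>\<dots>\<bar> \<le> \<bar>a\<bar> * \<bar>f x - f1 x\<bar> + \<bar>b\<bar> * \<bar>g x - g1 x\<bar>" by (metis abs_mult abs_triangle_ineq)
        also have "\<dots> \<le> \<bar>a\<bar> * e + \<bar>b\<bar> * e" using f1(2)[OF x] g1(2)[OF x] by (intro add_mono mult_left_mono) auto
        also have "\<dots> \<le> (\<bar>a\<bar> + \<bar>b\<bar> + 1) * e" using e by (simp add: distrib_right)
        finally show "\<bar>a * f x + b * g x - (a * f1 x + b * g1 x)\<bar> \<le> (\<bar>a\<bar> + \<bar>b\<bar> + 1) * e" .
      qed
      moreover have "\<bar>a * \<Lambda> f1 - a * \<Lambda>' f\<bar> \<le> \<bar>a\<bar> * (c * e)"
        using ext[OF f e f1] by (simp add: right_diff_distrib[symmetric] abs_mult mult_left_mono)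
      moreover have "\<bar>b * \<Lambda> g1 - b * \<Lambda>' g\<bar> \<le> \<bar>b\<bar> * (c * e)"
        using ext[OF g e g1] by (simp add: right_diff_distrib[symmetric] abs_mult mult_left_mono)
      moreover have "\<Lambda> (\<lambda>x. a * f1 x + b * g1 x) = a * \<Lambda> f1 + b * \<Lambda> g1" by (rule lin[OF f1(1) g1(1)])
      ultimately have "\<bar>\<Lambda>' (\<lambda>x. a * f x + b * g x) - (a * \<Lambda>' f + b * \<Lambda>' g)\<bar> \<le> c * ((\<bar>a\<bar> + \<bar>b\<bar> + 1) * e) + \<bar>a\<bar> * (c * e) + \<bar>b\<bar> * (c * e)"
        by linarith
      also have "\<dots> \<le> (2 * c * (\<bar>a\<bar> + \<bar>b\<bar> + 1)) * e" using c e by (simp add: algebra_simps)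
      finally show ?thesis .
    qed
    from small[OF this] show ?thesis by simp
  qed
  have pos': "0 \<le> \<Lambda>' f" if f: "continuous_on K f" "\<And>x. x \<in> K \<Longrightarrow> 0 \<le> f x" for f
  proof (rule ccontr)
    assume n: "\<not> 0 \<le> \<Lambda>' f"
    define e where "e = - \<Lambda>' f / (3 * (c + 1))"
    have e: "e > 0" unfolding e_def using n c by (intro divide_pos_pos) auto
    obtain g where g: "g \<in> V" "\<And>x. x \<in> K \<Longrightarrow> \<bar>f x - g x\<bar> \<le> e" using dense[OF f(1) e] by blast
    have "0 \<le> \<Lambda> (\<lambda>x. 1 * g x + e * 1)"
    proof (rule pos[OF Vl[OF g(1) V1]])
      fix x assume x: "x \<in> K" show "0 \<le> 1 * g x + e * 1" using g(2)[OF x] f(2)[OF x] by linarith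
    qed
    then have "0 \<le> \<Lambda> g + e * c" using lin[OF g(1) V1, of 1 e] by (simp add: c_def)
    moreover have "\<bar>\<Lambda> g - \<Lambda>' f\<bar> \<le> c * e" by (rule ext[OF f(1) e g])
    ultimately have "- \<Lambda>' f \<le> 2 * (c * e)" by (simp add: mult.commute)
    moreover have "3 * (c + 1) * e = - \<Lambda>' f" unfolding e_def using c by (simp add: nonzero_mult_div_cancel_left)
    moreover have "3 * (c + 1) * e = 3 * (c * e) + 3 * e" by (simp add: algebra_simps)
    ultimately have "3 * (c * e) + 3 * e \<le> 2 * (c * e)" by linarith
    moreover have "0 \<le> c * e" using c e by simp
    ultimately show False using e by linarith
  qed
  have "\<exists>M. finite_measure M \<and> sets M = borel_subsets K \<and> (\<forall>f. continuous_on K f \<longrightarrow> \<Lambda>' f = (LINT x|M. f x))"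
  proof (rule riesz_continuous[OF K, of \<Lambda>'])
    show "\<Lambda>' (\<lambda>x. a * f x + b * g x) = a * \<Lambda>' f + b * \<Lambda>' g" if "continuous_on K f" "continuous_on K g" for f g a b
      by (rule lin'[OF that])
    show "0 \<le> \<Lambda>' f" if "continuous_on K f" "\<And>x. x \<in> K \<Longrightarrow> 0 \<le> f x" for f
      by (rule pos'[OF that])
  qed
  then obtain M where M: "finite_measure M" "sets M = borel_subsets K" "\<And>f. continuous_on K f \<Longrightarrow> \<Lambda>' f = (LINT x|M. f x)"
    by blast
  have "\<forall>f\<in>V. \<Lambda> f = (LINT x|M. f x)"
  proof
    fix f assume f: "f \<in> V"
    show "\<Lambda> f = (LINT x|M. f x)" using agree[OF f] M(3)[OF Vc[OF f]] by simp
  qed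
  with M(1,2) show ?thesis by blast
qed

section \<open>Young's inequality and its equality case\<close>

lemma conj_exp_facts:
  assumes "r > 1"
  shows "conj_exp r > 1" "1 / r + 1 / conj_exp r = 1" "(conj_exp r - 1) * r = conj_exp r" "(r - 1) * conj_exp r = r"
    "(r - 1) * (conj_exp r - 1) = 1"
  using assms by (auto simp: conj_exp_def field_simps)

lemma conj_exp_antimono: "1 < r \<Longrightarrow> r \<le> q \<Longrightarrow> conj_exp q \<le> conj_exp r"
  by (auto simp: conj_exp_def field_simps)

lemma young_inner:
  fixes x y :: "'a::real_inner"
  assumes "r > 1"
  shows "y \<bullet> x \<le> norm x powr r / r + norm y powr conj_exp r / conj_exp r"
proof -
  have "y \<bullet> x \<le> norm x * norm y" using norm_cauchy_schwarz[of y x] by (simp add: mult.commute)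
  also have "\<dots> \<le> norm x powr r / r + norm y powr conj_exp r / conj_exp r"
    using conj_exp_facts[OF assms] assms by (intro Youngs_inequality) auto
  finally show ?thesis .
qed

text \<open>Scaling \<open>x\<close> by \<open>c\<close> and \<open>y\<close> by \<open>1 / c\<close> keeps the inner product, so that equality at \<open>c = 1\<close> makes \<open>1\<close> a minimum of the
  right-hand side as a function of \<open>c\<close>; its derivative there is the difference of the two powers.\<close>
lemma young_equality_norms:
  fixes x y :: "'a::real_inner"
  assumes r: "r > 1" and eq: "y \<bullet> x = norm x powr r / r + norm y powr conj_exp r / conj_exp r"
  shows "norm y powr conj_exp r = norm x powr r"
proof -
  let ?s = "conj_exp r"
  note s = conj_exp_facts[OF r]
  let ?k = "\<lambda>c. norm x powr r * (c powr r) / r + norm y powr ?s * (c powr (- ?s)) / ?s"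
  have min: "?k 1 \<le> ?k c" if c: "c > 0" for c
  proof -
    have "y \<bullet> x = ((1 / c) *\<^sub>R y) \<bullet> (c *\<^sub>R x)" using c by simp
    also have "\<dots> \<le> norm (c *\<^sub>R x) powr r / r + norm ((1 / c) *\<^sub>R y) powr ?s / ?s" by (rule young_inner[OF r])
    also have "\<dots> = ?k c" using c by (simp add: powr_mult powr_divide powr_minus_divide)
    finally show ?thesis using eq by simp
  qed
  have "(?k has_real_derivative (norm x powr r * (r * 1 powr (r - 1)) / r + norm y powr ?s * ((- ?s) * 1 powr (- ?s - 1)) / ?s)) (at 1)"
    by (intro DERIV_add DERIV_cdivide DERIV_cmult has_real_derivative_powr) auto
  then have "(?k has_real_derivative (norm x powr r - norm y powr ?s)) (at 1)" using r s(1) by simp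
  moreover have "\<forall>c. \<bar>1 - c\<bar> < 1 \<longrightarrow> ?k 1 \<le> ?k c" using min by auto
  ultimately have "norm x powr r - norm y powr ?s = 0" by (rule DERIV_local_min[OF _ zero_less_one])
  then show ?thesis by simp
qed

text \<open>With the norms known, equality holds in the Cauchy-Schwarz inequality, and \<open>y\<close> is a multiple of \<open>x\<close>.\<close>
lemma young_equality:
  fixes x y :: "'a::real_inner"
  assumes r: "r > 1" and eq: "y \<bullet> x = norm x powr r / r + norm y powr conj_exp r / conj_exp r"
  shows "y = norm x powr (r - 2) *\<^sub>R x"
proof -
  let ?s = "conj_exp r"
  note s = conj_exp_facts[OF r]
  note n = young_equality_norms[OF r eq]
  show ?thesis
  proof (cases "x = 0")
    case True
    then show ?thesis using n r by simp
  next
    case False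
    have "(norm y powr ?s) powr (1 / ?s) = (norm x powr r) powr (1 / ?s)" using n by simp
    moreover have "r * (1 / ?s) = r - 1" using s(4) s(1) by (simp add: field_simps)
    ultimately have ny: "norm y = norm x powr (r - 1)" using s(1) by (simp add: powr_powr)
    have "y \<bullet> x = norm x powr r * (1 / r + 1 / ?s)" using eq n by (simp add: distrib_left)
    then have "y \<bullet> x = norm x powr r" using s(2) by simp
    also have "\<dots> = norm y * norm x" using False by (simp add: ny powr_mult_base mult.commute)
    finally have "norm y *\<^sub>R x = norm x *\<^sub>R y" by (simp only: norm_cauchy_schwarz_eq)
    then have "(1 / norm x) *\<^sub>R (norm x *\<^sub>R y) = (1 / norm x) *\<^sub>R (norm y *\<^sub>R x)" by simp
    then have yx: "y = (norm y / norm x) *\<^sub>R x" using False by simp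
    have "norm x powr (r - 1 - 1) = norm x powr (r - 1) / norm x powr 1" by (rule powr_diff)
    then have "norm y / norm x = norm x powr (r - 2)" using False by (simp add: ny)
    then show ?thesis using yx by simp
  qed
qed

lemma duality_map:
  fixes x :: "'a::real_inner"
  assumes r: "r > 1"
  defines "y \<equiv> norm x powr (r - 2) *\<^sub>R x"
  shows "norm y = norm x powr (r - 1)" "norm y powr conj_exp r = norm x powr r" "y \<bullet> x = norm x powr r"
proof -
  have p: "norm x powr (r - 2) * norm x = norm x powr (r - 1)"
    by (cases "x = 0") (simp_all add: powr_mult_base mult.commute)
  show 1: "norm y = norm x powr (r - 1)" using p by (simp add: y_def)
  show "norm y powr conj_exp r = norm x powr r" using conj_exp_facts(4)[OF r] by (simp add: 1 powr_powr)
  have "y \<bullet> x = (norm x powr (r - 2) * norm x) * norm x" by (simp add: y_def dot_square_norm power2_eq_square)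
  also have "\<dots> = norm x powr r" unfolding p by (cases "x = 0") (simp_all add: powr_mult_base mult.commute)
  finally show "y \<bullet> x = norm x powr r" .
qed

section \<open>The integrand and its integral\<close>

lemma ell_pos: "a > 0 \<Longrightarrow> ell r a b = ereal (1 / r * (a * norm ((1 / a) *\<^sub>R b) powr r))"
proof -
  assume a: "a > 0"
  have "norm b powr r / a powr (r - 1) = a * norm ((1 / a) *\<^sub>R b) powr r"
    using a by (simp add: powr_divide powr_diff)
  then show ?thesis using a by (simp add: ell_def)
qed

lemma ell_zero: "ell r 0 0 = ereal 0"
  by (simp add: ell_def zero_ereal_def)

text \<open>In terms of the velocity \<open>v = b / a\<close> the integrand is linear in \<open>a\<close>. This form is also correct for \<open>a = 0\<close>.\<close>
lemma ell_scale: "a \<ge> 0 \<Longrightarrow> ell r a (a *\<^sub>R v) = ereal (1 / r * (a * norm v powr r))"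
  by (cases "a = 0") (simp_all add: ell_zero ell_pos)

text \<open>Young's inequality for \<open>\<beta>\<close> and \<open>b / a\<close>, multiplied by \<open>a\<close>.\<close>
lemma ell_ge_pairing:
  assumes r: "r > 1" and A: "\<alpha> + 1 / conj_exp r * norm \<beta> powr conj_exp r \<le> 0"
  shows "ereal (\<alpha> * a + \<beta> \<bullet> b) \<le> ell r a b"
proof -
  consider "a > 0" | "a = 0" "b = 0" | "\<not> a > 0" "\<not> (a = 0 \<and> b = 0)" by linarith
  then show ?thesis
  proof cases
    case 1
    define v where "v = (1 / a) *\<^sub>R b"
    have b: "b = a *\<^sub>R v" using 1 by (simp add: v_def)
    have "\<alpha> * a + \<beta> \<bullet> b = a * (\<alpha> + \<beta> \<bullet> v)" by (simp add: b distrib_left mult.commute)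
    also have "\<dots> \<le> a * (norm v powr r / r)"
      using young_inner[OF r, of \<beta> v] A 1 by (intro mult_left_mono) auto
    finally show ?thesis using ell_scale[of a r v] 1 by (simp add: b)
  qed (simp_all add: ell_zero ell_def)
qed

lemma Lfun_eq:
  assumes "AE x in lebesgue_on \<Omega>. ell r (m x) (w x) = ereal (h x)" "integrable (lebesgue_on \<Omega>) h" "AE x in lebesgue_on \<Omega>. 0 \<le> h x"
  shows "Lfun \<Omega> r m w = ereal (LINT x|lebesgue_on \<Omega>. h x)"
proof -
  have "(\<integral>\<^sup>+x. e2ennreal (ell r (m x) (w x)) \<partial>lebesgue_on \<Omega>) = (\<integral>\<^sup>+x. ennreal (h x) \<partial>lebesgue_on \<Omega>)"
    using assms(1) by (intro nn_integral_cong_AE) (auto elim!: eventually_mono)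
  also have "\<dots> = ennreal (LINT x|lebesgue_on \<Omega>. h x)" using assms(2,3) by (rule nn_integral_eq_integral)
  finally show ?thesis
    using integral_nonneg_AE[OF assms(3)] by (simp add: Lfun_def enn2ereal_ennreal)
qed

lemma Lfun_ge:
  assumes h: "integrable (lebesgue_on \<Omega>) h" and ae: "AE x in lebesgue_on \<Omega>. ereal (h x) \<le> ell r (m x) (w x)"
  shows "ereal (LINT x|lebesgue_on \<Omega>. h x) \<le> Lfun \<Omega> r m w"
proof -
  have i: "integrable (lebesgue_on \<Omega>) (\<lambda>x. max 0 (h x))" using h by auto
  have "ennreal (LINT x|lebesgue_on \<Omega>. max 0 (h x)) = (\<integral>\<^sup>+x. ennreal (max 0 (h x)) \<partial>lebesgue_on \<Omega>)"
    using i by (intro nn_integral_eq_integral[symmetric]) auto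
  also have "\<dots> \<le> (\<integral>\<^sup>+x. e2ennreal (ell r (m x) (w x)) \<partial>lebesgue_on \<Omega>)"
  proof (rule nn_integral_mono_AE)
    show "AE x in lebesgue_on \<Omega>. ennreal (max 0 (h x)) \<le> e2ennreal (ell r (m x) (w x))"
      using ae
    proof eventually_elim
      case (elim x)
      from e2ennreal_mono[OF elim] show ?case by (simp add: ennreal_max_0)
    qed
  qed
  finally have "ereal (LINT x|lebesgue_on \<Omega>. max 0 (h x)) \<le> Lfun \<Omega> r m w"
    unfolding Lfun_def by (simp add: less_eq_ennreal.rep_eq enn2ereal_ennreal integral_nonneg)
  moreover have "(LINT x|lebesgue_on \<Omega>. h x) \<le> (LINT x|lebesgue_on \<Omega>. max 0 (h x))"
    using h i by (intro integral_mono) auto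
  ultimately show ?thesis by (meson ereal_less_eq(3) order_trans)
qed

lemma ell_finite_cases:
  assumes "ell r a b \<noteq> \<infinity>" shows "a > 0 \<or> (a = 0 \<and> b = 0)"
  using assms by (auto simp: ell_def split: if_splits)

section \<open>Measures with a density\<close>

lemma sum_of_finite_measures:
  assumes fm: "finite_measure M" "finite_measure N" and se: "sets M = sets L" "sets N = sets L"
  shows "\<exists>S. finite_measure S \<and> sets S = sets L \<and> (\<forall>B\<in>sets L. measure S B = measure M B + measure N B)"
proof -
  interpret M: finite_measure M by fact
  interpret N: finite_measure N by fact
  let ?\<mu> = "\<lambda>B. emeasure M B + emeasure N B"
  define S where "S = measure_of (space L) (sets L) ?\<mu>"
  have sS: "sets S = sets L" by (simp add: S_def)
  have e: "emeasure S B = ?\<mu> B" if "B \<in> sets L" for B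
  proof (rule emeasure_measure_of[OF S_def sets.space_closed])
    show "positive (sets S) ?\<mu>" by (simp add: positive_def)
    show "countably_additive (sets S) ?\<mu>"
      unfolding countably_additive_def sS
    proof (intro allI impI)
      fix A :: "nat \<Rightarrow> 'a set" assume A: "range A \<subseteq> sets L" "disjoint_family A" "(\<Union>i. A i) \<in> sets L"
      have "(\<Sum>i. ?\<mu> (A i)) = (\<Sum>i. emeasure M (A i)) + (\<Sum>i. emeasure N (A i))"
        by (rule suminf_add[symmetric]) auto
      then show "(\<Sum>i. ?\<mu> (A i)) = ?\<mu> (\<Union>i. A i)" using A se by (simp add: suminf_emeasure)
    qed
  qed (use that sS in simp)
  have "finite_measure S"
    using sets_eq_imp_space_eq[OF sS] by (intro finite_measureI) (simp add: e M.emeasure_eq_measure N.emeasure_eq_measure)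
  moreover have "measure S B = measure M B + measure N B" if "B \<in> sets L" for B
    using e[OF that] by (intro measure_eq_emeasure_eq_ennreal)
      (simp_all add: M.emeasure_eq_measure N.emeasure_eq_measure ennreal_plus[symmetric] del: ennreal_plus)
  ultimately show ?thesis using sS by blast
qed

text \<open>The push-forward along the identity turns it into a measure on the Borel subsets of the closure, which is
  where signed measures are compared.\<close>
definition density_measure :: "'a::euclidean_space set \<Rightarrow> ('a \<Rightarrow> real) \<Rightarrow> 'a measure" where
  "density_measure \<Omega> h = distr (density (lebesgue_on \<Omega>) (\<lambda>x. ennreal (h x))) (restrict_space borel (closure \<Omega>)) (\<lambda>x. x)"

lemma id_measurable_closure: "(\<lambda>x. x) \<in> measurable (lebesgue_on \<Omega>) (restrict_space borel (closure \<Omega>))"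
proof (rule measurable_restrict_space2)
  show "(\<lambda>x. x) \<in> space (lebesgue_on \<Omega>) \<rightarrow> closure \<Omega>" using closure_subset by auto
  show "(\<lambda>x. x) \<in> measurable (lebesgue_on \<Omega>) borel"
    using id_borel_measurable_lebesgue_on[of \<Omega>] by (simp add: id_def)
qed

lemma density_measure_facts:
  fixes h :: "'a::euclidean_space \<Rightarrow> real"
  assumes h: "integrable (lebesgue_on \<Omega>) h" "\<And>x. 0 \<le> h x"
  shows "finite_measure (density_measure \<Omega> h)" "sets (density_measure \<Omega> h) = borel_subsets (closure \<Omega>)"
    "f \<in> borel_measurable (restrict_space borel (closure \<Omega>)) \<Longrightarrow> (LINT x|density_measure \<Omega> h. f x) = (LINT x|lebesgue_on \<Omega>. h x * f x)"
    "B \<in> borel_subsets (closure \<Omega>) \<Longrightarrow> measure (density_measure \<Omega> h) B = (LINT x|lebesgue_on \<Omega>. h x * indicator B x)"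
proof -
  show s: "sets (density_measure \<Omega> h) = borel_subsets (closure \<Omega>)" by (simp add: density_measure_def)
  have hm: "h \<in> borel_measurable (lebesgue_on \<Omega>)" using h by auto
  have idm: "(\<lambda>x. x) \<in> measurable (density (lebesgue_on \<Omega>) (\<lambda>x. ennreal (h x))) (restrict_space borel (closure \<Omega>))"
    using id_measurable_closure by simp
  have sp: "space (restrict_space borel (closure \<Omega>)) = closure \<Omega>" by (simp add: space_restrict_space)
  show "finite_measure (density_measure \<Omega> h)"
  proof (rule finite_measureI)
    have "emeasure (density_measure \<Omega> h) (space (density_measure \<Omega> h)) = emeasure (density (lebesgue_on \<Omega>) (\<lambda>x. ennreal (h x))) ((\<lambda>x. x) -` closure \<Omega> \<inter> \<Omega>)"
      unfolding density_measure_def using idm sets.top[of "restrict_space borel (closure \<Omega>)"] by (simp add: emeasure_distr sp)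
    also have "(\<lambda>x. x) -` closure \<Omega> \<inter> \<Omega> = \<Omega>" using closure_subset by auto
    also have "emeasure (density (lebesgue_on \<Omega>) (\<lambda>x. ennreal (h x))) \<Omega> = (\<integral>\<^sup>+x. ennreal (h x) * indicator \<Omega> x \<partial>lebesgue_on \<Omega>)"
      using hm by (subst emeasure_density) auto
    also have "\<dots> = (\<integral>\<^sup>+x. ennreal (h x) \<partial>lebesgue_on \<Omega>)"
      by (intro nn_integral_cong) (simp add: indicator_def)
    also have "\<dots> \<noteq> \<infinity>" using h(1) unfolding real_integrable_def by simp
    finally show "emeasure (density_measure \<Omega> h) (space (density_measure \<Omega> h)) \<noteq> \<infinity>" .
  qed
  show i: "(LINT x|density_measure \<Omega> h. f x) = (LINT x|lebesgue_on \<Omega>. h x * f x)"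
    if f: "f \<in> borel_measurable (restrict_space borel (closure \<Omega>))" for f :: "'a \<Rightarrow> real"
  proof -
    have f': "f \<in> borel_measurable (lebesgue_on \<Omega>)" using measurable_compose[OF id_measurable_closure f] by simp
    have "(LINT x|density_measure \<Omega> h. f x) = (LINT x|density (lebesgue_on \<Omega>) (\<lambda>x. ennreal (h x)). f x)"
      unfolding density_measure_def using idm f by (subst integral_distr) auto
    then show ?thesis using f' hm h(2) by (simp add: integral_density)
  qed
  show "measure (density_measure \<Omega> h) B = (LINT x|lebesgue_on \<Omega>. h x * indicator B x)" if B: "B \<in> borel_subsets (closure \<Omega>)"
  proof -
    have "B \<inter> space (density_measure \<Omega> h) = B"
      using sets.sets_into_space[of B "density_measure \<Omega> h"] s B by auto
    then have "measure (density_measure \<Omega> h) B = (LINT x|density_measure \<Omega> h. indicator B x)" by simp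
    then show ?thesis using i[of "indicator B"] B by simp
  qed
qed

lemma lebesgue_on_density_indicator:
  assumes S: "\<Omega> \<in> sets lebesgue"
  shows "(LINT x:A \<inter> \<Omega>|lebesgue. f x) = (LINT x|lebesgue_on \<Omega>. indicator A x * (f x :: real))"
proof -
  have "(LINT x|lebesgue_on \<Omega>. indicator A x * f x) = (LINT x|lebesgue. indicator \<Omega> x *\<^sub>R (indicator A x * f x))"
    using S by (intro integral_restrict_space) auto
  also have "\<dots> = (LINT x:A \<inter> \<Omega>|lebesgue. f x)"
    unfolding set_lebesgue_integral_def by (intro Bochner_Integration.integral_cong refl) (auto simp: indicator_def)
  finally show ?thesis by simp
qed

section \<open>The pairing of conjugate Lebesgue spaces\<close>

text \<open>The scaling parameter \<open>t\<close> makes the coefficient of \<open>|x|\<^sup>q\<close> as small as desired.\<close>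
lemma pairing_pointwise:
  fixes x y :: "'a::real_inner"
  assumes q: "q > 1" and t: "t > 0"
  shows "\<bar>y \<bullet> x\<bar> \<le> t powr q * norm x powr q + t powr (- conj_exp q) * norm y powr conj_exp q"
proof -
  note s = conj_exp_facts[OF q]
  have "\<bar>y \<bullet> x\<bar> \<le> norm (t *\<^sub>R x) * norm ((1 / t) *\<^sub>R y)"
    using Cauchy_Schwarz_ineq2[of y x] t by (simp add: mult.commute)
  also have "\<dots> \<le> norm (t *\<^sub>R x) powr q / q + norm ((1 / t) *\<^sub>R y) powr conj_exp q / conj_exp q"
    using q s by (intro Youngs_inequality) auto
  also have "\<dots> \<le> norm (t *\<^sub>R x) powr q + norm ((1 / t) *\<^sub>R y) powr conj_exp q"
  proof -
    have d: "a / p \<le> a" if "a \<ge> 0" "p > 1" for a p :: real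
      using that mult_left_mono[of 1 p a] by (simp add: divide_le_eq)
    show ?thesis using q s by (intro add_mono d) auto
  qed
  also have "\<dots> = t powr q * norm x powr q + t powr (- conj_exp q) * norm y powr conj_exp q"
    using t by (simp add: powr_mult powr_divide powr_minus_divide)
  finally show ?thesis .
qed

lemma Lp_pairing_integrable:
  fixes f g :: "'a::euclidean_space \<Rightarrow> 'a"
  assumes q: "q > 1" and f: "f \<in> Lp \<Omega> (conj_exp q)" and g: "g \<in> Lp \<Omega> q"
  shows "integrable (lebesgue_on \<Omega>) (\<lambda>x. f x \<bullet> g x)"
proof (rule Bochner_Integration.integrable_bound)
  show "integrable (lebesgue_on \<Omega>) (\<lambda>x. norm (g x) powr q + norm (f x) powr conj_exp q)"
    using f g by (auto simp: Lp_def)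
  show "(\<lambda>x. f x \<bullet> g x) \<in> borel_measurable (lebesgue_on \<Omega>)" using f g by (auto simp: Lp_def)
  show "AE x in lebesgue_on \<Omega>. norm (f x \<bullet> g x) \<le> norm (norm (g x) powr q + norm (f x) powr conj_exp q)"
    using pairing_pointwise[OF q zero_less_one] by (intro AE_I2) (simp add: add_nonneg_nonneg)
qed

text \<open>Continuity of the pairing, obtained from the pointwise bound with a small \<open>t\<close> that depends on \<open>g\<close> only.\<close>
lemma Lp_pairing_small:
  fixes g :: "'a::euclidean_space \<Rightarrow> 'a"
  assumes q: "q > 1" and g: "g \<in> Lp \<Omega> q" and \<eta>: "\<eta> > 0"
  shows "\<exists>\<epsilon>>0. \<forall>f\<in>Lp \<Omega> (conj_exp q). Lp_norm \<Omega> (conj_exp q) f < \<epsilon> \<longrightarrow> \<bar>LINT x|lebesgue_on \<Omega>. f x \<bullet> g x\<bar> \<le> \<eta>"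
proof -
  let ?s = "conj_exp q"
  note s = conj_exp_facts[OF q]
  define G where "G = (LINT x|lebesgue_on \<Omega>. norm (g x) powr q)"
  have G: "G \<ge> 0" by (simp add: G_def)
  obtain t where t: "t > 0" "G * t powr q \<le> \<eta> / 2"
    using powr_small[of q "\<eta> / 2" G 1] q \<eta> G by auto
  obtain \<epsilon> where e: "\<epsilon> > 0" "t powr (- ?s) * \<epsilon> powr ?s \<le> \<eta> / 2"
    using powr_small[of ?s "\<eta> / 2" "t powr (- ?s)" 1] s \<eta> by auto
  have "\<bar>LINT x|lebesgue_on \<Omega>. f x \<bullet> g x\<bar> \<le> \<eta>" if f: "f \<in> Lp \<Omega> ?s" and n: "Lp_norm \<Omega> ?s f < \<epsilon>" for f :: "'a \<Rightarrow> 'a"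
  proof -
    have i: "integrable (lebesgue_on \<Omega>) (\<lambda>x. norm (g x) powr q)" "integrable (lebesgue_on \<Omega>) (\<lambda>x. norm (f x) powr ?s)"
      using f g by (auto simp: Lp_def)
    have "\<bar>LINT x|lebesgue_on \<Omega>. f x \<bullet> g x\<bar> \<le> (LINT x|lebesgue_on \<Omega>. \<bar>f x \<bullet> g x\<bar>)" by (rule integral_abs_bound)
    also have "\<dots> \<le> (LINT x|lebesgue_on \<Omega>. t powr q * norm (g x) powr q + t powr (- ?s) * norm (f x) powr ?s)"
      using pairing_pointwise[OF q t(1)] i
      by (intro integral_mono integrable_abs Lp_pairing_integrable[OF q f g]) auto
    also have "\<dots> = t powr q * G + t powr (- ?s) * Lp_norm \<Omega> ?s f powr ?s"
      using i s(1) by (simp add: G_def Lp_norm_powr)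
    finally have fin: "\<bar>LINT x|lebesgue_on \<Omega>. f x \<bullet> g x\<bar> \<le> t powr q * G + t powr (- ?s) * Lp_norm \<Omega> ?s f powr ?s" .
    have "Lp_norm \<Omega> ?s f powr ?s \<le> \<epsilon> powr ?s" using n s(1) by (intro powr_mono2) (auto simp: Lp_norm_def)
    then have "t powr (- ?s) * Lp_norm \<Omega> ?s f powr ?s \<le> t powr (- ?s) * \<epsilon> powr ?s" by (rule mult_left_mono) simp
    with fin t(2) e(2) mult.commute[of G "t powr q"] show ?thesis by linarith
  qed
  then show ?thesis using e(1) by blast
qed

section \<open>Dual functionals and the closure of the constraint set\<close>

locale sobolev_domain =
  fixes \<Omega> :: "'a::euclidean_space set" and q :: real
  assumes op: "open \<Omega>" and bd: "bounded \<Omega>" and sb: "smooth_boundary \<Omega>" and qd: "q > real DIM('a)"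
begin

lemma q1: "q > 1"
  using qd DIM_ge_Suc0[where 'a='a] by linarith

lemma Om_sets: "\<Omega> \<in> sets lebesgue"
  using op by auto

lemma lm: "\<Omega> \<in> lmeasurable"
  using op bd by (rule bounded_open_lmeasurable[rotated])

lemma finite_Om: "finite_measure (lebesgue_on \<Omega>)"
  by (rule finite_measure_lebesgue_on[OF lm])

lemma compact_closure_Om: "compact (closure \<Omega>)"
  using bd by simp

lemma lincomb: "u \<in> W1 \<Omega> q \<Longrightarrow> v \<in> W1 \<Omega> q \<Longrightarrow> (\<lambda>x. a * u x + b * v x) \<in> W1 \<Omega> q"
  using W1_lincomb[OF op, of q] q1 by simp

lemma cmult: "u \<in> W1 \<Omega> q \<Longrightarrow> (\<lambda>x. a * u x) \<in> W1 \<Omega> q"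
  using lincomb[of u u a 0] by simp

lemma one_W1: "(\<lambda>x. c) \<in> W1 \<Omega> q"
  using q1 by (intro smooth_in_W1[OF op bd] smooth_const) simp

lemma rep_cont: "u \<in> W1 \<Omega> q \<Longrightarrow> continuous_on (closure \<Omega>) (cont_rep \<Omega> u)"
  by (rule cont_rep(1)[OF op bd sb qd])

lemma rep_AE: "u \<in> W1 \<Omega> q \<Longrightarrow> AE x in lebesgue_on \<Omega>. cont_rep \<Omega> u x = u x"
  by (rule cont_rep(2)[OF op bd sb qd])

lemma rep_W1: "u \<in> W1 \<Omega> q \<Longrightarrow> cont_rep \<Omega> u \<in> W1 \<Omega> q"
proof (rule W1_cong_AE(1)[OF op])
  assume u: "u \<in> W1 \<Omega> q"
  show "AE x in lebesgue_on \<Omega>. u x = cont_rep \<Omega> u x" using rep_AE[OF u] by eventually_elim simp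
qed

lemma rep_eq: "continuous_on (closure \<Omega>) u \<Longrightarrow> x \<in> closure \<Omega> \<Longrightarrow> cont_rep \<Omega> u x = u x"
  by (rule cont_rep_unique[OF op]) auto

lemma rep_lincomb:
  assumes "u \<in> W1 \<Omega> q" "v \<in> W1 \<Omega> q" "x \<in> closure \<Omega>"
  shows "cont_rep \<Omega> (\<lambda>x. a * u x + b * v x) x = a * cont_rep \<Omega> u x + b * cont_rep \<Omega> v x"
proof (rule cont_rep_unique[OF op _ _ assms(3)])
  show "continuous_on (closure \<Omega>) (\<lambda>x. a * cont_rep \<Omega> u x + b * cont_rep \<Omega> v x)"
    by (intro continuous_intros rep_cont assms)
  show "AE x in lebesgue_on \<Omega>. a * cont_rep \<Omega> u x + b * cont_rep \<Omega> v x = a * u x + b * v x"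
    using rep_AE[OF assms(1)] rep_AE[OF assms(2)] by eventually_elim simp
qed

lemma continuous_closure_bounded:
  fixes f :: "'a \<Rightarrow> real"
  assumes "continuous_on (closure \<Omega>) f" shows "\<exists>C. \<forall>x\<in>closure \<Omega>. \<bar>f x\<bar> \<le> C"
  using compact_imp_bounded[OF compact_continuous_image[OF assms compact_closure_Om]] by (fastforce simp: bounded_iff)

lemma continuous_measure_integrable:
  fixes f :: "'a \<Rightarrow> real"
  assumes f: "continuous_on (closure \<Omega>) f" and M: "finite_measure M" "sets M = borel_subsets (closure \<Omega>)"
  shows "integrable M f"
proof -
  interpret finite_measure M by fact
  obtain C where C: "\<forall>x\<in>closure \<Omega>. \<bar>f x\<bar> \<le> C" using continuous_closure_bounded[OF f] by blast
  have "space M = closure \<Omega>" using sets_eq_imp_space_eq[OF M(2)] by (simp add: space_restrict_space)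
  moreover have "f \<in> borel_measurable M"
    using borel_measurable_continuous_on_restrict[OF f] M(2) by (simp cong: measurable_cong_sets)
  ultimately show ?thesis using C by (intro integrable_const_bound[where B=C]) auto
qed

lemma continuous_closure_measurable:
  fixes f :: "'a \<Rightarrow> 'b::topological_space"
  assumes "continuous_on (closure \<Omega>) f" shows "f \<in> borel_measurable (lebesgue_on \<Omega>)"
  using measurable_compose[OF id_measurable_closure borel_measurable_continuous_on_restrict[OF assms]] by simp

lemma bounded_mult_integrable:
  fixes f h :: "'a \<Rightarrow> real"
  assumes h: "integrable (lebesgue_on \<Omega>) h" and f: "f \<in> borel_measurable (lebesgue_on \<Omega>)" and b: "AE x in lebesgue_on \<Omega>. \<bar>f x\<bar> \<le> C"
  shows "integrable (lebesgue_on \<Omega>) (\<lambda>x. h x * f x)"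
proof (rule Bochner_Integration.integrable_bound)
  show "integrable (lebesgue_on \<Omega>) (\<lambda>x. C * \<bar>h x\<bar>)" using h by auto
  show "(\<lambda>x. h x * f x) \<in> borel_measurable (lebesgue_on \<Omega>)" using h f by auto
  show "AE x in lebesgue_on \<Omega>. norm (h x * f x) \<le> norm (C * \<bar>h x\<bar>)"
    using b
  proof eventually_elim
    case (elim x)
    have "\<bar>h x\<bar> * \<bar>f x\<bar> \<le> \<bar>h x\<bar> * \<bar>C\<bar>" using elim by (intro mult_left_mono) auto
    then show ?case by (simp add: abs_mult mult.commute)
  qed
qed

lemma energy_le_one: "W1_norm \<Omega> q u \<le> 1 \<Longrightarrow> energy \<Omega> q u \<le> 1"
  using q1 powr_le1[of q "W1_norm \<Omega> q u"] by (simp add: energy_eq W1_norm_nonneg)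

text \<open>For norm \<open>0\<close> the homogeneity itself forces the value \<open>0\<close>, since all multiples of \<open>u\<close> lie in the unit ball.\<close>
lemma homogeneous_bound:
  assumes hom: "\<And>c u. u \<in> W1 \<Omega> q \<Longrightarrow> F (\<lambda>x. c * u x) = c * (F u :: real)"
    and unit: "\<And>u. u \<in> W1 \<Omega> q \<Longrightarrow> W1_norm \<Omega> q u \<le> 1 \<Longrightarrow> \<bar>F u\<bar> \<le> C"
    and u: "u \<in> W1 \<Omega> q"
  shows "\<bar>F u\<bar> \<le> C * W1_norm \<Omega> q u"
proof -
  let ?N = "W1_norm \<Omega> q u"
  have sc: "W1_norm \<Omega> q (\<lambda>x. c * u x) = \<bar>c\<bar> * ?N" for c
    using W1_norm_scale[OF op _ u] q1 by simp
  have key: "\<bar>c\<bar> * \<bar>F u\<bar> \<le> C" if "\<bar>c\<bar> * ?N \<le> 1" for c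
    using unit[OF cmult[OF u], of c] that by (simp add: sc hom[OF u] abs_mult)
  show ?thesis
  proof (cases "?N = 0")
    case True
    have "F u = 0"
    proof (rule ccontr)
      assume "F u \<noteq> 0"
      then have d: "\<bar>F u\<bar> > 0" by simp
      obtain n where "C < real n * \<bar>F u\<bar>" using reals_Archimedean3[OF d] by blast
      then show False using key[of "real n"] True by simp
    qed
    then show ?thesis using True by simp
  next
    case False
    then have N: "?N > 0" using W1_norm_nonneg[of \<Omega> q u] by linarith
    have "\<bar>1 / ?N\<bar> * \<bar>F u\<bar> \<le> C" using N by (intro key) simp
    then show ?thesis using N by (simp add: field_simps)
  qed
qed

lemma rep_bound: "\<exists>C\<ge>0. \<forall>u\<in>W1 \<Omega> q. \<forall>x\<in>closure \<Omega>. \<bar>cont_rep \<Omega> u x\<bar> \<le> C * W1_norm \<Omega> q u"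
proof -
  obtain C where C: "\<And>u x. u \<in> W1 \<Omega> q \<Longrightarrow> energy \<Omega> q u \<le> 1 \<Longrightarrow> x \<in> closure \<Omega> \<Longrightarrow> \<bar>cont_rep \<Omega> u x\<bar> \<le> C"
    using W1_bounded[OF op bd sb qd zero_le_one] by blast
  have "\<bar>cont_rep \<Omega> u x\<bar> \<le> max C 0 * W1_norm \<Omega> q u" if u: "u \<in> W1 \<Omega> q" and x: "x \<in> closure \<Omega>" for u x
  proof (rule homogeneous_bound[OF _ _ u])
    show "cont_rep \<Omega> (\<lambda>x. c * v x) x = c * cont_rep \<Omega> v x" if "v \<in> W1 \<Omega> q" for c v
      using rep_lincomb[OF that that x, of c 0] by simp
    show "\<bar>cont_rep \<Omega> v x\<bar> \<le> max C 0" if "v \<in> W1 \<Omega> q" "W1_norm \<Omega> q v \<le> 1" for v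
      using C[OF that(1) energy_le_one[OF that(2)] x] by simp
  qed
  then show ?thesis by (intro exI[of _ "max C 0"]) auto
qed

lemma dual_lincomb: "F \<in> W1_dual \<Omega> q \<Longrightarrow> u \<in> W1 \<Omega> q \<Longrightarrow> v \<in> W1 \<Omega> q \<Longrightarrow> F (\<lambda>x. a * u x + b * v x) = a * F u + b * F v"
  by (simp add: W1_dual_def)

lemma dual_cmult: "F \<in> W1_dual \<Omega> q \<Longrightarrow> u \<in> W1 \<Omega> q \<Longrightarrow> F (\<lambda>x. a * u x) = a * F u"
  using dual_lincomb[of F u u a 0] by simp

lemma dual_diff: "F \<in> W1_dual \<Omega> q \<Longrightarrow> u \<in> W1 \<Omega> q \<Longrightarrow> v \<in> W1 \<Omega> q \<Longrightarrow> F (\<lambda>x. u x - v x) = F u - F v"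
  using dual_lincomb[of F u v 1 "-1"] by simp

lemma dual_bounded: "F \<in> W1_dual \<Omega> q \<Longrightarrow> \<exists>C. \<forall>u\<in>W1 \<Omega> q. \<bar>F u\<bar> \<le> C * W1_norm \<Omega> q u"
  unfolding W1_dual_def by blast

lemma dual_cong_AE:
  assumes F: "F \<in> W1_dual \<Omega> q" and u: "u \<in> W1 \<Omega> q" and ae: "AE x in lebesgue_on \<Omega>. u x = v x"
  shows "F u = F v"
proof -
  have v: "v \<in> W1 \<Omega> q" by (rule W1_cong_AE(1)[OF op u ae])
  obtain C where C: "\<And>u. u \<in> W1 \<Omega> q \<Longrightarrow> \<bar>F u\<bar> \<le> C * W1_norm \<Omega> q u" using dual_bounded[OF F] by blast
  have d: "(\<lambda>x. u x - v x) \<in> W1 \<Omega> q" using lincomb[OF u v, of 1 "-1"] by simp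
  have "W1_norm \<Omega> q (\<lambda>x. u x - v x) = W1_norm \<Omega> q (\<lambda>x. 0 * u x)"
  proof (rule W1_cong_AE(2)[OF op cmult[OF u]])
    show "AE x in lebesgue_on \<Omega>. 0 * u x = u x - v x" using ae by eventually_elim simp
  qed
  also have "\<dots> = 0" using W1_norm_scale[OF op _ u, of 0] q1 by simp
  finally have "F (\<lambda>x. u x - v x) = 0" using C[OF d] by simp
  then show ?thesis using dual_diff[OF F u v] by simp
qed

lemma Linf_pairing_integrable:
  assumes a: "a \<in> Linf \<Omega>" and u: "u \<in> W1 \<Omega> q" shows "integrable (lebesgue_on \<Omega>) (\<lambda>x. a x * u x)"
proof -
  obtain C where "a \<in> borel_measurable (lebesgue_on \<Omega>)" "AE x in lebesgue_on \<Omega>. \<bar>a x\<bar> \<le> C"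
    using a by (auto simp: Linf_def)
  from bounded_mult_integrable[OF W1_integrable(1)[OF op bd less_imp_le[OF q1] u] this]
  show ?thesis by (simp add: mult.commute)
qed

lemma Linf_pairing_bound:
  assumes a: "a \<in> Linf \<Omega>"
  shows "\<exists>C. \<forall>u\<in>W1 \<Omega> q. W1_norm \<Omega> q u \<le> 1 \<longrightarrow> \<bar>LINT x|lebesgue_on \<Omega>. a x * u x\<bar> \<le> C"
proof -
  obtain A where A: "AE x in lebesgue_on \<Omega>. \<bar>a x\<bar> \<le> A" using a by (auto simp: Linf_def)
  have "\<bar>LINT x|lebesgue_on \<Omega>. a x * u x\<bar> \<le> \<bar>A\<bar> * (measure lebesgue \<Omega> + 1)"
    if u: "u \<in> W1 \<Omega> q" "W1_norm \<Omega> q u \<le> 1" for u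
  proof -
    note iu = W1_integrable[OF op bd less_imp_le[OF q1] u(1)]
    have "\<bar>LINT x|lebesgue_on \<Omega>. a x * u x\<bar> \<le> (LINT x|lebesgue_on \<Omega>. \<bar>a x * u x\<bar>)" by (rule integral_abs_bound)
    also have "\<dots> \<le> (LINT x|lebesgue_on \<Omega>. \<bar>A\<bar> * \<bar>u x\<bar>)"
    proof (rule integral_mono_AE)
      show "AE x in lebesgue_on \<Omega>. \<bar>a x * u x\<bar> \<le> \<bar>A\<bar> * \<bar>u x\<bar>"
        using A by eventually_elim (auto simp: abs_mult intro!: mult_right_mono)
    qed (use Linf_pairing_integrable[OF a u(1)] iu(1) in auto)
    also have "\<dots> = \<bar>A\<bar> * (LINT x|lebesgue_on \<Omega>. \<bar>u x\<bar>)" by simp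
    also have "\<dots> \<le> \<bar>A\<bar> * (measure lebesgue \<Omega> + 1)"
      using iu(2) energy_le_one[OF u(2)] by (intro mult_left_mono) auto
    finally show ?thesis .
  qed
  then show ?thesis by blast
qed

text \<open>The pointwise inequality \<open>ell_ge_pairing\<close> integrated over \<open>\<Omega>\<close>.\<close>
lemma A_pairing_le:
  assumes r: "1 < r" and ab: "(a, b) \<in> A_set \<Omega> (conj_exp r)" and m: "m \<in> W1 \<Omega> q" and w: "w \<in> Lp \<Omega> q"
  shows "ereal ((LINT x|lebesgue_on \<Omega>. a x * m x) + (LINT x|lebesgue_on \<Omega>. b x \<bullet> w x)) \<le> Lfun \<Omega> r m w" "b \<in> Lp \<Omega> (conj_exp q)"
proof -
  have a: "a \<in> Linf \<Omega>" and b: "b \<in> Linf \<Omega>" and ae: "AE x in lebesgue_on \<Omega>. a x + 1 / conj_exp r * norm (b x) powr conj_exp r \<le> 0"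
    using ab by (auto simp: A_set_def)
  interpret finite_measure "lebesgue_on \<Omega>" by (rule finite_Om)
  obtain B where B: "b \<in> borel_measurable (lebesgue_on \<Omega>)" "AE x in lebesgue_on \<Omega>. norm (b x) \<le> B" using b by (auto simp: Linf_def)
  have "integrable (lebesgue_on \<Omega>) (\<lambda>x. norm (b x) powr conj_exp q)"
  proof (rule integrable_const_bound[where B="B powr conj_exp q"])
    show "AE x in lebesgue_on \<Omega>. norm (norm (b x) powr conj_exp q) \<le> B powr conj_exp q"
      using B(2) by eventually_elim (use conj_exp_facts(1)[OF q1] in \<open>auto intro!: powr_mono2\<close>)
  qed (use B in auto)
  then show bL: "b \<in> Lp \<Omega> (conj_exp q)" using B by (simp add: Lp_def)
  have i: "integrable (lebesgue_on \<Omega>) (\<lambda>x. a x * m x)" "integrable (lebesgue_on \<Omega>) (\<lambda>x. b x \<bullet> w x)"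
    using Linf_pairing_integrable[OF a m] Lp_pairing_integrable[OF q1 bL w] .
  have "ereal (LINT x|lebesgue_on \<Omega>. a x * m x + b x \<bullet> w x) \<le> Lfun \<Omega> r m w"
  proof (rule Lfun_ge)
    show "AE x in lebesgue_on \<Omega>. ereal (a x * m x + b x \<bullet> w x) \<le> ell r (m x) (w x)"
      using ae by eventually_elim (rule ell_ge_pairing[OF r])
  qed (use i in auto)
  then show "ereal ((LINT x|lebesgue_on \<Omega>. a x * m x) + (LINT x|lebesgue_on \<Omega>. b x \<bullet> w x)) \<le> Lfun \<Omega> r m w" using i by simp
qed

text \<open>Both sides of the pairing are continuous in \<open>(F, \<beta>)\<close>, so the inequality passes from \<open>A_set\<close> to its closure.\<close>
lemma A_closure_pairing_le:
  assumes r: "1 < r" and FB: "(F, \<beta>) \<in> A_closure \<Omega> q (conj_exp r)" and m: "m \<in> W1 \<Omega> q" and w: "w \<in> Lp \<Omega> q"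
  shows "ereal (F m + (LINT x|lebesgue_on \<Omega>. \<beta> x \<bullet> w x)) \<le> Lfun \<Omega> r m w"
proof -
  have F: "F \<in> W1_dual \<Omega> q" and \<beta>: "\<beta> \<in> Lp \<Omega> (conj_exp q)" using FB by (auto simp: A_closure_def)
  have ap: "\<exists>a b. (a, b) \<in> A_set \<Omega> (conj_exp r) \<and>
           W1_dual_norm \<Omega> q (\<lambda>u. F u - function_functional \<Omega> q a u) < \<epsilon> \<and> Lp_norm \<Omega> (conj_exp q) (\<lambda>x. \<beta> x - b x) < \<epsilon>"
    if "\<epsilon> > 0" for \<epsilon>
  proof -
    have "\<forall>\<epsilon>>0. \<exists>(a, b)\<in>A_set \<Omega> (conj_exp r).
        W1_dual_norm \<Omega> q (\<lambda>u. F u - function_functional \<Omega> q a u) < \<epsilon> \<and> Lp_norm \<Omega> (conj_exp q) (\<lambda>x. \<beta> x - b x) < \<epsilon>"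
      using FB by (simp add: A_closure_def)
    from this[rule_format, OF that] obtain p where p: "p \<in> A_set \<Omega> (conj_exp r)" "case p of (a, b) \<Rightarrow>
           W1_dual_norm \<Omega> q (\<lambda>u. F u - function_functional \<Omega> q a u) < \<epsilon> \<and> Lp_norm \<Omega> (conj_exp q) (\<lambda>x. \<beta> x - b x) < \<epsilon>"
      by blast
    then show ?thesis by (cases p) auto
  qed
  have main: "ereal (F m + (LINT x|lebesgue_on \<Omega>. \<beta> x \<bullet> w x) - \<eta>) \<le> Lfun \<Omega> r m w" if \<eta>: "\<eta> > 0" for \<eta>
  proof -
    obtain e1 where e1: "e1 > 0" "\<And>f. f \<in> Lp \<Omega> (conj_exp q) \<Longrightarrow> Lp_norm \<Omega> (conj_exp q) f < e1 \<Longrightarrow> \<bar>LINT x|lebesgue_on \<Omega>. f x \<bullet> w x\<bar> \<le> \<eta> / 2"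
      using Lp_pairing_small[OF q1 w half_gt_zero[OF \<eta>]] by blast
    define N where "N = W1_norm \<Omega> q m"
    have N: "N \<ge> 0" by (simp add: N_def W1_norm_nonneg)
    define e where "e = min e1 (\<eta> / 2 / (N + 1))"
    have e: "e > 0" "e \<le> e1" "e * N \<le> \<eta> / 2"
    proof -
      show "e > 0" "e \<le> e1" using e1 \<eta> N by (auto simp: e_def)
      have "e * N \<le> \<eta> / 2 / (N + 1) * (N + 1)" using N \<open>e > 0\<close> by (intro mult_mono) (auto simp: e_def)
      moreover have "\<eta> / 2 / d * d = \<eta> / 2" if "d > 0" for d using that by simp
      ultimately show "e * N \<le> \<eta> / 2" using N by (metis add_nonneg_pos zero_less_one)
    qed
    obtain a b where ab: "(a, b) \<in> A_set \<Omega> (conj_exp r)"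
      and n1: "W1_dual_norm \<Omega> q (\<lambda>u. F u - function_functional \<Omega> q a u) < e"
      and n2: "Lp_norm \<Omega> (conj_exp q) (\<lambda>x. \<beta> x - b x) < e"
      using ap[OF e(1)] by blast
    have a: "a \<in> Linf \<Omega>" using ab by (simp add: A_set_def)
    note AB = A_pairing_le[OF r ab m w]
    have d: "(\<lambda>x. \<beta> x - b x) \<in> Lp \<Omega> (conj_exp q)"
      using Lp_add[OF _ \<beta> Lp_scaleR[OF AB(2), of "-1"]] conj_exp_facts(1)[OF q1] by simp
    have "(LINT x|lebesgue_on \<Omega>. (\<beta> x - b x) \<bullet> w x) = (LINT x|lebesgue_on \<Omega>. \<beta> x \<bullet> w x) - (LINT x|lebesgue_on \<Omega>. b x \<bullet> w x)"
      using Lp_pairing_integrable[OF q1 \<beta> w] Lp_pairing_integrable[OF q1 AB(2) w] by (simp add: inner_diff_left)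
    then have p2: "\<bar>(LINT x|lebesgue_on \<Omega>. \<beta> x \<bullet> w x) - (LINT x|lebesgue_on \<Omega>. b x \<bullet> w x)\<bar> \<le> \<eta> / 2"
      using e1(2)[OF d] n2 e(2) by simp
    let ?G = "\<lambda>u. F u - function_functional \<Omega> q a u"
    obtain C1 where C1: "\<And>u. u \<in> W1 \<Omega> q \<Longrightarrow> W1_norm \<Omega> q u \<le> 1 \<Longrightarrow> \<bar>F u\<bar> \<le> C1"
    proof -
      obtain C where C: "\<And>u. u \<in> W1 \<Omega> q \<Longrightarrow> \<bar>F u\<bar> \<le> C * W1_norm \<Omega> q u" using dual_bounded[OF F] by blast
      have "\<bar>F u\<bar> \<le> \<bar>C\<bar>" if "u \<in> W1 \<Omega> q" "W1_norm \<Omega> q u \<le> 1" for u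
      proof -
        have "C * W1_norm \<Omega> q u \<le> \<bar>C\<bar> * 1" using that W1_norm_nonneg[of \<Omega> q u] by (intro mult_mono) auto
        then show ?thesis using C[OF that(1)] by linarith
      qed
      then show thesis using that by blast
    qed
    obtain C2 where C2: "\<And>u. u \<in> W1 \<Omega> q \<Longrightarrow> W1_norm \<Omega> q u \<le> 1 \<Longrightarrow> \<bar>LINT x|lebesgue_on \<Omega>. a x * u x\<bar> \<le> C2"
      using Linf_pairing_bound[OF a] by blast
    have "\<bar>?G m\<bar> \<le> e * W1_norm \<Omega> q m"
    proof (rule homogeneous_bound[OF _ _ m])
      show "?G (\<lambda>x. c * u x) = c * ?G u" if u: "u \<in> W1 \<Omega> q" for c u
      proof -
        have "(LINT x|lebesgue_on \<Omega>. a x * (c * u x)) = c * (LINT x|lebesgue_on \<Omega>. a x * u x)"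
          unfolding integral_mult_right_zero[symmetric] by (intro Bochner_Integration.integral_cong refl) simp
        then show ?thesis using u cmult[OF u] by (simp add: dual_cmult[OF F u] function_functional_def right_diff_distrib)
      qed
      have bdd: "bdd_above ((\<lambda>u. \<bar>?G u\<bar>) ` {u \<in> W1 \<Omega> q. W1_norm \<Omega> q u \<le> 1})"
      proof (rule bdd_aboveI2[where M="C1 + C2"])
        fix u assume "u \<in> {u \<in> W1 \<Omega> q. W1_norm \<Omega> q u \<le> 1}"
        then show "\<bar>?G u\<bar> \<le> C1 + C2" using C1[of u] C2[of u] by (auto simp: function_functional_def)
      qed
      show "\<bar>?G u\<bar> \<le> e" if u: "u \<in> W1 \<Omega> q" "W1_norm \<Omega> q u \<le> 1" for u
      proof -
        have "\<bar>?G u\<bar> \<le> W1_dual_norm \<Omega> q ?G"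
          unfolding W1_dual_norm_def by (rule cSUP_upper[OF _ bdd]) (use u in simp)
        then show ?thesis using n1 by simp
      qed
    qed
    then have p1: "\<bar>F m - (LINT x|lebesgue_on \<Omega>. a x * m x)\<bar> \<le> \<eta> / 2"
      using e(3) m by (simp add: function_functional_def N_def)
    have "F m + (LINT x|lebesgue_on \<Omega>. \<beta> x \<bullet> w x) - \<eta> \<le> (LINT x|lebesgue_on \<Omega>. a x * m x) + (LINT x|lebesgue_on \<Omega>. b x \<bullet> w x)"
      using p1 p2 by linarith
    then show ?thesis using AB(1) by (meson ereal_less_eq(3) order_trans)
  qed
  show ?thesis
  proof (cases "Lfun \<Omega> r m w")
    case (real L)
    have "F m + (LINT x|lebesgue_on \<Omega>. \<beta> x \<bullet> w x) \<le> L"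
    proof (rule field_le_epsilon)
      fix \<eta> :: real assume "0 < \<eta>"
      from main[OF this] show "F m + (LINT x|lebesgue_on \<Omega>. \<beta> x \<bullet> w x) \<le> L + \<eta>" by (simp add: real)
    qed
    then show ?thesis by (simp add: real)
  next
    case MInf
    then show ?thesis using main[of 1] by simp
  qed simp
qed

text \<open>The closure is cut into pieces of small diameter, and the mass of each piece is spread evenly over the part of
  \<open>\<Omega>\<close> in a ball around it, which has positive volume. Since the unit ball of \<open>W1 \<Omega> q\<close> is equicontinuous, this changes the integrals of all its members by little.\<close>
lemma smear_measure:
  assumes M: "finite_measure M" "sets M = borel_subsets (closure \<Omega>)" and \<epsilon>: "\<epsilon> > 0"
  shows "\<exists>b\<in>Linf \<Omega>. (\<forall>x. 0 \<le> b x) \<and> (\<forall>u\<in>W1 \<Omega> q. W1_norm \<Omega> q u \<le> 1 \<longrightarrow>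
    \<bar>(LINT x|M. cont_rep \<Omega> u x) - (LINT x|lebesgue_on \<Omega>. b x * u x)\<bar> \<le> \<epsilon>)"
proof -
  interpret M: finite_measure M by (rule M(1))
  interpret L: finite_measure "lebesgue_on \<Omega>" by (rule finite_Om)
  have spM: "space M = closure \<Omega>" using sets_eq_imp_space_eq[OF M(2)] by (simp add: space_restrict_space)
  define \<eta> where "\<eta> = \<epsilon> / (2 * (measure M (closure \<Omega>) + 1))"
  have m0: "measure M (closure \<Omega>) \<ge> 0" by simp
  have \<eta>: "\<eta> > 0" "2 * \<eta> * measure M (closure \<Omega>) \<le> \<epsilon>"
  proof -
    show "\<eta> > 0" unfolding \<eta>_def using \<epsilon> m0 by (intro divide_pos_pos mult_pos_pos) linarith+
    have "2 * \<eta> * measure M (closure \<Omega>) \<le> 2 * \<eta> * (measure M (closure \<Omega>) + 1)" using \<open>\<eta> > 0\<close> by (intro mult_left_mono) auto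
    also have "\<dots> = \<epsilon>"
    proof -
      have "2 * (\<epsilon> / (2 * d)) * d = \<epsilon>" if "d > 0" for d using that by simp
      from this[of "measure M (closure \<Omega>) + 1"] show ?thesis unfolding \<eta>_def using m0 by linarith
    qed
    finally show "2 * \<eta> * measure M (closure \<Omega>) \<le> \<epsilon>" .
  qed
  obtain \<delta> where \<delta>: "\<delta> > 0" "\<And>u x y. u \<in> W1 \<Omega> q \<Longrightarrow> energy \<Omega> q u \<le> 1 \<Longrightarrow> x \<in> closure \<Omega> \<Longrightarrow> y \<in> closure \<Omega> \<Longrightarrow> dist x y < \<delta> \<Longrightarrow>
     \<bar>cont_rep \<Omega> u x - cont_rep \<Omega> u y\<bar> \<le> \<eta>"
    using W1_equicontinuous[OF op bd sb qd \<eta>(1) zero_le_one] by blast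
  obtain D where D: "finite D" "D \<subseteq> closure \<Omega>" "closure \<Omega> \<subseteq> (\<Union>x\<in>D. ball x \<delta>)"
  proof -
    have sub: "closure \<Omega> \<subseteq> (\<Union>x\<in>closure \<Omega>. ball x \<delta>)" using \<delta>(1) by force
    have "\<exists>D\<subseteq>closure \<Omega>. finite D \<and> closure \<Omega> \<subseteq> (\<Union>x\<in>D. ball x \<delta>)"
      using compactE_image[OF compact_closure_Om _ sub] by (metis open_ball)
    then show thesis using that by blast
  qed
  obtain c :: "nat \<Rightarrow> 'a" and n where c: "D = c ` {..<n}"
    using D(1) finite_imp_nat_seg_image_inj_on[of D] by (metis lessThan_def)
  \<comment> \<open>The mass of the piece \<open>P k\<close>, which may lie on the boundary, is spread over \<open>B k\<close> inside \<open>\<Omega>\<close>.\<close>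
  define P where "P k = closure \<Omega> \<inter> ball (c k) \<delta> - (\<Union>j<k. ball (c j) \<delta>)" for k
  define B where "B k = \<Omega> \<inter> ball (c k) \<delta>" for k
  have ck: "c k \<in> closure \<Omega>" if "k < n" for k using D(2) c that by auto
  have Pm: "P k \<in> sets M" for k
  proof -
    have "closure \<Omega> \<inter> (ball (c k) \<delta> - (\<Union>j<k. ball (c j) \<delta>)) \<in> borel_subsets (closure \<Omega>)"
      unfolding sets_restrict_space by (rule imageI) auto
    moreover have "closure \<Omega> \<inter> (ball (c k) \<delta> - (\<Union>j<k. ball (c j) \<delta>)) = P k" by (auto simp: P_def)
    ultimately show ?thesis using M(2) by simp
  qed
  have Bm: "B k \<in> sets (lebesgue_on \<Omega>)" for k
    using op Om_sets by (simp add: sets_restrict_space_iff B_def open_Int)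
  have Bpos: "measure (lebesgue_on \<Omega>) (B k) > 0" if k: "k < n" for k
  proof -
    obtain y where "y \<in> \<Omega>" "dist y (c k) < \<delta>" using ck[OF k] \<delta>(1) unfolding closure_approachable by blast
    then have "y \<in> B k" by (simp add: B_def dist_commute)
    then have "B k \<noteq> {}" by blast
    moreover have "open (B k)" using op by (simp add: B_def open_Int)
    ultimately have "\<not> negligible (B k)" using open_not_negligible by blast
    moreover have "B k \<in> lmeasurable" using bd \<open>open (B k)\<close> by (intro bounded_open_lmeasurable) (auto simp: B_def intro: bounded_subset)
    ultimately have "measure lebesgue (B k) \<noteq> 0" using negligible_iff_measure0 by blast
    moreover have "measure (lebesgue_on \<Omega>) (B k) = measure lebesgue (B k)"
      using Om_sets by (intro measure_restrict_space) (auto simp: B_def)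
    ultimately show ?thesis using measure_nonneg[of lebesgue "B k"] by linarith
  qed
  have Pdisj: "disjoint_family_on P {..<n}"
    unfolding disjoint_family_on_def
  proof (intro ballI impI)
    fix i j :: nat assume "i \<noteq> j"
    then have "i < j \<or> j < i" by auto
    then show "P i \<inter> P j = {}" unfolding P_def by blast
  qed
  have Pcov: "(\<Union>k<n. P k) = closure \<Omega>"
  proof (intro antisym subsetI)
    fix x assume x: "x \<in> closure \<Omega>"
    then obtain y where y: "y \<in> D" "x \<in> ball y \<delta>" using D(3) by blast
    then have ex: "\<exists>k. k < n \<and> x \<in> ball (c k) \<delta>" using c by blast
    define k where "k = (LEAST k. k < n \<and> x \<in> ball (c k) \<delta>)"
    have k: "k < n \<and> x \<in> ball (c k) \<delta>" unfolding k_def using ex by (rule LeastI_ex)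
    have "\<not> (j < n \<and> x \<in> ball (c j) \<delta>)" if "j < k" for j using that unfolding k_def by (rule not_less_Least)
    then have "x \<in> P k" using x k by (auto simp: P_def)
    then show "x \<in> (\<Union>k<n. P k)" using k by auto
  qed (auto simp: P_def)
  define w where "w k = measure M (P k) / measure (lebesgue_on \<Omega>) (B k)" for k
  define b where "b x = (\<Sum>k<n. w k * indicator (B k) x)" for x
  have w0: "w k \<ge> 0" for k by (simp add: w_def)
  have b0: "0 \<le> b x" for x unfolding b_def using w0 by (intro sum_nonneg) auto
  have bm: "b \<in> borel_measurable (lebesgue_on \<Omega>)"
    unfolding b_def by (intro borel_measurable_sum borel_measurable_times borel_measurable_const borel_measurable_indicator Bm)
  have "b \<in> Linf \<Omega>"
  proof -
    note bm
    moreover have "norm (b x) \<le> (\<Sum>k<n. w k)" for x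
    proof -
      have "b x \<le> (\<Sum>k<n. w k)" unfolding b_def using w0 by (intro sum_mono) (auto simp: indicator_def)
      then show ?thesis using b0[of x] by simp
    qed
    ultimately show ?thesis unfolding Linf_def by blast
  qed
  moreover have "\<bar>(LINT x|M. cont_rep \<Omega> u x) - (LINT x|lebesgue_on \<Omega>. b x * u x)\<bar> \<le> \<epsilon>"
    if u: "u \<in> W1 \<Omega> q" "W1_norm \<Omega> q u \<le> 1" for u
  proof -
    let ?f = "cont_rep \<Omega> u"
    have fM: "integrable M ?f" by (rule continuous_measure_integrable[OF rep_cont[OF u(1)] M])
    have iu: "integrable (lebesgue_on \<Omega>) u" by (rule W1_integrable(1)[OF op bd less_imp_le[OF q1] u(1)])
    have fl: "integrable (lebesgue_on \<Omega>) ?f"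
      by (rule W1_integrable(1)[OF op bd less_imp_le[OF q1] rep_W1[OF u(1)]])
    have iP: "integrable M (\<lambda>x. indicator (P k) x * g x)" if "integrable M g" for k and g :: "'a \<Rightarrow> real"
      using integrable_mult_indicator[OF Pm that] by simp
    have iB: "integrable (lebesgue_on \<Omega>) (\<lambda>x. indicator (B k) x * g x)" if "integrable (lebesgue_on \<Omega>) g" for k and g :: "'a \<Rightarrow> real"
      using integrable_mult_indicator[OF Bm that] by simp
    have e1: "(LINT x|M. ?f x) = (\<Sum>k<n. (LINT x|M. indicator (P k) x * ?f x))"
    proof -
      have "(LINT x|M. ?f x) = (LINT x|M. (\<Sum>k<n. indicator (P k) x * ?f x))"
      proof (intro Bochner_Integration.integral_cong refl)
        fix x assume "x \<in> space M"
        then have one: "indicator (\<Union>k<n. P k) x = (1 :: real)" using spM Pcov by simp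
        have I: "indicator (\<Union>k<n. P k) x = (\<Sum>k<n. indicator (P k) x :: real)"
          by (rule indicator_UN_disjoint[OF finite_lessThan Pdisj])
        have "(\<Sum>k<n. indicator (P k) x * ?f x) = ?f x"
          by (simp only: sum_distrib_right[symmetric] I[symmetric] one mult_1_left)
        then show "?f x = (\<Sum>k<n. indicator (P k) x * ?f x)" by (rule sym)
      qed
      also have "\<dots> = (\<Sum>k<n. (LINT x|M. indicator (P k) x * ?f x))"
        by (intro Bochner_Integration.integral_sum iP fM)
      finally show ?thesis .
    qed
    have e2: "(LINT x|lebesgue_on \<Omega>. b x * u x) = (\<Sum>k<n. w k * (LINT x|lebesgue_on \<Omega>. indicator (B k) x * ?f x))"
    proof -
      have "(LINT x|lebesgue_on \<Omega>. b x * u x) = (LINT x|lebesgue_on \<Omega>. b x * ?f x)"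
        using rep_AE[OF u(1)] iu fl bm by (intro integral_cong_AE) auto
      also have "\<dots> = (LINT x|lebesgue_on \<Omega>. (\<Sum>k<n. w k * (indicator (B k) x * ?f x)))"
        by (intro Bochner_Integration.integral_cong refl) (simp only: b_def sum_distrib_right mult.assoc)
      also have "\<dots> = (\<Sum>k<n. (LINT x|lebesgue_on \<Omega>. w k * (indicator (B k) x * ?f x)))"
        by (intro Bochner_Integration.integral_sum integrable_mult_right iB fl)
      finally show ?thesis by simp
    qed
    have piece: "\<bar>(LINT x|M. indicator (P k) x * ?f x) - w k * (LINT x|lebesgue_on \<Omega>. indicator (B k) x * ?f x)\<bar> \<le> 2 * \<eta> * measure M (P k)"
      if k: "k < n" for k
    proof -
      let ?t = "?f (c k)"
      have cl: "\<bar>?f x - ?t\<bar> \<le> \<eta>" if "x \<in> closure \<Omega>" "x \<in> ball (c k) \<delta>" for x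
        using \<delta>(2)[OF u(1) energy_le_one[OF u(2)] that(1) ck[OF k]] that(2) by (simp add: dist_commute)
      have PsubM: "P k \<inter> space M = P k" "B k \<inter> space (lebesgue_on \<Omega>) = B k" using spM by (auto simp: P_def B_def)
      have "(LINT x|M. indicator (P k) x * ?f x) - ?t * measure M (P k) = (LINT x|M. indicator (P k) x * (?f x - ?t))"
        using iP[OF fM, of k] Pm[of k] PsubM by (simp add: right_diff_distrib M.emeasure_eq_measure mult.commute)
      also have "\<bar>\<dots>\<bar> \<le> (LINT x|M. \<bar>indicator (P k) x * (?f x - ?t)\<bar>)" by (rule integral_abs_bound)
      also have "\<dots> \<le> (LINT x|M. \<eta> * indicator (P k) x)"
      proof (rule integral_mono)
        show "integrable M (\<lambda>x. \<bar>indicator (P k) x * (?f x - ?t)\<bar>)" using fM by (intro integrable_abs iP) auto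
        show "integrable M (\<lambda>x. \<eta> * indicator (P k) x)" using Pm by (auto simp: M.emeasure_eq_measure)
        show "\<bar>indicator (P k) x * (?f x - ?t)\<bar> \<le> \<eta> * indicator (P k) x" for x
          using cl[of x] \<eta>(1) by (auto simp: indicator_def P_def)
      qed
      finally have 1: "\<bar>(LINT x|M. indicator (P k) x * ?f x) - ?t * measure M (P k)\<bar> \<le> \<eta> * measure M (P k)" using PsubM by simp
      have "(LINT x|lebesgue_on \<Omega>. indicator (B k) x * ?f x) - ?t * measure (lebesgue_on \<Omega>) (B k) = (LINT x|lebesgue_on \<Omega>. indicator (B k) x * (?f x - ?t))"
        using iB[OF fl, of k] Bm[of k] PsubM by (simp add: right_diff_distrib L.emeasure_eq_measure mult.commute)
      also have "\<bar>\<dots>\<bar> \<le> (LINT x|lebesgue_on \<Omega>. \<bar>indicator (B k) x * (?f x - ?t)\<bar>)" by (rule integral_abs_bound)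
      also have "\<dots> \<le> (LINT x|lebesgue_on \<Omega>. \<eta> * indicator (B k) x)"
      proof (rule integral_mono)
        show "integrable (lebesgue_on \<Omega>) (\<lambda>x. \<bar>indicator (B k) x * (?f x - ?t)\<bar>)" using fl by (intro integrable_abs iB) auto
        show "integrable (lebesgue_on \<Omega>) (\<lambda>x. \<eta> * indicator (B k) x)" using Bm by (auto simp: L.emeasure_eq_measure)
        show "\<bar>indicator (B k) x * (?f x - ?t)\<bar> \<le> \<eta> * indicator (B k) x" for x
          using cl[of x] \<eta>(1) closure_subset[of \<Omega>] by (auto simp: indicator_def B_def)
      qed
      finally have 2: "\<bar>(LINT x|lebesgue_on \<Omega>. indicator (B k) x * ?f x) - ?t * measure (lebesgue_on \<Omega>) (B k)\<bar> \<le> \<eta> * measure (lebesgue_on \<Omega>) (B k)"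
        using PsubM by simp
      have wB: "w k * measure (lebesgue_on \<Omega>) (B k) = measure M (P k)" using Bpos[OF k] by (simp add: w_def)
      have "\<bar>w k * (LINT x|lebesgue_on \<Omega>. indicator (B k) x * ?f x) - ?t * (w k * measure (lebesgue_on \<Omega>) (B k))\<bar>
          = w k * \<bar>(LINT x|lebesgue_on \<Omega>. indicator (B k) x * ?f x) - ?t * measure (lebesgue_on \<Omega>) (B k)\<bar>"
        using w0[of k] by (simp add: abs_mult right_diff_distrib[symmetric] mult.left_commute)
      also have "\<dots> \<le> w k * (\<eta> * measure (lebesgue_on \<Omega>) (B k))" using 2 w0 by (rule mult_left_mono)
      finally have "\<bar>w k * (LINT x|lebesgue_on \<Omega>. indicator (B k) x * ?f x) - ?t * measure M (P k)\<bar> \<le> \<eta> * measure M (P k)"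
        by (simp only: wB mult.left_commute[of "w k" \<eta>])
      with 1 show ?thesis by linarith
    qed
    have "\<bar>(LINT x|M. ?f x) - (LINT x|lebesgue_on \<Omega>. b x * u x)\<bar> =
       \<bar>\<Sum>k<n. (LINT x|M. indicator (P k) x * ?f x) - w k * (LINT x|lebesgue_on \<Omega>. indicator (B k) x * ?f x)\<bar>"
      by (simp only: e1 e2 sum_subtractf)
    also have "\<dots> \<le> (\<Sum>k<n. \<bar>(LINT x|M. indicator (P k) x * ?f x) - w k * (LINT x|lebesgue_on \<Omega>. indicator (B k) x * ?f x)\<bar>)" by (rule sum_abs)
    also have "\<dots> \<le> (\<Sum>k<n. 2 * \<eta> * measure M (P k))" using piece by (intro sum_mono) auto
    also have "\<dots> = 2 * \<eta> * measure M (\<Union>k<n. P k)"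
      using M.finite_measure_finite_Union[OF finite_lessThan _ Pdisj] Pm by (simp add: sum_distrib_left image_subset_iff)
    finally show ?thesis using \<eta>(2) Pcov by simp
  qed
  ultimately show ?thesis using b0 by blast
qed

end

context sobolev_domain begin

text \<open>Cutting to \<open>0\<close> rather than to norm \<open>n\<close> keeps \<open>truncation n \<beta>\<close> orthogonal to \<open>\<beta> - truncation n \<beta>\<close> pointwise.\<close>
definition truncation :: "real \<Rightarrow> ('a \<Rightarrow> 'a) \<Rightarrow> 'a \<Rightarrow> 'a" where
  "truncation n \<beta> x = (if norm (\<beta> x) \<le> n then \<beta> x else 0)"

lemma truncation_measurable:
  assumes "\<beta> \<in> borel_measurable (lebesgue_on \<Omega>)" shows "truncation n \<beta> \<in> borel_measurable (lebesgue_on \<Omega>)"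
proof -
  have [measurable]: "\<beta> \<in> borel_measurable (lebesgue_on \<Omega>)" by fact
  show ?thesis unfolding truncation_def by measurable
qed

lemma truncation_bounds: "n \<ge> 0 \<Longrightarrow> norm (truncation n \<beta> x) \<le> n" "norm (truncation n \<beta> x) \<le> norm (\<beta> x)"
  by (auto simp: truncation_def)

lemma truncation_eventually: "eventually (\<lambda>n. truncation (real n) \<beta> x = \<beta> x) sequentially"
proof -
  obtain N :: nat where "norm (\<beta> x) \<le> real N" using real_arch_simple by blast
  then show ?thesis by (intro eventually_sequentiallyI[of N]) (auto simp: truncation_def)
qed

lemma powr_integrable_of_Lp:
  "\<beta> \<in> Lp \<Omega> p \<Longrightarrow> integrable (lebesgue_on \<Omega>) (\<lambda>x. norm (\<beta> x) powr p)"
  by (simp add: Lp_def)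

lemma truncation_powr_integrable:
  assumes p: "p \<ge> 0" and \<beta>: "\<beta> \<in> borel_measurable (lebesgue_on \<Omega>)"
  shows "integrable (lebesgue_on \<Omega>) (\<lambda>x. norm (truncation (real n) \<beta> x) powr p)"
proof -
  interpret finite_measure "lebesgue_on \<Omega>" by (rule finite_Om)
  have [measurable]: "truncation (real n) \<beta> \<in> borel_measurable (lebesgue_on \<Omega>)" by (rule truncation_measurable[OF \<beta>])
  show ?thesis
    by (rule integrable_const_bound[where B="real n powr p"])
       (use truncation_bounds(1)[of "real n" \<beta>] p in \<open>auto intro!: powr_mono2\<close>)
qed

lemma representation_in_dual:
  fixes h :: "'a \<Rightarrow> real"
  assumes M: "finite_measure M" "sets M = borel_subsets (closure \<Omega>)" and h: "integrable (lebesgue_on \<Omega>) h"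
  shows "(\<lambda>u\<in>W1 \<Omega> q. - (LINT x|M. cont_rep \<Omega> u x) - (LINT x|lebesgue_on \<Omega>. h x * u x)) \<in> W1_dual \<Omega> q"
    and "u \<in> W1 \<Omega> q \<Longrightarrow> integrable (lebesgue_on \<Omega>) (\<lambda>x. h x * u x)"
proof -
  let ?F = "\<lambda>u\<in>W1 \<Omega> q. - (LINT x|M. cont_rep \<Omega> u x) - (LINT x|lebesgue_on \<Omega>. h x * u x)"
  interpret M: finite_measure M by (rule M(1))
  have spM: "space M = closure \<Omega>" using sets_eq_imp_space_eq[OF M(2)] by (simp add: space_restrict_space)
  obtain C where C: "C \<ge> 0" "\<And>u x. u \<in> W1 \<Omega> q \<Longrightarrow> x \<in> closure \<Omega> \<Longrightarrow> \<bar>cont_rep \<Omega> u x\<bar> \<le> C * W1_norm \<Omega> q u"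
    using rep_bound by blast
  have iM: "integrable M (cont_rep \<Omega> u)" if "u \<in> W1 \<Omega> q" for u
    by (rule continuous_measure_integrable[OF rep_cont[OF that] M])
  have ub: "AE x in lebesgue_on \<Omega>. \<bar>u x\<bar> \<le> C * W1_norm \<Omega> q u" if u: "u \<in> W1 \<Omega> q" for u
  proof -
    have "AE x in lebesgue_on \<Omega>. x \<in> \<Omega>" by (rule AE_I2) simp
    with rep_AE[OF u] show ?thesis
    proof eventually_elim
      case (elim x)
      then have "x \<in> closure \<Omega>" using closure_subset by blast
      then show ?case using C(2)[OF u] elim(1) by metis
    qed
  qed
  have ih: "integrable (lebesgue_on \<Omega>) (\<lambda>x. h x * u x)" if u: "u \<in> W1 \<Omega> q" for u
    using W1_integrable(1)[OF op bd less_imp_le[OF q1] u] by (intro bounded_mult_integrable[OF h _ ub[OF u]]) auto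
  show "u \<in> W1 \<Omega> q \<Longrightarrow> integrable (lebesgue_on \<Omega>) (\<lambda>x. h x * u x)" by (rule ih)
  have lin: "?F (\<lambda>x. a * u x + b * v x) = a * ?F u + b * ?F v" if u: "u \<in> W1 \<Omega> q" and v: "v \<in> W1 \<Omega> q" for u v a b
  proof -
    have "(LINT x|M. cont_rep \<Omega> (\<lambda>x. a * u x + b * v x) x) = (LINT x|M. a * cont_rep \<Omega> u x + b * cont_rep \<Omega> v x)"
      using rep_lincomb[OF u v] spM by (intro Bochner_Integration.integral_cong refl) simp
    also have "\<dots> = a * (LINT x|M. cont_rep \<Omega> u x) + b * (LINT x|M. cont_rep \<Omega> v x)" using iM[OF u] iM[OF v] by simp
    finally have 1: "(LINT x|M. cont_rep \<Omega> (\<lambda>x. a * u x + b * v x) x) = a * (LINT x|M. cont_rep \<Omega> u x) + b * (LINT x|M. cont_rep \<Omega> v x)" .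
    have "(LINT x|lebesgue_on \<Omega>. h x * (a * u x + b * v x)) = (LINT x|lebesgue_on \<Omega>. a * (h x * u x) + b * (h x * v x))"
      by (intro Bochner_Integration.integral_cong refl) (simp add: algebra_simps)
    also have "\<dots> = a * (LINT x|lebesgue_on \<Omega>. h x * u x) + b * (LINT x|lebesgue_on \<Omega>. h x * v x)" using ih[OF u] ih[OF v] by simp
    finally show ?thesis using 1 u v lincomb[OF u v] by (simp add: algebra_simps)
  qed
  define H where "H = (LINT x|lebesgue_on \<Omega>. \<bar>h x\<bar>)"
  have bnd: "\<bar>?F u\<bar> \<le> (C * measure M (space M) + C * H) * W1_norm \<Omega> q u" if u: "u \<in> W1 \<Omega> q" for u
  proof -
    let ?N = "C * W1_norm \<Omega> q u"
    have "\<bar>LINT x|M. cont_rep \<Omega> u x\<bar> \<le> (LINT x|M. \<bar>cont_rep \<Omega> u x\<bar>)" by (rule integral_abs_bound)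
    also have "\<dots> \<le> (LINT x|M. ?N)" using iM[OF u] C(2)[OF u] spM by (intro integral_mono) auto
    also have "\<dots> = ?N * measure M (space M)" by (simp only: lebesgue_integral_const real_scaleR_def mult.commute)
    finally have 1: "\<bar>LINT x|M. cont_rep \<Omega> u x\<bar> \<le> ?N * measure M (space M)" .
    have "\<bar>LINT x|lebesgue_on \<Omega>. h x * u x\<bar> \<le> (LINT x|lebesgue_on \<Omega>. \<bar>h x * u x\<bar>)" by (rule integral_abs_bound)
    also have "\<dots> \<le> (LINT x|lebesgue_on \<Omega>. \<bar>h x\<bar> * ?N)"
    proof (rule integral_mono_AE)
      show "AE x in lebesgue_on \<Omega>. \<bar>h x * u x\<bar> \<le> \<bar>h x\<bar> * ?N"
        using ub[OF u] by eventually_elim (auto simp: abs_mult intro: mult_left_mono)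
    qed (use ih[OF u] h in auto)
    finally have 2: "\<bar>LINT x|lebesgue_on \<Omega>. h x * u x\<bar> \<le> H * ?N" by (simp add: H_def)
    have "\<bar>?F u\<bar> \<le> \<bar>LINT x|M. cont_rep \<Omega> u x\<bar> + \<bar>LINT x|lebesgue_on \<Omega>. h x * u x\<bar>" using u by simp
    also have "\<dots> \<le> ?N * measure M (space M) + H * ?N" using 1 2 by linarith
    finally show ?thesis by (simp add: algebra_simps)
  qed
  show "?F \<in> W1_dual \<Omega> q" unfolding W1_dual_def
    using lin bnd by (intro CollectI conjI ballI allI exI[of _ "C * measure M (space M) + C * H"]) (simp_all only: restrict_extensional)
qed

text \<open>The vector field is approximated by its truncations, the density by that of the truncations, and the measure \<open>M\<close> by
  bounded functions; the sum of the last two, with a minus sign, is the first component of an element of \<open>A_set\<close>.\<close>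
lemma A_closure_intro:
  assumes r: "1 < r" "r \<le> q" and M: "finite_measure M" "sets M = borel_subsets (closure \<Omega>)" and \<beta>: "\<beta> \<in> Lp \<Omega> (conj_exp r)"
  defines "h \<equiv> \<lambda>x. 1 / conj_exp r * norm (\<beta> x) powr conj_exp r"
  shows "((\<lambda>u\<in>W1 \<Omega> q. - (LINT x|M. cont_rep \<Omega> u x) - (LINT x|lebesgue_on \<Omega>. h x * u x)), \<beta>) \<in> A_closure \<Omega> q (conj_exp r)"
    (is "(?F, \<beta>) \<in> _")
proof -
  let ?s = "conj_exp r" and ?p = "conj_exp q"
  note s = conj_exp_facts[OF r(1)] and p = conj_exp_facts[OF q1]
  have \<beta>m: "\<beta> \<in> borel_measurable (lebesgue_on \<Omega>)" using \<beta> by (simp add: Lp_def)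
  have \<beta>p: "\<beta> \<in> Lp \<Omega> ?p" using conj_exp_antimono[OF r] p(1) by (intro Lp_mono_exponent[OF lm _ _ \<beta>]) auto
  have ih: "integrable (lebesgue_on \<Omega>) h" unfolding h_def using powr_integrable_of_Lp[OF \<beta>] by auto
  note rep = representation_in_dual[OF M ih]
  obtain C where C: "C \<ge> 0" "\<And>u x. u \<in> W1 \<Omega> q \<Longrightarrow> x \<in> closure \<Omega> \<Longrightarrow> \<bar>cont_rep \<Omega> u x\<bar> \<le> C * W1_norm \<Omega> q u"
    using rep_bound by blast
  let ?T = "\<lambda>n. truncation (real n) \<beta>"
  define hn where "hn n x = 1 / ?s * norm (?T n x) powr ?s" for n x
  have Tm: "?T n \<in> borel_measurable (lebesgue_on \<Omega>)" for n by (rule truncation_measurable[OF \<beta>m])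
  have ihn: "integrable (lebesgue_on \<Omega>) (hn n)" for n
    unfolding hn_def using truncation_powr_integrable[OF _ \<beta>m, of ?s] s(1) by (intro integrable_mult_right) auto
  have hnle: "0 \<le> hn n x" "hn n x \<le> h x" for n x
    unfolding hn_def h_def using s(1) truncation_bounds(2)[of "real n" \<beta> x] by (auto intro!: divide_right_mono powr_mono2)
  have lim1: "(\<lambda>n. LINT x|lebesgue_on \<Omega>. h x - hn n x) \<longlonglongrightarrow> (LINT x|lebesgue_on \<Omega>. 0)"
  proof (rule integral_dominated_convergence[where w=h])
    show "AE x in lebesgue_on \<Omega>. (\<lambda>n. h x - hn n x) \<longlonglongrightarrow> 0"
    proof (rule AE_I2)
      fix x show "(\<lambda>n. h x - hn n x) \<longlonglongrightarrow> 0"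
        by (rule tendsto_eventually) (use truncation_eventually[of \<beta> x] in eventually_elim, simp add: h_def hn_def)
    qed
    show "AE x in lebesgue_on \<Omega>. norm (h x - hn n x) \<le> h x" for n
      using hnle by (intro AE_I2) (auto simp: abs_le_iff intro: order_trans[OF _ hnle(1)])
  qed (use ih ihn in auto)
  have lim2: "(\<lambda>n. LINT x|lebesgue_on \<Omega>. norm (\<beta> x - ?T n x) powr ?p) \<longlonglongrightarrow> (LINT x|lebesgue_on \<Omega>. 0)"
  proof (rule integral_dominated_convergence[where w="\<lambda>x. norm (\<beta> x) powr ?p"])
    show "AE x in lebesgue_on \<Omega>. (\<lambda>n. norm (\<beta> x - ?T n x) powr ?p) \<longlonglongrightarrow> 0"
    proof (rule AE_I2)
      fix x show "(\<lambda>n. norm (\<beta> x - ?T n x) powr ?p) \<longlonglongrightarrow> 0"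
        by (rule tendsto_eventually) (use truncation_eventually[of \<beta> x] in eventually_elim, simp)
    qed
    show "AE x in lebesgue_on \<Omega>. norm (norm (\<beta> x - ?T n x) powr ?p) \<le> norm (\<beta> x) powr ?p" for n
      by (intro AE_I2) (simp add: truncation_def)
    have [measurable]: "\<beta> \<in> borel_measurable (lebesgue_on \<Omega>)" "?T n \<in> borel_measurable (lebesgue_on \<Omega>)" for n by (fact \<beta>m, fact Tm)
    show "(\<lambda>x. norm (\<beta> x - ?T n x) powr ?p) \<in> borel_measurable (lebesgue_on \<Omega>)" for n by measurable
  qed (use powr_integrable_of_Lp[OF \<beta>p] in auto)
  have "\<exists>(a, b)\<in>A_set \<Omega> ?s. W1_dual_norm \<Omega> q (\<lambda>u. ?F u - function_functional \<Omega> q a u) < \<epsilon> \<and> Lp_norm \<Omega> ?p (\<lambda>x. \<beta> x - b x) < \<epsilon>"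
    if \<epsilon>: "\<epsilon> > 0" for \<epsilon>
  proof -
    have e4: "\<epsilon> / 4 > 0" "\<epsilon> / (4 * (C + 1)) > 0" "(\<epsilon> / 2) powr ?p > 0" using \<epsilon> C(1) by auto
    have "\<forall>\<^sub>F n in sequentially. (LINT x|lebesgue_on \<Omega>. h x - hn n x) < \<epsilon> / (4 * (C + 1))"
      using lim1 e4(2) by (intro order_tendstoD(2)[OF lim1]) simp
    moreover have "\<forall>\<^sub>F n in sequentially. (LINT x|lebesgue_on \<Omega>. norm (\<beta> x - ?T n x) powr ?p) < (\<epsilon> / 2) powr ?p"
      using e4(3) by (intro order_tendstoD(2)[OF lim2]) simp
    ultimately have "\<forall>\<^sub>F n in sequentially. (LINT x|lebesgue_on \<Omega>. h x - hn n x) < \<epsilon> / (4 * (C + 1)) \<and>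
       (LINT x|lebesgue_on \<Omega>. norm (\<beta> x - ?T n x) powr ?p) < (\<epsilon> / 2) powr ?p" by eventually_elim simp
    then obtain n where n: "(LINT x|lebesgue_on \<Omega>. h x - hn n x) < \<epsilon> / (4 * (C + 1))"
       "(LINT x|lebesgue_on \<Omega>. norm (\<beta> x - ?T n x) powr ?p) < (\<epsilon> / 2) powr ?p"
      by (auto simp: eventually_sequentially)
    obtain b where b: "b \<in> Linf \<Omega>" "\<And>x. 0 \<le> b x"
      "\<And>u. u \<in> W1 \<Omega> q \<Longrightarrow> W1_norm \<Omega> q u \<le> 1 \<Longrightarrow> \<bar>(LINT x|M. cont_rep \<Omega> u x) - (LINT x|lebesgue_on \<Omega>. b x * u x)\<bar> \<le> \<epsilon> / 4"
      using smear_measure[OF M e4(1)] by blast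
    define a where "a x = - hn n x - b x" for x
    have hnb: "hn n \<in> Linf \<Omega>"
    proof -
      have "norm (hn n x) \<le> 1 / ?s * real n powr ?s" for x
        unfolding hn_def using s(1) truncation_bounds(1)[of "real n" \<beta> x] by (auto intro!: divide_right_mono powr_mono2)
      then show ?thesis using ihn[of n] unfolding Linf_def by auto
    qed
    have aL: "a \<in> Linf \<Omega>"
    proof -
      obtain B1 where B1: "AE x in lebesgue_on \<Omega>. norm (b x) \<le> B1" "b \<in> borel_measurable (lebesgue_on \<Omega>)" using b(1) by (auto simp: Linf_def)
      obtain B2 where B2: "AE x in lebesgue_on \<Omega>. norm (hn n x) \<le> B2" "hn n \<in> borel_measurable (lebesgue_on \<Omega>)" using hnb by (auto simp: Linf_def)
      have "AE x in lebesgue_on \<Omega>. norm (a x) \<le> B1 + B2" using B1(1) B2(1)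
      proof eventually_elim
        case (elim x) then show ?case unfolding a_def real_norm_def by linarith
      qed
      moreover have "a \<in> borel_measurable (lebesgue_on \<Omega>)" unfolding a_def using B1(2) B2(2) by (intro borel_measurable_diff borel_measurable_uminus)
      ultimately show ?thesis unfolding Linf_def by blast
    qed
    have TL: "?T n \<in> Linf \<Omega>" unfolding Linf_def using Tm[of n] truncation_bounds(1)[of "real n" \<beta>] by (intro CollectI conjI exI[of _ "real n"]) auto
    have inA: "(a, ?T n) \<in> A_set \<Omega> ?s"
      unfolding A_set_def using aL TL b(2) by (auto simp: a_def hn_def)
    have un: "\<bar>?F u - function_functional \<Omega> q a u\<bar> \<le> \<epsilon> / 2" if u: "u \<in> W1 \<Omega> q" "W1_norm \<Omega> q u \<le> 1" for u
    proof -
      note ib = Linf_pairing_integrable[OF b(1) u(1)] and iu = rep(2)[OF u(1)] and inn = Linf_pairing_integrable[OF hnb u(1)]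
      have ff: "function_functional \<Omega> q a u = - (LINT x|lebesgue_on \<Omega>. hn n x * u x) - (LINT x|lebesgue_on \<Omega>. b x * u x)"
        using ib inn u(1) by (simp add: function_functional_def a_def left_diff_distrib)
      have "(LINT x|lebesgue_on \<Omega>. h x * u x) - (LINT x|lebesgue_on \<Omega>. hn n x * u x) = (LINT x|lebesgue_on \<Omega>. (h x - hn n x) * u x)"
        using iu inn by (simp add: left_diff_distrib)
      also have "\<bar>\<dots>\<bar> \<le> (LINT x|lebesgue_on \<Omega>. \<bar>(h x - hn n x) * u x\<bar>)" by (rule integral_abs_bound)
      also have "\<dots> \<le> (LINT x|lebesgue_on \<Omega>. (h x - hn n x) * C)"
      proof (rule integral_mono_AE)
        have "AE x in lebesgue_on \<Omega>. x \<in> \<Omega>" by (rule AE_I2) simp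
        with rep_AE[OF u(1)] show "AE x in lebesgue_on \<Omega>. \<bar>(h x - hn n x) * u x\<bar> \<le> (h x - hn n x) * C"
        proof eventually_elim
          case (elim x)
          then have "x \<in> closure \<Omega>" using closure_subset by blast
          then have "\<bar>u x\<bar> \<le> C * W1_norm \<Omega> q u" using C(2)[OF u(1)] elim(1) by metis
          also have "\<dots> \<le> C * 1" using C(1) u(2) by (rule mult_left_mono[rotated])
          finally show ?case using hnle(2)[of n x] by (simp add: abs_mult mult_left_mono)
        qed
      qed (use iu inn ih ihn in \<open>auto simp: left_diff_distrib\<close>)
      also have "\<dots> = (LINT x|lebesgue_on \<Omega>. h x - hn n x) * C" by simp
      also have "\<dots> \<le> \<epsilon> / (4 * (C + 1)) * C" using n(1) C(1) by (intro mult_right_mono) auto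
      also have "\<dots> \<le> \<epsilon> / 4"
      proof -
        have "\<epsilon> / (4 * (C + 1)) * C \<le> \<epsilon> / (4 * (C + 1)) * (C + 1)" using e4(2) by (intro mult_left_mono) auto
        also have "\<dots> = \<epsilon> / 4" using C(1) by (simp add: field_simps)
        finally show ?thesis .
      qed
      finally have "\<bar>(LINT x|lebesgue_on \<Omega>. h x * u x) - (LINT x|lebesgue_on \<Omega>. hn n x * u x)\<bar> \<le> \<epsilon> / 4" .
      moreover note b(3)[OF u]
      moreover have "?F u = - (LINT x|M. cont_rep \<Omega> u x) - (LINT x|lebesgue_on \<Omega>. h x * u x)" using u by simp
      ultimately show ?thesis unfolding ff by linarith
    qed
    have "W1_dual_norm \<Omega> q (\<lambda>u. ?F u - function_functional \<Omega> q a u) \<le> \<epsilon> / 2"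
      unfolding W1_dual_norm_def
    proof (rule cSUP_least)
      have "W1_norm \<Omega> q (\<lambda>x. 0 * 1) = 0" using W1_norm_scale[OF op _ one_W1, of 0 1] q1 by simp
      then have "(\<lambda>x. 0) \<in> {u \<in> W1 \<Omega> q. W1_norm \<Omega> q u \<le> 1}" using one_W1[of 0] by simp
      then show "{u \<in> W1 \<Omega> q. W1_norm \<Omega> q u \<le> 1} \<noteq> {}" by blast
    qed (use un in blast)
    moreover have "Lp_norm \<Omega> ?p (\<lambda>x. \<beta> x - ?T n x) \<le> ((\<epsilon> / 2) powr ?p) powr (1 / ?p)"
      unfolding Lp_norm_def using n(2) p(1) by (intro powr_mono2) (auto intro: integral_nonneg)
    moreover have "((\<epsilon> / 2) powr ?p) powr (1 / ?p) = \<epsilon> / 2" using p(1) \<epsilon> by (simp add: powr_powr)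
    ultimately show ?thesis using \<epsilon> inA by (intro bexI[of _ "(a, ?T n)"]) auto
  qed
  then show ?thesis unfolding A_closure_def using rep(1) \<beta>p by blast
qed

end

section \<open>From subgradients to measures\<close>

locale subdifferential_setting = sobolev_domain \<Omega> q for \<Omega> :: "'a::euclidean_space set" and q :: real +
  fixes r :: real and m :: "'a \<Rightarrow> real" and w :: "'a \<Rightarrow> 'a"
  assumes r1: "1 < r" and rq: "r \<le> q" and mW: "m \<in> W1 \<Omega> q" and mc: "continuous_on (closure \<Omega>) m"
    and wL: "w \<in> Lp \<Omega> q" and fin: "Lfun \<Omega> r m w < \<infinity>"
begin

abbreviation "s \<equiv> conj_exp r"
abbreviation "v \<equiv> velocity \<Omega> m w"
abbreviation "hL \<equiv> \<lambda>x. 1 / r * (m x * norm (v x) powr r)"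

lemmas sf = conj_exp_facts[OF r1]

lemma mm: "m \<in> borel_measurable (lebesgue_on \<Omega>)"
  by (rule continuous_closure_measurable[OF mc])

lemma wm: "w \<in> borel_measurable (lebesgue_on \<Omega>)"
  using wL by (simp add: Lp_def)

lemma E1_borel: "E1 \<Omega> m \<in> borel_subsets (closure \<Omega>)"
proof -
  have [measurable]: "m \<in> borel_measurable (restrict_space borel (closure \<Omega>))"
    by (rule borel_measurable_continuous_on_restrict[OF mc])
  have "{x \<in> space (restrict_space borel (closure \<Omega>)). 0 < m x} \<in> sets (restrict_space borel (closure \<Omega>))" by measurable
  then show ?thesis by (simp add: E1_def space_restrict_space)
qed

lemma AE_in: "AE x in lebesgue_on \<Omega>. x \<in> \<Omega>"
  by (rule AE_I2) simp

lemma in_E1: "x \<in> \<Omega> \<Longrightarrow> x \<in> E1 \<Omega> m \<longleftrightarrow> m x > 0"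
  using closure_subset by (auto simp: E1_def)

lemma ell_measurable: "(\<lambda>x. e2ennreal (ell r (m x) (w x))) \<in> borel_measurable (lebesgue_on \<Omega>)"
proof -
  have [measurable]: "m \<in> borel_measurable (lebesgue_on \<Omega>)" "w \<in> borel_measurable (lebesgue_on \<Omega>)" by (fact mm, fact wm)
  have e0: "e2ennreal 0 = 0" using e2ennreal_ereal[of 0] by (simp add: zero_ereal_def[symmetric])
  have eq: "(\<lambda>x. e2ennreal (ell r (m x) (w x))) = (\<lambda>x. if m x > 0 then ennreal (1 / r * (norm (w x) powr r / m x powr (r - 1)))
     else if m x = 0 \<and> w x = 0 then 0 else \<infinity>)"
    using e0 by (auto simp: ell_def e2ennreal_infty fun_eq_iff)
  show ?thesis unfolding eq by measurable
qed

lemma fin_nn: "(\<integral>\<^sup>+x. e2ennreal (ell r (m x) (w x)) \<partial>lebesgue_on \<Omega>) \<noteq> \<infinity>"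
  using fin by (auto simp: Lfun_def)

lemma AE_finite: "AE x in lebesgue_on \<Omega>. m x > 0 \<or> (m x = 0 \<and> w x = 0)"
proof -
  have "AE x in lebesgue_on \<Omega>. e2ennreal (ell r (m x) (w x)) \<noteq> \<infinity>"
    by (rule nn_integral_PInf_AE[OF ell_measurable fin_nn])
  then show ?thesis
  proof eventually_elim
    case (elim x)
    then have "ell r (m x) (w x) \<noteq> \<infinity>" by (auto simp: e2ennreal_infty)
    then show ?case by (rule ell_finite_cases)
  qed
qed

text \<open>Finiteness of the functional gives this almost everywhere, and continuity everywhere on the closure.\<close>
lemma m_nonneg: "x \<in> closure \<Omega> \<Longrightarrow> 0 \<le> m x"
proof -
  assume x: "x \<in> closure \<Omega>"
  have "m x = max 0 (m x)"
  proof (rule continuous_AE_eq_imp_eq[OF op mc _ _ x])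
    show "continuous_on (closure \<Omega>) (\<lambda>x. max 0 (m x))" by (intro continuous_on_max continuous_on_const mc)
    show "AE x in lebesgue_on \<Omega>. m x = max 0 (m x)" using AE_finite by eventually_elim auto
  qed
  then show ?thesis by simp
qed

lemma m_nonneg': "x \<in> \<Omega> \<Longrightarrow> 0 \<le> m x"
  using m_nonneg closure_subset by blast

lemma w_eq: "AE x in lebesgue_on \<Omega>. w x = m x *\<^sub>R v x"
  using AE_finite AE_in by eventually_elim (auto simp: velocity_def in_E1)

lemma vm: "v \<in> borel_measurable (lebesgue_on \<Omega>)"
proof (rule lebesgue_on_measurable_AE[OF Om_sets])
  have [measurable]: "m \<in> borel_measurable (lebesgue_on \<Omega>)" "w \<in> borel_measurable (lebesgue_on \<Omega>)" by (fact mm, fact wm)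
  show "(\<lambda>x. if m x > 0 then (1 / m x) *\<^sub>R w x else 0) \<in> borel_measurable (lebesgue_on \<Omega>)" by measurable
  show "AE x in lebesgue_on \<Omega>. (if m x > 0 then (1 / m x) *\<^sub>R w x else 0) = v x"
    using AE_in by eventually_elim (auto simp: velocity_def in_E1)
qed

lemma ell_eq: "AE x in lebesgue_on \<Omega>. ell r (m x) (w x) = ereal (hL x)"
  using w_eq AE_in
proof eventually_elim
  case (elim x)
  then show ?case using ell_scale[of "m x" r "v x"] m_nonneg'[of x] by simp
qed

lemma hL_nonneg: "x \<in> \<Omega> \<Longrightarrow> 0 \<le> hL x"
  using m_nonneg' r1 by (auto intro!: divide_nonneg_pos mult_nonneg_nonneg)

lemma hL_AE_nonneg: "AE x in lebesgue_on \<Omega>. 0 \<le> hL x"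
  using AE_in by eventually_elim (rule hL_nonneg)

lemma hL_integrable: "integrable (lebesgue_on \<Omega>) hL"
proof (rule integrableI_nonneg[OF _ hL_AE_nonneg])
  have [measurable]: "m \<in> borel_measurable (lebesgue_on \<Omega>)" "v \<in> borel_measurable (lebesgue_on \<Omega>)" by (fact mm, fact vm)
  show "hL \<in> borel_measurable (lebesgue_on \<Omega>)" by measurable
  have "(\<integral>\<^sup>+x. ennreal (hL x) \<partial>lebesgue_on \<Omega>) = (\<integral>\<^sup>+x. e2ennreal (ell r (m x) (w x)) \<partial>lebesgue_on \<Omega>)"
  proof (rule nn_integral_cong_AE)
    show "AE x in lebesgue_on \<Omega>. ennreal (hL x) = e2ennreal (ell r (m x) (w x))" using ell_eq by eventually_elim simp
  qed
  then show "(\<integral>\<^sup>+x. ennreal (hL x) \<partial>lebesgue_on \<Omega>) < \<infinity>" using fin_nn by (simp add: less_top)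
qed

lemma Lfun_scaled: "c \<ge> 0 \<Longrightarrow> Lfun \<Omega> r (\<lambda>x. c * m x) (\<lambda>x. c *\<^sub>R w x) = ereal (c * (LINT x|lebesgue_on \<Omega>. hL x))"
proof -
  assume c: "c \<ge> 0"
  have "Lfun \<Omega> r (\<lambda>x. c * m x) (\<lambda>x. c *\<^sub>R w x) = ereal (LINT x|lebesgue_on \<Omega>. c * hL x)"
  proof (rule Lfun_eq)
    show "AE x in lebesgue_on \<Omega>. ell r (c * m x) (c *\<^sub>R w x) = ereal (c * hL x)"
      using w_eq AE_in
    proof eventually_elim
      case (elim x)
      have "c *\<^sub>R w x = (c * m x) *\<^sub>R v x" using elim(1) by simp
      moreover have "0 \<le> c * m x" using c m_nonneg'[OF elim(2)] by simp
      ultimately show ?case using ell_scale[of "c * m x" r "v x"] by (simp add: mult_ac)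
    qed
    show "integrable (lebesgue_on \<Omega>) (\<lambda>x. c * hL x)" by (rule integrable_mult_right[OF hL_integrable])
    show "AE x in lebesgue_on \<Omega>. 0 \<le> c * hL x" using hL_AE_nonneg by eventually_elim (use c in \<open>rule mult_nonneg_nonneg\<close>)
  qed
  then show ?thesis by (simp only: integral_mult_right_zero)
qed

lemma Lfun_value: "Lfun \<Omega> r m w = ereal (LINT x|lebesgue_on \<Omega>. hL x)"
  by (rule Lfun_eq[OF ell_eq hL_integrable hL_AE_nonneg])

text \<open>The functional is homogeneous along the ray through \<open>(m, w)\<close>. Testing the subgradient inequality at
  \<open>(0, 0)\<close> and at \<open>(2 m, 2 w)\<close> gives the two inequalities that make up the equality at \<open>(m, w)\<close>; with it the subgradient inequality
  becomes the bound on the pairing.\<close>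
lemma subdifferential_pairing:
  assumes sd: "(F, \<beta>) \<in> subdifferential \<Omega> q (Lfun \<Omega> r) m w"
  shows "F \<in> W1_dual \<Omega> q" "\<beta> \<in> Lp \<Omega> (conj_exp q)"
    "F m + (LINT x|lebesgue_on \<Omega>. \<beta> x \<bullet> w x) = (LINT x|lebesgue_on \<Omega>. hL x)"
    "\<And>m' w'. m' \<in> W1 \<Omega> q \<Longrightarrow> w' \<in> Lp \<Omega> q \<Longrightarrow> ereal (F m' + (LINT x|lebesgue_on \<Omega>. \<beta> x \<bullet> w' x)) \<le> Lfun \<Omega> r m' w'"
proof -
  show F: "F \<in> W1_dual \<Omega> q" and \<beta>: "\<beta> \<in> Lp \<Omega> (conj_exp q)" using sd by (auto simp: subdifferential_def)
  let ?L = "LINT x|lebesgue_on \<Omega>. hL x" and ?P = "F m + (LINT x|lebesgue_on \<Omega>. \<beta> x \<bullet> w x)"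
  have ineq: "ereal (?L + (F m' + (LINT x|lebesgue_on \<Omega>. \<beta> x \<bullet> w' x)) - ?P) \<le> Lfun \<Omega> r m' w'" if m': "m' \<in> W1 \<Omega> q" and w': "w' \<in> Lp \<Omega> q" for m' w'
  proof -
    have "Lfun \<Omega> r m w + ereal (F (\<lambda>x. m' x - m x) + (LINT x|lebesgue_on \<Omega>. \<beta> x \<bullet> (w' x - w x))) \<le> Lfun \<Omega> r m' w'"
      using sd m' w' by (simp add: subdifferential_def)
    moreover have "(LINT x|lebesgue_on \<Omega>. \<beta> x \<bullet> (w' x - w x)) = (LINT x|lebesgue_on \<Omega>. \<beta> x \<bullet> w' x) - (LINT x|lebesgue_on \<Omega>. \<beta> x \<bullet> w x)"
      using Lp_pairing_integrable[OF q1 \<beta> w'] Lp_pairing_integrable[OF q1 \<beta> wL] by (simp add: inner_diff_right)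
    ultimately have "ereal ?L + ereal ((F m' - F m) + ((LINT x|lebesgue_on \<Omega>. \<beta> x \<bullet> w' x) - (LINT x|lebesgue_on \<Omega>. \<beta> x \<bullet> w x))) \<le> Lfun \<Omega> r m' w'"
      by (simp only: Lfun_value dual_diff[OF F m' mW])
    moreover have "?L + ((F m' - F m) + ((LINT x|lebesgue_on \<Omega>. \<beta> x \<bullet> w' x) - (LINT x|lebesgue_on \<Omega>. \<beta> x \<bullet> w x)))
        = ?L + (F m' + (LINT x|lebesgue_on \<Omega>. \<beta> x \<bullet> w' x)) - ?P" by linarith
    ultimately show ?thesis by (simp only: plus_ereal.simps(1))
  qed
  have sc: "?L + c * ?P - ?P \<le> c * ?L" if c: "c \<ge> 0" for c
  proof -
    have "(LINT x|lebesgue_on \<Omega>. \<beta> x \<bullet> (c *\<^sub>R w x)) = c * (LINT x|lebesgue_on \<Omega>. \<beta> x \<bullet> w x)" by simp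
    then show ?thesis
      using ineq[OF cmult[OF mW, of c] Lp_scaleR[OF wL, of c]] unfolding Lfun_scaled[OF c] dual_cmult[OF F mW]
      by (simp add: distrib_left)
  qed
  show eq: "?P = ?L" using sc[of 0] sc[of 2] by simp
  show "ereal (F m' + (LINT x|lebesgue_on \<Omega>. \<beta> x \<bullet> w' x)) \<le> Lfun \<Omega> r m' w'" if "m' \<in> W1 \<Omega> q" "w' \<in> Lp \<Omega> q" for m' w'
    using ineq[OF that] unfolding eq by simp
qed

text \<open>The test field is \<open>u *\<^sub>R y\<close>, where \<open>y\<close> is dual to the truncation \<open>T\<close> of \<open>\<beta>\<close>: \<open>\<beta> \<bullet> y = |T|\<^sup>s\<close> and \<open>|y|\<^sup>r = |T|\<^sup>s\<close>. The functional at \<open>(u, u *\<^sub>R y)\<close>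
  is \<open>1 / r\<close> times the integral of \<open>|T|\<^sup>s u\<close>, the pairing contains this integral once, and \<open>1 - 1 / r = 1 / s\<close>.\<close>
lemma truncated_inequality:
  assumes le: "\<And>m' w'. m' \<in> W1 \<Omega> q \<Longrightarrow> w' \<in> Lp \<Omega> q \<Longrightarrow> ereal (F m' + (LINT x|lebesgue_on \<Omega>. \<beta> x \<bullet> w' x)) \<le> Lfun \<Omega> r m' w'"
    and \<beta>m: "\<beta> \<in> borel_measurable (lebesgue_on \<Omega>)"
    and u: "u \<in> W1 \<Omega> q" "continuous_on (closure \<Omega>) u" "\<And>x. x \<in> closure \<Omega> \<Longrightarrow> 0 \<le> u x"
  shows "F u + (LINT x|lebesgue_on \<Omega>. 1 / s * norm (truncation (real n) \<beta> x) powr s * u x) \<le> 0"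
proof -
  let ?T = "truncation (real n) \<beta>"
  define y where "y x = norm (?T x) powr (s - 2) *\<^sub>R ?T x" for x
  have ss: "conj_exp s = r" using r1 by (simp add: conj_exp_def field_simps)
  note dm = duality_map[OF sf(1), where x="?T x" for x, folded y_def, unfolded ss]
  have Tm: "?T \<in> borel_measurable (lebesgue_on \<Omega>)" by (rule truncation_measurable[OF \<beta>m])
  have um: "u \<in> borel_measurable (lebesgue_on \<Omega>)" by (rule continuous_closure_measurable[OF u(2)])
  obtain C where C: "\<forall>x\<in>closure \<Omega>. \<bar>u x\<bar> \<le> C" using continuous_closure_bounded[OF u(2)] by blast
  have w': "(\<lambda>x. u x *\<^sub>R y x) \<in> Lp \<Omega> q"
  proof (rule Lp_bounded[OF lm])
    have [measurable]: "?T \<in> borel_measurable (lebesgue_on \<Omega>)" "u \<in> borel_measurable (lebesgue_on \<Omega>)" by (fact Tm, fact um)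
    show "(\<lambda>x. u x *\<^sub>R y x) \<in> borel_measurable (lebesgue_on \<Omega>)" unfolding y_def by measurable
    fix x assume x: "x \<in> \<Omega>"
    have "norm (y x) \<le> real n powr (s - 1)"
      unfolding dm(1) using truncation_bounds(1)[of "real n" \<beta> x] sf(1) by (intro powr_mono2) auto
    moreover have "\<bar>u x\<bar> \<le> C" using C x closure_subset by blast
    ultimately show "norm (u x *\<^sub>R y x) \<le> C * real n powr (s - 1)" unfolding norm_scaleR by (intro mult_mono) auto
  qed (use q1 in simp)
  define g where "g x = norm (?T x) powr s * u x" for x
  have gi: "integrable (lebesgue_on \<Omega>) g" unfolding g_def
  proof (rule bounded_mult_integrable[OF _ um])
    show "integrable (lebesgue_on \<Omega>) (\<lambda>x. norm (?T x) powr s)" using sf(1) by (intro truncation_powr_integrable \<beta>m) simp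
    show "AE x in lebesgue_on \<Omega>. \<bar>u x\<bar> \<le> C" using AE_in by eventually_elim (use C closure_subset in blast)
  qed
  have g0: "AE x in lebesgue_on \<Omega>. 0 \<le> g x"
    using AE_in
  proof eventually_elim
    case (elim x)
    then have "0 \<le> u x" by (intro u(3) subsetD[OF closure_subset])
    then show ?case by (simp add: g_def)
  qed
  have "Lfun \<Omega> r u (\<lambda>x. u x *\<^sub>R y x) = ereal (LINT x|lebesgue_on \<Omega>. 1 / r * g x)"
  proof (rule Lfun_eq)
    show "AE x in lebesgue_on \<Omega>. ell r (u x) (u x *\<^sub>R y x) = ereal (1 / r * g x)"
      using AE_in
    proof eventually_elim
      case (elim x)
      then have "x \<in> closure \<Omega>" using closure_subset by blast
      then show ?case using ell_scale[OF u(3), of x r "y x"] by (simp only: dm(2) g_def mult.commute)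
    qed
    show "integrable (lebesgue_on \<Omega>) (\<lambda>x. 1 / r * g x)" by (rule integrable_mult_right[OF gi])
    show "AE x in lebesgue_on \<Omega>. 0 \<le> 1 / r * g x" using g0 by eventually_elim (use r1 in simp)
  qed
  moreover have "(LINT x|lebesgue_on \<Omega>. \<beta> x \<bullet> (u x *\<^sub>R y x)) = (LINT x|lebesgue_on \<Omega>. g x)"
  proof (intro Bochner_Integration.integral_cong refl)
    fix x
    have "\<beta> x \<bullet> y x = y x \<bullet> ?T x" by (simp add: y_def truncation_def inner_commute)
    then show "\<beta> x \<bullet> (u x *\<^sub>R y x) = g x" using dm(3)[of x] by (simp add: g_def)
  qed
  ultimately have "F u + (LINT x|lebesgue_on \<Omega>. g x) \<le> 1 / r * (LINT x|lebesgue_on \<Omega>. g x)"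
    using le[OF u(1) w'] by (simp only: integral_mult_right_zero) simp
  moreover have "1 / s * (LINT x|lebesgue_on \<Omega>. g x) = (LINT x|lebesgue_on \<Omega>. g x) - 1 / r * (LINT x|lebesgue_on \<Omega>. g x)"
  proof -
    have "1 / s = 1 - 1 / r" using sf(2) by linarith
    then show ?thesis by (simp only: left_diff_distrib mult_1_left)
  qed
  moreover have "(LINT x|lebesgue_on \<Omega>. 1 / s * norm (?T x) powr s * u x) = 1 / s * (LINT x|lebesgue_on \<Omega>. g x)"
    unfolding g_def integral_mult_right_zero[symmetric] by (simp only: mult.assoc)
  ultimately show ?thesis by linarith
qed

text \<open>The truncated inequality for \<open>u = 1\<close> bounds the integrals of the truncations by a constant, and monotone
  convergence removes the truncation.\<close>
lemma beta_in_Lp: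
  assumes le: "\<And>m' w'. m' \<in> W1 \<Omega> q \<Longrightarrow> w' \<in> Lp \<Omega> q \<Longrightarrow> ereal (F m' + (LINT x|lebesgue_on \<Omega>. \<beta> x \<bullet> w' x)) \<le> Lfun \<Omega> r m' w'"
    and \<beta>m: "\<beta> \<in> borel_measurable (lebesgue_on \<Omega>)"
  shows "\<beta> \<in> Lp \<Omega> s"
proof -
  let ?T = "\<lambda>n. truncation (real n) \<beta>"
  have Ti: "integrable (lebesgue_on \<Omega>) (\<lambda>x. norm (?T n x) powr s)" for n
    using sf(1) by (intro truncation_powr_integrable \<beta>m) simp
  have b: "(LINT x|lebesgue_on \<Omega>. norm (?T n x) powr s) \<le> s * - F (\<lambda>x. 1)" for n
  proof -
    have "F (\<lambda>x. 1) + (LINT x|lebesgue_on \<Omega>. 1 / s * norm (?T n x) powr s * 1) \<le> 0"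
      by (rule truncated_inequality[OF le \<beta>m one_W1]) auto
    then have "(LINT x|lebesgue_on \<Omega>. norm (?T n x) powr s) / s \<le> - F (\<lambda>x. 1)" by simp
    then show ?thesis using sf(1) by (simp add: field_simps)
  qed
  have lim: "(\<lambda>n. \<integral>\<^sup>+x. ennreal (norm (?T n x) powr s) \<partial>lebesgue_on \<Omega>) \<longlonglongrightarrow> (\<integral>\<^sup>+x. ennreal (norm (\<beta> x) powr s) \<partial>lebesgue_on \<Omega>)"
  proof (rule nn_integral_LIMSEQ)
    show "incseq (\<lambda>n x. ennreal (norm (?T n x) powr s))"
      by (auto simp: incseq_def le_fun_def truncation_def intro!: ennreal_leI)
    show "(\<lambda>x. ennreal (norm (?T n x) powr s)) \<in> borel_measurable (lebesgue_on \<Omega>)" for n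
      using Ti[of n] by auto
    show "(\<lambda>n. ennreal (norm (?T n x) powr s)) \<longlonglongrightarrow> ennreal (norm (\<beta> x) powr s)" for x
      by (rule tendsto_eventually) (use truncation_eventually[of \<beta> x] in eventually_elim, simp)
  qed
  have "(\<integral>\<^sup>+x. ennreal (norm (?T n x) powr s) \<partial>lebesgue_on \<Omega>) \<le> ennreal (s * - F (\<lambda>x. 1))" for n
    using nn_integral_eq_integral[OF Ti[of n]] b[of n] by (simp add: ennreal_leI)
  then have "(\<integral>\<^sup>+x. ennreal (norm (\<beta> x) powr s) \<partial>lebesgue_on \<Omega>) \<le> ennreal (s * - F (\<lambda>x. 1))"
    by (intro LIMSEQ_le_const2[OF lim]) auto
  then have "(\<integral>\<^sup>+x. ennreal (norm (\<beta> x) powr s) \<partial>lebesgue_on \<Omega>) < \<infinity>" using ennreal_less_top le_less_trans by fastforce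
  then have "integrable (lebesgue_on \<Omega>) (\<lambda>x. norm (\<beta> x) powr s)"
    using \<beta>m by (intro integrableI_nonneg) auto
  then show ?thesis using \<beta>m by (simp add: Lp_def)
qed

text \<open>The polynomials would suffice; smooth functions are an algebra that separates points, so the Stone-Weierstrass theorem
  applies, and they all belong to \<open>W1 \<Omega> q\<close>.\<close>
lemma smooth_dense:
  assumes f: "continuous_on (closure \<Omega>) f" and e: "\<epsilon> > 0"
  shows "\<exists>g. smooth g \<and> (\<forall>x\<in>closure \<Omega>. \<bar>f x - g x\<bar> \<le> \<epsilon>)"
proof -
  have "\<exists>g. smooth g \<and> (\<forall>x\<in>closure \<Omega>. \<bar>f x - g x\<bar> < \<epsilon>)"
  proof (rule Stone_Weierstrass_HOL[OF compact_closure_Om _ _ _ _ _ f e])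
    show "\<exists>g. smooth g \<and> g x \<noteq> g y" if "x \<in> closure \<Omega> \<and> y \<in> closure \<Omega> \<and> x \<noteq> y" for x y
    proof -
      from that have "\<not> (\<forall>b\<in>Basis. x \<bullet> b = y \<bullet> b)" using euclidean_eq_iff[of x y] by simp
      then obtain b where "x \<bullet> b \<noteq> y \<bullet> b" by blast
      with smooth_inner[of b] show ?thesis by (intro exI[of _ "\<lambda>x. x \<bullet> b"] conjI)
    qed
    show "smooth (\<lambda>x. c)" for c :: real by (rule smooth_const)
    show "continuous_on (closure \<Omega>) g" if "smooth g" for g by (rule smooth_continuous[OF that])
    show "smooth (\<lambda>x. g x + h x)" if "smooth g \<and> smooth h" for g h using that by (intro smooth_add) simp_all
    show "smooth (\<lambda>x. g x * h x)" if "smooth g \<and> smooth h" for g h using that by (intro smooth_mult) simp_all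
  qed
  then obtain g where g: "smooth g" "\<forall>x\<in>closure \<Omega>. \<bar>f x - g x\<bar> < \<epsilon>" by blast
  then show ?thesis by (intro exI[of _ g]) (simp add: less_imp_le)
qed

text \<open>By the truncated inequality and dominated convergence \<open>u \<mapsto> - F u - \<integral> |\<beta>|\<^sup>s u / s\<close> is non-negative for \<open>u \<ge> 0\<close>. Its domain contains the smooth
  functions, which are dense, so that it is integration against a finite measure.\<close>
lemma functional_representation:
  assumes F: "F \<in> W1_dual \<Omega> q"
    and le: "\<And>m' w'. m' \<in> W1 \<Omega> q \<Longrightarrow> w' \<in> Lp \<Omega> q \<Longrightarrow> ereal (F m' + (LINT x|lebesgue_on \<Omega>. \<beta> x \<bullet> w' x)) \<le> Lfun \<Omega> r m' w'"
    and \<beta>: "\<beta> \<in> Lp \<Omega> s"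
  shows "\<exists>M. finite_measure M \<and> sets M = borel_subsets (closure \<Omega>) \<and>
    F = (\<lambda>u\<in>W1 \<Omega> q. - (LINT x|M. cont_rep \<Omega> u x) - (LINT x|lebesgue_on \<Omega>. (1 / s * norm (\<beta> x) powr s) * u x))"
proof -
  let ?H = "\<lambda>x. 1 / s * norm (\<beta> x) powr s"
  let ?V = "{u \<in> W1 \<Omega> q. continuous_on (closure \<Omega>) u}"
  have \<beta>m: "\<beta> \<in> borel_measurable (lebesgue_on \<Omega>)" using \<beta> by (simp add: Lp_def)
  have iH: "integrable (lebesgue_on \<Omega>) ?H" by (intro integrable_mult_right powr_integrable_of_Lp[OF \<beta>])
  have iHu: "integrable (lebesgue_on \<Omega>) (\<lambda>x. ?H x * u x)" if u: "u \<in> W1 \<Omega> q" for u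
  proof -
    have i1: "integrable (lebesgue_on \<Omega>) (\<lambda>x. ?H x * cont_rep \<Omega> u x)"
    proof -
      obtain C where C: "\<forall>x\<in>closure \<Omega>. \<bar>cont_rep \<Omega> u x\<bar> \<le> C" using continuous_closure_bounded[OF rep_cont[OF u]] by blast
      have "AE x in lebesgue_on \<Omega>. \<bar>cont_rep \<Omega> u x\<bar> \<le> C" using AE_in by eventually_elim (use C closure_subset in blast)
      then show ?thesis by (rule bounded_mult_integrable[OF iH continuous_closure_measurable[OF rep_cont[OF u]]])
    qed
    have ae: "AE x in lebesgue_on \<Omega>. ?H x * cont_rep \<Omega> u x = ?H x * u x" using rep_AE[OF u] by eventually_elim simp
    have me: "(\<lambda>x. ?H x * u x) \<in> borel_measurable (lebesgue_on \<Omega>)"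
      using iH W1_integrable(1)[OF op bd less_imp_le[OF q1] u] by (intro borel_measurable_times borel_measurable_integrable)
    show ?thesis using integrable_cong_AE[OF borel_measurable_integrable[OF i1] me ae] i1 by simp
  qed
  define \<Lambda> where "\<Lambda> u = - F u - (LINT x|lebesgue_on \<Omega>. ?H x * u x)" for u
  have "\<exists>M. finite_measure M \<and> sets M = borel_subsets (closure \<Omega>) \<and> (\<forall>u\<in>?V. \<Lambda> u = (LINT x|M. u x))"
  proof (rule riesz_dense[OF compact_closure_Om])
    show "(\<lambda>x. 1) \<in> ?V" using one_W1[of 1] by auto
    show "(\<lambda>x. a * f x + b * g x) \<in> ?V" if "f \<in> ?V" "g \<in> ?V" for f g a b
      using that lincomb by (auto intro!: continuous_intros)
    show "\<exists>g\<in>?V. \<forall>x\<in>closure \<Omega>. \<bar>f x - g x\<bar> \<le> \<epsilon>" if f: "continuous_on (closure \<Omega>) f" and e: "\<epsilon> > 0" for f \<epsilon>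
    proof -
      obtain g where g: "smooth g" "\<forall>x\<in>closure \<Omega>. \<bar>f x - g x\<bar> \<le> \<epsilon>" using smooth_dense[OF f e] by blast
      have "g \<in> ?V" using smooth_in_W1[OF op bd less_imp_le[OF q1] g(1)] smooth_continuous[OF g(1)] by simp
      then show ?thesis using g(2) by blast
    qed
    show "\<Lambda> (\<lambda>x. a * f x + b * g x) = a * \<Lambda> f + b * \<Lambda> g" if "f \<in> ?V" "g \<in> ?V" for f g a b
    proof -
      have fg: "f \<in> W1 \<Omega> q" "g \<in> W1 \<Omega> q" using that by auto
      have "(LINT x|lebesgue_on \<Omega>. ?H x * (a * f x + b * g x)) = (LINT x|lebesgue_on \<Omega>. a * (?H x * f x) + b * (?H x * g x))"
        by (intro Bochner_Integration.integral_cong refl) (simp only: distrib_left mult.left_commute mult.assoc)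
      also have "\<dots> = a * (LINT x|lebesgue_on \<Omega>. ?H x * f x) + b * (LINT x|lebesgue_on \<Omega>. ?H x * g x)"
        using iHu[OF fg(1)] iHu[OF fg(2)]
        by (subst Bochner_Integration.integral_add) (auto simp only: integral_mult_right_zero intro!: integrable_mult_right)
      finally show ?thesis using dual_lincomb[OF F fg, of a b] by (simp add: \<Lambda>_def algebra_simps)
    qed
    show "0 \<le> \<Lambda> u" if u: "u \<in> ?V" "\<And>x. x \<in> closure \<Omega> \<Longrightarrow> 0 \<le> u x" for u
    proof -
      have uW: "u \<in> W1 \<Omega> q" and uc: "continuous_on (closure \<Omega>) u" using u by auto
      have lim: "(\<lambda>n. LINT x|lebesgue_on \<Omega>. 1 / s * norm (truncation (real n) \<beta> x) powr s * u x) \<longlonglongrightarrow> (LINT x|lebesgue_on \<Omega>. ?H x * u x)"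
      proof (rule integral_dominated_convergence[where w="\<lambda>x. \<bar>?H x * u x\<bar>"])
        show "AE x in lebesgue_on \<Omega>. (\<lambda>n. 1 / s * norm (truncation (real n) \<beta> x) powr s * u x) \<longlonglongrightarrow> ?H x * u x"
        proof (rule AE_I2)
          fix x show "(\<lambda>n. 1 / s * norm (truncation (real n) \<beta> x) powr s * u x) \<longlonglongrightarrow> ?H x * u x"
            by (rule tendsto_eventually) (use truncation_eventually[of \<beta> x] in eventually_elim, simp)
        qed
        show "AE x in lebesgue_on \<Omega>. norm (1 / s * norm (truncation (real n) \<beta> x) powr s * u x) \<le> \<bar>?H x * u x\<bar>" for n
          by (intro AE_I2) (simp add: truncation_def)
        show "(\<lambda>x. 1 / s * norm (truncation (real n) \<beta> x) powr s * u x) \<in> borel_measurable (lebesgue_on \<Omega>)" for n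
          using truncation_powr_integrable[OF _ \<beta>m, of s n] sf(1) continuous_closure_measurable[OF uc]
          by (intro borel_measurable_times borel_measurable_const) auto
        show "integrable (lebesgue_on \<Omega>) (\<lambda>x. \<bar>?H x * u x\<bar>)" by (rule integrable_abs[OF iHu[OF uW]])
      qed (rule borel_measurable_integrable[OF iHu[OF uW]])
      have "(LINT x|lebesgue_on \<Omega>. 1 / s * norm (truncation (real n) \<beta> x) powr s * u x) \<le> - F u" for n
        using truncated_inequality[OF le \<beta>m uW uc u(2), of n] by linarith
      then have "(LINT x|lebesgue_on \<Omega>. ?H x * u x) \<le> - F u" by (intro LIMSEQ_le_const2[OF lim]) auto
      then show ?thesis by (simp add: \<Lambda>_def)
    qed
  qed auto
  then obtain M where M: "finite_measure M" "sets M = borel_subsets (closure \<Omega>)" "\<And>u. u \<in> ?V \<Longrightarrow> \<Lambda> u = (LINT x|M. u x)" by blast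
  have "F = (\<lambda>u\<in>W1 \<Omega> q. - (LINT x|M. cont_rep \<Omega> u x) - (LINT x|lebesgue_on \<Omega>. ?H x * u x))"
  proof (rule extensionalityI[of F "W1 \<Omega> q"])
    show "F \<in> extensional (W1 \<Omega> q)" using F by (simp add: W1_dual_def)
    fix u assume u: "u \<in> W1 \<Omega> q"
    have ae: "AE x in lebesgue_on \<Omega>. u x = cont_rep \<Omega> u x" using rep_AE[OF u] by eventually_elim simp
    have "F u = F (cont_rep \<Omega> u)" by (rule dual_cong_AE[OF F u ae])
    also have "\<dots> = - (LINT x|M. cont_rep \<Omega> u x) - (LINT x|lebesgue_on \<Omega>. ?H x * cont_rep \<Omega> u x)"
      using M(3)[of "cont_rep \<Omega> u"] rep_W1[OF u] rep_cont[OF u] by (simp add: \<Lambda>_def)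
    also have "(LINT x|lebesgue_on \<Omega>. ?H x * cont_rep \<Omega> u x) = (LINT x|lebesgue_on \<Omega>. ?H x * u x)"
    proof (rule integral_cong_AE)
      show "AE x in lebesgue_on \<Omega>. ?H x * cont_rep \<Omega> u x = ?H x * u x" using ae by eventually_elim simp
    qed (use iHu[OF u] iHu[OF rep_W1[OF u]] in auto)
    finally show "F u = (\<lambda>u\<in>W1 \<Omega> q. - (LINT x|M. cont_rep \<Omega> u x) - (LINT x|lebesgue_on \<Omega>. ?H x * u x)) u" using u by simp
  qed (rule restrict_extensional)
  then show ?thesis using M by blast
qed

end

context subdifferential_setting
begin

section \<open>The structure of the subdifferential\<close>

abbreviation representation :: "'a measure \<Rightarrow> ('a \<Rightarrow> 'a) \<Rightarrow> ('a \<Rightarrow> real) \<Rightarrow> real" where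
  "representation M \<beta> \<equiv> (\<lambda>u\<in>W1 \<Omega> q. - (LINT x|M. cont_rep \<Omega> u x) - (LINT x|lebesgue_on \<Omega>. (1 / s * norm (\<beta> x) powr s) * u x))"

abbreviation closure_borel :: "'a measure" where "closure_borel \<equiv> restrict_space borel (closure \<Omega>)"

lemma null_measure_facts:
  "finite_measure (null_measure closure_borel)" "sets (null_measure closure_borel) = borel_subsets (closure \<Omega>)"
  "measure (null_measure closure_borel) B = 0" "(LINT x|null_measure closure_borel. f x) = (0::real)"
proof -
  show "finite_measure (null_measure closure_borel)" by (rule finite_measureI) simp
  show "sets (null_measure closure_borel) = borel_subsets (closure \<Omega>)" by simp
  show "measure (null_measure closure_borel) B = 0" by (simp add: measure_def)
  have "AE x in null_measure closure_borel. f x = 0"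
    by (rule AE_I[of _ _ "space (null_measure closure_borel)", OF _ _ sets.top]) auto
  then show "(LINT x|null_measure closure_borel. f x) = 0" by (rule integral_eq_zero_AE)
qed

lemma velocity_outside: "x \<notin> E1 \<Omega> m \<Longrightarrow> v x = 0"
  by (simp add: velocity_def)

lemma integrable_mult_m:
  assumes "integrable (lebesgue_on \<Omega>) h" shows "integrable (lebesgue_on \<Omega>) (\<lambda>x. h x * m x)"
proof -
  obtain C where C: "\<forall>x\<in>closure \<Omega>. \<bar>m x\<bar> \<le> C" using continuous_closure_bounded[OF mc] by blast
  have "AE x in lebesgue_on \<Omega>. \<bar>m x\<bar> \<le> C" using AE_in by eventually_elim (use C closure_subset in blast)
  then show ?thesis by (rule bounded_mult_integrable[OF assms mm])
qed

lemma sets_closure: "sets M = borel_subsets (closure \<Omega>) \<Longrightarrow> space M = closure \<Omega>"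
  using sets_eq_imp_space_eq[of M closure_borel] by (simp add: space_restrict_space)

text \<open>In the equality of \<open>subdifferential_pairing\<close> all terms are integrals, with respect to \<open>M\<close> and to Lebesgue measure. Collected on one side
  they are \<open>\<integral> m \<partial>M + \<integral> G\<close>, where \<open>G = m * K\<close> and \<open>K\<close> is the defect in Young's inequality for \<open>\<beta>\<close> and \<open>v\<close>. Both are
  non-negative, so both vanish.\<close>
lemma subdifferential_forward:
  assumes sd: "(F, \<beta>) \<in> subdifferential \<Omega> q (Lfun \<Omega> r) m w"
  shows "\<beta> \<in> Lp \<Omega> s" "v \<in> Lp \<Omega> r"
    "AE x in lebesgue_on \<Omega>. x \<in> E1 \<Omega> m \<longrightarrow> \<beta> x = norm (v x) powr (r - 2) *\<^sub>R v x"
    "\<exists>M. finite_measure M \<and> sets M = borel_subsets (closure \<Omega>) \<and> measure M (E1 \<Omega> m) = 0 \<and> F = representation M \<beta>"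
proof -
  note sp = subdifferential_pairing[OF sd]
  have \<beta>m: "\<beta> \<in> borel_measurable (lebesgue_on \<Omega>)" using sp(2) by (simp add: Lp_def)
  show bL: "\<beta> \<in> Lp \<Omega> s" by (rule beta_in_Lp[OF sp(4) \<beta>m])
  obtain M where M: "finite_measure M" "sets M = borel_subsets (closure \<Omega>)" "F = representation M \<beta>"
    using functional_representation[OF sp(1) sp(4) bL] by blast
  note spM = sets_closure[OF M(2)]
  let ?H = "\<lambda>x. 1 / s * norm (\<beta> x) powr s"
  have iH: "integrable (lebesgue_on \<Omega>) ?H" by (intro integrable_mult_right powr_integrable_of_Lp[OF bL])
  have Fm: "F m = - (LINT x|M. cont_rep \<Omega> m x) - (LINT x|lebesgue_on \<Omega>. ?H x * m x)"
    by (subst M(3)) (simp only: restrict_apply mW if_True)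
  have crm: "(LINT x|M. cont_rep \<Omega> m x) = (LINT x|M. m x)"
    by (intro Bochner_Integration.integral_cong refl rep_eq[OF mc]) (simp add: spM)
  have bw: "AE x in lebesgue_on \<Omega>. \<beta> x \<bullet> w x = m x * (\<beta> x \<bullet> v x)" using w_eq by eventually_elim simp
  have ibw: "integrable (lebesgue_on \<Omega>) (\<lambda>x. \<beta> x \<bullet> w x)" by (rule Lp_pairing_integrable[OF q1 sp(2) wL])
  have mbv: "(\<lambda>x. m x * (\<beta> x \<bullet> v x)) \<in> borel_measurable (lebesgue_on \<Omega>)"
    using \<beta>m vm mm by measurable
  have imbv: "integrable (lebesgue_on \<Omega>) (\<lambda>x. m x * (\<beta> x \<bullet> v x))"
    using integrable_cong_AE[OF borel_measurable_integrable[OF ibw] mbv bw] ibw by simp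
  have ebw: "(LINT x|lebesgue_on \<Omega>. \<beta> x \<bullet> w x) = (LINT x|lebesgue_on \<Omega>. m x * (\<beta> x \<bullet> v x))"
    by (rule integral_cong_AE[OF borel_measurable_integrable[OF ibw] mbv bw])
  define K where "K x = norm (v x) powr r / r + norm (\<beta> x) powr s / s - \<beta> x \<bullet> v x" for x
  define G where "G x = ?H x * m x + hL x - m x * (\<beta> x \<bullet> v x)" for x
  have GK: "G x = m x * K x" for x by (simp add: G_def K_def algebra_simps)
  have K0: "0 \<le> K x" for x using young_inner[OF r1, of "\<beta> x" "v x"] by (simp add: K_def)
  have G0: "AE x in lebesgue_on \<Omega>. 0 \<le> G x"
    using AE_in by eventually_elim (simp only: GK mult_nonneg_nonneg[OF m_nonneg' K0])
  have iHm: "integrable (lebesgue_on \<Omega>) (\<lambda>x. ?H x * m x)" by (rule integrable_mult_m[OF iH])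
  have i2: "integrable (lebesgue_on \<Omega>) (\<lambda>x. ?H x * m x + hL x)" by (rule Bochner_Integration.integrable_add[OF iHm hL_integrable])
  have iG: "integrable (lebesgue_on \<Omega>) G" unfolding G_def by (rule Bochner_Integration.integrable_diff[OF i2 imbv])
  have "(LINT x|lebesgue_on \<Omega>. G x) = (LINT x|lebesgue_on \<Omega>. ?H x * m x) + (LINT x|lebesgue_on \<Omega>. hL x) - (LINT x|lebesgue_on \<Omega>. m x * (\<beta> x \<bullet> v x))"
    unfolding G_def Bochner_Integration.integral_diff[OF i2 imbv] Bochner_Integration.integral_add[OF iHm hL_integrable] by (rule refl)
  then have sum0: "(LINT x|M. m x) + (LINT x|lebesgue_on \<Omega>. G x) = 0"
    using sp(3) unfolding Fm crm ebw by linarith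
  have m0: "AE x in M. 0 \<le> m x" by (rule AE_I2) (use spM m_nonneg in blast)
  have im: "integrable M m" by (rule continuous_measure_integrable[OF mc M(1,2)])
  have z: "(LINT x|M. m x) = 0" "(LINT x|lebesgue_on \<Omega>. G x) = 0"
    using sum0 integral_nonneg_AE[OF m0] integral_nonneg_AE[OF G0] by linarith+
  have "AE x in M. m x = 0" using integral_nonneg_eq_0_iff_AE[OF im m0] z(1) by blast
  then have "AE x in M. \<not> 0 < m x" by eventually_elim simp
  then have "emeasure M {x \<in> space M. 0 < m x} = 0" by (rule emeasure_eq_0_AE)
  then have "measure M (E1 \<Omega> m) = 0" by (simp add: spM E1_def measure_def)
  then show "\<exists>M. finite_measure M \<and> sets M = borel_subsets (closure \<Omega>) \<and> measure M (E1 \<Omega> m) = 0 \<and> F = representation M \<beta>"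
    using M by blast
  have AG: "AE x in lebesgue_on \<Omega>. G x = 0" using integral_nonneg_eq_0_iff_AE[OF iG G0] z(2) by blast
  show e1: "AE x in lebesgue_on \<Omega>. x \<in> E1 \<Omega> m \<longrightarrow> \<beta> x = norm (v x) powr (r - 2) *\<^sub>R v x"
    using AG AE_in
  proof eventually_elim
    case (elim x)
    show ?case
    proof
      assume "x \<in> E1 \<Omega> m"
      then have "m x \<noteq> 0" by (auto simp: E1_def)
      then have "K x = 0" using elim(1) by (simp add: GK)
      then have "\<beta> x \<bullet> v x = norm (v x) powr r / r + norm (\<beta> x) powr s / s" by (simp add: K_def)
      then show "\<beta> x = norm (v x) powr (r - 2) *\<^sub>R v x" by (rule young_equality[OF r1])
    qed
  qed
  have "integrable (lebesgue_on \<Omega>) (\<lambda>x. norm (v x) powr r)"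
  proof (rule Bochner_Integration.integrable_bound[OF powr_integrable_of_Lp[OF bL]])
    show "(\<lambda>x. norm (v x) powr r) \<in> borel_measurable (lebesgue_on \<Omega>)" using vm by measurable
    show "AE x in lebesgue_on \<Omega>. norm (norm (v x) powr r) \<le> norm (norm (\<beta> x) powr s)"
      using e1
    proof eventually_elim
      case (elim x)
      show ?case
      proof (cases "x \<in> E1 \<Omega> m")
        case True
        then show ?thesis using duality_map(2)[OF r1, of "v x"] elim by simp
      next
        case False
        then show ?thesis using r1 by (simp add: velocity_outside)
      qed
    qed
  qed
  then show "v \<in> Lp \<Omega> r" using vm by (simp add: Lp_def)
qed

lemma velocity_density_integrable:
  assumes vL: "v \<in> Lp \<Omega> r"
  shows "integrable (lebesgue_on \<Omega>) (\<lambda>x. 1 / s * norm (v x) powr r)"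
  by (intro integrable_mult_right powr_integrable_of_Lp[OF vL])

lemma density_nonneg: "0 \<le> 1 / s * norm (y :: 'a) powr t"
  using sf(1) by simp

lemma borel_subsets_borel: "B \<in> borel_subsets (closure \<Omega>) \<Longrightarrow> B \<in> sets borel"
  by (subst (asm) sets_restrict_space_iff) auto

text \<open>The functional is integration against minus the sum of \<open>M\<close> and the measure with density \<open>|\<beta>|\<^sup>s / s\<close>. On \<open>E1 \<Omega> m\<close> the
  first vanishes, and the density of the second is \<open>|v|\<^sup>r / s\<close>.\<close>
lemma representation_membership:
  assumes bL: "\<beta> \<in> Lp \<Omega> s" and M: "finite_measure M" "sets M = borel_subsets (closure \<Omega>)"
    and M0: "measure M (E1 \<Omega> m) = 0" and vL: "v \<in> Lp \<Omega> r"
    and e1: "AE x in lebesgue_on \<Omega>. x \<in> E1 \<Omega> m \<longrightarrow> \<beta> x = norm (v x) powr (r - 2) *\<^sub>R v x"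
  shows "(representation M \<beta>, \<beta>) \<in> A_closure \<Omega> q s"
    "\<exists>\<alpha>. signed_radon (closure \<Omega>) \<alpha> \<and> representation M \<beta> = measure_functional \<Omega> q \<alpha> \<and>
       restriction_has_density \<Omega> \<alpha> (E1 \<Omega> m) (\<lambda>x. - (1 / s) * norm (v x) powr r)"
proof -
  let ?H = "\<lambda>x. 1 / s * norm (\<beta> x) powr s" and ?N = "null_measure closure_borel"
  let ?f = "\<lambda>x. - (1 / s) * norm (v x) powr r"
  interpret M: finite_measure M by (rule M(1))
  show "(representation M \<beta>, \<beta>) \<in> A_closure \<Omega> q s" by (rule A_closure_intro[OF r1 rq M bL])
  have \<beta>m: "\<beta> \<in> borel_measurable (lebesgue_on \<Omega>)" using bL by (simp add: Lp_def)
  have iH: "integrable (lebesgue_on \<Omega>) ?H" by (intro integrable_mult_right powr_integrable_of_Lp[OF bL])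
  note D = density_measure_facts[where \<Omega>=\<Omega> and h="?H", OF iH density_nonneg]
  note N = null_measure_facts
  obtain S where S: "finite_measure S" "sets S = borel_subsets (closure \<Omega>)"
    "\<And>B. B \<in> borel_subsets (closure \<Omega>) \<Longrightarrow> measure S B = measure M B + measure (density_measure \<Omega> ?H) B"
    using sum_of_finite_measures[OF M(1) D(1) M(2) D(2)] by blast
  define \<alpha> where "\<alpha> B = measure ?N B - measure S B" for B
  have sr: "signed_radon (closure \<Omega>) \<alpha>" unfolding \<alpha>_def by (rule signed_radon_diff_measures[OF N(1) S(1) N(2) S(2)])
  have "representation M \<beta> = measure_functional \<Omega> q \<alpha>" unfolding measure_functional_def
  proof (rule restrict_ext)
    fix u assume u: "u \<in> W1 \<Omega> q"
    have cm: "cont_rep \<Omega> u \<in> borel_measurable closure_borel" by (rule borel_measurable_continuous_on_restrict[OF rep_cont[OF u]])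
    obtain C where C: "\<And>x. x \<in> closure \<Omega> \<Longrightarrow> \<bar>cont_rep \<Omega> u x\<bar> \<le> C" using continuous_closure_bounded[OF rep_cont[OF u]] by blast
    have si: "signed_integral (closure \<Omega>) \<alpha> (cont_rep \<Omega> u) = (LINT x|?N. cont_rep \<Omega> u x) - (LINT x|S. cont_rep \<Omega> u x)"
      by (rule signed_integral_eq[OF sr N(1) S(1) N(2) S(2) _ cm C]) (simp_all add: \<alpha>_def)
    have "(LINT x|M. cont_rep \<Omega> u x) + (LINT x|density_measure \<Omega> ?H. cont_rep \<Omega> u x) = (LINT x|S. cont_rep \<Omega> u x) + (LINT x|?N. cont_rep \<Omega> u x)"
    proof (rule integral_diff_cong[OF M(1) D(1) S(1) N(1) M(2) D(2) S(2) N(2) _ cm])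
      show "measure M B + measure (density_measure \<Omega> ?H) B = measure S B + measure ?N B" if "B \<in> borel_subsets (closure \<Omega>)" for B
        using S(3)[OF that] N(3)[of B] by linarith
      show "\<bar>cont_rep \<Omega> u x\<bar> \<le> C" if "x \<in> space closure_borel" for x
        by (rule C) (use that in \<open>simp add: space_restrict_space\<close>)
    qed
    moreover have "(LINT x|density_measure \<Omega> ?H. cont_rep \<Omega> u x) = (LINT x|lebesgue_on \<Omega>. ?H x * u x)"
      unfolding D(3)[OF cm]
    proof (rule integral_cong_AE)
      show "(\<lambda>x. ?H x * cont_rep \<Omega> u x) \<in> borel_measurable (lebesgue_on \<Omega>)"
        by (rule borel_measurable_integrable[OF representation_in_dual(2)[OF M iH rep_W1[OF u]]])
      show "(\<lambda>x. ?H x * u x) \<in> borel_measurable (lebesgue_on \<Omega>)"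
        by (rule borel_measurable_integrable[OF representation_in_dual(2)[OF M iH u]])
      show "AE x in lebesgue_on \<Omega>. ?H x * cont_rep \<Omega> u x = ?H x * u x" using rep_AE[OF u] by eventually_elim simp
    qed
    ultimately show "- (LINT x|M. cont_rep \<Omega> u x) - (LINT x|lebesgue_on \<Omega>. ?H x * u x) = signed_integral (closure \<Omega>) \<alpha> (cont_rep \<Omega> u)"
      using si N(4)[of "cont_rep \<Omega> u"] by linarith
  qed
  moreover have "restriction_has_density \<Omega> \<alpha> (E1 \<Omega> m) ?f" unfolding restriction_has_density_def
  proof (intro conjI ballI)
    have "integrable (lebesgue_on \<Omega>) ?f"
      by (intro integrable_mult_right powr_integrable_of_Lp[OF vL])
    then have "integrable lebesgue (\<lambda>x. indicator \<Omega> x *\<^sub>R ?f x)"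
      by (subst (asm) integrable_restrict_space) (use Om_sets in auto)
    moreover have "indicator \<Omega> x *\<^sub>R ?f x = indicator (E1 \<Omega> m \<inter> \<Omega>) x *\<^sub>R ?f x" for x
      using velocity_outside[of x] r1 by (auto simp: indicator_def)
    ultimately show "set_integrable lebesgue (E1 \<Omega> m \<inter> \<Omega>) ?f" unfolding set_integrable_def by (simp only:)
    fix B assume B: "B \<in> borel_subsets (closure \<Omega>)"
    then have EB: "E1 \<Omega> m \<inter> B \<in> borel_subsets (closure \<Omega>)" using E1_borel by blast
    have "measure M (E1 \<Omega> m \<inter> B) \<le> measure M (E1 \<Omega> m)" by (rule M.finite_measure_mono) (use E1_borel M(2) in auto)
    then have MB: "measure M (E1 \<Omega> m \<inter> B) = 0" using M0 measure_nonneg[of M "E1 \<Omega> m \<inter> B"] by linarith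
    have [measurable]: "(indicator (E1 \<Omega> m \<inter> B) :: 'a \<Rightarrow> real) \<in> borel_measurable (lebesgue_on \<Omega>)"
      by (intro measurable_restrict_space1 borel_measurable_indicator) (use borel_subsets_borel[OF EB] in auto)
    have [measurable]: "\<beta> \<in> borel_measurable (lebesgue_on \<Omega>)" "v \<in> borel_measurable (lebesgue_on \<Omega>)" by (fact \<beta>m, fact vm)
    have "(LINT x:E1 \<Omega> m \<inter> B \<inter> \<Omega>|lebesgue. ?f x) = (LINT x|lebesgue_on \<Omega>. indicator (E1 \<Omega> m \<inter> B) x * ?f x)"
      by (rule lebesgue_on_density_indicator[OF Om_sets])
    also have "\<dots> = (LINT x|lebesgue_on \<Omega>. - (?H x * indicator (E1 \<Omega> m \<inter> B) x))"
    proof (rule integral_cong_AE)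
      show "AE x in lebesgue_on \<Omega>. indicator (E1 \<Omega> m \<inter> B) x * ?f x = - (?H x * indicator (E1 \<Omega> m \<inter> B) x)"
        using e1
      proof eventually_elim
        case (elim x)
        show ?case
        proof (cases "x \<in> E1 \<Omega> m")
          case True
          then have "norm (\<beta> x) powr s = norm (v x) powr r" using duality_map(2)[OF r1, of "v x"] elim by simp
          then show ?thesis by simp
        qed simp
      qed
    qed measurable
    also have "\<dots> = - measure (density_measure \<Omega> ?H) (E1 \<Omega> m \<inter> B)" unfolding D(4)[OF EB] by (rule integral_minus)
    finally show "\<alpha> (E1 \<Omega> m \<inter> B) = (LINT x:E1 \<Omega> m \<inter> B \<inter> \<Omega>|lebesgue. ?f x)"
      using S(3)[OF EB] MB N(3)[of "E1 \<Omega> m \<inter> B"] unfolding \<alpha>_def by linarith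
  qed
  ultimately show "\<exists>\<alpha>. signed_radon (closure \<Omega>) \<alpha> \<and> representation M \<beta> = measure_functional \<Omega> q \<alpha> \<and>
       restriction_has_density \<Omega> \<alpha> (E1 \<Omega> m) ?f" using sr by blast
qed

text \<open>Since \<open>m\<close> vanishes on the rest of the closure, only the restriction of the measure to \<open>E1 \<Omega> m\<close> matters for the integral of \<open>m\<close>.\<close>
lemma restricted_integral:
  assumes P: "finite_measure P" "sets P = borel_subsets (closure \<Omega>)"
  shows "finite_measure (density P (indicator (E1 \<Omega> m)))" "sets (density P (indicator (E1 \<Omega> m))) = borel_subsets (closure \<Omega>)"
    "B \<in> borel_subsets (closure \<Omega>) \<Longrightarrow> measure (density P (indicator (E1 \<Omega> m))) B = measure P (E1 \<Omega> m \<inter> B)"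
    "(LINT x|P. m x) = (LINT x|density P (indicator (E1 \<Omega> m)). m x)"
proof -
  interpret P: finite_measure P by (rule P(1))
  note spP = sets_closure[OF P(2)]
  have E: "E1 \<Omega> m \<in> sets P" using E1_borel P(2) by simp
  have em: "emeasure (density P (indicator (E1 \<Omega> m))) B = emeasure P (E1 \<Omega> m \<inter> B)" if "B \<in> sets P" for B
    by (rule emeasure_restricted[OF E that])
  have "emeasure (density P (indicator (E1 \<Omega> m))) (space P) \<noteq> \<infinity>"
    using em[OF sets.top] P.emeasure_finite by simp
  then show "finite_measure (density P (indicator (E1 \<Omega> m)))" by (intro finite_measureI) simp
  show "sets (density P (indicator (E1 \<Omega> m))) = borel_subsets (closure \<Omega>)" using P(2) by simp
  show "measure (density P (indicator (E1 \<Omega> m))) B = measure P (E1 \<Omega> m \<inter> B)" if "B \<in> borel_subsets (closure \<Omega>)"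
    using em[of B] that P(2) by (simp add: measure_def)
  have mP: "m \<in> borel_measurable P"
    by (rule borel_measurable_integrable[OF continuous_measure_integrable[OF mc P]])
  have iP: "(indicator (E1 \<Omega> m) :: 'a \<Rightarrow> real) \<in> borel_measurable P" using E by simp
  have d: "density P (indicator (E1 \<Omega> m)) = density P (\<lambda>x. ennreal (indicator (E1 \<Omega> m) x))"
    by (simp add: ennreal_indicator)
  have "(LINT x|density P (indicator (E1 \<Omega> m)). m x) = (LINT x|P. indicator (E1 \<Omega> m) x * m x)"
    unfolding d by (rule integral_real_density[OF iP _ mP]) simp
  also have "\<dots> = (LINT x|P. m x)"
  proof (intro Bochner_Integration.integral_cong refl)
    fix x assume "x \<in> space P"
    then have "x \<in> closure \<Omega>" by (simp add: spP)
    then show "indicator (E1 \<Omega> m) x * m x = m x" using m_nonneg[of x] by (auto simp: indicator_def E1_def)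
  qed
  finally show "(LINT x|P. m x) = (LINT x|density P (indicator (E1 \<Omega> m)). m x)" by simp
qed

text \<open>The restrictions of the positive and the negative part of \<open>\<alpha>\<close> to \<open>E1 \<Omega> m\<close> differ by the measure with density \<open>|v|\<^sup>r / s\<close>.\<close>
lemma functional_value:
  assumes sr: "signed_radon (closure \<Omega>) \<alpha>" and vL: "v \<in> Lp \<Omega> r"
    and rd: "restriction_has_density \<Omega> \<alpha> (E1 \<Omega> m) (\<lambda>x. - (1 / s) * norm (v x) powr r)"
  shows "measure_functional \<Omega> q \<alpha> m = - (LINT x|lebesgue_on \<Omega>. (1 / s * norm (v x) powr r) * m x)"
proof -
  let ?f = "\<lambda>x. - (1 / s) * norm (v x) powr r" and ?h = "\<lambda>x. 1 / s * norm (v x) powr r"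
  let ?P = "pos_part (closure \<Omega>) \<alpha>" and ?Q = "pos_part (closure \<Omega>) (\<lambda>B. - \<alpha> B)" and ?N = "null_measure closure_borel"
  note P = restricted_integral[OF pos_part_facts(1)[OF sr] sets_pos_part]
  note Q = restricted_integral[OF pos_part_facts(1)[OF signed_radon_uminus[OF sr]] sets_pos_part]
  note D = density_measure_facts[where \<Omega>=\<Omega> and h="?h", OF velocity_density_integrable[OF vL] density_nonneg]
  note N = null_measure_facts
  have cm: "m \<in> borel_measurable closure_borel" by (rule borel_measurable_continuous_on_restrict[OF mc])
  obtain C where C: "\<And>x. x \<in> closure \<Omega> \<Longrightarrow> \<bar>m x\<bar> \<le> C" using continuous_closure_bounded[OF mc] by blast
  have "(LINT x|density ?P (indicator (E1 \<Omega> m)). m x) + (LINT x|density_measure \<Omega> ?h. m x)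
      = (LINT x|density ?Q (indicator (E1 \<Omega> m)). m x) + (LINT x|?N. m x)"
  proof (rule integral_diff_cong[OF P(1) D(1) Q(1) N(1) P(2) D(2) Q(2) N(2) _ cm])
    fix B assume B: "B \<in> borel_subsets (closure \<Omega>)"
    then have EB: "E1 \<Omega> m \<inter> B \<in> borel_subsets (closure \<Omega>)" using E1_borel by blast
    have "\<alpha> (E1 \<Omega> m \<inter> B) = (LINT x:E1 \<Omega> m \<inter> B \<inter> \<Omega>|lebesgue. ?f x)" using rd B by (simp add: restriction_has_density_def)
    also have "\<dots> = (LINT x|lebesgue_on \<Omega>. indicator (E1 \<Omega> m \<inter> B) x * ?f x)"
      by (rule lebesgue_on_density_indicator[OF Om_sets])
    also have "\<dots> = (LINT x|lebesgue_on \<Omega>. - (?h x * indicator B x))"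
    proof (intro Bochner_Integration.integral_cong refl)
      fix x show "indicator (E1 \<Omega> m \<inter> B) x * ?f x = - (?h x * indicator B x)"
        using velocity_outside[of x] r1 by (cases "x \<in> E1 \<Omega> m") (auto simp: indicator_def)
    qed
    also have "\<dots> = - measure (density_measure \<Omega> ?h) B" unfolding D(4)[OF B] by (rule integral_minus)
    finally have "\<alpha> (E1 \<Omega> m \<inter> B) = - measure (density_measure \<Omega> ?h) B" .
    then show "measure (density ?P (indicator (E1 \<Omega> m))) B + measure (density_measure \<Omega> ?h) B
        = measure (density ?Q (indicator (E1 \<Omega> m))) B + measure ?N B"
      using P(3)[OF B] Q(3)[OF B] N(3)[of B] jordan_decomposition[OF sr EB] by linarith
  next
    show "\<bar>m x\<bar> \<le> C" if "x \<in> space closure_borel" for x by (rule C) (use that in \<open>simp add: space_restrict_space\<close>)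
  qed
  moreover have "measure_functional \<Omega> q \<alpha> m = (LINT x|?P. m x) - (LINT x|?Q. m x)"
  proof -
    have "(LINT x|?P. cont_rep \<Omega> m x) = (LINT x|?P. m x)" "(LINT x|?Q. cont_rep \<Omega> m x) = (LINT x|?Q. m x)"
      by (intro Bochner_Integration.integral_cong refl rep_eq[OF mc]; simp add: sets_closure[OF sets_pos_part])+
    then show ?thesis unfolding measure_functional_def signed_integral_def by (simp only: restrict_apply mW if_True)
  qed
  ultimately show ?thesis using P(4) Q(4) D(3)[OF cm] N(4)[of m] by linarith
qed

text \<open>The pairing with \<open>(m, w)\<close> is \<open>- \<integral> m |v|\<^sup>r / s + \<integral> m |v|\<^sup>r\<close>, which is the value of the functional. The subgradient
  inequality is then the bound \<open>A_closure_pairing_le\<close> minus this equality.\<close>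
lemma subdifferential_backward:
  assumes AC: "(F, \<beta>) \<in> A_closure \<Omega> q s" and vL: "v \<in> Lp \<Omega> r"
    and sr: "signed_radon (closure \<Omega>) \<alpha>" and F\<alpha>: "F = measure_functional \<Omega> q \<alpha>"
    and rd: "restriction_has_density \<Omega> \<alpha> (E1 \<Omega> m) (\<lambda>x. - (1 / s) * norm (v x) powr r)"
    and e1: "AE x in lebesgue_on \<Omega>. x \<in> E1 \<Omega> m \<longrightarrow> \<beta> x = norm (v x) powr (r - 2) *\<^sub>R v x"
  shows "(F, \<beta>) \<in> subdifferential \<Omega> q (Lfun \<Omega> r) m w"
proof -
  have F: "F \<in> W1_dual \<Omega> q" and \<beta>: "\<beta> \<in> Lp \<Omega> (conj_exp q)" using AC by (auto simp: A_closure_def)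
  let ?I = "LINT x|lebesgue_on \<Omega>. m x * norm (v x) powr r"
  have [measurable]: "m \<in> borel_measurable (lebesgue_on \<Omega>)" "v \<in> borel_measurable (lebesgue_on \<Omega>)" by (fact mm, fact vm)
  have Fm: "F m = - (1 / s * ?I)"
  proof -
    have "(LINT x|lebesgue_on \<Omega>. (1 / s * norm (v x) powr r) * m x) = (LINT x|lebesgue_on \<Omega>. 1 / s * (m x * norm (v x) powr r))"
      by (intro Bochner_Integration.integral_cong refl) simp
    then show ?thesis unfolding F\<alpha> functional_value[OF sr vL rd] by (simp only: integral_mult_right_zero)
  qed
  have bw: "(LINT x|lebesgue_on \<Omega>. \<beta> x \<bullet> w x) = ?I"
  proof (rule integral_cong_AE)
    show "(\<lambda>x. \<beta> x \<bullet> w x) \<in> borel_measurable (lebesgue_on \<Omega>)"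
      by (rule borel_measurable_integrable[OF Lp_pairing_integrable[OF q1 \<beta> wL]])
    show "(\<lambda>x. m x * norm (v x) powr r) \<in> borel_measurable (lebesgue_on \<Omega>)" by measurable
    show "AE x in lebesgue_on \<Omega>. \<beta> x \<bullet> w x = m x * norm (v x) powr r"
      using e1 w_eq
    proof eventually_elim
      case (elim x)
      show ?case
      proof (cases "x \<in> E1 \<Omega> m")
        case True
        then have "\<beta> x \<bullet> v x = norm (v x) powr r" using duality_map(3)[OF r1, of "v x"] elim(1) by simp
        then show ?thesis using elim(2) by simp
      next
        case False
        then show ?thesis using elim(2) r1 by (simp add: velocity_outside)
      qed
    qed
  qed
  have "1 / r * ?I = ?I - 1 / s * ?I"
  proof -
    have "1 / r = 1 - 1 / s" using sf(2) by linarith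
    then show ?thesis by (simp only: left_diff_distrib mult_1_left)
  qed
  then have eq: "(LINT x|lebesgue_on \<Omega>. hL x) = F m + (LINT x|lebesgue_on \<Omega>. \<beta> x \<bullet> w x)"
    unfolding Fm bw integral_mult_right_zero by linarith
  have "Lfun \<Omega> r m w + ereal (F (\<lambda>x. m' x - m x) + (LINT x|lebesgue_on \<Omega>. \<beta> x \<bullet> (w' x - w x))) \<le> Lfun \<Omega> r m' w'"
    if m': "m' \<in> W1 \<Omega> q" and w': "w' \<in> Lp \<Omega> q" for m' w'
  proof -
    have i: "(LINT x|lebesgue_on \<Omega>. \<beta> x \<bullet> (w' x - w x)) = (LINT x|lebesgue_on \<Omega>. \<beta> x \<bullet> w' x) - (LINT x|lebesgue_on \<Omega>. \<beta> x \<bullet> w x)"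
      using Lp_pairing_integrable[OF q1 \<beta> w'] Lp_pairing_integrable[OF q1 \<beta> wL] by (simp add: inner_diff_right)
    have "(LINT x|lebesgue_on \<Omega>. hL x) + (F (\<lambda>x. m' x - m x) + (LINT x|lebesgue_on \<Omega>. \<beta> x \<bullet> (w' x - w x)))
        = F m' + (LINT x|lebesgue_on \<Omega>. \<beta> x \<bullet> w' x)"
      unfolding i eq dual_diff[OF F m' mW] by linarith
    then show ?thesis using A_closure_pairing_le[OF r1 AC m' w'] unfolding Lfun_value by (simp only: plus_ereal.simps(1))
  qed
  then show ?thesis using F \<beta> fin unfolding subdifferential_def by blast
qed

text \<open>The subgradient with the smallest measure: \<open>\<beta>\<close> is the field dual to \<open>v\<close>, and \<open>M = 0\<close>.\<close>
lemma subdifferential_nonempty: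
  assumes vL: "v \<in> Lp \<Omega> r"
  shows "subdifferential \<Omega> q (Lfun \<Omega> r) m w \<noteq> {}"
proof -
  let ?\<beta> = "\<lambda>x. norm (v x) powr (r - 2) *\<^sub>R v x"
  have [measurable]: "v \<in> borel_measurable (lebesgue_on \<Omega>)" by (fact vm)
  have "?\<beta> \<in> borel_measurable (lebesgue_on \<Omega>)" by measurable
  moreover have "integrable (lebesgue_on \<Omega>) (\<lambda>x. norm (?\<beta> x) powr s)"
    unfolding duality_map(2)[OF r1] by (rule powr_integrable_of_Lp[OF vL])
  ultimately have bL: "?\<beta> \<in> Lp \<Omega> s" by (simp only: Lp_def mem_Collect_eq simp_thms)
  have e1: "AE x in lebesgue_on \<Omega>. x \<in> E1 \<Omega> m \<longrightarrow> ?\<beta> x = norm (v x) powr (r - 2) *\<^sub>R v x" by simp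
  note R = representation_membership[OF bL null_measure_facts(1,2) null_measure_facts(3) vL e1]
  obtain \<alpha> where \<alpha>: "signed_radon (closure \<Omega>) \<alpha>" "representation (null_measure closure_borel) ?\<beta> = measure_functional \<Omega> q \<alpha>"
       "restriction_has_density \<Omega> \<alpha> (E1 \<Omega> m) (\<lambda>x. - (1 / s) * norm (v x) powr r)" using R(2) by blast
  from subdifferential_backward[OF R(1) vL \<alpha> e1] show ?thesis by blast
qed

text \<open>Smooth functions belong to \<open>W1 \<Omega> q\<close> and are dense in the continuous functions. With the negative parts moved to
  the other side, the two measures become two finite positive measures with the same integrals of continuous functions.\<close>
lemma measure_functional_inject:
  assumes s1: "signed_radon (closure \<Omega>) \<alpha>" and s2: "signed_radon (closure \<Omega>) \<alpha>'"
    and eq: "measure_functional \<Omega> q \<alpha> = measure_functional \<Omega> q \<alpha>'" and B: "B \<in> borel_subsets (closure \<Omega>)"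
  shows "\<alpha> B = \<alpha>' B"
proof -
  let ?P = "pos_part (closure \<Omega>) \<alpha>" and ?Q = "pos_part (closure \<Omega>) (\<lambda>B. - \<alpha> B)"
  let ?P' = "pos_part (closure \<Omega>) \<alpha>'" and ?Q' = "pos_part (closure \<Omega>) (\<lambda>B. - \<alpha>' B)" and ?N = "null_measure closure_borel"
  note p = pos_part_facts(1)[OF s1] pos_part_facts(1)[OF signed_radon_uminus[OF s1]]
    pos_part_facts(1)[OF s2] pos_part_facts(1)[OF signed_radon_uminus[OF s2]]
  note N = null_measure_facts
  have int_sum: "(LINT x|M1. f x) + (LINT x|M2. f x) = (LINT x|S. f x)"
    if "finite_measure M1" "finite_measure M2" "finite_measure S" "sets M1 = borel_subsets (closure \<Omega>)" "sets M2 = borel_subsets (closure \<Omega>)"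
      "sets S = borel_subsets (closure \<Omega>)" and add: "\<forall>B\<in>borel_subsets (closure \<Omega>). measure S B = measure M1 B + measure M2 B"
      and fc: "continuous_on (closure \<Omega>) f"
    for M1 M2 S and f :: "'a \<Rightarrow> real"
  proof -
    obtain C where C: "\<And>x. x \<in> closure \<Omega> \<Longrightarrow> \<bar>f x\<bar> \<le> C" using continuous_closure_bounded[OF fc] by blast
    have "(LINT x|M1. f x) + (LINT x|M2. f x) = (LINT x|S. f x) + (LINT x|?N. f x)"
    proof (rule integral_diff_cong[OF that(1,2,3) N(1) that(4,5,6) N(2)])
      show "f \<in> borel_measurable closure_borel" by (rule borel_measurable_continuous_on_restrict[OF fc])
      show "\<bar>f x\<bar> \<le> C" if "x \<in> space closure_borel" for x by (rule C) (use that in \<open>simp add: space_restrict_space\<close>)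
      show "measure M1 B + measure M2 B = measure S B + measure ?N B" if B: "B \<in> borel_subsets (closure \<Omega>)" for B
        using bspec[OF add B] N(3)[of B] by linarith
    qed
    then show ?thesis using N(4)[of f] by linarith
  qed
  obtain S where S: "finite_measure S" "sets S = borel_subsets (closure \<Omega>)"
    "\<forall>B\<in>borel_subsets (closure \<Omega>). measure S B = measure ?P B + measure ?Q' B"
    using sum_of_finite_measures[OF p(1) p(4) sets_pos_part sets_pos_part] by blast
  obtain T where T: "finite_measure T" "sets T = borel_subsets (closure \<Omega>)"
    "\<forall>B\<in>borel_subsets (closure \<Omega>). measure T B = measure ?Q B + measure ?P' B"
    using sum_of_finite_measures[OF p(2) p(3) sets_pos_part sets_pos_part] by blast
  have smooth_eq: "(LINT x|S. g x) = (LINT x|T. g x)" if g: "smooth g" for g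
  proof -
    have gW: "g \<in> W1 \<Omega> q" by (rule smooth_in_W1[OF op bd less_imp_le[OF q1] g])
    have gc: "continuous_on (closure \<Omega>) g" by (rule smooth_continuous[OF g])
    have rg: "(LINT x|pos_part (closure \<Omega>) \<gamma>. cont_rep \<Omega> g x) = (LINT x|pos_part (closure \<Omega>) \<gamma>. g x)" for \<gamma>
      by (intro Bochner_Integration.integral_cong refl rep_eq[OF gc]) (simp add: sets_closure[OF sets_pos_part])
    have "(LINT x|?P. g x) - (LINT x|?Q. g x) = (LINT x|?P'. g x) - (LINT x|?Q'. g x)"
      using fun_cong[OF eq, of g] unfolding measure_functional_def signed_integral_def rg by (simp only: restrict_apply gW if_True rg)
    then show ?thesis
      using int_sum[OF p(1) p(4) S(1) sets_pos_part sets_pos_part S(2,3) gc]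
        int_sum[OF p(2) p(3) T(1) sets_pos_part sets_pos_part T(2,3) gc] by linarith
  qed
  have "S = T"
  proof (rule measure_eqI_continuous[OF compact_closure_Om S(1) T(1) S(2) T(2)])
    fix f :: "'a \<Rightarrow> real" assume f: "continuous_on (closure \<Omega>) f"
    let ?c = "measure S (space S) + measure T (space T)"
    have close: "\<bar>(LINT x|U. f x) - (LINT x|U. g x)\<bar> \<le> e * measure U (space U)"
      if U: "finite_measure U" "sets U = borel_subsets (closure \<Omega>)" and g: "continuous_on (closure \<Omega>) g" "\<forall>x\<in>closure \<Omega>. \<bar>f x - g x\<bar> \<le> e" for U g e
    proof -
      interpret U: finite_measure U by (rule U(1))
      have i: "integrable U f" "integrable U g" using continuous_measure_integrable[OF _ U] f g(1) by blast+
      have "\<bar>LINT x|U. f x - g x\<bar> \<le> (LINT x|U. \<bar>f x - g x\<bar>)" by (rule integral_abs_bound)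
      also have "\<dots> \<le> (LINT x|U. e)"
        by (rule integral_mono) (use i g(2) sets_closure[OF U(2)] in auto)
      finally show ?thesis using i by (simp add: mult.commute)
    qed
    have "\<bar>(LINT x|S. f x) - (LINT x|T. f x)\<bar> \<le> 0 + \<epsilon>" if e: "\<epsilon> > 0" for \<epsilon>
    proof -
      have c0: "?c \<ge> 0" by simp
      let ?e = "\<epsilon> / (?c + 1)"
      have e': "?e > 0" using e c0 by (intro divide_pos_pos) linarith+
      obtain g where g: "smooth g" "\<forall>x\<in>closure \<Omega>. \<bar>f x - g x\<bar> \<le> ?e" using smooth_dense[OF f e'] by blast
      have gc: "continuous_on (closure \<Omega>) g" by (rule smooth_continuous[OF g(1)])
      have "?e * measure S (space S) + ?e * measure T (space T) = ?e * ?c" by (simp only: distrib_left)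
      also have "\<dots> \<le> ?e * (?c + 1)" using e' by (intro mult_left_mono) linarith+
      also have "\<dots> = \<epsilon>" using c0 by (intro nonzero_divide_eq_eq[THEN iffD1, symmetric] refl) linarith
      finally have "?e * measure S (space S) + ?e * measure T (space T) \<le> \<epsilon>" .
      then show ?thesis
        using close[OF S(1,2) gc g(2)] close[OF T(1,2) gc g(2)] smooth_eq[OF g(1)] by linarith
    qed
    then have "\<bar>(LINT x|S. f x) - (LINT x|T. f x)\<bar> \<le> 0" by (rule field_le_epsilon)
    then show "(LINT x|S. f x) = (LINT x|T. f x)" by simp
  qed
  then have "measure ?P B + measure ?Q' B = measure ?Q B + measure ?P' B" using S(3) T(3) B by metis
  then show ?thesis using jordan_decomposition[OF s1 B] jordan_decomposition[OF s2 B] by linarith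
qed

text \<open>The measure is determined by \<open>F\<close>, hence it is the one found for \<open>F\<close> above and has a density on \<open>E1 \<Omega> m\<close>. The singular part of a
  Borel subset of \<open>E1 \<Omega> m\<close> is its value on a null subset, where both \<open>\<alpha>\<close> and \<open>\<alpha>a\<close> vanish.\<close>
lemma singular_part_concentrated:
  assumes sd: "(F, \<beta>) \<in> subdifferential \<Omega> q (Lfun \<Omega> r) m w"
    and sr: "signed_radon (closure \<Omega>) \<alpha>" and F\<alpha>: "F = measure_functional \<Omega> q \<alpha>"
    and ld: "lebesgue_decomposition (closure \<Omega>) \<alpha> \<alpha>a \<alpha>s"
  shows "concentrated_in (closure \<Omega>) \<alpha>s (E0 \<Omega> m)"
  unfolding concentrated_in_def
proof (intro ballI impI)
  fix B assume B: "B \<in> borel_subsets (closure \<Omega>)" and BE: "B \<inter> E0 \<Omega> m = {}"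
  note fw = subdifferential_forward[OF sd]
  obtain M where M: "finite_measure M" "sets M = borel_subsets (closure \<Omega>)" "measure M (E1 \<Omega> m) = 0" "F = representation M \<beta>"
    using fw(4) by blast
  obtain \<alpha>0 where \<alpha>0: "signed_radon (closure \<Omega>) \<alpha>0" "representation M \<beta> = measure_functional \<Omega> q \<alpha>0"
    "restriction_has_density \<Omega> \<alpha>0 (E1 \<Omega> m) (\<lambda>x. - (1 / s) * norm (v x) powr r)"
    using representation_membership(2)[OF fw(1) M(1,2,3) fw(2,3)] by blast
  obtain Z where Z: "Z \<in> borel_subsets (closure \<Omega>)" "emeasure lborel Z = 0" "\<And>B. B \<in> borel_subsets (closure \<Omega>) \<Longrightarrow> \<alpha>s B = \<alpha>s (B \<inter> Z)"
    using ld unfolding lebesgue_decomposition_def by blast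
  have BZ: "B \<inter> Z \<in> borel_subsets (closure \<Omega>)" using B Z(1) by blast
  have Bs: "B \<subseteq> closure \<Omega>" using sets.sets_into_space[OF B] by (simp add: space_restrict_space)
  have "B \<subseteq> E1 \<Omega> m"
  proof
    fix x assume x: "x \<in> B"
    then have c: "x \<in> closure \<Omega>" using Bs by blast
    moreover have "m x \<noteq> 0" using x BE c by (auto simp: E0_def)
    ultimately show "x \<in> E1 \<Omega> m" using m_nonneg[OF c] by (simp add: E1_def)
  qed
  then have EB: "E1 \<Omega> m \<inter> (B \<inter> Z) = B \<inter> Z" by blast
  have nullZ: "B \<inter> Z \<in> null_sets lborel"
  proof (rule null_sets_subset)
    show "Z \<in> null_sets lborel" using Z(2) borel_subsets_borel[OF Z(1)] by (simp add: null_sets_def)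
    show "B \<inter> Z \<in> sets lborel" using borel_subsets_borel[OF BZ] by simp
  qed blast
  then have ae: "AE x in lebesgue. x \<notin> B \<inter> Z" by (intro AE_completion AE_not_in)
  have "\<alpha> (B \<inter> Z) = \<alpha>0 (B \<inter> Z)"
    by (rule measure_functional_inject[OF sr \<alpha>0(1) _ BZ]) (use F\<alpha> M(4) \<alpha>0(2) in simp)
  also have "\<dots> = (LINT x:E1 \<Omega> m \<inter> (B \<inter> Z) \<inter> \<Omega>|lebesgue. - (1 / s) * norm (v x) powr r)"
    using \<alpha>0(3) BZ EB unfolding restriction_has_density_def by metis
  also have "\<dots> = 0" unfolding set_lebesgue_integral_def
  proof (rule integral_eq_zero_AE)
    show "AE x in lebesgue. indicator (E1 \<Omega> m \<inter> (B \<inter> Z) \<inter> \<Omega>) x *\<^sub>R (- (1 / s) * norm (v x) powr r) = 0"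
      using ae by eventually_elim (auto simp: indicator_def)
  qed
  finally have a0: "\<alpha> (B \<inter> Z) = 0" .
  have aa: "\<alpha>a (B \<inter> Z) = 0" using ld BZ nullZ unfolding lebesgue_decomposition_def by (simp add: null_sets_def)
  have "\<alpha> (B \<inter> Z) = \<alpha>a (B \<inter> Z) + \<alpha>s (B \<inter> Z)" using ld BZ unfolding lebesgue_decomposition_def by blast
  then show "\<alpha>s B = 0" using Z(3)[OF B] a0 aa by linarith
qed

lemma subdifferential_characterization:
  assumes vL: "v \<in> Lp \<Omega> r"
  shows "subdifferential \<Omega> q (Lfun \<Omega> r) m w =
         {(F, \<beta>). (F, \<beta>) \<in> A_closure \<Omega> q s \<and>
            (\<exists>\<alpha>. signed_radon (closure \<Omega>) \<alpha> \<and> F = measure_functional \<Omega> q \<alpha> \<and>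
               restriction_has_density \<Omega> \<alpha> (E1 \<Omega> m) (\<lambda>x. - (1 / s) * norm (v x) powr r)) \<and>
            (AE x in lebesgue_on \<Omega>. x \<in> E1 \<Omega> m \<longrightarrow> \<beta> x = norm (v x) powr (r - 2) *\<^sub>R v x)}" (is "_ = ?R")
proof (intro set_eqI iffI)
  fix p assume p: "p \<in> subdifferential \<Omega> q (Lfun \<Omega> r) m w"
  obtain F \<beta> where pF: "p = (F, \<beta>)" by (cases p)
  note fw = subdifferential_forward[OF p[unfolded pF]]
  obtain M where M: "finite_measure M" "sets M = borel_subsets (closure \<Omega>)" "measure M (E1 \<Omega> m) = 0" "F = representation M \<beta>"
    using fw(4) by blast
  note R = representation_membership[OF fw(1) M(1,2,3) fw(2,3), folded M(4)]
  show "p \<in> ?R" unfolding pF mem_Collect_eq prod.case using R fw(3) by (intro conjI)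
next
  fix p assume p: "p \<in> ?R"
  obtain F \<beta> where pF: "p = (F, \<beta>)" by (cases p)
  from p[unfolded pF mem_Collect_eq prod.case] obtain \<alpha> where h: "(F, \<beta>) \<in> A_closure \<Omega> q s" "signed_radon (closure \<Omega>) \<alpha>"
    "F = measure_functional \<Omega> q \<alpha>" "restriction_has_density \<Omega> \<alpha> (E1 \<Omega> m) (\<lambda>x. - (1 / s) * norm (v x) powr r)"
    "AE x in lebesgue_on \<Omega>. x \<in> E1 \<Omega> m \<longrightarrow> \<beta> x = norm (v x) powr (r - 2) *\<^sub>R v x" by blast
  show "p \<in> subdifferential \<Omega> q (Lfun \<Omega> r) m w" unfolding pF by (rule subdifferential_backward[OF h(1) vL h(2-5)])
qed

end

theorem theorem2p2:
  fixes \<Omega> :: "'a::euclidean_space set" and q r :: real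
    and m :: "'a \<Rightarrow> real" and w :: "'a \<Rightarrow> 'a"
  assumes "DIM('a) \<ge> 2"
    and "\<Omega> \<noteq> {}" and "bounded \<Omega>" and "open \<Omega>"
    and "smooth_boundary \<Omega>" and "uniform_interior_ball \<Omega>"
    and "q > real DIM('a)" and "1 < r" and "r \<le> q"
    and "m \<in> W1 \<Omega> q" and "continuous_on (closure \<Omega>) m"
    and "w \<in> Lp \<Omega> q"
    and "Lfun \<Omega> r m w < \<infinity>"
  shows "(velocity \<Omega> m w \<notin> Lp \<Omega> r \<longrightarrow> subdifferential \<Omega> q (Lfun \<Omega> r) m w = {}) \<and>
    (velocity \<Omega> m w \<in> Lp \<Omega> r \<longrightarrow>
       subdifferential \<Omega> q (Lfun \<Omega> r) m w \<noteq> {} \<and>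
       subdifferential \<Omega> q (Lfun \<Omega> r) m w =
         {(F, \<beta>). (F, \<beta>) \<in> A_closure \<Omega> q (conj_exp r) \<and>
            (\<exists>\<alpha>. signed_radon (closure \<Omega>) \<alpha> \<and> F = measure_functional \<Omega> q \<alpha> \<and>
               restriction_has_density \<Omega> \<alpha> (E1 \<Omega> m)
                 (\<lambda>x. - (1 / conj_exp r) * norm (velocity \<Omega> m w x) powr r)) \<and>
            (AE x in lebesgue_on \<Omega>. x \<in> E1 \<Omega> m \<longrightarrow>
               \<beta> x = norm (velocity \<Omega> m w x) powr (r - 2) *\<^sub>R velocity \<Omega> m w x)} \<and>
       (\<forall>(F, \<beta>)\<in>subdifferential \<Omega> q (Lfun \<Omega> r) m w.
          \<forall>\<alpha> \<alpha>a \<alpha>s. signed_radon (closure \<Omega>) \<alpha> \<and> F = measure_functional \<Omega> q \<alpha> \<and>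
             lebesgue_decomposition (closure \<Omega>) \<alpha> \<alpha>a \<alpha>s \<longrightarrow>
             concentrated_in (closure \<Omega>) \<alpha>s (E0 \<Omega> m)))"
proof -
  interpret subdifferential_setting \<Omega> q r m w
    by unfold_locales (fact assms)+
  show ?thesis
  proof (intro conjI impI)
    assume nv: "velocity \<Omega> m w \<notin> Lp \<Omega> r"
    show "subdifferential \<Omega> q (Lfun \<Omega> r) m w = {}"
    proof (rule equals0I)
      fix p assume p: "p \<in> subdifferential \<Omega> q (Lfun \<Omega> r) m w"
      obtain F \<beta> where "p = (F, \<beta>)" by (cases p)
      with p subdifferential_forward(2)[of F \<beta>] nv show False by simp
    qed
  next
    assume "velocity \<Omega> m w \<in> Lp \<Omega> r"
    then show "subdifferential \<Omega> q (Lfun \<Omega> r) m w \<noteq> {}" by (rule subdifferential_nonempty)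
  next
    assume "velocity \<Omega> m w \<in> Lp \<Omega> r"
    then show "subdifferential \<Omega> q (Lfun \<Omega> r) m w =
         {(F, \<beta>). (F, \<beta>) \<in> A_closure \<Omega> q (conj_exp r) \<and>
            (\<exists>\<alpha>. signed_radon (closure \<Omega>) \<alpha> \<and> F = measure_functional \<Omega> q \<alpha> \<and>
               restriction_has_density \<Omega> \<alpha> (E1 \<Omega> m)
                 (\<lambda>x. - (1 / conj_exp r) * norm (velocity \<Omega> m w x) powr r)) \<and>
            (AE x in lebesgue_on \<Omega>. x \<in> E1 \<Omega> m \<longrightarrow>
               \<beta> x = norm (velocity \<Omega> m w x) powr (r - 2) *\<^sub>R velocity \<Omega> m w x)}"
      by (rule subdifferential_characterization)
  next
    show "\<forall>(F, \<beta>)\<in>subdifferential \<Omega> q (Lfun \<Omega> r) m w.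
          \<forall>\<alpha> \<alpha>a \<alpha>s. signed_radon (closure \<Omega>) \<alpha> \<and> F = measure_functional \<Omega> q \<alpha> \<and>
             lebesgue_decomposition (closure \<Omega>) \<alpha> \<alpha>a \<alpha>s \<longrightarrow>
             concentrated_in (closure \<Omega>) \<alpha>s (E0 \<Omega> m)"
    proof (clarify)
      fix F \<beta> \<alpha> \<alpha>a \<alpha>s
      assume "(measure_functional \<Omega> q \<alpha>, \<beta>) \<in> subdifferential \<Omega> q (Lfun \<Omega> r) m w" "signed_radon (closure \<Omega>) \<alpha>"
        "lebesgue_decomposition (closure \<Omega>) \<alpha> \<alpha>a \<alpha>s"
      then show "concentrated_in (closure \<Omega>) \<alpha>s (E0 \<Omega> m)" by (intro singular_part_concentrated[OF _ _ refl])
    qed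
  qed
qed

end
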